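(* Let $M,M^*\subset\mathbb{C}^2$ be two real-algebraic Levi-nonflat hypersurfaces, $p\in M$, $p^*\in M^*$, and let $\widehat H\colon (M,p)\to (M^*,p^* )$ be a formal invertible CR-map. Then $\widehat H$ is algebraic, and in particular $\widehat H$ is convergent.
   Context: Hypersurfaces are smooth real-analytic hypersurfaces considered as germs at their reference points. $M\subset\mathbb{C}^2$ is real-algebraic if it is contained in the vanishing locus of a nontrivial real polynomial in the underlying real variables of $\mathbb{R}^4=\mathbb{C}^2$. A real-analytic hypersurface (germ) is Levi-flat if it is foliated by complex curves (equivalently, in suitable local holomorphic coordinates $(z,w)$ it is $\{\operatorname{Im}w=0\}$), and Levi-nonflat otherwise. Let $M=\{\varrho=0\}$, $M^*=\{\varrho^*=0\}$ with real-analytic defining functions with nonvanishing differentials near $p,p^*$. A formal CR map $\widehat H\colon (M,p)\to (M^*,p^* )$ is a pair of formal power series $\widehat H=(\widehat H_1,\widehat H_2)\in\mathbb{C}[[Z-p]]^2$ in the holomorphic coordinates $Z\in\mathbb{C}^2$ with $\widehat H(p)=p^*$ and $\varrho^*(\widehat H(Z),\overline{\widehat H(Z)})=A(Z,\bar Z)\,\varrho(Z,\bar Z)$ for some $A\in\mathbb{C}[[Z-p,\overline{Z-p}]]$. It is invertible if its Jacobian matrix at $p$ is invertible. A formal map $\widehat H$ is algebraic if there exist nontrivial polynomials $P_j(Z,t)$ with $P_j(Z,\widehat H_j(Z))=0$ for $j=1,2$ (nontrivial in the sense that each $\widehat H_j$ is algebraic over the field of rational functions in $Z$). *)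

theory Defs
  imports "HOL-Analysis.Analysis" "HOL-Computational_Algebra.Computational_Algebra"
begin

section \<open>Formal power series in two and four variables\<close>

text \<open>
  Iterated univariate series: in \<open>fps2\<close> the outer variable is the first one, so that
  \<open>fps_nth (fps_nth f a) b\<close> is the coefficient of \<open>X1^a X2^b\<close>; similarly for \<open>fps4\<close>, where
  the variables are, from the outside inwards, \<open>Z1, Z2, W1, W2\<close> (with \<open>W\<close> in the role of the
  conjugate of \<open>Z\<close>). All series are centred: the variables stand for \<open>Z - p\<close> and its conjugate.
\<close>

type_synonym fps2 = "complex fps fps"
type_synonym fps4 = "complex fps fps fps fps"

definition coeff2 :: "fps2 \<Rightarrow> nat \<Rightarrow> nat \<Rightarrow> complex" where
  "coeff2 f a b = fps_nth (fps_nth f a) b"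

definition coeff4 :: "fps4 \<Rightarrow> nat \<Rightarrow> nat \<Rightarrow> nat \<Rightarrow> nat \<Rightarrow> complex" where
  "coeff4 F a b c d = fps_nth (fps_nth (fps_nth (fps_nth F a) b) c) d"

definition const2 :: "complex \<Rightarrow> fps2" where
  "const2 c = fps_const (fps_const c)"

definition const4 :: "complex \<Rightarrow> fps4" where
  "const4 c = fps_const (fps_const (fps_const (fps_const c)))"

definition in_Z :: "fps2 \<Rightarrow> fps4" where
  "in_Z f = Abs_fps (\<lambda>a. Abs_fps (\<lambda>b. fps_const (fps_const (coeff2 f a b))))"

definition conj_in_W :: "fps2 \<Rightarrow> fps4" where
  "conj_in_W f = fps_const (fps_const (Abs_fps (\<lambda>c. Abs_fps (\<lambda>d. cnj (coeff2 f c d)))))"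

text \<open>
  Substitution \<open>F(G1, G2, G3, G4)\<close>. It is only meaningful when the \<open>Gi\<close> have zero constant term;
  then \<open>G1^i G2^j G3^k G4^l\<close> has order at least \<open>i + j + k + l\<close>, so no term omitted from the
  finite sum contributes to the coefficient in question.
\<close>

definition compose4 :: "fps4 \<Rightarrow> fps4 \<Rightarrow> fps4 \<Rightarrow> fps4 \<Rightarrow> fps4 \<Rightarrow> fps4" where
  "compose4 F G1 G2 G3 G4 =
     Abs_fps (\<lambda>a. Abs_fps (\<lambda>b. Abs_fps (\<lambda>c. Abs_fps (\<lambda>d.
       let N = a + b + c + d in
       \<Sum>i\<le>N. \<Sum>j\<le>N. \<Sum>k\<le>N. \<Sum>l\<le>N.
         coeff4 F i j k l * coeff4 (G1 ^ i * G2 ^ j * G3 ^ k * G4 ^ l) a b c d))))"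


section \<open>Real-analytic and real-algebraic hypersurface germs\<close>

text \<open>
  \<open>f(Z) = F(Z - p, cnj (Z - p))\<close> near \<open>p\<close>, with unconditional (hence absolute) convergence.
  Expansions in \<open>Z, cnj Z\<close> and in the real coordinates \<open>Re Z, Im Z\<close> correspond to each other under
  a linear change of variables, so the existence of \<open>F\<close> is real-analyticity of \<open>f\<close> at \<open>p\<close>.
\<close>

definition zzbar_expansion :: "(complex^2 \<Rightarrow> real) \<Rightarrow> complex^2 \<Rightarrow> fps4 \<Rightarrow> bool" where
  "zzbar_expansion f p F \<longleftrightarrow>
     (\<exists>r>0. \<forall>Z\<in>ball p r.
        ((\<lambda>(a, b, c, d). coeff4 F a b c d * (Z$1 - p$1) ^ a * (Z$2 - p$2) ^ b
             * cnj (Z$1 - p$1) ^ c * cnj (Z$2 - p$2) ^ d) has_sum of_real (f Z)) UNIV)"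

definition real_analytic_at :: "(complex^2 \<Rightarrow> real) \<Rightarrow> complex^2 \<Rightarrow> bool" where
  "real_analytic_at f p \<longleftrightarrow> (\<exists>F. zzbar_expansion f p F)"

definition local_defining_function ::
    "(complex^2) set \<Rightarrow> complex^2 \<Rightarrow> (complex^2 \<Rightarrow> real) \<Rightarrow> bool" where
  "local_defining_function M p \<rho> \<longleftrightarrow>
     (\<exists>U. open U \<and> p \<in> U \<and> M \<inter> U = {Z \<in> U. \<rho> Z = 0} \<and>
        (\<forall>Z\<in>U. real_analytic_at \<rho> Z \<and>
           (\<exists>D. (\<rho> has_derivative D) (at Z) \<and> D \<noteq> (\<lambda>v. 0))))"

definition hypersurface_germ :: "(complex^2) set \<Rightarrow> complex^2 \<Rightarrow> bool" where
  "hypersurface_germ M p \<longleftrightarrow> p \<in> M \<and> (\<exists>\<rho>. local_defining_function M p \<rho>)"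

text \<open>The polynomial lives in \<open>\<real>[y2][x2][y1][x1]\<close>, where \<open>Zj = xj + \<i> yj\<close>.\<close>

definition eval_real_poly4 :: "real poly poly poly poly \<Rightarrow> complex^2 \<Rightarrow> real" where
  "eval_real_poly4 P Z =
     poly (poly (poly (poly P [:[:[:Re (Z$1):]:]:]) [:[:Im (Z$1):]:]) [:Re (Z$2):]) (Im (Z$2))"

definition real_algebraic_germ :: "(complex^2) set \<Rightarrow> complex^2 \<Rightarrow> bool" where
  "real_algebraic_germ M p \<longleftrightarrow>
     (\<exists>U P. open U \<and> p \<in> U \<and> P \<noteq> 0 \<and> M \<inter> U \<subseteq> {Z. eval_real_poly4 P Z = 0})"


section \<open>Levi-flatness\<close>

text \<open>Holomorphy: the real Frechet derivative exists and is complex linear.\<close>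

definition holomorphic2_on :: "(complex^2 \<Rightarrow> complex^2) \<Rightarrow> (complex^2) set \<Rightarrow> bool" where
  "holomorphic2_on f U \<longleftrightarrow>
     (\<forall>Z\<in>U. \<exists>A::complex^2^2. (f has_derivative (\<lambda>v. A *v v)) (at Z))"

definition biholomorphic2_on :: "(complex^2 \<Rightarrow> complex^2) \<Rightarrow> (complex^2) set \<Rightarrow> bool" where
  "biholomorphic2_on f U \<longleftrightarrow>
     open U \<and> open (f ` U) \<and> holomorphic2_on f U \<and>
     (\<exists>g. holomorphic2_on g (f ` U) \<and> (\<forall>Z\<in>U. g (f Z) = Z))"

text \<open>
  In local holomorphic coordinates \<open>(z, w) = \<phi> Z\<close> the germ is \<open>Im w = 0\<close>; the complex curves
  foliating it are the level sets of \<open>w\<close>.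
\<close>

definition levi_flat_germ :: "(complex^2) set \<Rightarrow> complex^2 \<Rightarrow> bool" where
  "levi_flat_germ M p \<longleftrightarrow>
     (\<exists>U \<phi>. p \<in> U \<and> biholomorphic2_on \<phi> U \<and> M \<inter> U = {Z \<in> U. Im (\<phi> Z $ 2) = 0})"


section \<open>Formal maps\<close>

text \<open>
  A formal map at \<open>p\<close> is a pair of series in \<open>Z - p\<close>. In \<open>formal_CR_map\<close> the series \<open>R'\<close> is centred
  at \<open>p'\<close>, whence the subtraction of \<open>p'\<close> from the map before substitution. The notion does not
  depend on the choice of the defining functions \<open>\<rho>, \<rho>'\<close>.
\<close>

definition formal_CR_map ::
    "(complex^2) set \<Rightarrow> complex^2 \<Rightarrow> (complex^2) set \<Rightarrow> complex^2 \<Rightarrow> fps2^2 \<Rightarrow> bool" where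
  "formal_CR_map M p M' p' H \<longleftrightarrow>
     (\<forall>j. coeff2 (H$j) 0 0 = p'$j) \<and>
     (\<exists>\<rho> \<rho>' R R' A.
        local_defining_function M p \<rho> \<and> zzbar_expansion \<rho> p R \<and>
        local_defining_function M' p' \<rho>' \<and> zzbar_expansion \<rho>' p' R' \<and>
        compose4 R'
          (in_Z (H$1) - const4 (p'$1)) (in_Z (H$2) - const4 (p'$2))
          (conj_in_W (H$1) - const4 (cnj (p'$1))) (conj_in_W (H$2) - const4 (cnj (p'$2)))
        = A * R)"

definition formal_jacobian :: "fps2^2 \<Rightarrow> complex^2^2" where
  "formal_jacobian H = (\<chi> j k. if k = 1 then coeff2 (H$j) 1 0 else coeff2 (H$j) 0 1)"

definition formally_invertible :: "fps2^2 \<Rightarrow> bool" where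
  "formally_invertible H \<longleftrightarrow> invertible (formal_jacobian H)"

text \<open>
  The value \<open>P(Z, h(Z))\<close> for \<open>P \<in> \<complex>[Z2][Z1][t]\<close> and a series \<open>h\<close> in \<open>X = Z - p\<close>: the polynomial
  is in the original coordinates, so \<open>Zj\<close> is replaced by \<open>pj + Xj\<close>.
\<close>

definition eval_poly_series :: "complex^2 \<Rightarrow> complex poly poly poly \<Rightarrow> fps2 \<Rightarrow> fps2" where
  "eval_poly_series p P h =
     poly (map_poly (\<lambda>Q.
       poly (map_poly (\<lambda>q.
         poly (map_poly const2 q) (const2 (p$2) + fps_const fps_X)) Q)
       (const2 (p$1) + fps_X)) P) h"

text \<open>
  A nonzero \<open>P\<close> annihilating \<open>h\<close> automatically has positive degree in \<open>t\<close>, because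
  \<open>\<complex>[Z1,Z2]\<close> embeds into the power series; so this is algebraicity over \<open>\<complex>(Z1,Z2)\<close>.
\<close>

definition algebraic_formal_map :: "complex^2 \<Rightarrow> fps2^2 \<Rightarrow> bool" where
  "algebraic_formal_map p H \<longleftrightarrow> (\<forall>j. \<exists>P. P \<noteq> 0 \<and> eval_poly_series p P (H$j) = 0)"

definition convergent_formal_map :: "complex^2 \<Rightarrow> fps2^2 \<Rightarrow> bool" where
  "convergent_formal_map p H \<longleftrightarrow>
     (\<exists>r>0. \<forall>Z\<in>ball p r. \<forall>j.
        (\<lambda>(a, b). coeff2 (H$j) a b * (Z$1 - p$1) ^ a * (Z$2 - p$2) ^ b) summable_on UNIV)"

end

theory Submission
  imports Defs
begin

text \<open>
  Replace \<open>(Z, cnj Z)\<close> by independent variables \<open>(Z, W)\<close>. The source becomes a complex hypersurface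
  \<open>R = 0\<close>, parametrised by \<open>W = (x, t)\<close> and the first coordinate of \<open>Z = (z, w)\<close>, the second being a
  function \<open>w = w(x, t, z)\<close>; for fixed \<open>W\<close> the points \<open>Z\<close> form the Segre variety of \<open>W\<close>. On this
  hypersurface the map \<open>h = H(Z)\<close> and its conjugate \<open>g = cnj H(cnj W)\<close> satisfy the polynomial equation of
  the target. Algebraicity is proved by a reflection principle that determines \<open>h\<close> from jets at a remote
  point.

  \<^item> Reflection (\<open>reflection\<close>, \<open>segre_point\<close>). Differentiating the equation of the target along Segre
  varieties shows that, over the coordinates \<open>x, t, z\<close>, the map \<open>g\<close> is algebraic over the 1-jet of \<open>h\<close>, and
  likewise \<open>h\<close> over the 1-jet of \<open>g\<close>. The determinant to be inverted is the product of a Jacobian of the map and the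
  Levi determinant of the source. As everything happens in the fraction field of the ring of power series,
  this determinant need not be a unit, only nonzero.

  \<^item> Two steps along Segre varieties (\<open>map_determined_by_remote_jet\<close>, \<open>formal_map_algebraic\<close>). Let \<open>(y, v)\<close>
  be a second point on the Segre variety of \<open>(x, t)\<close>. Then \<open>h\<close> at \<open>(z, w)\<close> is algebraic over the 1-jet of \<open>g\<close>
  at \<open>(x, t)\<close>, which is algebraic over the 2-jet of \<open>h\<close> at \<open>(y, v)\<close>; and \<open>(x, t)\<close> is algebraic over the two
  points. Again because the Levi determinant is not zero, \<open>(z, w)\<close> and \<open>(y, v)\<close> are independent. Comparing
  coefficients of powers of \<open>(y, v)\<close> in the resulting relation leaves polynomials in \<open>(z, w)\<close>.

  \<^item> Algebraic dependence is handled by derivations: in characteristic zero an element is algebraic over a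
  subring as soon as every derivation of the field that kills the subring kills the element
  (\<open>der_closure_algebraic\<close>). This replaces elimination by linear algebra.

  \<^item> A real polynomial vanishing on the points of a hypersurface vanishes formally on its complexification
  (\<open>real_algebraic_formal\<close>), by convergence of the defining function and the identity theorem.

  \<^item> If the Levi determinant vanishes identically, the Segre varieties form a one-parameter family, and
  its parameter is a convergent holomorphic function that can be normalised to be real on the hypersurface
  (\<open>degenerate_first_integral\<close>); this is Levi-flatness (\<open>levi_flatI\<close>).

  \<^item> Algebraic power series converge (\<open>algebraic_zser_Conv\<close>). After a linear change of coordinates and a
  blow-up, Newton's method presents the series as a solution of a convergent implicit equation.
\<close>

section \<open>Derivations and algebraic dependence\<close>

lemma poly_sum_le:
  fixes p :: "'a::comm_semiring_1 poly"
  assumes "degree p \<le> n" shows "poly p x = (\<Sum>i\<le>n. coeff p i * x ^ i)"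
proof -
  have "coeff p i * x ^ i = 0" if "i \<in> {..n} - {..degree p}" for i
    using that by (simp add: coeff_eq_0 not_le)
  then show ?thesis
    unfolding poly_altdef using assms by (intro sum.mono_neutral_left) auto
qed

definition derivation :: "('a::comm_ring_1 \<Rightarrow> 'a) \<Rightarrow> bool" where
  "derivation D \<longleftrightarrow> (\<forall>x y. D (x + y) = D x + D y) \<and> (\<forall>x y. D (x * y) = x * D y + D x * y)"

lemma derivation_add: "derivation D \<Longrightarrow> D (x + y) = D x + D y"
  and derivation_mult: "derivation D \<Longrightarrow> D (x * y) = x * D y + D x * y"
  by (auto simp: derivation_def)

lemma derivation_0: assumes "derivation D" shows "D 0 = 0"
proof -
  have "D (0 + 0) = D 0 + D 0" using assms by (rule derivation_add)
  then have "D 0 + D 0 - D 0 = D 0 - D 0" by (metis add.right_neutral)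
  then show ?thesis by simp
qed

lemma derivation_1: assumes "derivation D" shows "D 1 = 0"
proof -
  have "D (1 * 1) = 1 * D 1 + D 1 * 1" using assms by (rule derivation_mult)
  then show ?thesis by simp
qed

lemma derivation_uminus: assumes "derivation D" shows "D (- x) = - D x"
proof -
  have "D (x + - x) = D x + D (- x)" using assms by (rule derivation_add)
  then show ?thesis using derivation_0[OF assms] by (simp add: eq_neg_iff_add_eq_0 add.commute)
qed

lemma derivation_diff: "derivation D \<Longrightarrow> D (x - y) = D x - D y"
  using derivation_add[of D x "- y"] derivation_uminus[of D y] by simp

lemma derivation_comb:
  assumes "derivation D" "derivation E"
  shows "derivation (\<lambda>x. c * D x - d * E x)"
  using assms unfolding derivation_def by (auto simp: algebra_simps)

lemma derivation_commutator:
  assumes "derivation D" "derivation E"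
  shows "derivation (\<lambda>x. D (E x) - E (D x))"
  using assms unfolding derivation_def by (auto simp: algebra_simps)

text \<open>
  In a field of characteristic zero the elements killed by every derivation that kills \<open>B\<close> are the
  algebraic closure, inside the field, of the subfield generated by \<open>B\<close>. In this description
  elimination theory becomes linear algebra: to see that some elements depend algebraically on others,
  one differentiates the relations between them and solves a linear system.
\<close>

definition der_closure :: "'a::comm_ring_1 set \<Rightarrow> 'a set" where
  "der_closure B = {x. \<forall>D. derivation D \<longrightarrow> (\<forall>b\<in>B. D b = 0) \<longrightarrow> D x = 0}"

lemma der_closureD: "x \<in> der_closure B \<Longrightarrow> derivation D \<Longrightarrow> (\<And>b. b \<in> B \<Longrightarrow> D b = 0) \<Longrightarrow> D x = 0"
  by (auto simp: der_closure_def)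

lemma der_closureI: "(\<And>D. derivation D \<Longrightarrow> (\<And>b. b \<in> B \<Longrightarrow> D b = 0) \<Longrightarrow> D x = 0) \<Longrightarrow> x \<in> der_closure B"
  by (auto simp: der_closure_def)

lemma der_closure_trans:
  assumes "x \<in> der_closure B" "B \<subseteq> der_closure C" shows "x \<in> der_closure C"
  using assms by (auto simp: der_closure_def)

text \<open>
  A derivation \<open>E\<close> killing \<open>C\<close> need not commute with \<open>D\<close>, but their commutator is again a derivation;
  it kills \<open>B\<close> and hence \<open>x\<close>.
\<close>

lemma derivation_der_closure:
  assumes D: "derivation D" and x: "x \<in> der_closure B"
    and B: "B \<subseteq> der_closure C" and DB: "D ` B \<subseteq> der_closure C"
  shows "D x \<in> der_closure C"
proof (rule der_closureI)
  fix E :: "'a \<Rightarrow> 'a" assume E: "derivation E" and EC: "\<And>b. b \<in> C \<Longrightarrow> E b = 0"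
  have EB: "E b = 0" if "b \<in> B" for b using B that E EC by (blast intro: der_closureD)
  have EDB: "E (D b) = 0" if "b \<in> B" for b using DB that E EC by (blast intro: der_closureD)
  have "E (D x) - D (E x) = 0"
    by (rule der_closureD[OF x derivation_commutator[OF E D]]) (simp add: EB EDB derivation_0[OF D])
  moreover have "E x = 0" by (rule der_closureD[OF x E EB])
  ultimately show "E (D x) = 0" by (simp add: derivation_0[OF D])
qed

inductive_set ring_gen :: "'a::comm_ring_1 set \<Rightarrow> 'a set" for B where
  gen: "b \<in> B \<Longrightarrow> b \<in> ring_gen B"
| one: "1 \<in> ring_gen B"
| diff: "x \<in> ring_gen B \<Longrightarrow> y \<in> ring_gen B \<Longrightarrow> x - y \<in> ring_gen B"
| mult: "x \<in> ring_gen B \<Longrightarrow> y \<in> ring_gen B \<Longrightarrow> x * y \<in> ring_gen B"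

lemma ring_gen_0: "0 \<in> ring_gen B"
  using ring_gen.diff[OF ring_gen.one ring_gen.one] by simp

lemma ring_gen_uminus: "x \<in> ring_gen B \<Longrightarrow> - x \<in> ring_gen B"
  using ring_gen.diff[OF ring_gen_0] by fastforce

lemma ring_gen_add: "x \<in> ring_gen B \<Longrightarrow> y \<in> ring_gen B \<Longrightarrow> x + y \<in> ring_gen B"
  using ring_gen.diff[of x B "- y"] ring_gen_uminus by fastforce

lemma ring_gen_sum: "(\<And>i. i \<in> A \<Longrightarrow> f i \<in> ring_gen B) \<Longrightarrow> sum f A \<in> ring_gen B"
  by (induction A rule: infinite_finite_induct) (auto intro: ring_gen_0 ring_gen_add)

lemma ring_gen_power: "x \<in> ring_gen B \<Longrightarrow> x ^ n \<in> ring_gen B"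
  by (induction n) (auto intro: ring_gen.one ring_gen.mult)

lemma ring_gen_of_nat: "of_nat n \<in> ring_gen B"
  by (induction n) (auto intro: ring_gen_0 ring_gen_add ring_gen.one)

lemma ring_gen_mono: "B \<subseteq> C \<Longrightarrow> ring_gen B \<subseteq> ring_gen C"
proof
  fix x assume "B \<subseteq> C" "x \<in> ring_gen B"
  show "x \<in> ring_gen C" using \<open>x \<in> ring_gen B\<close>
    by induction (use \<open>B \<subseteq> C\<close> in \<open>auto intro: ring_gen.intros\<close>)
qed

lemma ring_gen_der_closure: "ring_gen B \<subseteq> der_closure B"
proof
  fix x assume "x \<in> ring_gen B"
  then show "x \<in> der_closure B"
  proof induction
    case (mult x y)
    then show ?case using derivation_mult unfolding der_closure_def by fastforce
  qed (auto simp: der_closure_def derivation_1 derivation_diff)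
qed

text \<open>
  A derivation on a subring, represented by its graph: such sets are closed under unions of chains, and
  adjoining an element to the domain is an enlargement of the set. The last condition makes the graph
  single-valued.
\<close>

definition partial_derivation :: "('a::comm_ring_1 \<times> 'a) set \<Rightarrow> bool" where
  "partial_derivation G \<longleftrightarrow> (1, 0) \<in> G
     \<and> (\<forall>x a y b. (x, a) \<in> G \<longrightarrow> (y, b) \<in> G \<longrightarrow> (x - y, a - b) \<in> G \<and> (x * y, x * b + a * y) \<in> G)
     \<and> (\<forall>a. (0, a) \<in> G \<longrightarrow> a = 0)"

text \<open>The polynomial \<open>p1\<close> arises from \<open>p\<close> by differentiating the coefficients.\<close>

definition over_graph :: "('a::comm_ring_1 \<times> 'a) set \<Rightarrow> 'a poly \<Rightarrow> 'a poly \<Rightarrow> bool" where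
  "over_graph G p p1 \<longleftrightarrow> (\<forall>n. (coeff p n, coeff p1 n) \<in> G)"

text \<open>The extension to the ring generated by \<open>y\<close> that sends \<open>y\<close> to \<open>e\<close>, by the chain rule.\<close>

definition adjoin :: "('a::idom \<times> 'a) set \<Rightarrow> 'a \<Rightarrow> 'a \<Rightarrow> ('a \<times> 'a) set" where
  "adjoin G y e = {(poly p y, poly p1 y + poly (pderiv p) y * e) | p p1. over_graph G p p1}"

context
  fixes G :: "('a::field_char_0 \<times> 'a) set"
  assumes G: "partial_derivation G"
begin

lemma graph_1: "(1, 0) \<in> G" using G by (simp add: partial_derivation_def)
lemma graph_diff: "(x, a) \<in> G \<Longrightarrow> (y, b) \<in> G \<Longrightarrow> (x - y, a - b) \<in> G"
  using G by (simp add: partial_derivation_def)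
lemma graph_mult: "(x, a) \<in> G \<Longrightarrow> (y, b) \<in> G \<Longrightarrow> (x * y, x * b + a * y) \<in> G"
  using G by (simp add: partial_derivation_def)
lemma graph_zero: "(0, a) \<in> G \<Longrightarrow> a = 0" using G by (simp add: partial_derivation_def)
lemma graph_0: "(0, 0) \<in> G" using graph_diff[OF graph_1 graph_1] by simp
lemma graph_add: assumes "(x, a) \<in> G" "(y, b) \<in> G" shows "(x + y, a + b) \<in> G"
  using graph_diff[OF assms(1) graph_diff[OF graph_0 assms(2)]] by simp
lemma graph_sum: "(\<And>i. i \<in> A \<Longrightarrow> (f i, g i) \<in> G) \<Longrightarrow> (sum f A, sum g A) \<in> G"
  by (induction A rule: infinite_finite_induct) (auto intro: graph_0 graph_add)

lemma over_graph_diff: "over_graph G p p1 \<Longrightarrow> over_graph G q q1 \<Longrightarrow> over_graph G (p - q) (p1 - q1)"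
  by (simp add: over_graph_def graph_diff)

lemma over_graph_mult:
  assumes "over_graph G p p1" "over_graph G q q1"
  shows "over_graph G (p * q) (p * q1 + p1 * q)"
  using assms by (auto simp: over_graph_def coeff_mult sum.distrib[symmetric] intro!: graph_sum graph_mult)

lemma over_graph_monom: "(x, a) \<in> G \<Longrightarrow> over_graph G (monom x n) (monom a n)"
  by (auto simp: over_graph_def graph_0)

lemma over_graph_0: "over_graph G 0 p1 \<Longrightarrow> p1 = 0"
  by (auto simp: over_graph_def poly_eq_iff intro: graph_zero)

text \<open>
  The value at \<open>y\<close> of the extended derivation is forced by a relation of least degree; every other
  relation reduces to it by pseudo-division.
\<close>

lemma adjoin_value_exists:
  "\<exists>e. (\<forall>p p1. over_graph G p p1 \<longrightarrow> poly p y = 0 \<longrightarrow> poly p1 y + poly (pderiv p) y * e = 0)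
      \<and> ((\<forall>p p1. over_graph G p p1 \<longrightarrow> poly p y = 0 \<longrightarrow> p = 0) \<longrightarrow> e = 1)"
proof (cases "\<forall>p p1. over_graph G p p1 \<longrightarrow> poly p y = 0 \<longrightarrow> p = 0")
  case True
  then show ?thesis using over_graph_0 by (intro exI[of _ 1]) fastforce
next
  case False
  define rel where "rel = (\<lambda>p. p \<noteq> 0 \<and> poly p y = 0 \<and> (\<exists>p1. over_graph G p p1))"
  have "\<exists>p. rel p" using False by (auto simp: rel_def)
  then obtain p0 where p0: "rel p0" and min: "\<And>q. rel q \<Longrightarrow> degree p0 \<le> degree q"
    using exists_least_iff[of "\<lambda>n. \<exists>p. rel p \<and> degree p = n"] by (metis linorder_not_less)
  obtain p01 where p01: "over_graph G p0 p01" using p0 by (auto simp: rel_def)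
  have deg: "degree p0 \<noteq> 0"
  proof
    assume "degree p0 = 0"
    then obtain c where "p0 = [:c:]" by (rule degree_eq_zeroE)
    then show False using p0 by (auto simp: rel_def)
  qed
  have "poly (pderiv p0) y \<noteq> 0"
  proof
    assume eq: "poly (pderiv p0) y = 0"
    have "over_graph G (pderiv p0) (pderiv p01)"
    proof (unfold over_graph_def coeff_pderiv, rule)
      fix n
      have c: "(of_nat (Suc n), 0) \<in> G"
      proof (induction n)
        case (Suc n)
        then show ?case using graph_add[OF graph_1] by fastforce
      qed (use graph_1 in simp)
      have d: "(coeff p0 (Suc n), coeff p01 (Suc n)) \<in> G"
        using p01 by (auto simp: over_graph_def)
      show "(of_nat (Suc n) * coeff p0 (Suc n), of_nat (Suc n) * coeff p01 (Suc n)) \<in> G"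
        using graph_mult[OF c d] by simp
    qed
    then have "rel (pderiv p0)" using eq deg by (auto simp: rel_def pderiv_eq_0_iff)
    from min[OF this] show False using deg by (simp add: degree_pderiv)
  qed
  define e where "e = - poly p01 y / poly (pderiv p0) y"
  have e: "poly p01 y + poly (pderiv p0) y * e = 0"
    using \<open>poly (pderiv p0) y \<noteq> 0\<close> by (simp add: e_def)
  have main: "over_graph G p p1 \<Longrightarrow> poly p y = 0 \<Longrightarrow> poly p1 y + poly (pderiv p) y * e = 0" for p p1
  proof (induction "degree p" arbitrary: p p1 rule: less_induct)
    case less
    show ?case
    proof (cases "p = 0")
      case True
      then have "p1 = 0" using over_graph_0 less.prems(1) by blast
      then show ?thesis using True by simp
    next
      case False
      then have "rel p" using less.prems by (auto simp: rel_def)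
      then have le: "degree p0 \<le> degree p" by (rule min)
      define k a a1 c c1 where "k = degree p - degree p0" and "a = lead_coeff p0"
        and "a1 = coeff p01 (degree p0)" and "c = lead_coeff p" and "c1 = coeff p1 (degree p)"
      have G1: "(a, a1) \<in> G" "(c, c1) \<in> G"
        using p01 less.prems by (auto simp: over_graph_def a_def a1_def c_def c1_def)
      define r where "r = monom a 0 * p - monom c k * p0"
      define r1 where "r1 = (monom a 0 * p1 + monom a1 0 * p) - (monom c k * p01 + monom c1 k * p0)"
      have og: "over_graph G r r1"
        unfolding r_def r1_def
        by (intro over_graph_diff over_graph_mult over_graph_monom G1 less.prems p01)
      have ry: "poly r y = 0" using less.prems p0 by (simp add: r_def rel_def)
      have pd: "poly r1 y + poly (pderiv r) y * e = 0"
      proof (cases "r = 0")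
        case True
        then have "r1 = 0" using over_graph_0 og by blast
        then show ?thesis using True by simp
      next
        case r0: False
        have an0: "a \<noteq> 0" using p0 by (auto simp: rel_def a_def)
        have cn0: "c \<noteq> 0" using False by (auto simp: c_def)
        have d1: "degree (monom a 0 * p) = degree p" using an0 False
          by (simp add: degree_mult_eq degree_monom_eq)
        have d2: "degree (monom c k * p0) = degree p" using cn0 p0 le
          by (simp add: degree_mult_eq degree_monom_eq k_def rel_def)
        have l: "coeff r (degree p) = 0"
        proof -
          have "coeff (monom c k * p0) (degree p) = c * a"
            using lead_coeff_mult[of "monom c k" p0] d2 cn0 by (simp add: a_def degree_monom_eq)
          moreover have "coeff (monom a 0 * p) (degree p) = a * c"
            by (simp add: c_def coeff_monom_mult)
          ultimately show ?thesis by (simp add: r_def)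
        qed
        have "degree r \<le> degree p" unfolding r_def by (rule degree_diff_le) (use d1 d2 in auto)
        moreover have "degree r \<noteq> degree p" using l r0 by (metis leading_coeff_0_iff)
        ultimately have "degree r < degree p" by simp
        then show ?thesis by (rule less.hyps[OF _ og ry])
      qed
      have p0y: "poly p0 y = 0" using p0 by (simp add: rel_def)
      have "poly r1 y + poly (pderiv r) y * e
          = a * (poly p1 y + poly (pderiv p) y * e) - c * y ^ k * (poly p01 y + poly (pderiv p0) y * e)"
        using less.prems p0y
        by (simp add: r_def r1_def poly_monom pderiv_diff pderiv_mult algebra_simps)
      then have "a * (poly p1 y + poly (pderiv p) y * e) = 0" using pd e by simp
      moreover have "a \<noteq> 0" using p0 by (auto simp: rel_def a_def)
      ultimately show ?thesis by simp
    qed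
  qed
  then show ?thesis using False by blast
qed

lemma adjoin_partial_derivation:
  assumes wd: "\<And>p p1. over_graph G p p1 \<Longrightarrow> poly p y = 0 \<Longrightarrow> poly p1 y + poly (pderiv p) y * e = 0"
  shows "partial_derivation (adjoin G y e)" "G \<subseteq> adjoin G y e" "(y, e) \<in> adjoin G y e"
proof -
  show "G \<subseteq> adjoin G y e"
  proof
    fix z assume z: "z \<in> G"
    obtain x a where xa: "z = (x, a)" by (cases z)
    have "over_graph G [:x:] [:a:]" using over_graph_monom[of x a 0] z xa by (simp add: monom_0)
    then show "z \<in> adjoin G y e" unfolding adjoin_def xa by force
  qed
  have "over_graph G [:0, 1:] 0" using over_graph_monom[OF graph_1, of 1] by (simp add: monom_Suc monom_0)
  then have "(poly [:0, 1:] y, poly 0 y + poly (pderiv [:0, 1:]) y * e) \<in> adjoin G y e"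
    unfolding adjoin_def by blast
  then show "(y, e) \<in> adjoin G y e" by (simp add: pderiv_pCons)
  show "partial_derivation (adjoin G y e)"
    unfolding partial_derivation_def
  proof (intro conjI allI impI)
    show "(1, 0) \<in> adjoin G y e" using \<open>G \<subseteq> _\<close> graph_1 by auto
  next
    fix x a z b assume "(x, a) \<in> adjoin G y e" "(z, b) \<in> adjoin G y e"
    then obtain p p1 q q1 where p: "over_graph G p p1" "x = poly p y" "a = poly p1 y + poly (pderiv p) y * e"
      and q: "over_graph G q q1" "z = poly q y" "b = poly q1 y + poly (pderiv q) y * e"
      by (auto simp: adjoin_def)
    have intro: "over_graph G r r1 \<Longrightarrow> (poly r y, poly r1 y + poly (pderiv r) y * e) \<in> adjoin G y e" for r r1
      unfolding adjoin_def by blast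
    show "(x - z, a - b) \<in> adjoin G y e" using intro[OF over_graph_diff[OF p(1) q(1)]]
      by (simp add: p q pderiv_diff algebra_simps)
    show "(x * z, x * b + a * z) \<in> adjoin G y e" using intro[OF over_graph_mult[OF p(1) q(1)]]
      by (simp add: p q pderiv_mult algebra_simps)
  next
    fix a assume "(0, a) \<in> adjoin G y e"
    then show "a = 0" using wd by (auto simp: adjoin_def)
  qed
qed

end

text \<open>
  A maximal extension, which exists by Zorn's lemma, is defined everywhere, since otherwise a further
  element could be adjoined to its domain.
\<close>

lemma partial_derivation_extends:
  fixes G :: "('a::field_char_0 \<times> 'a) set"
  assumes G: "partial_derivation G"
  shows "\<exists>D. derivation D \<and> (\<forall>(x, a) \<in> G. D x = a)"
proof -
  define \<A> where "\<A> = {K. partial_derivation K \<and> G \<subseteq> K}"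
  have "\<exists>M\<in>\<A>. \<forall>X\<in>\<A>. M \<subseteq> X \<longrightarrow> X = M"
  proof (rule subset_Zorn_nonempty)
    show "\<A> \<noteq> {}" using G by (auto simp: \<A>_def)
    fix C assume C: "C \<noteq> {}" "subset.chain \<A> C"
    have mem: "partial_derivation K \<and> G \<subseteq> K" if "K \<in> C" for K
      using C that by (auto simp: \<A>_def subset.chain_def)
    have two: "\<exists>K\<in>C. u \<in> K \<and> v \<in> K" if "u \<in> \<Union>C" "v \<in> \<Union>C" for u v
      using C(2) that unfolding subset.chain_def by blast
    have "partial_derivation (\<Union>C)"
      unfolding partial_derivation_def
    proof (intro conjI allI impI)
      show "(1, 0) \<in> \<Union>C" using C(1) mem unfolding partial_derivation_def by blast
    next
      fix x a y b assume "(x, a) \<in> \<Union>C" "(y, b) \<in> \<Union>C"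
      from two[OF this] obtain K where "K \<in> C" "(x, a) \<in> K" "(y, b) \<in> K" by blast
      then show "(x - y, a - b) \<in> \<Union>C" "(x * y, x * b + a * y) \<in> \<Union>C"
        using mem unfolding partial_derivation_def by blast+
    next
      fix a assume "(0, a) \<in> \<Union>C"
      then show "a = 0" using mem unfolding partial_derivation_def by blast
    qed
    then show "\<Union>C \<in> \<A>" using C(1) mem by (auto simp: \<A>_def)
  qed
  then obtain M where M: "partial_derivation M" "G \<subseteq> M"
    and max: "\<And>X. partial_derivation X \<Longrightarrow> M \<subseteq> X \<Longrightarrow> X = M"
    by (auto simp: \<A>_def)
  have total: "\<exists>a. (y, a) \<in> M" for y
  proof -
    obtain e where "\<And>p p1. over_graph M p p1 \<Longrightarrow> poly p y = 0 \<Longrightarrow> poly p1 y + poly (pderiv p) y * e = 0"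
      using adjoin_value_exists[OF M(1)] by metis
    from adjoin_partial_derivation[OF M(1) this] max show ?thesis by metis
  qed
  define D where "D = (\<lambda>y. SOME a. (y, a) \<in> M)"
  have DM: "(y, D y) \<in> M" for y unfolding D_def using total by (rule someI_ex)
  have uniq: "(y, a) \<in> M \<Longrightarrow> D y = a" for y a
    using graph_diff[OF M(1) DM[of y], of y a] graph_zero[OF M(1), of "D y - a"] by simp
  have "derivation D" unfolding derivation_def
    using uniq graph_add[OF M(1) DM DM] graph_mult[OF M(1) DM DM] by blast
  then show ?thesis using uniq M(2) by blast
qed

instance fract :: ("{idom,ring_char_0}") ring_char_0
proof
  have "to_fract (of_nat n) = of_nat n" for n :: nat
    by (induction n) auto
  then show "inj (of_nat :: nat \<Rightarrow> 'a fract)"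
    by (metis injI of_nat_eq_iff to_fract_eq_iff)
qed

instance fract :: ("{idom,ring_char_0}") field_char_0 ..

text \<open>
  At an element \<open>x\<close> without polynomial relation over the ring generated by \<open>B\<close> the zero derivation of
  that ring can be given the value \<open>1\<close>; its extension to the whole field kills \<open>B\<close> but not \<open>x\<close>.
\<close>

lemma der_closure_algebraic:
  fixes x :: "'a::field_char_0"
  assumes x: "x \<in> der_closure B"
  shows "\<exists>p. p \<noteq> 0 \<and> (\<forall>n. coeff p n \<in> ring_gen B) \<and> poly p x = 0"
proof (rule ccontr)
  assume neg: "\<not> ?thesis"
  define G where "G = ring_gen B \<times> {0::'a}"
  have G: "partial_derivation G"
    unfolding partial_derivation_def G_def by (auto intro: ring_gen.intros)
  have og: "over_graph G p p1 \<longleftrightarrow> (\<forall>n. coeff p n \<in> ring_gen B) \<and> p1 = 0" for p p1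
    by (auto simp: over_graph_def G_def poly_eq_iff)
  obtain e where e: "\<And>p p1. over_graph G p p1 \<Longrightarrow> poly p x = 0 \<Longrightarrow> poly p1 x + poly (pderiv p) x * e = 0"
    and 1: "(\<forall>p p1. over_graph G p p1 \<longrightarrow> poly p x = 0 \<longrightarrow> p = 0) \<longrightarrow> e = 1"
    using adjoin_value_exists[OF G, of x] by metis
  have "e = 1" using 1 neg og by blast
  note adj = adjoin_partial_derivation[OF G e]
  obtain D where D: "derivation D" "\<forall>(y, a) \<in> adjoin G x e. D y = a"
    using partial_derivation_extends[OF adj(1)] by blast
  have "D b = 0" if "b \<in> B" for b
  proof -
    have "(b, 0) \<in> adjoin G x e" using adj(2) that by (auto simp: G_def intro: ring_gen.gen)
    then show ?thesis using D(2) by auto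
  qed
  then have "D x = 0" by (rule der_closureD[OF x D(1)])
  moreover have "D x = 1" using D(2) adj(3) \<open>e = 1\<close> by auto
  ultimately show False by simp
qed

section \<open>Algebraic relations and derivations\<close>

lemma ring_gen_subset: assumes "B \<subseteq> ring_gen C" shows "ring_gen B \<subseteq> ring_gen C"
proof
  fix x assume "x \<in> ring_gen B"
  then show "x \<in> ring_gen C" by induction (use assms in \<open>auto intro: ring_gen.intros\<close>)
qed

text \<open>A relation of least degree has nonvanishing derivative at the root, in characteristic zero.\<close>

lemma separable_relation:
  fixes x :: "'a::{idom,ring_char_0}"
  assumes "p \<noteq> 0" "\<And>n. coeff p n \<in> ring_gen B" "poly p x = 0"
  shows "\<exists>q. (\<forall>n. coeff q n \<in> ring_gen B) \<and> poly q x = 0 \<and> poly (pderiv q) x \<noteq> 0"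
proof -
  define rel where "rel = (\<lambda>p. p \<noteq> 0 \<and> (\<forall>n. coeff p n \<in> ring_gen B) \<and> poly p x = 0)"
  have "rel p" using assms by (simp add: rel_def)
  then obtain q where q: "rel q" and min: "\<And>r. rel r \<Longrightarrow> degree q \<le> degree r"
    using exists_least_iff[of "\<lambda>n. \<exists>p. rel p \<and> degree p = n"] by (metis linorder_not_less)
  have deg: "degree q \<noteq> 0"
  proof
    assume "degree q = 0"
    then obtain c where "q = [:c:]" by (rule degree_eq_zeroE)
    then show False using q by (auto simp: rel_def)
  qed
  have "poly (pderiv q) x \<noteq> 0"
  proof
    assume "poly (pderiv q) x = 0"
    moreover have "pderiv q \<noteq> 0" using deg by (simp add: pderiv_eq_0_iff)
    moreover have "coeff (pderiv q) n \<in> ring_gen B" for n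
      using q by (auto simp: coeff_pderiv rel_def simp del: of_nat_Suc intro!: ring_gen.mult ring_gen_of_nat)
    ultimately have "rel (pderiv q)" by (simp add: rel_def)
    from min[OF this] show False using deg by (simp add: degree_pderiv)
  qed
  then show ?thesis using q by (auto simp: rel_def)
qed

lemma derivation_poly:
  assumes D: "derivation D"
  shows "D (poly p x) = poly (map_poly D p) x + poly (pderiv p) x * D x"
proof (induction p)
  case 0 then show ?case by (simp add: derivation_0[OF D])
next
  case (pCons a p)
  have "map_poly D (pCons a p) = pCons (D a) (map_poly D p)"
    by (rule map_poly_pCons) (use pCons derivation_0[OF D] in auto)
  with pCons show ?case
    by (simp add: derivation_add[OF D] derivation_mult[OF D] pderiv_pCons algebra_simps)
qed

text \<open>
  The differential of \<open>c\<close> is the combination of those of \<open>y1, y2, y3\<close> with coefficients \<open>e1, e2, e3\<close>,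
  expressed by testing against all derivations over \<open>K\<close>.
\<close>

definition has_differential :: "'a::comm_ring_1 set \<Rightarrow> 'a \<Rightarrow> 'a \<Rightarrow> 'a \<Rightarrow> 'a \<Rightarrow> 'a \<Rightarrow> 'a \<Rightarrow> 'a \<Rightarrow> bool" where
  "has_differential K y1 y2 y3 c e1 e2 e3 \<longleftrightarrow>
     (\<forall>D. derivation D \<longrightarrow> (\<forall>k\<in>K. D k = 0) \<longrightarrow> D c = e1 * D y1 + e2 * D y2 + e3 * D y3)"

lemma ring_gen_differential:
  assumes "c \<in> ring_gen (K \<union> {y1, y2, y3})"
  shows "\<exists>e1 e2 e3. {e1, e2, e3} \<subseteq> ring_gen (K \<union> {y1, y2, y3}) \<and> has_differential K y1 y2 y3 c e1 e2 e3"
  using assms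
proof induction
  case (gen b)
  consider "b \<in> K" | "b = y1" | "b = y2" | "b = y3" using gen by blast
  then show ?case
  proof cases
    case 1
    show ?thesis by (rule exI[of _ 0], rule exI[of _ 0], rule exI[of _ 0]) (simp add: ring_gen_0 ring_gen.one has_differential_def 1)
  next
    case 2
    show ?thesis by (rule exI[of _ 1], rule exI[of _ 0], rule exI[of _ 0]) (simp add: ring_gen_0 ring_gen.one has_differential_def 2)
  next
    case 3
    show ?thesis by (rule exI[of _ 0], rule exI[of _ 1], rule exI[of _ 0]) (simp add: ring_gen_0 ring_gen.one has_differential_def 3)
  next
    case 4
    show ?thesis by (rule exI[of _ 0], rule exI[of _ 0], rule exI[of _ 1]) (simp add: ring_gen_0 ring_gen.one has_differential_def 4)
  qed
next
  case one
  show ?case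
    by (rule exI[of _ 0], rule exI[of _ 0], rule exI[of _ 0])
      (simp add: ring_gen_0 has_differential_def derivation_1)
next
  case (diff x y)
  from diff.IH(1) obtain e1 e2 e3 where
    e: "{e1, e2, e3} \<subseteq> ring_gen (K \<union> {y1, y2, y3})" "has_differential K y1 y2 y3 x e1 e2 e3" by blast
  from diff.IH(2) obtain f1 f2 f3 where
    f: "{f1, f2, f3} \<subseteq> ring_gen (K \<union> {y1, y2, y3})" "has_differential K y1 y2 y3 y f1 f2 f3" by blast
  have "has_differential K y1 y2 y3 (x - y) (e1 - f1) (e2 - f2) (e3 - f3)"
    using e(2) f(2) by (simp add: has_differential_def derivation_diff algebra_simps)
  moreover have "{e1 - f1, e2 - f2, e3 - f3} \<subseteq> ring_gen (K \<union> {y1, y2, y3})"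
    using e(1) f(1) by (simp add: ring_gen.diff)
  ultimately show ?case by blast
next
  case (mult x y)
  from mult.IH(1) obtain e1 e2 e3 where
    e: "{e1, e2, e3} \<subseteq> ring_gen (K \<union> {y1, y2, y3})" "has_differential K y1 y2 y3 x e1 e2 e3" by blast
  from mult.IH(2) obtain f1 f2 f3 where
    f: "{f1, f2, f3} \<subseteq> ring_gen (K \<union> {y1, y2, y3})" "has_differential K y1 y2 y3 y f1 f2 f3" by blast
  have "has_differential K y1 y2 y3 (x * y) (x * f1 + e1 * y) (x * f2 + e2 * y) (x * f3 + e3 * y)"
    unfolding has_differential_def
  proof (intro allI impI)
    fix D assume D: "derivation D" "\<forall>k\<in>K. D k = 0"
    then have "D x = e1 * D y1 + e2 * D y2 + e3 * D y3" "D y = f1 * D y1 + f2 * D y2 + f3 * D y3"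
      using e(2) f(2) by (auto simp: has_differential_def)
    then show "D (x * y) = (x * f1 + e1 * y) * D y1 + (x * f2 + e2 * y) * D y2 + (x * f3 + e3 * y) * D y3"
      unfolding derivation_mult[OF D(1)] by (simp add: algebra_simps)
  qed
  moreover have "{x * f1 + e1 * y, x * f2 + e2 * y, x * f3 + e3 * y} \<subseteq> ring_gen (K \<union> {y1, y2, y3})"
    using e(1) f(1) mult.hyps by (simp add: ring_gen_add ring_gen.mult)
  ultimately show ?case by blast
qed

text \<open>A linear relation over the field between the differentials of \<open>y1, \<dots>, y4\<close>, relative to \<open>K\<close>.\<close>

definition grad_rel :: "'a::comm_ring_1 set \<Rightarrow> 'a \<Rightarrow> 'a \<Rightarrow> 'a \<Rightarrow> 'a \<Rightarrow> 'a \<Rightarrow> 'a \<Rightarrow> 'a \<Rightarrow> 'a \<Rightarrow> bool" where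
  "grad_rel K y1 y2 y3 y4 a1 a2 a3 a4 \<longleftrightarrow>
     (\<forall>D. derivation D \<longrightarrow> (\<forall>k\<in>K. D k = 0) \<longrightarrow> a1 * D y1 + a2 * D y2 + a3 * D y3 + a4 * D y4 = 0)"

text \<open>
  Differentiate a separable polynomial relation: its derivative at the root is the coefficient of \<open>D x\<close>.
\<close>

lemma relation_gradient:
  fixes x :: "'a::field_char_0"
  assumes "p \<noteq> 0" "\<And>n. coeff p n \<in> ring_gen (K \<union> {y1, y2, y3})" "poly p x = 0"
  shows "\<exists>a1 a2 a3 a4. {a1, a2, a3, a4} \<subseteq> ring_gen (K \<union> {y1, y2, y3, x}) \<and> a4 \<noteq> 0 \<and>
    grad_rel K y1 y2 y3 x a1 a2 a3 a4"
proof -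
  obtain q where q: "\<And>n. coeff q n \<in> ring_gen (K \<union> {y1, y2, y3})" "poly q x = 0" "poly (pderiv q) x \<noteq> 0"
    using separable_relation[OF assms] by blast
  define n where "n = degree q"
  have mono: "ring_gen (K \<union> {y1, y2, y3}) \<subseteq> ring_gen (K \<union> {y1, y2, y3, x})" by (rule ring_gen_mono) auto
  let ?R = "ring_gen (K \<union> {y1, y2, y3, x})"
  have x: "x ^ i \<in> ?R" for i by (intro ring_gen_power ring_gen.gen) auto
  have "\<exists>u. {fst u, fst (snd u), snd (snd u)} \<subseteq> ring_gen (K \<union> {y1, y2, y3})
      \<and> has_differential K y1 y2 y3 (coeff q i) (fst u) (fst (snd u)) (snd (snd u))" for i
  proof -
    obtain e1 e2 e3 where "{e1, e2, e3} \<subseteq> ring_gen (K \<union> {y1, y2, y3})"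
      "has_differential K y1 y2 y3 (coeff q i) e1 e2 e3" using ring_gen_differential[OF q(1)[of i]] by blast
    then show ?thesis by (intro exI[of _ "(e1, e2, e3)"]) simp
  qed
  then obtain e where e': "\<And>i. {fst (e i), fst (snd (e i)), snd (snd (e i))} \<subseteq> ring_gen (K \<union> {y1, y2, y3})
      \<and> has_differential K y1 y2 y3 (coeff q i) (fst (e i)) (fst (snd (e i))) (snd (snd (e i)))" by metis
  have e: "fst (e i) \<in> ring_gen (K \<union> {y1, y2, y3})" "fst (snd (e i)) \<in> ring_gen (K \<union> {y1, y2, y3})"
    "snd (snd (e i)) \<in> ring_gen (K \<union> {y1, y2, y3})"
    "derivation D \<Longrightarrow> \<forall>k\<in>K. D k = 0 \<Longrightarrow>
        D (coeff q i) = fst (e i) * D y1 + fst (snd (e i)) * D y2 + snd (snd (e i)) * D y3" for i D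
    using e'[of i] by (simp_all add: has_differential_def)
  define A where "A = (\<lambda>f. \<Sum>i\<le>n. f (e i) * x ^ i)"
  have "A fst * D y1 + A (\<lambda>u. fst (snd u)) * D y2 + A (\<lambda>u. snd (snd u)) * D y3 + poly (pderiv q) x * D x = 0"
    if D: "derivation D" "\<forall>k\<in>K. D k = 0" for D
  proof -
    have "poly (map_poly D q) x = (\<Sum>i\<le>n. D (coeff q i) * x ^ i)"
    proof (subst poly_sum_le[of _ n])
      show "degree (map_poly D q) \<le> n" unfolding n_def by (rule map_poly_degree_leq)
    qed (simp add: coeff_map_poly derivation_0[OF D(1)])
    also have "\<dots> = A fst * D y1 + A (\<lambda>u. fst (snd u)) * D y2 + A (\<lambda>u. snd (snd u)) * D y3"
      by (simp add: e(4)[OF D] A_def sum_distrib_left sum.distrib algebra_simps)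
    finally show ?thesis using derivation_poly[OF D(1), of q x] q(2) by (simp add: derivation_0[OF D(1)])
  qed
  moreover have "poly (pderiv q) x \<in> ring_gen (K \<union> {y1, y2, y3, x})"
    unfolding poly_altdef coeff_pderiv using q(1) mono
    by (intro ring_gen_sum ring_gen.mult x ring_gen_of_nat) blast
  moreover have "A fst \<in> ring_gen (K \<union> {y1, y2, y3, x})" "A (\<lambda>u. fst (snd u)) \<in> ring_gen (K \<union> {y1, y2, y3, x})"
    "A (\<lambda>u. snd (snd u)) \<in> ring_gen (K \<union> {y1, y2, y3, x})"
    unfolding A_def using e(1-3) mono by (intro ring_gen_sum ring_gen.mult x; blast)+
  ultimately show ?thesis using q(3) unfolding grad_rel_def
    by (intro exI[of _ "A fst"] exI[of _ "A (\<lambda>u. fst (snd u))"] exI[of _ "A (\<lambda>u. snd (snd u))"] exI[of _ "poly (pderiv q) x"]) auto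
qed

lemma finite_sum_gradient:
  fixes x :: "'a::field_char_0"
  assumes s: "(\<Sum>i\<le>N. A i * x ^ i) = 0" and i: "i \<le> N" "A i \<noteq> 0"
    and A: "\<And>i. A i \<in> ring_gen (K \<union> {y1, y2, y3})"
  shows "\<exists>a1 a2 a3 a4. {a1, a2, a3, a4} \<subseteq> ring_gen (K \<union> {y1, y2, y3, x}) \<and> a4 \<noteq> 0 \<and>
    grad_rel K y1 y2 y3 x a1 a2 a3 a4"
proof (rule relation_gradient)
  define p where "p = (\<Sum>i\<le>N. monom (A i) i)"
  have c: "coeff p n = (if n \<le> N then A n else 0)" for n
    by (simp add: p_def coeff_sum)
  show "p \<noteq> 0" using c[of i] i by auto
  show "coeff p n \<in> ring_gen (K \<union> {y1, y2, y3})" for n using A by (simp add: c ring_gen_0)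
  show "poly p x = 0" using s by (simp add: p_def poly_sum poly_monom)
qed

text \<open>
  The plain gradient of the given relation might vanish at the point. Reading the sum as a polynomial in
  the last variable, either one of its coefficients is nonzero at the point, and \<open>x4\<close> is algebraic over
  the other three elements, or the coefficient of \<open>x4^l0\<close> is a relation between fewer elements; repeat.
\<close>

lemma dependence_gradient:
  fixes x1 x2 x3 x4 :: "'a::field_char_0" and c :: "nat \<Rightarrow> nat \<Rightarrow> nat \<Rightarrow> nat \<Rightarrow> 'a"
  assumes s: "(\<Sum>i\<le>N. \<Sum>j\<le>N. \<Sum>k\<le>N. \<Sum>l\<le>N. c i j k l * x1 ^ i * x2 ^ j * x3 ^ k * x4 ^ l) = 0"
    and nz: "i0 \<le> N" "j0 \<le> N" "k0 \<le> N" "l0 \<le> N" "c i0 j0 k0 l0 \<noteq> 0"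
    and c: "\<And>i j k l. c i j k l \<in> K"
  shows "\<exists>a1 a2 a3 a4. {a1, a2, a3, a4} \<subseteq> ring_gen (K \<union> {x1, x2, x3, x4}) \<and>
    (a1 \<noteq> 0 \<or> a2 \<noteq> 0 \<or> a3 \<noteq> 0 \<or> a4 \<noteq> 0) \<and>
    grad_rel K x1 x2 x3 x4 a1 a2 a3 a4"
proof -
  define A4 where "A4 = (\<lambda>l. \<Sum>i\<le>N. \<Sum>j\<le>N. \<Sum>k\<le>N. c i j k l * x1 ^ i * x2 ^ j * x3 ^ k)"
  define A3 where "A3 = (\<lambda>k. \<Sum>i\<le>N. \<Sum>j\<le>N. c i j k l0 * x1 ^ i * x2 ^ j)"
  define A2 where "A2 = (\<lambda>j. \<Sum>i\<le>N. c i j k0 l0 * x1 ^ i)"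
  note ri = ring_gen_sum ring_gen.mult ring_gen_power
  have xs: "x \<in> S \<Longrightarrow> x \<in> ring_gen (K \<union> S)" for x S by (auto intro: ring_gen.gen)
  have cs: "c i j k l \<in> ring_gen (K \<union> S)" for i j k l S using c by (auto intro: ring_gen.gen)
  have s4: "(\<Sum>l\<le>N. A4 l * x4 ^ l) = 0"
  proof -
    have "(\<Sum>l\<le>N. A4 l * x4 ^ l) = (\<Sum>l\<le>N. \<Sum>i\<le>N. \<Sum>j\<le>N. \<Sum>k\<le>N. c i j k l * x1 ^ i * x2 ^ j * x3 ^ k * x4 ^ l)"
      by (simp add: A4_def sum_distrib_right)
    also have "\<dots> = (\<Sum>i\<le>N. \<Sum>l\<le>N. \<Sum>j\<le>N. \<Sum>k\<le>N. c i j k l * x1 ^ i * x2 ^ j * x3 ^ k * x4 ^ l)" by (rule sum.swap)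
    also have "\<dots> = (\<Sum>i\<le>N. \<Sum>j\<le>N. \<Sum>l\<le>N. \<Sum>k\<le>N. c i j k l * x1 ^ i * x2 ^ j * x3 ^ k * x4 ^ l)"
      by (intro sum.cong refl sum.swap)
    also have "\<dots> = (\<Sum>i\<le>N. \<Sum>j\<le>N. \<Sum>k\<le>N. \<Sum>l\<le>N. c i j k l * x1 ^ i * x2 ^ j * x3 ^ k * x4 ^ l)"
      by (intro sum.cong refl sum.swap)
    finally show ?thesis using s by simp
  qed
  have s3: "A4 l0 = (\<Sum>k\<le>N. A3 k * x3 ^ k)"
  proof -
    have "A4 l0 = (\<Sum>i\<le>N. \<Sum>k\<le>N. \<Sum>j\<le>N. c i j k l0 * x1 ^ i * x2 ^ j * x3 ^ k)"
      unfolding A4_def by (intro sum.cong refl sum.swap)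
    also have "\<dots> = (\<Sum>k\<le>N. \<Sum>i\<le>N. \<Sum>j\<le>N. c i j k l0 * x1 ^ i * x2 ^ j * x3 ^ k)" by (rule sum.swap)
    finally show ?thesis by (simp add: A3_def sum_distrib_right)
  qed
  have s2: "A3 k0 = (\<Sum>j\<le>N. A2 j * x2 ^ j)"
    unfolding A3_def A2_def sum_distrib_right by (rule sum.swap)
  let ?R = "ring_gen (K \<union> {x1, x2, x3, x4})"
  have incl: "ring_gen (K \<union> S) \<subseteq> ?R" if "S \<subseteq> {0, x1, x2, x3, x4}" for S
  proof (rule ring_gen_subset, rule subsetI)
    fix u assume "u \<in> K \<union> S"
    then have "u \<in> K \<union> {x1, x2, x3, x4} \<or> u = 0" using that by auto
    then show "u \<in> ?R" using ring_gen.gen[of u "K \<union> {x1, x2, x3, x4}"] ring_gen_0[of "K \<union> {x1, x2, x3, x4}"] by auto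
  qed
  have lift: ?thesis if "{b1, b2, b3, b4} \<subseteq> ?R" "b1 \<noteq> 0 \<or> b2 \<noteq> 0 \<or> b3 \<noteq> 0 \<or> b4 \<noteq> 0" "grad_rel K x1 x2 x3 x4 b1 b2 b3 b4"
    for b1 b2 b3 b4
    using that by (intro exI conjI) assumption+
  have zero: "0 \<in> ?R" by (rule ring_gen_0)
  consider l where "l \<le> N" "A4 l \<noteq> 0" | k where "A4 l0 = 0" "k \<le> N" "A3 k \<noteq> 0"
    | j where "A3 k0 = 0" "j \<le> N" "A2 j \<noteq> 0" | "A2 j0 = 0" using nz by blast
  then show ?thesis
  proof cases
    case 1
    have "A4 l \<in> ring_gen (K \<union> {x1, x2, x3})" for l unfolding A4_def by (intro ri cs xs) auto
    from finite_sum_gradient[where N = N and A = A4 and x = x4 and i = l, OF s4 1 this] obtain a1 a2 a3 a4 where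
      a: "{a1, a2, a3, a4} \<subseteq> ring_gen (K \<union> {x1, x2, x3, x4})" "a4 \<noteq> 0" "grad_rel K x1 x2 x3 x4 a1 a2 a3 a4" by blast
    show ?thesis by (rule lift[of a1 a2 a3 a4]) (use a in simp_all)
  next
    case 2
    have 3: "A3 l \<in> ring_gen (K \<union> {x1, x2, 0})" for l unfolding A3_def by (intro ri cs xs) auto
    have "(\<Sum>k\<le>N. A3 k * x3 ^ k) = 0" using s3 2(1) by simp
    from finite_sum_gradient[where N = N and A = A3 and x = x3 and i = k, OF this 2(2,3) 3] obtain a1 a2 a3 a4 where
      a: "{a1, a2, a3, a4} \<subseteq> ring_gen (K \<union> {x1, x2, 0, x3})" "a4 \<noteq> 0" "grad_rel K x1 x2 0 x3 a1 a2 a3 a4" by blast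
    have "{a1, a2, a3, a4} \<subseteq> ?R" using a(1) incl[of "{x1, x2, 0, x3}"] by blast
    moreover have "grad_rel K x1 x2 x3 x4 a1 a2 a4 0" using a(3) by (auto simp: grad_rel_def derivation_0)
    ultimately show ?thesis using zero a(2) by (intro lift[of a1 a2 a4 0]) simp_all
  next
    case 3
    have 2: "A2 l \<in> ring_gen (K \<union> {x1, 0, 0})" for l unfolding A2_def by (intro ri cs xs) auto
    have "(\<Sum>k\<le>N. A2 k * x2 ^ k) = 0" using s2 3(1) by simp
    from finite_sum_gradient[where N = N and A = A2 and x = x2 and i = j, OF this 3(2,3) 2] obtain a1 a2 a3 a4 where
      a: "{a1, a2, a3, a4} \<subseteq> ring_gen (K \<union> {x1, 0, 0, x2})" "a4 \<noteq> 0" "grad_rel K x1 0 0 x2 a1 a2 a3 a4" by blast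
    have "{a1, a2, a3, a4} \<subseteq> ?R" using a(1) incl[of "{x1, 0, 0, x2}"] by blast
    moreover have "grad_rel K x1 x2 x3 x4 a1 a4 0 0" using a(3) by (auto simp: grad_rel_def derivation_0)
    ultimately show ?thesis using zero a(2) by (intro lift[of a1 a4 0 0]) simp_all
  next
    case 4
    have s1: "(\<Sum>i\<le>N. c i j0 k0 l0 * x1 ^ i) = 0" using 4 by (simp add: A2_def)
    have 5: "c i j0 k0 l0 \<in> ring_gen (K \<union> {0, 0, 0})" for i by (rule cs)
    from finite_sum_gradient[where N = N and A = "\<lambda>i. c i j0 k0 l0" and x = x1 and i = i0, OF s1 nz(1,5) 5] obtain a1 a2 a3 a4 where
      a: "{a1, a2, a3, a4} \<subseteq> ring_gen (K \<union> {0, 0, 0, x1})" "a4 \<noteq> 0" "grad_rel K 0 0 0 x1 a1 a2 a3 a4" by blast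
    have "{a1, a2, a3, a4} \<subseteq> ?R" using a(1) incl[of "{0, 0, 0, x1}"] by blast
    moreover have "grad_rel K x1 x2 x3 x4 a4 0 0 0" using a(3) by (auto simp: grad_rel_def derivation_0)
    ultimately show ?thesis using zero a(2) by (intro lift[of a4 0 0 0]) simp_all
  qed
qed

section \<open>The reflection principle for jets\<close>

text \<open>
  Here \<open>L\<close> and \<open>L'\<close> are the CR and anti-CR vector fields of the complexified source, \<open>h\<close> and \<open>g\<close> the
  map and its conjugate, and \<open>(a, b)\<close> the gradient of an equation of the target. A derivation \<open>D\<close>
  killing \<open>h\<close> moves \<open>g\<close> along the fibre of that equation, hence agrees with a multiple \<open>\<mu> L'\<close> on
  \<open>h, g\<close> and so on \<open>a\<close>. Differentiating \<open>a . L h = 0\<close> by \<open>D\<close> and by \<open>L'\<close> then gives \<open>\<mu> = 0\<close>.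
\<close>

lemma reflection:
  fixes h1 h2 g1 g2 :: "'a::field_char_0"
  assumes rel: "\<And>D. derivation D \<Longrightarrow> \<forall>k\<in>K. D k = 0 \<Longrightarrow> a1 * D h1 + a2 * D h2 + b1 * D g1 + b2 * D g2 = 0"
    and acl: "{a1, a2} \<subseteq> der_closure (K \<union> {h1, h2, g1, g2})"
    and a: "a1 \<noteq> 0 \<or> a2 \<noteq> 0" and b: "b1 \<noteq> 0 \<or> b2 \<noteq> 0"
    and L: "derivation L" "\<forall>k\<in>K. L k = 0" "L g1 = 0" "L g2 = 0"
    and L': "derivation L'" "\<forall>k\<in>K. L' k = 0" "L' h1 = 0" "L' h2 = 0"
    and L'g: "L' g1 \<noteq> 0 \<or> L' g2 \<noteq> 0"
    and levi: "L' (L h1) * L h2 \<noteq> L' (L h2) * L h1"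
    and D: "derivation D" "\<forall>k\<in>K. D k = 0" "D h1 = 0" "D h2 = 0" "D (L h1) = 0" "D (L h2) = 0"
  shows "D g1 = 0" "D g2 = 0"
proof -
  have aL: "a1 * L h1 + a2 * L h2 = 0" using rel[OF L(1,2)] L by simp
  have bL: "b1 * L' g1 + b2 * L' g2 = 0" using rel[OF L'(1,2)] L' by simp
  have bD: "b1 * D g1 + b2 * D g2 = 0" using rel[OF D(1,2)] D by simp
  obtain \<mu> where \<mu>: "D g1 = \<mu> * L' g1" "D g2 = \<mu> * L' g2"
  proof (cases "b1 = 0")
    case True
    then have "L' g2 = 0" "D g2 = 0" "L' g1 \<noteq> 0" using bL bD b L'g by auto
    then show ?thesis using that[of "D g1 / L' g1"] by simp
  next
    case False
    have e: "L' g1 = - b2 * L' g2 / b1" "D g1 = - b2 * D g2 / b1"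
      using False eq_neg_iff_add_eq_0[THEN iffD2, OF bL] eq_neg_iff_add_eq_0[THEN iffD2, OF bD]
      by (metis mult_minus_left nonzero_mult_div_cancel_left)+
    then have "L' g2 \<noteq> 0" using L'g by auto
    then show ?thesis using that[of "D g2 / L' g2"] e by simp
  qed
  have dE: "derivation (\<lambda>x. 1 * D x - \<mu> * L' x)" by (rule derivation_comb[OF D(1) L'(1)])
  have Da: "D a = \<mu> * L' a" if "a \<in> {a1, a2}" for a
  proof -
    have "1 * D a - \<mu> * L' a = 0"
      by (rule der_closureD[OF _ dE, where B = "K \<union> {h1, h2, g1, g2}"]) (use that acl D L' \<mu> in auto)
    then show ?thesis by simp
  qed
  have "D (a1 * L h1 + a2 * L h2) = 0" unfolding aL by (rule derivation_0[OF D(1)])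
  then have "\<mu> * (L' a1 * L h1 + L' a2 * L h2) = 0"
    using D Da by (simp add: derivation_add[OF D(1)] derivation_mult[OF D(1)] algebra_simps)
  moreover have "L' (a1 * L h1 + a2 * L h2) = 0" unfolding aL by (rule derivation_0[OF L'(1)])
  then have "L' a1 * L h1 + L' a2 * L h2 = - (a1 * L' (L h1) + a2 * L' (L h2))"
    by (simp add: derivation_add[OF L'(1)] derivation_mult[OF L'(1)] eq_neg_iff_add_eq_0 algebra_simps)
  ultimately have m: "\<mu> * (a1 * L' (L h1) + a2 * L' (L h2)) = 0"
    by (metis minus_mult_right neg_equal_0_iff_equal)
  have "\<mu> = 0"
  proof (rule ccontr)
    assume "\<mu> \<noteq> 0"
    then have z: "a1 * L' (L h1) + a2 * L' (L h2) = 0" using m by simp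
    have "a1 * (L' (L h1) * L h2 - L' (L h2) * L h1)
        = (a1 * L' (L h1) + a2 * L' (L h2)) * L h2 - (a1 * L h1 + a2 * L h2) * L' (L h2)" by (simp add: algebra_simps)
    moreover have "a2 * (L' (L h1) * L h2 - L' (L h2) * L h1)
        = (a1 * L h1 + a2 * L h2) * L' (L h1) - (a1 * L' (L h1) + a2 * L' (L h2)) * L h1" by (simp add: algebra_simps)
    ultimately show False using z aL a levi by auto
  qed
  then show "D g1 = 0" "D g2 = 0" using \<mu> by auto
qed

lemma der_closure_superset: "b \<in> B \<Longrightarrow> b \<in> der_closure B"
  by (auto intro: der_closureI)

lemma der_closure_mono: "B \<subseteq> C \<Longrightarrow> der_closure B \<subseteq> der_closure C"
  by (auto simp: der_closure_def)

lemma der_closure_0: "0 \<in> der_closure B"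
  by (rule der_closureI) (rule derivation_0)

lemma der_closure_1: "1 \<in> der_closure B"
  by (rule der_closureI) (rule derivation_1)

lemma der_closure_mult: "x \<in> der_closure B \<Longrightarrow> y \<in> der_closure B \<Longrightarrow> x * y \<in> der_closure B"
  by (rule der_closureI) (simp add: derivation_mult der_closureD)

section \<open>Jet determination along Segre varieties\<close>

text \<open>
  An algebraic picture of a point \<open>(z, w)\<close> moving on the Segre variety of \<open>(x, t)\<close>, both seen in a
  field with derivations: \<open>w\<close> is algebraic over \<open>x, t, z\<close>; \<open>g1, g2\<close> depend on \<open>(x, t)\<close> only; \<open>h1, h2\<close>
  depend on \<open>(z, w)\<close> only, \<open>ha, hb\<close> being their derivatives in \<open>z\<close> and \<open>w\<close>, and \<open>hab, hbb\<close> the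
  derivatives of \<open>ha, hb\<close> in \<open>w\<close>. The assumption \<open>dep\<close> is the gradient of the target equation.
\<close>

locale segre_point =
  fixes K :: "'a::field_char_0 set" and dx dt dz :: "'a \<Rightarrow> 'a"
    and x t z w g1 g2 h1 h2 ha1 ha2 hb1 hb2 hab1 hab2 hbb1 hbb2 :: 'a
  assumes der: "derivation dx" "derivation dt" "derivation dz"
    and const: "\<And>k. k \<in> K \<Longrightarrow> dx k = 0" "\<And>k. k \<in> K \<Longrightarrow> dt k = 0" "\<And>k. k \<in> K \<Longrightarrow> dz k = 0"
    and coords: "dx x = 1" "dx t = 0" "dx z = 0" "dt x = 0" "dt t = 1" "dt z = 0" "dz x = 0" "dz t = 0" "dz z = 1"
    and w: "w \<in> der_closure (K \<union> {x, t, z})"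
    and comm: "dx (dz w) = dz (dx w)" "dt (dz w) = dz (dt w)"
    and levi: "dt w * dz (dx w) \<noteq> dx w * dz (dt w)"
    and dtw: "dt w \<noteq> 0"
    and g: "dz g1 = 0" "dz g2 = 0" "dz (dx g1) = 0" "dz (dx g2) = 0" "dz (dt g1) = 0" "dz (dt g2) = 0"
    and detg: "dx g1 * dt g2 \<noteq> dx g2 * dt g1"
    and hz: "dz h1 = ha1 + dz w * hb1" "dz h2 = ha2 + dz w * hb2"
    and hx: "dx h1 = dx w * hb1" "dx h2 = dx w * hb2" "dt h1 = dt w * hb1" "dt h2 = dt w * hb2"
    and hax: "dx ha1 = dx w * hab1" "dx ha2 = dx w * hab2" "dt ha1 = dt w * hab1" "dt ha2 = dt w * hab2"
    and hbx: "dx hb1 = dx w * hbb1" "dx hb2 = dx w * hbb2" "dt hb1 = dt w * hbb1" "dt hb2 = dt w * hbb2"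
    and deth: "ha1 * hb2 \<noteq> ha2 * hb1"
    and dep: "\<exists>a1 a2 b1 b2. {a1, a2, b1, b2} \<subseteq> der_closure (K \<union> {h1, h2, g1, g2}) \<and>
      (a1 \<noteq> 0 \<or> a2 \<noteq> 0 \<or> b1 \<noteq> 0 \<or> b2 \<noteq> 0) \<and>
      grad_rel K h1 h2 g1 g2 a1 a2 b1 b2"
begin

text \<open>
  The anti-CR field: the combination of \<open>dx\<close> and \<open>dt\<close> annihilating \<open>w\<close>, hence everything depending on
  \<open>(z, w)\<close> only.
\<close>

definition "dbar u = dt w * dx u - dx w * dt u"

lemma dbar: "derivation dbar" unfolding dbar_def by (rule derivation_comb[OF der(1,2)])

lemma dbar_const: "\<forall>k\<in>K. dbar k = 0" by (simp add: dbar_def const)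

lemma dbar_h: "dbar h1 = 0" "dbar h2 = 0" "dbar ha1 = 0" "dbar ha2 = 0" "dbar hb1 = 0" "dbar hb2 = 0"
  by (simp_all add: dbar_def hx hax hbx)

lemma linear_system_zero:
  fixes a b p q r s :: 'a
  assumes "a * p + b * q = 0" "a * r + b * s = 0" "p * s \<noteq> q * r"
  shows "a = 0" "b = 0"
proof -
  have "a * (p * s - q * r) = (a * p + b * q) * s - (a * r + b * s) * q" by (simp add: algebra_simps)
  then show "a = 0" using assms by simp
  have "b * (p * s - q * r) = (a * r + b * s) * p - (a * p + b * q) * r" by (simp add: algebra_simps)
  then show "b = 0" using assms by simp
qed

text \<open>
  If one half of the gradient vanished, the other half would annihilate both rows of an invertible
  Jacobian matrix, that of \<open>(g1, g2)\<close> in \<open>(x, t)\<close> or that of \<open>(h1, h2)\<close> in \<open>(z, w)\<close>.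
\<close>

lemma gradient_nonzero:
  assumes rel: "\<And>D. derivation D \<Longrightarrow> \<forall>k\<in>K. D k = 0 \<Longrightarrow> a1 * D h1 + a2 * D h2 + b1 * D g1 + b2 * D g2 = 0"
    and nz: "a1 \<noteq> 0 \<or> a2 \<noteq> 0 \<or> b1 \<noteq> 0 \<or> b2 \<noteq> 0"
  shows "a1 \<noteq> 0 \<or> a2 \<noteq> 0" "b1 \<noteq> 0 \<or> b2 \<noteq> 0"
proof -
  have r: "a1 * dx h1 + a2 * dx h2 + b1 * dx g1 + b2 * dx g2 = 0"
    "a1 * dt h1 + a2 * dt h2 + b1 * dt g1 + b2 * dt g2 = 0"
    "a1 * dz h1 + a2 * dz h2 = 0"
    using rel[OF der(1)] rel[OF der(2)] rel[OF der(3)] const g by simp_all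
  show "a1 \<noteq> 0 \<or> a2 \<noteq> 0"
  proof (rule ccontr)
    assume a: "\<not> (a1 \<noteq> 0 \<or> a2 \<noteq> 0)"
    then have "b1 * dx g1 + b2 * dx g2 = 0" "b1 * dt g1 + b2 * dt g2 = 0" using r by auto
    from linear_system_zero[OF this] detg nz a show False by (auto simp: mult.commute)
  qed
  show "b1 \<noteq> 0 \<or> b2 \<noteq> 0"
  proof (rule ccontr)
    assume b: "\<not> (b1 \<noteq> 0 \<or> b2 \<noteq> 0)"
    have "dt w * (a1 * hb1 + a2 * hb2) = 0" using r(2) b by (simp add: hx algebra_simps)
    then have e: "a1 * hb1 + a2 * hb2 = 0" using dtw by simp
    have "a1 * ha1 + a2 * ha2 + dz w * (a1 * hb1 + a2 * hb2) = 0" using r(3) by (simp add: hz algebra_simps)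
    then have "a1 * ha1 + a2 * ha2 = 0" using e by simp
    from linear_system_zero[OF this e] deth nz b show False by (auto simp: mult.commute)
  qed
qed

lemma dz_w: "dz w \<in> der_closure (K \<union> {x, t, z})"
  and dx_w: "dx w \<in> der_closure (K \<union> {x, t, z})"
  and dt_w: "dt w \<in> der_closure (K \<union> {x, t, z})"
proof -
  have sup: "K \<union> {x, t, z} \<subseteq> der_closure (K \<union> {x, t, z})" by (intro subsetI der_closure_superset)
  show "dz w \<in> der_closure (K \<union> {x, t, z})"
    by (rule derivation_der_closure[OF der(3) w sup]) (auto simp: const coords der_closure_0 der_closure_1)
  show "dx w \<in> der_closure (K \<union> {x, t, z})"
    by (rule derivation_der_closure[OF der(1) w sup]) (auto simp: const coords der_closure_0 der_closure_1)
  show "dt w \<in> der_closure (K \<union> {x, t, z})"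
    by (rule derivation_der_closure[OF der(2) w sup]) (auto simp: const coords der_closure_0 der_closure_1)
qed

text \<open>The Levi form of the source in the present coordinates.\<close>

lemma dbar_dz_w: "dbar (dz w) \<noteq> 0" using levi by (simp add: dbar_def comm)

text \<open>
  The reflection principle with \<open>L = dz\<close> and \<open>L' = dbar\<close>. A derivation killing the right-hand side kills
  \<open>dz h\<close>, because \<open>dz w\<close> is algebraic over \<open>x, t, z\<close>; the nondegeneracy required of \<open>h\<close> is the Levi
  form times the Jacobian of \<open>h\<close>.
\<close>

lemma conjugate_determined:
  "{g1, g2} \<subseteq> der_closure (K \<union> {x, t, z, h1, h2, ha1, ha2, hb1, hb2})"
proof -
  obtain a1 a2 b1 b2 where ab: "{a1, a2, b1, b2} \<subseteq> der_closure (K \<union> {h1, h2, g1, g2})"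
      "a1 \<noteq> 0 \<or> a2 \<noteq> 0 \<or> b1 \<noteq> 0 \<or> b2 \<noteq> 0"
    and gr: "grad_rel K h1 h2 g1 g2 a1 a2 b1 b2"
    using dep by blast
  have rel: "derivation D \<Longrightarrow> \<forall>k\<in>K. D k = 0 \<Longrightarrow> a1 * D h1 + a2 * D h2 + b1 * D g1 + b2 * D g2 = 0" for D
    using gr by (simp add: grad_rel_def)
  have dg: "dbar g1 \<noteq> 0 \<or> dbar g2 \<noteq> 0"
  proof (rule ccontr)
    assume "\<not> ?thesis"
    then have "dt w * dx g1 + (- dx w) * dt g1 = 0" "dt w * dx g2 + (- dx w) * dt g2 = 0" by (simp_all add: dbar_def)
    from linear_system_zero(1)[OF this] detg dtw show False by (auto simp: mult.commute)
  qed
  have Lh: "dbar (dz h1) = dbar (dz w) * hb1" "dbar (dz h2) = dbar (dz w) * hb2"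
    by (simp_all add: hz derivation_add[OF dbar] derivation_mult[OF dbar] dbar_h)
  have lev: "dbar (dz h1) * dz h2 \<noteq> dbar (dz h2) * dz h1"
  proof -
    have "dbar (dz h1) * dz h2 - dbar (dz h2) * dz h1 = dbar (dz w) * (hb1 * ha2 - hb2 * ha1)"
      unfolding Lh by (simp add: hz algebra_simps)
    then show ?thesis using dbar_dz_w deth by (auto simp: mult.commute)
  qed
  have "D g1 = 0 \<and> D g2 = 0"
    if D: "derivation D" "\<And>b. b \<in> K \<union> {x, t, z, h1, h2, ha1, ha2, hb1, hb2} \<Longrightarrow> D b = 0" for D
  proof -
    have "D (dz w) = 0" by (rule der_closureD[OF dz_w D(1)]) (use D(2) in auto)
    moreover have D0: "\<forall>k\<in>K. D k = 0" "D h1 = 0" "D h2 = 0" "D ha1 = 0" "D ha2 = 0" "D hb1 = 0" "D hb2 = 0"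
      using D(2) by simp_all
    ultimately have DL: "D (dz h1) = 0" "D (dz h2) = 0"
      by (simp_all add: hz derivation_add[OF D(1)] derivation_mult[OF D(1)])
    have a: "{a1, a2} \<subseteq> der_closure (K \<union> {h1, h2, g1, g2})" using ab(1) by simp
    have c: "\<forall>k\<in>K. dz k = 0" using const by simp
    show ?thesis
      using reflection[OF rel a gradient_nonzero[OF rel ab(2)] der(3) c g(1,2) dbar dbar_const dbar_h(1,2) dg lev D(1) D0(1-3) DL]
      by (rule conjI)
  qed
  then show ?thesis by (auto simp: der_closure_def)
qed

text \<open>
  Differentiate the previous dependence by \<open>dx\<close> and \<open>dt\<close>. They move \<open>(z, w)\<close> through \<open>w\<close> only, so of the
  higher derivatives of \<open>h\<close> only those in the direction of \<open>w\<close> appear.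
\<close>

lemma conjugate_jet_determined:
  "{g1, g2, dx g1, dx g2, dt g1, dt g2} \<subseteq>
     der_closure (K \<union> {x, t, z, h1, h2, ha1, ha2, hb1, hb2, hab1, hab2, hbb1, hbb2})"
    (is "_ \<subseteq> der_closure ?C")
proof -
  let ?B = "K \<union> {x, t, z, h1, h2, ha1, ha2, hb1, hb2}"
  have BC: "?B \<subseteq> der_closure ?C" by (rule subsetI, rule der_closure_superset) auto
  have 1: "{g1, g2} \<subseteq> der_closure ?B" by (rule conjugate_determined)
  have xtz: "der_closure (K \<union> {x, t, z}) \<subseteq> der_closure ?C" by (rule der_closure_mono) auto
  have wC: "dx w \<in> der_closure ?C" "dt w \<in> der_closure ?C" using dx_w dt_w xtz by (meson subsetD)+
  have m: "hb1 \<in> der_closure ?C" "hb2 \<in> der_closure ?C" "hab1 \<in> der_closure ?C" "hab2 \<in> der_closure ?C"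
    "hbb1 \<in> der_closure ?C" "hbb2 \<in> der_closure ?C" by (rule der_closure_superset; simp)+
  note mm = der_closure_mult[OF wC(1)] der_closure_mult[OF wC(2)]
  have B: "dx b \<in> der_closure ?C \<and> dt b \<in> der_closure ?C" if "b \<in> ?B" for b
    using that
    by (elim UnE insertE emptyE)
      (simp_all only: const coords hx hax hbx der_closure_0 der_closure_1 mm[OF m(1)] mm[OF m(2)] mm[OF m(3)]
        mm[OF m(4)] mm[OF m(5)] mm[OF m(6)] simp_thms)
  have B0: "dx ` ?B \<subseteq> der_closure ?C" "dt ` ?B \<subseteq> der_closure ?C" using B by (auto simp del: Un_insert_right)
  have g: "g1 \<in> der_closure ?B" "g2 \<in> der_closure ?B" using 1 by simp_all
  show ?thesis
    unfolding insert_subset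
    by (intro conjI empty_subsetI der_closure_trans[OF g(1) BC] der_closure_trans[OF g(2) BC]
        derivation_der_closure[OF der(1) _ BC B0(1)] derivation_der_closure[OF der(2) _ BC B0(2)] g)
qed

text \<open>
  The reflection principle with the two sides exchanged, \<open>L = dbar\<close> and \<open>L' = dz\<close>: here the derivatives
  of \<open>g\<close> along the anti-CR field are needed, that is, its 1-jet.
\<close>

lemma map_determined:
  "{h1, h2} \<subseteq> der_closure (K \<union> {x, t, z, g1, g2, dx g1, dx g2, dt g1, dt g2})"
proof -
  obtain a1 a2 b1 b2 where ab: "{a1, a2, b1, b2} \<subseteq> der_closure (K \<union> {h1, h2, g1, g2})"
      "a1 \<noteq> 0 \<or> a2 \<noteq> 0 \<or> b1 \<noteq> 0 \<or> b2 \<noteq> 0"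
    and gr: "grad_rel K h1 h2 g1 g2 a1 a2 b1 b2"
    using dep by blast
  have rel: "derivation D \<Longrightarrow> \<forall>k\<in>K. D k = 0 \<Longrightarrow> a1 * D h1 + a2 * D h2 + b1 * D g1 + b2 * D g2 = 0" for D
    using gr by (simp add: grad_rel_def)
  note nz = gradient_nonzero[OF rel ab(2)]
  have rel': "b1 * D g1 + b2 * D g2 + a1 * D h1 + a2 * D h2 = 0" if "derivation D" "\<forall>k\<in>K. D k = 0" for D
    using rel[OF that] by (simp add: algebra_simps)
  have dh: "dz h1 \<noteq> 0 \<or> dz h2 \<noteq> 0"
  proof (rule ccontr)
    assume "\<not> ?thesis"
    then have "1 * ha1 + dz w * hb1 = 0" "1 * ha2 + dz w * hb2 = 0" by (simp_all add: hz)
    from linear_system_zero(1)[OF this] deth show False by (auto simp: mult.commute)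
  qed
  have Lg: "dz (dbar g1) = dz (dt w) * dx g1 - dz (dx w) * dt g1" "dz (dbar g2) = dz (dt w) * dx g2 - dz (dx w) * dt g2"
    by (simp_all add: dbar_def derivation_diff[OF der(3)] derivation_mult[OF der(3)] g)
  have lev: "dz (dbar g1) * dbar g2 \<noteq> dz (dbar g2) * dbar g1"
  proof -
    have "dz (dbar g1) * dbar g2 - dz (dbar g2) * dbar g1
        = (dt w * dz (dx w) - dx w * dz (dt w)) * (dx g1 * dt g2 - dx g2 * dt g1)"
      unfolding Lg by (simp add: dbar_def algebra_simps)
    then show ?thesis using levi detg by (metis mult_eq_0_iff right_minus_eq)
  qed
  have "D h1 = 0 \<and> D h2 = 0"
    if D: "derivation D" "\<And>b. b \<in> K \<union> {x, t, z, g1, g2, dx g1, dx g2, dt g1, dt g2} \<Longrightarrow> D b = 0" for D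
  proof -
    have Dw: "D (dx w) = 0" "D (dt w) = 0"
      by (rule der_closureD[OF dx_w D(1)], rule D(2), blast) (rule der_closureD[OF dt_w D(1)], rule D(2), blast)
    have D0: "\<forall>k\<in>K. D k = 0" "D g1 = 0" "D g2 = 0"
      and D1: "D (dx g1) = 0" "D (dx g2) = 0" "D (dt g1) = 0" "D (dt g2) = 0" using D(2) by simp_all
    have c: "\<forall>k\<in>K. dz k = 0" using const by simp
    have "D (dbar g1) = 0" "D (dbar g2) = 0"
      by (simp_all add: dbar_def derivation_diff[OF D(1)] derivation_mult[OF D(1)] Dw D1)
    moreover have "{b1, b2} \<subseteq> der_closure (K \<union> {g1, g2, h1, h2})" using ab(1) by (simp add: insert_commute)
    ultimately show ?thesis
      using reflection[OF rel' _ nz(2) nz(1) dbar dbar_const dbar_h(1,2) der(3) c g(1,2) dh lev D(1) D0]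
      by blast
  qed
  then show ?thesis by (auto simp: der_closure_def)
qed

text \<open>
  The derivation \<open>D - D x dx - D t dt - D z dz\<close> kills \<open>x, t, z\<close>, and \<open>w\<close> is algebraic over them.
\<close>

lemma differential_w:
  assumes D: "derivation D" "\<And>k. k \<in> K \<Longrightarrow> D k = 0"
  shows "D w = dx w * D x + dt w * D t + dz w * D z"
proof -
  define E where "E = (\<lambda>u. 1 * (1 * (1 * D u - D x * dx u) - D t * dt u) - D z * dz u)"
  have "derivation E" unfolding E_def by (intro derivation_comb D der)
  moreover have "E b = 0" if "b \<in> K \<union> {x, t, z}" for b
    using that by (auto simp: E_def const coords D)
  ultimately have "E w = 0" using der_closureD[OF w] by blast
  then show ?thesis by (simp add: E_def algebra_simps)
qed

end

text \<open>
  Going from \<open>(z, w)\<close> to \<open>(x, t)\<close> and on to \<open>(y, v)\<close> along Segre varieties: the map at \<open>(z, w)\<close> is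
  algebraic over the two points and the 2-jet of the map at \<open>(y, v)\<close>.
\<close>

theorem map_determined_by_remote_jet:
  assumes W: "segre_point K dx dt dz x t z w g1 g2 h1 h2 ha1 ha2 hb1 hb2 hab1 hab2 hbb1 hbb2"
    and V: "segre_point K dx dt dy x t y v g1 g2 k1 k2 ka1 ka2 kb1 kb2 kab1 kab2 kbb1 kbb2"
    and J: "dx w * dt v \<noteq> dt w * dx v"
  shows "{h1, h2} \<subseteq> der_closure (K \<union> {z, w, y, v, k1, k2, ka1, ka2, kb1, kb2, kab1, kab2, kbb1, kbb2})"
    (is "_ \<subseteq> der_closure ?C")
proof -
  interpret W: segre_point K dx dt dz x t z w g1 g2 h1 h2 ha1 ha2 hb1 hb2 hab1 hab2 hbb1 hbb2 by fact
  interpret V: segre_point K dx dt dy x t y v g1 g2 k1 k2 ka1 ka2 kb1 kb2 kab1 kab2 kbb1 kbb2 by fact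
  have "D x = 0 \<and> D t = 0" if D: "derivation D" "\<And>b. b \<in> ?C \<Longrightarrow> D b = 0" for D
  proof -
    have "D x * dx w + D t * dt w = 0" "D x * dx v + D t * dt v = 0"
      using W.differential_w[OF D(1)] V.differential_w[OF D(1)] D(2) by (auto simp: mult.commute)
    from W.linear_system_zero[OF this] J show ?thesis by blast
  qed
  then have xt: "{x, t} \<subseteq> der_closure ?C" by (auto simp: der_closure_def)
  have "K \<union> {x, t, y, k1, k2, ka1, ka2, kb1, kb2, kab1, kab2, kbb1, kbb2} \<subseteq> der_closure ?C"
    using xt by (auto simp del: Un_insert_right intro: der_closure_superset)
  then have "{g1, g2, dx g1, dx g2, dt g1, dt g2} \<subseteq> der_closure ?C"
    using V.conjugate_jet_determined der_closure_trans by blast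
  then have "K \<union> {x, t, z, g1, g2, dx g1, dx g2, dt g1, dt g2} \<subseteq> der_closure ?C"
    using xt by (auto simp del: Un_insert_right intro: der_closure_superset)
  then show ?thesis using W.map_determined der_closure_trans by blast
qed

section \<open>Power series in four variables\<close>

declare split_paired_All [simp del] split_paired_Ex [simp del]

type_synonym mi = "nat \<times> nat \<times> nat \<times> nat"

text \<open>
  Coefficients indexed by exponent quadruples, so that the Cauchy product is a single convolution and
  identities can be tested on monomials.
\<close>

definition co :: "fps4 \<Rightarrow> mi \<Rightarrow> complex" where
  "co F = (\<lambda>(a, b, c, d). coeff4 F a b c d)"

definition mk :: "(mi \<Rightarrow> complex) \<Rightarrow> fps4" where
  "mk \<phi> = Abs_fps (\<lambda>a. Abs_fps (\<lambda>b. Abs_fps (\<lambda>c. Abs_fps (\<lambda>d. \<phi> (a, b, c, d)))))"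

lemma co_mk [simp]: "co (mk \<phi>) = \<phi>"
  by (auto simp: co_def mk_def coeff4_def)

lemma co_eqI: "(\<And>e. co F e = co G e) \<Longrightarrow> F = G"
  by (intro fps_ext) (auto simp: co_def coeff4_def split: prod.splits)

lemma mk_co [simp]: "mk (co F) = F"
  by (rule co_eqI) simp

lemma co_add [simp]: "co (F + G) e = co F e + co G e"
  and co_diff [simp]: "co (F - G) e = co F e - co G e"
  and co_uminus [simp]: "co (- F) e = - co F e"
  and co_0 [simp]: "co 0 e = 0"
  by (cases e; simp add: co_def coeff4_def)+

lemma co_sum [simp]: "co (sum F A) e = (\<Sum>i\<in>A. co (F i) e)"
  by (induction A rule: infinite_finite_induct) auto

fun deg :: "mi \<Rightarrow> nat" where "deg (a, b, c, d) = a + b + c + d"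

lemma deg_add [simp]: "deg (e + f) = deg e + deg f"
  by (cases e; cases f) auto

lemma deg_0 [simp]: "deg 0 = 0" by (simp add: zero_prod_def)

lemma deg_eq_0 [simp]: "deg e = 0 \<longleftrightarrow> e = 0" by (cases e) (auto simp: zero_prod_def)

definition upto :: "nat \<Rightarrow> mi set" where "upto n = {e. deg e \<le> n}"

lemma finite_upto [simp]: "finite (upto n)"
proof (rule finite_subset)
  show "upto n \<subseteq> {..n} \<times> {..n} \<times> {..n} \<times> {..n}" by (auto simp: upto_def)
qed auto

definition splits :: "mi \<Rightarrow> (mi \<times> mi) set" where "splits e = {(f, g). f + g = e}"

lemma finite_splits [simp]: "finite (splits e)"
proof (rule finite_subset)
  show "splits e \<subseteq> upto (deg e) \<times> upto (deg e)" by (auto simp: upto_def splits_def)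
qed auto

lemma co_mult: "co (F * G) e = (\<Sum>(f, g)\<in>splits e. co F f * co G g)"
proof -
  obtain a b c d where e: "e = (a, b, c, d)" by (cases e)
  have "co (F * G) e = (\<Sum>i=0..a. \<Sum>j=0..b. \<Sum>k=0..c. \<Sum>l=0..d.
      coeff4 F i j k l * coeff4 G (a - i) (b - j) (c - k) (d - l))"
    by (simp add: e co_def coeff4_def fps_mult_nth fps_sum_nth)
  also have "\<dots> = (\<Sum>(i, j, k, l)\<in>{0..a} \<times> {0..b} \<times> {0..c} \<times> {0..d}.
      coeff4 F i j k l * coeff4 G (a - i) (b - j) (c - k) (d - l))"
    by (simp add: sum.cartesian_product)
  also have "\<dots> = (\<Sum>(f, g)\<in>splits e. co F f * co G g)"
    by (rule sum.reindex_bij_witness[where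
          j = "\<lambda>(i, j, k, l). ((i, j, k, l), (a - i, b - j, c - k, d - l))" and i = fst])
       (auto simp: splits_def e co_def)
  finally show ?thesis .
qed

definition monom4 :: "complex \<Rightarrow> mi \<Rightarrow> fps4" where
  "monom4 c e = mk (\<lambda>f. if f = e then c else 0)"

lemma co_monom4: "co (monom4 c e) f = (if f = e then c else 0)"
  by (simp add: monom4_def)

lemma co_monom4_mult: "co (monom4 c e * F) (e + f) = c * co F f"
proof -
  have "co (monom4 c e * F) (e + f) = (\<Sum>p\<in>splits (e + f). if p = (e, f) then c * co F f else 0)"
    unfolding co_mult
  proof (rule sum.cong[OF refl])
    fix p assume p: "p \<in> splits (e + f)"
    then obtain g h where "p = (g, h)" "g + h = e + f" by (auto simp: splits_def)
    then show "(case p of (g, h) \<Rightarrow> co (monom4 c e) g * co F h) = (if p = (e, f) then c * co F f else 0)"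
      by (cases "g = e") (simp_all add: co_monom4)
  qed
  also have "\<dots> = c * co F f"
    by (subst sum.delta[OF finite_splits]) (simp add: splits_def)
  finally show ?thesis .
qed

lemma co_monom4_mult_0: "(\<And>f. g \<noteq> e + f) \<Longrightarrow> co (monom4 c e * F) g = 0"
proof (unfold co_mult, rule sum.neutral, rule ballI)
  fix p assume g: "\<And>f. g \<noteq> e + f" and p: "p \<in> splits g"
  then obtain h k where "p = (h, k)" "g = h + k" by (auto simp: splits_def)
  then show "(case p of (f, g) \<Rightarrow> co (monom4 c e) f * co F g) = 0"
    using g by (cases "h = e") (simp_all add: co_monom4)
qed

lemma co_const_mult [simp]: "co (monom4 c 0 * F) e = c * co F e"
  using co_monom4_mult[of c 0 F e] by simp

lemma monom4_mult: "monom4 c e * monom4 d f = monom4 (c * d) (e + f)"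
proof (rule co_eqI)
  fix g show "co (monom4 c e * monom4 d f) g = co (monom4 (c * d) (e + f)) g"
  proof (cases "\<exists>h. g = e + h")
    case True
    then obtain h where "g = e + h" by blast
    then show ?thesis by (simp add: co_monom4_mult) (simp add: co_monom4)
  next
    case False
    then have "\<And>h. g \<noteq> e + h" by blast
    then show ?thesis by (simp add: co_monom4_mult_0 co_monom4)
  qed
qed

lemma monom4_add: "monom4 (c + d) e = monom4 c e + monom4 d e"
  by (rule co_eqI) (simp add: co_monom4)

lemma monom4_zero [simp]: "monom4 0 e = 0"
  by (rule co_eqI) (simp add: co_monom4)

lemma const4_monom4: "const4 c = monom4 c 0"
  by (rule co_eqI, subst co_monom4) (auto simp: co_def coeff4_def const4_def zero_prod_def split: if_splits)

lemma const4_one [simp]: "const4 1 = 1" by (simp add: const4_def)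

lemma co_const4: "co (const4 c) e = (if e = 0 then c else 0)"
  by (simp add: const4_monom4 co_monom4)

lemma co_const4_mult [simp]: "co (const4 c * F) e = c * co F e"
  by (simp add: const4_monom4)

lemma const4_mult: "const4 (c * d) = const4 c * const4 d"
  and const4_add: "const4 (c + d) = const4 c + const4 d"
  and const4_uminus: "const4 (- c) = - const4 c"
  and const4_zero [simp]: "const4 0 = 0"
  by (simp_all add: const4_def)

lemma co_1: "co 1 e = (if e = 0 then 1 else 0)"
  using co_const4[of 1 e] by simp

lemma monom4_const: "monom4 c e = const4 c * monom4 1 e"
  by (rule co_eqI) (simp add: co_monom4)

definition E1 :: mi where "E1 = (1, 0, 0, 0)"
definition E2 :: mi where "E2 = (0, 1, 0, 0)"
definition E3 :: mi where "E3 = (0, 0, 1, 0)"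
definition E4 :: mi where "E4 = (0, 0, 0, 1)"

lemmas E_defs = E1_def E2_def E3_def E4_def

lemma deg_E [simp]: "deg E1 = 1" "deg E2 = 1" "deg E3 = 1" "deg E4 = 1"
  by (simp_all add: E_defs)

definition "X1 = monom4 1 E1"
definition "X2 = monom4 1 E2"
definition "X3 = monom4 1 E3"
definition "X4 = monom4 1 E4"

subsection \<open>The filtration by order\<close>

text \<open>The filtration by order; a series lying in all its steps is zero.\<close>

definition ord_ge :: "nat \<Rightarrow> fps4 \<Rightarrow> bool" where
  "ord_ge n F \<longleftrightarrow> (\<forall>e. deg e < n \<longrightarrow> co F e = 0)"

lemma ord_ge_0 [simp]: "ord_ge 0 F" "ord_ge n 0"
  by (simp_all add: ord_ge_def)

lemma ord_ge_mono: "ord_ge n F \<Longrightarrow> m \<le> n \<Longrightarrow> ord_ge m F"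
  by (auto simp: ord_ge_def)

lemma ord_ge_add: "ord_ge n F \<Longrightarrow> ord_ge n G \<Longrightarrow> ord_ge n (F + G)"
  and ord_ge_diff: "ord_ge n F \<Longrightarrow> ord_ge n G \<Longrightarrow> ord_ge n (F - G)"
  and ord_ge_uminus: "ord_ge n F \<Longrightarrow> ord_ge n (- F)"
  by (simp_all add: ord_ge_def)

lemma ord_ge_mult: assumes "ord_ge m F" "ord_ge n G" shows "ord_ge (m + n) (F * G)"
  unfolding ord_ge_def
proof (intro allI impI)
  fix e assume "deg e < m + n"
  then have "co F f * co G g = 0" if "(f, g) \<in> splits e" for f g
  proof (cases "deg f < m")
    case False
    then have "deg g < n" using that \<open>deg e < m + n\<close> by (auto simp: splits_def)
    then show ?thesis using assms by (simp add: ord_ge_def)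
  qed (use assms in \<open>simp add: ord_ge_def\<close>)
  then show "co (F * G) e = 0" unfolding co_mult
    by (intro sum.neutral ballI) (metis (mono_tags, lifting) case_prod_unfold prod.collapse)
qed

lemma ord_ge_mult1: "ord_ge n F \<Longrightarrow> ord_ge n (G * F)" "ord_ge n F \<Longrightarrow> ord_ge n (F * G)"
  using ord_ge_mult[of 0 G n F] ord_ge_mult[of n F 0 G] by simp_all

lemma ord_ge_power: "ord_ge 1 F \<Longrightarrow> ord_ge n (F ^ n)"
  by (induction n) (use ord_ge_mult[of 1 F] in auto)

lemma ord_ge_eqI: "(\<And>n. ord_ge n (F - G)) \<Longrightarrow> F = G"
  by (rule co_eqI) (metis co_diff eq_iff_diff_eq_0 lessI ord_ge_def)

lemma ord_ge_zeroI: "(\<And>n. ord_ge n F) \<Longrightarrow> F = 0"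
  using ord_ge_eqI[of F 0] by simp

lemma ord_ge_monom4: "deg e = n \<Longrightarrow> ord_ge n (monom4 c e)"
  by (auto simp: ord_ge_def co_monom4)

lemma ord_ge_X: "ord_ge 1 X1" "ord_ge 1 X2" "ord_ge 1 X3" "ord_ge 1 X4"
  by (auto simp: X1_def X2_def X3_def X4_def intro!: ord_ge_monom4)

lemma co_0_mult: "co (F * G) 0 = co F 0 * co G 0"
proof -
  have "splits 0 = {(0, 0)}" by (auto simp: splits_def zero_prod_def)
  then show ?thesis by (simp add: co_mult)
qed

lemma ord_ge_1: "ord_ge 1 F \<longleftrightarrow> co F 0 = 0"
  by (auto simp: ord_ge_def)

definition tail4 :: "nat \<Rightarrow> fps4 \<Rightarrow> fps4" where
  "tail4 n F = mk (\<lambda>e. if deg e \<le> n then 0 else co F e)"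

lemma co_tail4: "co (tail4 n F) e = (if deg e \<le> n then 0 else co F e)"
  by (simp add: tail4_def)

lemma ord_ge_tail4: "ord_ge (Suc n) (tail4 n F)"
  by (simp add: ord_ge_def co_tail4)

lemma tail4_decomp: "F = (\<Sum>f\<in>upto n. monom4 (co F f) f) + tail4 n F"
proof (rule co_eqI)
  fix e
  have "(\<Sum>f\<in>upto n. co (monom4 (co F f) f) e) = (\<Sum>f\<in>upto n. if f = e then co F e else 0)"
    by (auto simp: co_monom4 intro!: sum.cong)
  also have "\<dots> = (if e \<in> upto n then co F e else 0)" by simp
  finally show "co F e = co ((\<Sum>f\<in>upto n. monom4 (co F f) f) + tail4 n F) e"
    by (simp add: co_tail4 upto_def)
qed

text \<open>
  Continuity in the filtration reduces identities between additive operators to monomials; the next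
  lemma is the algebraic half of that argument.
\<close>

lemma additive_tail:
  fixes \<Delta> :: "fps4 \<Rightarrow> 'b::ab_group_add"
  assumes add: "\<And>F G. \<Delta> (F + G) = \<Delta> F + \<Delta> G" and mon: "\<And>c e. \<Delta> (monom4 c e) = 0"
  shows "\<Delta> F = \<Delta> (tail4 n F)"
proof -
  have "\<Delta> (0 + 0) = \<Delta> 0 + \<Delta> 0" by (rule add)
  then have 0: "\<Delta> 0 = 0" by simp
  have "\<Delta> (sum f A) = (\<Sum>i\<in>A. \<Delta> (f i))" for f :: "mi \<Rightarrow> fps4" and A
    by (induction A rule: infinite_finite_induct) (auto simp: 0 add)
  then have "\<Delta> (\<Sum>f\<in>upto n. monom4 (co F f) f) = 0" by (simp add: mon)
  then show ?thesis using tail4_decomp[of F n] add by (metis add_0)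
qed

text \<open>The remaining half: a remainder of arbitrarily high order vanishes.\<close>

lemma additive_zero:
  assumes add: "\<And>F G. \<Delta> (F + G) = \<Delta> F + \<Delta> G" and mon: "\<And>c e. \<Delta> (monom4 c e) = 0"
    and ord: "\<And>n F. ord_ge (Suc n) F \<Longrightarrow> ord_ge n (\<Delta> F)"
  shows "\<Delta> F = (0::fps4)"
proof (rule ord_ge_zeroI)
  fix n show "ord_ge n (\<Delta> F)"
    by (subst additive_tail[of \<Delta>, OF add mon, of F n]) (rule ord[OF ord_ge_tail4])
qed

subsection \<open>Substitution\<close>

type_synonym tup = "fps4 \<times> fps4 \<times> fps4 \<times> fps4"

fun gpow :: "tup \<Rightarrow> mi \<Rightarrow> fps4" where
  "gpow (G1, G2, G3, G4) (a, b, c, d) = G1 ^ a * G2 ^ b * G3 ^ c * G4 ^ d"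

fun sub :: "fps4 \<Rightarrow> tup \<Rightarrow> fps4" where
  "sub F (G1, G2, G3, G4) = compose4 F G1 G2 G3 G4"

text \<open>The substitutions that make sense: into series without constant term.\<close>

fun adm :: "tup \<Rightarrow> bool" where
  "adm (G1, G2, G3, G4) \<longleftrightarrow> ord_ge 1 G1 \<and> ord_ge 1 G2 \<and> ord_ge 1 G3 \<and> ord_ge 1 G4"

declare sub.simps [simp del] gpow.simps [simp del]

lemma ord_ge_gpow: "adm G \<Longrightarrow> ord_ge (deg f) (gpow G f)"
  by (cases G; cases f) (auto simp: gpow.simps intro!: ord_ge_mult ord_ge_power)

lemma gpow_0 [simp]: "gpow G 0 = 1"
  by (cases G) (simp add: gpow.simps zero_prod_def)

lemma gpow_add: "gpow G (e + f) = gpow G e * gpow G f"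
  by (cases G; cases e; cases f) (simp add: gpow.simps power_add algebra_simps)

text \<open>Beyond the degree of the coefficient the number of summands does not matter.\<close>

lemma co_sub:
  assumes G: "adm G" and n: "deg e \<le> n"
  shows "co (sub F G) e = (\<Sum>f\<in>upto n. co F f * co (gpow G f) e)"
proof -
  obtain G1 G2 G3 G4 where Geq: "G = (G1, G2, G3, G4)" by (cases G)
  obtain a b c d where e: "e = (a, b, c, d)" by (cases e)
  define N where "N = deg e"
  have z: "co (gpow G f) e = 0" if "deg f > N" for f
    using ord_ge_gpow[OF G, of f] that by (auto simp: ord_ge_def N_def)
  have "co (sub F G) e = (\<Sum>i\<le>N. \<Sum>j\<le>N. \<Sum>k\<le>N. \<Sum>l\<le>N. co F (i, j, k, l) * co (gpow G (i, j, k, l)) e)"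
    by (simp add: Geq sub.simps e compose4_def co_def coeff4_def Let_def gpow.simps N_def)
  also have "\<dots> = (\<Sum>f\<in>{..N} \<times> {..N} \<times> {..N} \<times> {..N}. co F f * co (gpow G f) e)"
    by (simp add: sum.cartesian_product case_prod_unfold)
  also have "\<dots> = (\<Sum>f\<in>upto N. co F f * co (gpow G f) e)"
  proof (rule sum.mono_neutral_right)
    show "\<forall>f\<in>{..N} \<times> {..N} \<times> {..N} \<times> {..N} - upto N. co F f * co (gpow G f) e = 0"
      using z by (auto simp: upto_def not_le simp del: deg.simps)
  qed (auto simp: upto_def)
  also have "\<dots> = (\<Sum>f\<in>upto n. co F f * co (gpow G f) e)"
    using n z by (intro sum.mono_neutral_left[OF finite_upto]) (auto simp: upto_def N_def)
  finally show ?thesis .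
qed

lemma sub_add: "adm G \<Longrightarrow> sub (F + F') G = sub F G + sub F' G"
  by (rule co_eqI) (simp add: co_sub[OF _ order.refl] algebra_simps sum.distrib)

lemma sub_uminus: "adm G \<Longrightarrow> sub (- F) G = - sub F G"
  by (rule co_eqI) (simp add: co_sub[OF _ order.refl] sum_negf)

lemma sub_diff: "adm G \<Longrightarrow> sub (F - F') G = sub F G - sub F' G"
  using sub_add[of G F "- F'"] sub_uminus[of G F'] by simp

lemma sub_monom4: assumes "adm G" shows "sub (monom4 c f) G = const4 c * gpow G f"
proof (rule co_eqI)
  fix e
  define n where "n = max (deg e) (deg f)"
  have "co (sub (monom4 c f) G) e = (\<Sum>g\<in>upto n. if g = f then c * co (gpow G f) e else 0)"
    unfolding co_sub[OF assms, of e n, OF max.cobounded1[of "deg e" "deg f", folded n_def]]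
    by (rule sum.cong) (simp_all add: co_monom4)
  also have "\<dots> = c * co (gpow G f) e"
    by (subst sum.delta[OF finite_upto]) (simp add: upto_def n_def)
  finally show "co (sub (monom4 c f) G) e = co (const4 c * gpow G f) e" by simp
qed

lemma ord_ge_sub: assumes "adm G" "ord_ge n F" shows "ord_ge n (sub F G)"
  unfolding ord_ge_def
proof (intro allI impI)
  fix e assume e: "deg e < n"
  show "co (sub F G) e = 0"
    using assms(2) e by (subst co_sub[OF assms(1) order.refl]) (auto simp: upto_def ord_ge_def intro!: sum.neutral)
qed

lemma sub_mult: assumes G: "adm G" shows "sub (F * F') G = sub F G * sub F' G"
proof -
  have 1: "sub (monom4 c f * F) G - sub (monom4 c f) G * sub F G = 0" for c f F
  proof (rule additive_zero[where \<Delta> = "\<lambda>F. sub (monom4 c f * F) G - sub (monom4 c f) G * sub F G"])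
    fix n :: nat and F assume "ord_ge (Suc n) F"
    then have "ord_ge n F" by (rule ord_ge_mono) simp
    then show "ord_ge n (sub (monom4 c f * F) G - sub (monom4 c f) G * sub F G)"
      by (intro ord_ge_diff ord_ge_sub[OF G] ord_ge_mult1)
  qed (auto simp: sub_add[OF G] sub_monom4[OF G] monom4_mult gpow_add const4_mult algebra_simps)
  have "sub (F * F') G - sub F G * sub F' G = 0"
  proof (rule additive_zero[where \<Delta> = "\<lambda>F. sub (F * F') G - sub F G * sub F' G"])
    fix n :: nat and F assume "ord_ge (Suc n) F"
    then have "ord_ge n F" by (rule ord_ge_mono) simp
    then show "ord_ge n (sub (F * F') G - sub F G * sub F' G)"
      by (intro ord_ge_diff ord_ge_sub[OF G] ord_ge_mult1)
  qed (use 1 in \<open>auto simp: sub_add[OF G] algebra_simps\<close>)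
  then show ?thesis by simp
qed

lemma sub_const4: "adm G \<Longrightarrow> sub (const4 c) G = const4 c"
  using sub_monom4[of G c 0] by (simp add: const4_monom4)

lemma sub_0: "adm G \<Longrightarrow> sub 0 G = 0" using sub_const4[of G 0] by simp
lemma sub_1: "adm G \<Longrightarrow> sub 1 G = 1" using sub_const4[of G 1] by simp

lemma sub_power: "adm G \<Longrightarrow> sub (F ^ n) G = sub F G ^ n"
  by (induction n) (auto simp: sub_1 sub_mult)

lemma sub_sum: "adm G \<Longrightarrow> sub (sum f A) G = (\<Sum>i\<in>A. sub (f i) G)"
  by (induction A rule: infinite_finite_induct) (auto simp: sub_0 sub_add)

lemma sub_X:
  assumes "adm (G1, G2, G3, G4)"
  shows "sub X1 (G1, G2, G3, G4) = G1" "sub X2 (G1, G2, G3, G4) = G2"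
    "sub X3 (G1, G2, G3, G4) = G3" "sub X4 (G1, G2, G3, G4) = G4"
  using assms by (simp_all only: X1_def X2_def X3_def X4_def sub_monom4) (simp_all add: gpow.simps E_defs)

fun subt :: "tup \<Rightarrow> tup \<Rightarrow> tup" where
  "subt (G1, G2, G3, G4) K = (sub G1 K, sub G2 K, sub G3 K, sub G4 K)"

lemma adm_subt: "adm G \<Longrightarrow> adm K \<Longrightarrow> adm (subt G K)"
  by (cases G) (auto intro: ord_ge_sub)

lemma sub_gpow: "adm K \<Longrightarrow> sub (gpow G f) K = gpow (subt G K) f"
  by (cases G; cases f) (simp add: gpow.simps sub_mult sub_power)

lemma sub_sub: assumes G: "adm G" and K: "adm K" shows "sub (sub F G) K = sub F (subt G K)"
proof -
  have "sub (sub F G) K - sub F (subt G K) = 0"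
  proof (rule additive_zero[where \<Delta> = "\<lambda>F. sub (sub F G) K - sub F (subt G K)"])
    fix n :: nat and F assume "ord_ge (Suc n) F"
    then have "ord_ge n F" by (rule ord_ge_mono) simp
    then show "ord_ge n (sub (sub F G) K - sub F (subt G K))"
      by (intro ord_ge_diff ord_ge_sub G K adm_subt)
  qed (auto simp: sub_add G K adm_subt sub_monom4 sub_mult sub_const4 sub_gpow algebra_simps)
  then show ?thesis by simp
qed

definition XX :: tup where "XX = (X1, X2, X3, X4)"

lemma adm_XX: "adm XX" using ord_ge_X by (simp add: XX_def)

lemma monom4_gpow: "monom4 1 e = gpow XX e"
proof -
  have p: "monom4 1 e ^ n = monom4 1 (n * fst e, n * fst (snd e), n * fst (snd (snd e)), n * snd (snd (snd e)))" for e n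
  proof (induction n)
    case 0 then show ?case by (rule_tac co_eqI) (simp add: co_1 co_monom4 zero_prod_def)
  next
    case (Suc n) then show ?case by (cases e) (simp add: monom4_mult)
  qed
  show ?thesis
    by (cases e) (simp add: XX_def gpow.simps X1_def X2_def X3_def X4_def p monom4_mult E_defs)
qed

lemma sub_XX: "sub F XX = F"
proof -
  have "sub F XX - F = 0"
  proof (rule additive_zero[where \<Delta> = "\<lambda>F. sub F XX - F"])
    fix n :: nat and F assume "ord_ge (Suc n) F"
    then have "ord_ge n F" by (rule ord_ge_mono) simp
    then show "ord_ge n (sub F XX - F)" by (intro ord_ge_diff ord_ge_sub adm_XX)
  next
    fix c e show "sub (monom4 c e) XX - monom4 c e = 0"
      unfolding sub_monom4[OF adm_XX] using monom4_const[of c e] by (simp add: monom4_gpow)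
  qed (auto simp: sub_add adm_XX)
  then show ?thesis by simp
qed

lemma co_sub_0: "adm G \<Longrightarrow> co (sub F G) 0 = co F 0"
proof -
  have "upto 0 = {0}" by (auto simp: upto_def)
  then show "adm G \<Longrightarrow> co (sub F G) 0 = co F 0" by (simp add: co_sub[of G 0 0] co_1)
qed

subsection \<open>Partial derivatives\<close>

text \<open>
  The exponent of the variable \<open>u\<close>, where \<open>u\<close> is one of the unit quadruples \<open>E1, \<dots>, E4\<close>.
\<close>

fun ip :: "mi \<Rightarrow> mi \<Rightarrow> nat" where
  "ip (a, b, c, d) (a', b', c', d') = a * a' + b * b' + c * c' + d * d'"

definition pd :: "mi \<Rightarrow> fps4 \<Rightarrow> fps4" where
  "pd u F = mk (\<lambda>e. of_nat (ip u (e + u)) * co F (e + u))"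

lemma co_pd: "co (pd u F) e = of_nat (ip u (e + u)) * co F (e + u)"
  by (simp add: pd_def)

definition units :: "mi set" where "units = {E1, E2, E3, E4}"

lemma pd_add: "pd u (F + G) = pd u F + pd u G"
  by (rule co_eqI) (simp add: co_pd algebra_simps)

lemma ord_ge_pd: "u \<in> units \<Longrightarrow> ord_ge (Suc n) F \<Longrightarrow> ord_ge n (pd u F)"
  by (auto simp: ord_ge_def co_pd units_def E_defs)

lemma pd_monom4: assumes u: "u \<in> units"
  shows "pd u (monom4 c e) = monom4 (of_nat (ip u e) * c) (e - u)"
proof (rule co_eqI)
  fix g :: mi
  obtain g1 g2 g3 g4 e1 e2 e3 e4 where ge: "g = (g1, g2, g3, g4)" "e = (e1, e2, e3, e4)"
    by (cases g; cases e)
  show "co (pd u (monom4 c e)) g = co (monom4 (of_nat (ip u e) * c) (e - u)) g"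
    using u unfolding units_def E_defs ge by (auto simp: co_pd co_monom4)
qed

lemma pd_mult: assumes u: "u \<in> units" shows "pd u (F * G) = F * pd u G + pd u F * G"
proof -
  have mm: "pd u (monom4 c e * monom4 d f) = monom4 c e * pd u (monom4 d f) + pd u (monom4 c e) * monom4 d f"
    for c d e f
  proof -
    have 1: "monom4 (of_nat (ip u f) * x) (e + (f - u)) = monom4 (of_nat (ip u f) * x) (e + f - u)" for x e f
      using u by (cases "ip u f = 0"; cases e; cases f) (auto simp: units_def E_defs)
    have 2: "monom4 (of_nat (ip u e) * x) (e - u + f) = monom4 (of_nat (ip u e) * x) (e + f - u)" for x
      using 1[of e x f] by (simp add: add.commute)
    have ipa: "ip u (e + f) = ip u e + ip u f"
      using u by (cases e; cases f) (auto simp: units_def E_defs)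
    show ?thesis
      using 1[of f "c * d" e] 2[of "c * d"]
      by (simp add: pd_monom4[OF u] monom4_mult mult.left_commute mult.assoc ipa)
         (simp add: algebra_simps monom4_add)
  qed
  have 1: "pd u (monom4 c f * F) - (monom4 c f * pd u F + pd u (monom4 c f) * F) = 0" for c f F
  proof (rule additive_zero[where \<Delta> = "\<lambda>F. pd u (monom4 c f * F) - (monom4 c f * pd u F + pd u (monom4 c f) * F)"])
    fix n F assume F: "ord_ge (Suc n) F"
    then have "ord_ge n F" by (rule ord_ge_mono) simp
    then show "ord_ge n (pd u (monom4 c f * F) - (monom4 c f * pd u F + pd u (monom4 c f) * F))"
      by (intro ord_ge_diff ord_ge_add ord_ge_mult1 ord_ge_pd u F)
  qed (auto simp: pd_add mm algebra_simps)
  have "pd u (F * G) - (F * pd u G + pd u F * G) = 0"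
  proof (rule additive_zero[where \<Delta> = "\<lambda>F. pd u (F * G) - (F * pd u G + pd u F * G)"])
    fix n F assume F: "ord_ge (Suc n) F"
    then have "ord_ge n F" by (rule ord_ge_mono) simp
    then show "ord_ge n (pd u (F * G) - (F * pd u G + pd u F * G))"
      by (intro ord_ge_diff ord_ge_add ord_ge_mult1 ord_ge_pd u F)
  qed (use 1 in \<open>auto simp: pd_add algebra_simps\<close>)
  then show ?thesis by simp
qed

lemma derivation_pd: "u \<in> units \<Longrightarrow> derivation (pd u)"
  by (simp add: derivation_def pd_add pd_mult)

lemma pd_const4: "u \<in> units \<Longrightarrow> pd u (const4 c) = 0"
  by (rule co_eqI) (auto simp: co_pd co_const4 units_def E_defs zero_prod_def)

lemma pd_const4_mult: "u \<in> units \<Longrightarrow> pd u (const4 c * F) = const4 c * pd u F"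
  by (simp add: pd_mult pd_const4)

lemma derivation_power: "derivation D \<Longrightarrow> D (x ^ n) = of_nat n * x ^ (n - 1) * D x"
proof (induction n)
  case (Suc n)
  then show ?case
    by (cases n) (auto simp: derivation_mult derivation_1 algebra_simps)
qed (simp add: derivation_1)

lemma chain_rule:
  assumes G: "adm (G1, G2, G3, G4)" and u: "u \<in> units"
  shows "pd u (sub F (G1, G2, G3, G4)) =
    sub (pd E1 F) (G1, G2, G3, G4) * pd u G1 + sub (pd E2 F) (G1, G2, G3, G4) * pd u G2
    + sub (pd E3 F) (G1, G2, G3, G4) * pd u G3 + sub (pd E4 F) (G1, G2, G3, G4) * pd u G4"
    (is "?L F = ?R F")
proof -
  have E: "E1 \<in> units" "E2 \<in> units" "E3 \<in> units" "E4 \<in> units" by (auto simp: units_def E_defs)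
  have cn: "const4 (of_nat n * c) = of_nat n * const4 c" for n c
    by (induction n) (auto simp: const4_add algebra_simps)
  have "?L F - ?R F = 0"
  proof (rule additive_zero[where \<Delta> = "\<lambda>F. ?L F - ?R F"])
    fix n F assume F: "ord_ge (Suc n) F"
    then show "ord_ge n (?L F - ?R F)"
      by (intro ord_ge_diff ord_ge_add ord_ge_mult1(2) ord_ge_sub[OF G] ord_ge_pd u E)
  next
    fix c and e :: mi
    obtain e1 e2 e3 e4 where e: "e = (e1, e2, e3, e4)" by (cases e)
    have pe: "pd E1 (monom4 c e) = monom4 (of_nat e1 * c) (e1 - 1, e2, e3, e4)"
      "pd E2 (monom4 c e) = monom4 (of_nat e2 * c) (e1, e2 - 1, e3, e4)"
      "pd E3 (monom4 c e) = monom4 (of_nat e3 * c) (e1, e2, e3 - 1, e4)"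
      "pd E4 (monom4 c e) = monom4 (of_nat e4 * c) (e1, e2, e3, e4 - 1)"
      by (simp_all add: pd_monom4[OF E(1)] pd_monom4[OF E(2)] pd_monom4[OF E(3)] pd_monom4[OF E(4)])
        (simp_all add: e E_defs)
    note pw = derivation_power[OF derivation_pd[OF u]]
    show "?L (monom4 c e) - ?R (monom4 c e) = 0"
      unfolding pe
      by (simp add: sub_monom4[OF G] e gpow.simps pd_const4_mult[OF u] pd_const4[OF u] pd_mult[OF u] pw cn E_defs)
        (simp add: algebra_simps)
  next
    fix F F' show "?L (F + F') - ?R (F + F') = (?L F - ?R F) + (?L F' - ?R F')"
      by (simp add: pd_add sub_add[OF G] algebra_simps)
  qed
  then show ?thesis by simp
qed

lemma pd_X [simp]:
  "pd E1 X1 = 1" "pd E1 X2 = 0" "pd E1 X3 = 0" "pd E1 X4 = 0"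
  "pd E2 X1 = 0" "pd E2 X2 = 1" "pd E2 X3 = 0" "pd E2 X4 = 0"
  "pd E3 X1 = 0" "pd E3 X2 = 0" "pd E3 X3 = 1" "pd E3 X4 = 0"
  "pd E4 X1 = 0" "pd E4 X2 = 0" "pd E4 X3 = 0" "pd E4 X4 = 1"
  by (rule co_eqI; auto simp: co_pd X1_def X2_def X3_def X4_def co_monom4 co_1 zero_prod_def E_defs)+

lemma pd_commute: "u \<in> units \<Longrightarrow> v \<in> units \<Longrightarrow> pd u (pd v F) = pd v (pd u F)"
  by (rule co_eqI) (auto simp: co_pd units_def E_defs split: prod.splits)

lemma unitsI [simp]: "E1 \<in> units" "E2 \<in> units" "E3 \<in> units" "E4 \<in> units"
  by (auto simp: units_def E_defs)

section \<open>The formal implicit function theorem\<close>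

text \<open>
  The limit of a sequence whose \<open>n\<close>-th term is final in all degrees below \<open>n\<close>.
\<close>

definition fixes_lim :: "(nat \<Rightarrow> fps4) \<Rightarrow> fps4" where
  "fixes_lim q = mk (\<lambda>e. co (q (Suc (deg e))) e)"

text \<open>Banach's fixed point theorem for the order filtration.\<close>

lemma contraction_fixpoint:
  assumes T1: "\<And>s. ord_ge 1 s \<Longrightarrow> ord_ge 1 (T s)"
    and contr: "\<And>n s s'. 1 \<le> n \<Longrightarrow> ord_ge 1 s \<Longrightarrow> ord_ge 1 s' \<Longrightarrow> ord_ge n (s - s') \<Longrightarrow> ord_ge (Suc n) (T s - T s')"
  shows "\<exists>s. ord_ge 1 s \<and> T s = s"
proof -
  define q where "q = (\<lambda>n. (T ^^ n) 0)"
  have q1: "ord_ge 1 (q n)" for n by (induction n) (use T1 in \<open>simp_all add: q_def del: One_nat_def\<close>)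
  have step: "ord_ge (Suc n) (q (Suc n) - q n)" for n
  proof (induction n)
    case 0
    then show ?case using q1[of 1] by (simp add: q_def)
  next
    case (Suc n)
    then show ?case using contr[OF _ q1 q1 Suc] by (simp add: q_def)
  qed
  have cauchy: "ord_ge (Suc n) (q (n + k) - q n)" for n k
  proof (induction k)
    case (Suc k)
    have "ord_ge (Suc n) (q (Suc (n + k)) - q (n + k))" by (rule ord_ge_mono[OF step]) simp
    from ord_ge_add[OF this Suc] show ?case by simp
  qed simp
  define s where "s = fixes_lim q"
  have sq: "ord_ge n (s - q n)" for n
    unfolding ord_ge_def
  proof (intro allI impI)
    fix e assume e: "deg e < n"
    then obtain k where "n = Suc (deg e) + k" using less_iff_Suc_add by auto
    then have "co (q n) e = co (q (Suc (deg e))) e"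
      using cauchy[of "Suc (deg e)" k] by (simp add: ord_ge_def)
    then show "co (s - q n) e = 0" by (simp add: s_def fixes_lim_def)
  qed
  have s1: "ord_ge 1 s" using ord_ge_add[OF sq[of 1] q1[of 1]] by simp
  have "ord_ge n (T s - s)" for n
  proof -
    have "ord_ge (Suc (Suc n)) (T s - T (q (Suc n)))" by (rule contr[OF _ s1 q1 sq]) simp
    then have "ord_ge n (T s - q (Suc (Suc n)))" by (rule_tac ord_ge_mono) (auto simp: q_def)
    moreover have "ord_ge n (s - q (Suc (Suc n)))" by (rule ord_ge_mono[OF sq]) simp
    ultimately have "ord_ge n ((T s - q (Suc (Suc n))) - (s - q (Suc (Suc n))))" by (rule ord_ge_diff)
    then show ?thesis by simp
  qed
  then show ?thesis using ord_ge_eqI s1 by blast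
qed

lemma ord_ge_power_diff:
  assumes "1 \<le> n" "ord_ge 1 x" "ord_ge 1 y" "ord_ge n (x - y)"
  shows "ord_ge (n + a - 1) (x ^ a - y ^ a)"
proof (induction a)
  case (Suc a)
  have eq: "x ^ Suc a - y ^ Suc a = x * (x ^ a - y ^ a) + (x - y) * y ^ a"
    by (simp add: algebra_simps)
  have "ord_ge (n + a) (x * (x ^ a - y ^ a))"
    using ord_ge_mult[OF assms(2) Suc] assms(1) by simp
  moreover have "ord_ge (n + a) ((x - y) * y ^ a)"
    by (rule ord_ge_mult[OF assms(4) ord_ge_power[OF assms(3)]])
  ultimately show ?case using assms(1) unfolding eq by (auto intro: ord_ge_add)
qed simp

lemma ord_ge_mult_diff:
  assumes "1 \<le> n" "ord_ge a A" "ord_ge b B'" "ord_ge (n + a - 1) (A - A')" "ord_ge (n + b - 1) (B - B')"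
  shows "ord_ge (n + (a + b) - 1) (A * B - A' * B')"
proof -
  have eq: "A * B - A' * B' = A * (B - B') + (A - A') * B'" by (simp add: algebra_simps)
  have "a + (n + b - 1) = n + (a + b) - 1" "n + a - 1 + b = n + (a + b) - 1" using assms(1) by auto
  then show ?thesis unfolding eq
    using ord_ge_mult[OF assms(2,5)] ord_ge_mult[OF assms(4,3)] by (auto intro: ord_ge_add)
qed

fun tdiff_ge :: "nat \<Rightarrow> tup \<Rightarrow> tup \<Rightarrow> bool" where
  "tdiff_ge n (G1, G2, G3, G4) (K1, K2, K3, K4) \<longleftrightarrow>
     ord_ge n (G1 - K1) \<and> ord_ge n (G2 - K2) \<and> ord_ge n (G3 - K3) \<and> ord_ge n (G4 - K4)"

lemma ord_ge_gpow_diff: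
  assumes n: "1 \<le> n" and "adm G" "adm K" "tdiff_ge n G K"
  shows "ord_ge (n + deg f - 1) (gpow G f - gpow K f)"
proof -
  obtain G1 G2 G3 G4 K1 K2 K3 K4 where eq: "G = (G1, G2, G3, G4)" "K = (K1, K2, K3, K4)"
    by (cases G; cases K)
  obtain a b c d where f: "f = (a, b, c, d)" by (cases f)
  note pw = ord_ge_power ord_ge_power_diff[OF n]
  show ?thesis using assms unfolding eq f gpow.simps deg.simps
    by (intro ord_ge_mult_diff[OF n] ord_ge_mult pw) auto
qed

text \<open>
  Every factor \<open>Gi - Ki\<close> replaces a factor of order one, so a perturbation of order \<open>n\<close> of the arguments
  of a series of order \<open>k\<close> changes its value in order \<open>n + k - 1\<close>.
\<close>

lemma ord_ge_sub_diff:
  assumes n: "1 \<le> n" and G: "adm G" and K: "adm K" and d: "tdiff_ge n G K" and F: "ord_ge k F"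
  shows "ord_ge (n + k - 1) (sub F G - sub F K)"
  unfolding ord_ge_def
proof (intro allI impI)
  fix e assume e: "deg e < n + k - 1"
  have "co F f * co (gpow G f) e = co F f * co (gpow K f) e" for f
  proof (cases "deg f < k")
    case False
    then have "deg e < n + deg f - 1" using e by simp
    then show ?thesis using ord_ge_gpow_diff[OF n G K d, of f] by (simp add: ord_ge_def)
  qed (use F in \<open>simp add: ord_ge_def\<close>)
  then show "co (sub F G - sub F K) e = 0"
    by (simp only: co_diff co_sub[OF G order.refl] co_sub[OF K order.refl] diff_self)
qed

type_synonym vec4 = "complex \<times> complex \<times> complex \<times> complex"

fun lin :: "fps4 \<Rightarrow> vec4 \<Rightarrow> complex" where
  "lin R (v1, v2, v3, v4) = v1 * co R E1 + v2 * co R E2 + v3 * co R E3 + v4 * co R E4"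

text \<open>
  Moving the four arguments along a constant direction. Solving for one of the variables is the case of a
  unit vector with a zero in the corresponding argument; real directions \<open>(v, cnj v)\<close> keep a substitution
  compatible with conjugation.
\<close>

fun shift :: "tup \<Rightarrow> vec4 \<Rightarrow> fps4 \<Rightarrow> tup" where
  "shift (G1, G2, G3, G4) (v1, v2, v3, v4) s =
     (G1 + const4 v1 * s, G2 + const4 v2 * s, G3 + const4 v3 * s, G4 + const4 v4 * s)"

fun linpart :: "fps4 \<Rightarrow> tup \<Rightarrow> fps4" where
  "linpart R (G1, G2, G3, G4) =
     const4 (co R E1) * G1 + const4 (co R E2) * G2 + const4 (co R E3) * G3 + const4 (co R E4) * G4"

lemma upto_1: "upto 1 = {0, E1, E2, E3, E4}"
proof (rule set_eqI)
  fix e :: mi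
  obtain a b c d where e: "e = (a, b, c, d)" by (cases e)
  show "e \<in> upto 1 \<longleftrightarrow> e \<in> {0, E1, E2, E3, E4}"
    unfolding e by (cases a; cases b; cases c; cases d) (simp_all add: upto_def E_defs zero_prod_def)
qed

lemma E_distinct [simp]: "E1 \<noteq> E2" "E1 \<noteq> E3" "E1 \<noteq> E4" "E2 \<noteq> E3" "E2 \<noteq> E4" "E3 \<noteq> E4"
  "E2 \<noteq> E1" "E3 \<noteq> E1" "E4 \<noteq> E1" "E3 \<noteq> E2" "E4 \<noteq> E2" "E4 \<noteq> E3"
  "0 \<noteq> E1" "0 \<noteq> E2" "0 \<noteq> E3" "0 \<noteq> E4" "E1 \<noteq> 0" "E2 \<noteq> 0" "E3 \<noteq> 0" "E4 \<noteq> 0"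
  by (simp_all add: E_defs zero_prod_def)

lemma co_X: "co X1 e = (if e = E1 then 1 else 0)" "co X2 e = (if e = E2 then 1 else 0)"
  "co X3 e = (if e = E3 then 1 else 0)" "co X4 e = (if e = E4 then 1 else 0)"
  by (simp_all add: X1_def X2_def X3_def X4_def co_monom4)

lemma linear_decomp:
  assumes "co R 0 = 0" shows "R = linpart R XX + tail4 1 R"
proof -
  have "R = (\<Sum>f\<in>upto 1. monom4 (co R f) f) + tail4 1 R" by (rule tail4_decomp)
  also have "(\<Sum>f\<in>upto 1. monom4 (co R f) f) = linpart R XX"
    unfolding upto_1 using assms monom4_const[of "co R E1" E1] monom4_const[of "co R E2" E2]
      monom4_const[of "co R E3" E3] monom4_const[of "co R E4" E4]
    by (simp add: XX_def X1_def X2_def X3_def X4_def)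
  finally show ?thesis .
qed

lemma sub_linear_decomp:
  assumes "co R 0 = 0" and G: "adm G"
  shows "sub R G = linpart R G + sub (tail4 1 R) G"
proof -
  obtain G1 G2 G3 G4 where Geq: "G = (G1, G2, G3, G4)" by (cases G)
  have "sub R G = sub (linpart R XX + tail4 1 R) G" using linear_decomp[OF assms(1)] by simp
  also have "\<dots> = linpart R G + sub (tail4 1 R) G"
    using G unfolding Geq by (simp add: XX_def sub_add sub_mult sub_const4 sub_X)
  finally show ?thesis .
qed

lemma adm_shift: "adm G \<Longrightarrow> ord_ge 1 s \<Longrightarrow> adm (shift G V s)"
  by (cases G; cases V) (auto intro!: ord_ge_add ord_ge_mult1(1))

lemma const4_inverse: "c \<noteq> 0 \<Longrightarrow> const4 (1 / c) * (const4 c * F) = F" "c \<noteq> 0 \<Longrightarrow> const4 c * (const4 (1 / c) * F) = F"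
  by (simp_all add: mult.assoc[symmetric] flip: const4_mult)

text \<open>
  The equation \<open>sub R (shift G V s) = g\<close>, solved for the linear term in \<open>s\<close>.
\<close>

definition ift_op :: "fps4 \<Rightarrow> tup \<Rightarrow> vec4 \<Rightarrow> fps4 \<Rightarrow> fps4 \<Rightarrow> fps4" where
  "ift_op R G V g s = const4 (1 / lin R V) * (g - linpart R G - sub (tail4 1 R) (shift G V s))"

lemma ift_op_iff:
  assumes R: "co R 0 = 0" and c: "lin R V \<noteq> 0" and G: "adm G" and s: "ord_ge 1 s"
  shows "sub R (shift G V s) = g \<longleftrightarrow> ift_op R G V g s = s"
proof -
  have "linpart R (shift G V s) = linpart R G + const4 (lin R V) * s"
    by (cases G; cases V) (simp add: const4_add const4_mult algebra_simps)
  then have eq: "sub R (shift G V s) = linpart R G + const4 (lin R V) * s + sub (tail4 1 R) (shift G V s)"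
    using sub_linear_decomp[OF R adm_shift[OF G s]] by simp
  have "ift_op R G V g s = s \<longleftrightarrow> const4 (lin R V) * ift_op R G V g s = const4 (lin R V) * s"
    using c const4_inverse(1)[OF c, of s] const4_inverse(1)[OF c, of "ift_op R G V g s"] by metis
  also have "\<dots> \<longleftrightarrow> g - linpart R G - sub (tail4 1 R) (shift G V s) = const4 (lin R V) * s"
    unfolding ift_op_def const4_inverse(2)[OF c] ..
  finally show ?thesis unfolding eq by (auto simp: algebra_simps)
qed

lemma tdiff_shift: "ord_ge n (s - s') \<Longrightarrow> tdiff_ge n (shift G V s) (shift G V s')"
  by (cases G; cases V) (auto simp: ord_ge_mult1 right_diff_distrib[symmetric])

lemma ift_op_contraction:
  assumes "1 \<le> n" and G: "adm G" and s: "ord_ge 1 s" "ord_ge 1 s'" and d: "ord_ge n (s - s')"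
  shows "ord_ge (Suc n) (ift_op R G V g s - ift_op R G V g s')"
proof -
  have "ord_ge (n + 2 - 1) (sub (tail4 1 R) (shift G V s) - sub (tail4 1 R) (shift G V s'))"
    by (rule ord_ge_sub_diff[OF assms(1) adm_shift[OF G s(1)] adm_shift[OF G s(2)] tdiff_shift[OF d]])
      (use ord_ge_tail4[of 1 R] in \<open>simp add: numeral_2_eq_2\<close>)
  then have "ord_ge (Suc n) (sub (tail4 1 R) (shift G V s') - sub (tail4 1 R) (shift G V s))"
    using ord_ge_uminus by fastforce
  from ord_ge_mult1(1)[OF this, of "const4 (1 / lin R V)"] show ?thesis
    by (simp add: ift_op_def algebra_simps)
qed

lemma implicit_exists:
  assumes R: "co R 0 = 0" and c: "lin R V \<noteq> 0" and G: "adm G" and g: "ord_ge 1 g"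
  shows "\<exists>s. ord_ge 1 s \<and> sub R (shift G V s) = g"
proof -
  have "\<exists>s. ord_ge 1 s \<and> ift_op R G V g s = s"
  proof (rule contraction_fixpoint)
    fix s assume s: "ord_ge 1 s"
    have "ord_ge 1 (linpart R G)" using G by (cases G) (auto intro!: ord_ge_add ord_ge_mult1(1))
    moreover have "ord_ge 1 (sub (tail4 1 R) (shift G V s))"
      by (rule ord_ge_sub[OF adm_shift[OF G s] ord_ge_mono[OF ord_ge_tail4]]) simp
    ultimately show "ord_ge 1 (ift_op R G V g s)"
      unfolding ift_op_def by (intro ord_ge_mult1 ord_ge_diff g)
  qed (rule ift_op_contraction[OF _ G])
  then show ?thesis using ift_op_iff[OF R c G] by blast
qed

lemma implicit_unique:
  assumes R: "co R 0 = 0" and c: "lin R V \<noteq> 0" and G: "adm G"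
    and s: "ord_ge 1 s" "ord_ge 1 s'" and eq: "sub R (shift G V s) = sub R (shift G V s')"
  shows "s = s'"
proof -
  define g where "g = sub R (shift G V s)"
  have 1: "ift_op R G V g s = s" "ift_op R G V g s' = s'"
    using ift_op_iff[OF R c G s(1), of g] ift_op_iff[OF R c G s(2), of g] eq by (auto simp: g_def)
  have "ord_ge (Suc n) (s - s')" for n
  proof (induction n)
    case 0
    then show ?case using ord_ge_diff[OF s] by simp
  next
    case (Suc n)
    from ift_op_contraction[OF _ G s Suc, of R V g] show ?case by (simp add: 1)
  qed
  then show ?thesis using ord_ge_mono[of "Suc _"] by (intro ord_ge_eqI) (meson Suc_n_not_le_n nat_le_linear)
qed

section \<open>Convergent series\<close>

lemma finite_deg_le [simp]: "finite {e. deg e \<le> n}"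
  using finite_upto by (simp add: upto_def)

text \<open>
  The weighted norm of the truncation to degree \<open>n\<close>. All estimates are made for these finite sums,
  uniformly in \<open>n\<close>.
\<close>

definition tn :: "nat \<Rightarrow> real \<Rightarrow> fps4 \<Rightarrow> real" where
  "tn n r F = (\<Sum>e\<in>upto n. cmod (co F e) * r ^ deg e)"

lemma tn_nonneg: "0 \<le> r \<Longrightarrow> 0 \<le> tn n r F"
  by (auto simp: tn_def intro!: sum_nonneg)

lemma tn_add: "0 \<le> r \<Longrightarrow> tn n r (F + G) \<le> tn n r F + tn n r G"
  unfolding tn_def sum.distrib[symmetric]
  by (intro sum_mono) (auto simp: norm_triangle_ineq mult_right_mono simp flip: distrib_right)

lemma tn_uminus [simp]: "tn n r (- F) = tn n r F" by (simp add: tn_def)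

lemma tn_diff: "0 \<le> r \<Longrightarrow> tn n r (F - G) \<le> tn n r F + tn n r G"
  using tn_add[of r n F "- G"] by simp

lemma tn_const_mult: "tn n r (const4 c * F) = cmod c * tn n r F"
  by (simp add: tn_def norm_mult sum_distrib_left mult.assoc)

lemma tn_one: "tn n r 1 = 1"
proof -
  have "tn n r 1 = (\<Sum>e\<in>upto n. if e = 0 then 1 else 0)"
    unfolding tn_def by (intro sum.cong) (auto simp: co_1)
  also have "\<dots> = 1" by (subst sum.delta[OF finite_upto]) (simp add: upto_def)
  finally show ?thesis .
qed

lemma tn_mono_radius: "0 \<le> r \<Longrightarrow> r \<le> r' \<Longrightarrow> tn n r F \<le> tn n r' F"
  unfolding tn_def by (intro sum_mono mult_left_mono power_mono) auto

lemma tn_mono_deg: "0 \<le> r \<Longrightarrow> m \<le> n \<Longrightarrow> tn m r F \<le> tn n r F"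
  unfolding tn_def by (rule sum_mono2) (auto simp: upto_def)

lemma tn_mult: assumes "0 \<le> r" shows "tn n r (F * G) \<le> tn n r F * tn n r G"
proof -
  have "tn n r (F * G) \<le> (\<Sum>e\<in>upto n. \<Sum>(f, g)\<in>splits e. (cmod (co F f) * r ^ deg f) * (cmod (co G g) * r ^ deg g))"
    unfolding tn_def
  proof (rule sum_mono)
    fix e assume "e \<in> upto n"
    have "cmod (co (F * G) e) * r ^ deg e \<le> (\<Sum>p\<in>splits e. cmod (case p of (f, g) \<Rightarrow> co F f * co G g)) * r ^ deg e"
      unfolding co_mult by (intro mult_right_mono norm_sum) (use assms in auto)
    also have "\<dots> = (\<Sum>(f, g)\<in>splits e. (cmod (co F f) * r ^ deg f) * (cmod (co G g) * r ^ deg g))"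
      unfolding sum_distrib_right
    proof (rule sum.cong[OF refl])
      fix p assume "p \<in> splits e"
      then obtain f g where "p = (f, g)" "e = f + g" by (auto simp: splits_def)
      then show "cmod (case p of (f, g) \<Rightarrow> co F f * co G g) * r ^ deg e =
         (case p of (f, g) \<Rightarrow> (cmod (co F f) * r ^ deg f) * (cmod (co G g) * r ^ deg g))"
        by (simp add: norm_mult power_add)
    qed
    finally show "cmod (co (F * G) e) * r ^ deg e \<le> \<dots>" .
  qed
  also have "\<dots> = (\<Sum>(f, g)\<in>{(f, g). f + g \<in> upto n}. (cmod (co F f) * r ^ deg f) * (cmod (co G g) * r ^ deg g))"
    by (subst sum.Sigma, simp, simp, rule sum.reindex_bij_witness[where
        i = "\<lambda>p. (fst p + snd p, p)" and j = snd])
      (auto elim!: SigmaE simp del: split_paired_All simp: splits_def case_prod_unfold)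
  also have "\<dots> \<le> (\<Sum>(f, g)\<in>upto n \<times> upto n. (cmod (co F f) * r ^ deg f) * (cmod (co G g) * r ^ deg g))"
    by (rule sum_mono2) (auto simp: upto_def assms)
  also have "\<dots> = tn n r F * tn n r G"
    by (simp add: tn_def sum_product sum.cartesian_product)
  finally show ?thesis .
qed

lemma tn_power: "0 \<le> r \<Longrightarrow> tn n r F \<le> \<epsilon> \<Longrightarrow> tn n r (F ^ k) \<le> \<epsilon> ^ k"
proof (induction k)
  case (Suc k)
  have "tn n r (F ^ Suc k) \<le> tn n r F * tn n r (F ^ k)" using tn_mult[OF Suc.prems(1)] by simp
  also have "\<dots> \<le> \<epsilon> * \<epsilon> ^ k" using Suc tn_nonneg[OF Suc.prems(1)] by (intro mult_mono) (auto intro: order_trans)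
  finally show ?case by simp
qed (simp add: tn_one)

fun tn_le :: "nat \<Rightarrow> real \<Rightarrow> tup \<Rightarrow> real \<Rightarrow> bool" where
  "tn_le n r (G1, G2, G3, G4) \<epsilon> \<longleftrightarrow> tn n r G1 \<le> \<epsilon> \<and> tn n r G2 \<le> \<epsilon> \<and> tn n r G3 \<le> \<epsilon> \<and> tn n r G4 \<le> \<epsilon>"

lemma tn_gpow: assumes r: "0 \<le> r" and G: "tn_le n r G \<epsilon>" shows "tn n r (gpow G f) \<le> \<epsilon> ^ deg f"
proof -
  obtain G1 G2 G3 G4 where Geq: "G = (G1, G2, G3, G4)" by (cases G)
  obtain a b c d where f: "f = (a, b, c, d)" by (cases f)
  have e: "0 \<le> \<epsilon>" using G tn_nonneg[OF r] order_trans unfolding Geq tn_le.simps by blast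
  have m: "tn n r (A * B) \<le> \<epsilon> ^ i * \<epsilon> ^ j" if "tn n r A \<le> \<epsilon> ^ i" "tn n r B \<le> \<epsilon> ^ j" for A B i j
    using tn_mult[OF r, of n A B] mult_mono[OF that] tn_nonneg[OF r] e by fastforce
  have "tn n r (G1 ^ a * G2 ^ b) \<le> \<epsilon> ^ (a + b)"
    using m[OF tn_power[OF r] tn_power[OF r]] G by (simp add: Geq power_add)
  then have "tn n r (G1 ^ a * G2 ^ b * G3 ^ c) \<le> \<epsilon> ^ (a + b + c)"
    using m[OF _ tn_power[OF r], of "G1 ^ a * G2 ^ b" "a + b" G3 c] G by (simp add: Geq power_add)
  then have "tn n r (G1 ^ a * G2 ^ b * G3 ^ c * G4 ^ d) \<le> \<epsilon> ^ (a + b + c + d)"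
    using m[OF _ tn_power[OF r], of "G1 ^ a * G2 ^ b * G3 ^ c" "a + b + c" G4 d] G
    by (simp add: Geq power_add)
  then show ?thesis by (simp add: Geq f gpow.simps)
qed

text \<open>Majorisation: a monomial of degree \<open>k\<close> in the \<open>Gi\<close> has norm at most \<open>\<epsilon>^k\<close>.\<close>

lemma tn_sub:
  assumes r: "0 \<le> r" and a: "adm G" and G: "tn_le n r G \<epsilon>"
  shows "tn n r (sub F G) \<le> tn n \<epsilon> F"
proof -
  have "tn n r (sub F G) \<le> (\<Sum>e\<in>upto n. \<Sum>f\<in>upto n. cmod (co F f) * (cmod (co (gpow G f) e) * r ^ deg e))"
    unfolding tn_def
  proof (rule sum_mono)
    fix e assume "e \<in> upto n"
    then have "deg e \<le> n" by (simp add: upto_def)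
    have "cmod (co (sub F G) e) * r ^ deg e \<le> (\<Sum>f\<in>upto n. cmod (co F f * co (gpow G f) e)) * r ^ deg e"
      unfolding co_sub[OF a \<open>deg e \<le> n\<close>] by (intro mult_right_mono norm_sum) (use r in auto)
    then show "cmod (co (sub F G) e) * r ^ deg e \<le> (\<Sum>f\<in>upto n. cmod (co F f) * (cmod (co (gpow G f) e) * r ^ deg e))"
      by (simp add: norm_mult sum_distrib_right mult.assoc)
  qed
  also have "\<dots> = (\<Sum>f\<in>upto n. cmod (co F f) * tn n r (gpow G f))"
    unfolding tn_def sum_distrib_left by (rule sum.swap)
  also have "\<dots> \<le> tn n \<epsilon> F" unfolding tn_def[of n \<epsilon>]
    by (intro sum_mono mult_left_mono tn_gpow r G) auto
  finally show ?thesis .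
qed

lemma tn_scale:
  assumes F: "ord_ge k F" and t: "0 \<le> t" "t \<le> 1" and r: "0 \<le> r"
  shows "tn n (t * r) F \<le> t ^ k * tn n r F"
  unfolding tn_def sum_distrib_left
proof (rule sum_mono)
  fix e
  show "cmod (co F e) * (t * r) ^ deg e \<le> t ^ k * (cmod (co F e) * r ^ deg e)"
  proof (cases "deg e < k")
    case False
    then have "t ^ deg e \<le> t ^ k" using t by (intro power_decreasing) auto
    then have "t ^ deg e * (cmod (co F e) * r ^ deg e) \<le> t ^ k * (cmod (co F e) * r ^ deg e)"
      using r by (intro mult_right_mono) auto
    then show ?thesis by (simp add: power_mult_distrib algebra_simps)
  qed (use F in \<open>simp add: ord_ge_def\<close>)
qed

definition nb :: "fps4 \<Rightarrow> real \<Rightarrow> real \<Rightarrow> bool" where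
  "nb F r B \<longleftrightarrow> (\<forall>n. tn n r F \<le> B)"

definition Conv :: "fps4 \<Rightarrow> bool" where "Conv F \<longleftrightarrow> (\<exists>r>0. \<exists>B. nb F r B)"

lemma nb_nonneg: "0 \<le> r \<Longrightarrow> nb F r B \<Longrightarrow> 0 \<le> B"
  using tn_nonneg[of r 0 F] unfolding nb_def by (meson order_trans)

lemma nb_mono_radius: "nb F r B \<Longrightarrow> 0 \<le> r' \<Longrightarrow> r' \<le> r \<Longrightarrow> nb F r' B"
  unfolding nb_def using tn_mono_radius by (meson order_trans)

lemma nb_add: "0 \<le> r \<Longrightarrow> nb F r B \<Longrightarrow> nb G r C \<Longrightarrow> nb (F + G) r (B + C)"
  unfolding nb_def by (meson add_mono order_trans tn_add)

lemma nb_mult: "0 \<le> r \<Longrightarrow> nb F r B \<Longrightarrow> nb G r C \<Longrightarrow> nb (F * G) r (B * C)"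
  unfolding nb_def by (meson mult_mono order_trans tn_mult tn_nonneg)

lemma Conv_common: assumes "Conv F" "Conv G" shows "\<exists>r>0. \<exists>B C. nb F r B \<and> nb G r C"
proof -
  obtain r s B C where rs: "r > 0" "s > 0" "nb F r B" "nb G s C" using assms by (auto simp: Conv_def)
  then have "nb F (min r s) B" "nb G (min r s) C" by (auto intro: nb_mono_radius)
  then show ?thesis using rs by (intro exI[of _ "min r s"]) auto
qed

lemma Conv_add: "Conv F \<Longrightarrow> Conv G \<Longrightarrow> Conv (F + G)"
  using Conv_common[of F G] nb_add unfolding Conv_def by (meson less_imp_le)

lemma Conv_mult: "Conv F \<Longrightarrow> Conv G \<Longrightarrow> Conv (F * G)"
  using Conv_common[of F G] nb_mult unfolding Conv_def by (meson less_imp_le)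

lemma Conv_uminus: "Conv F \<Longrightarrow> Conv (- F)" by (simp add: Conv_def nb_def)

lemma Conv_diff: "Conv F \<Longrightarrow> Conv G \<Longrightarrow> Conv (F - G)"
  using Conv_add[of F "- G"] Conv_uminus by simp

lemma geometric_box:
  fixes q :: real
  assumes q: "0 \<le> q" "q \<le> 1 / 2" shows "(\<Sum>e\<in>upto n. q ^ deg e) \<le> 16"
proof -
  have g: "(\<Sum>a\<le>n. q ^ a) \<le> 2"
  proof -
    have "(\<Sum>a\<le>n. q ^ a) \<le> (\<Sum>a. q ^ a)"
      by (rule sum_le_suminf) (use q in \<open>auto intro: summable_geometric\<close>)
    also have "\<dots> = 1 / (1 - q)" by (rule suminf_geometric) (use q in auto)
    also have "\<dots> \<le> 2" using q by (simp add: field_simps)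
    finally show ?thesis .
  qed
  have "(\<Sum>e\<in>upto n. q ^ deg e) \<le> (\<Sum>e\<in>{..n} \<times> {..n} \<times> {..n} \<times> {..n}. q ^ deg e)"
    by (rule sum_mono2) (use q in \<open>auto simp: upto_def\<close>)
  also have "\<dots> = (\<Sum>a\<le>n. q ^ a) * ((\<Sum>a\<le>n. q ^ a) * ((\<Sum>a\<le>n. q ^ a) * (\<Sum>a\<le>n. q ^ a)))"
    by (simp add: sum_product sum.cartesian_product power_add mult.assoc case_prod_unfold)
      (rule sum.cong[OF refl], simp add: power_add[symmetric] case_prod_unfold, metis deg.simps prod.collapse add.assoc)
  also have "\<dots> \<le> 2 * (2 * (2 * 2))"
    by (intro mult_mono g) (use q in \<open>auto intro!: sum_nonneg mult_nonneg_nonneg\<close>)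
  finally show ?thesis by simp
qed

lemma Conv_bound:
  assumes r: "r > 0" and b: "\<And>e. cmod (co F e) * r ^ deg e \<le> M" shows "Conv F"
  unfolding Conv_def nb_def
proof (intro exI conjI allI)
  show "r / 2 > 0" using r by simp
  fix n
  have M: "0 \<le> M" using b[of 0] by (meson mult_nonneg_nonneg norm_ge_zero order_trans r zero_le_power less_imp_le)
  have "tn n (r / 2) F \<le> (\<Sum>e\<in>upto n. M * (1 / 2) ^ deg e)"
    unfolding tn_def
  proof (rule sum_mono)
    fix e
    have "cmod (co F e) * (r / 2) ^ deg e = (cmod (co F e) * r ^ deg e) * (1 / 2) ^ deg e"
      by (simp add: power_divide)
    also have "\<dots> \<le> M * (1 / 2) ^ deg e" by (intro mult_right_mono b) auto
    finally show "cmod (co F e) * (r / 2) ^ deg e \<le> M * (1 / 2) ^ deg e" .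
  qed
  also have "\<dots> \<le> M * 16" unfolding sum_distrib_left[symmetric]
    by (intro mult_left_mono geometric_box M) auto
  finally show "tn n (r / 2) F \<le> M * 16" .
qed

lemma nb_coeff: assumes "0 \<le> r" "nb F r B" shows "cmod (co F e) * r ^ deg e \<le> B"
proof -
  have "cmod (co F e) * r ^ deg e \<le> tn (deg e) r F"
    unfolding tn_def by (rule member_le_sum) (use assms in \<open>auto simp: upto_def\<close>)
  then show ?thesis using assms(2) unfolding nb_def by (meson order_trans)
qed

lemma Conv_iff: "Conv F \<longleftrightarrow> (\<exists>r>0. \<exists>M. \<forall>e. cmod (co F e) * r ^ deg e \<le> M)"
proof
  assume "Conv F"
  then obtain r B where "r > 0" "nb F r B" by (auto simp: Conv_def)
  then show "\<exists>r>0. \<exists>M. \<forall>e. cmod (co F e) * r ^ deg e \<le> M"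
    using nb_coeff[of r F B] less_imp_le by blast
qed (use Conv_bound in blast)

lemma Conv_finite: assumes "\<And>e. deg e > n \<Longrightarrow> co F e = 0" shows "Conv F"
proof (rule Conv_bound[of 1])
  fix e
  show "cmod (co F e) * 1 ^ deg e \<le> (\<Sum>f\<in>upto n. cmod (co F f))"
  proof (cases "deg e \<le> n")
    case True
    then show ?thesis by (simp, intro member_le_sum) (auto simp: upto_def)
  qed (use assms in \<open>auto intro: sum_nonneg\<close>)
qed simp

lemma Conv_const4: "Conv (const4 c)" by (rule Conv_finite[of 0]) (auto simp: co_const4)

lemma Conv_0: "Conv 0" using Conv_const4[of 0] by simp
lemma Conv_1: "Conv 1" using Conv_const4[of 1] by simp

lemma Conv_X: "Conv X1" "Conv X2" "Conv X3" "Conv X4"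
  by (rule Conv_finite[of 1]; auto simp: co_X)+

lemma Conv_power: "Conv F \<Longrightarrow> Conv (F ^ n)"
  by (induction n) (auto intro: Conv_1 Conv_mult)

lemma Conv_sum: "(\<And>i. i \<in> A \<Longrightarrow> Conv (f i)) \<Longrightarrow> Conv (sum f A)"
  by (induction A rule: infinite_finite_induct) (auto intro: Conv_0 Conv_add)

lemma Conv_smaller: assumes "Conv F" "\<And>e. cmod (co G e) \<le> cmod (co F e)" shows "Conv G"
proof -
  obtain r M where r: "r > 0" "\<And>e. cmod (co F e) * r ^ deg e \<le> M" using assms(1) by (auto simp: Conv_iff)
  then show ?thesis
    using assms(2) by (intro Conv_bound[of r G M]) (auto intro: order_trans[OF mult_right_mono r(2)])
qed

lemma Conv_small:
  assumes "Conv F" "ord_ge 1 F" shows "\<exists>r0>0. \<exists>K. 0 \<le> K \<and> (\<forall>r. 0 < r \<longrightarrow> r \<le> r0 \<longrightarrow> nb F r (K * r))"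
proof -
  obtain r0 B where r0: "r0 > 0" "nb F r0 B" using assms by (auto simp: Conv_def)
  have "nb F r (B / r0 * r)" if "0 < r" "r \<le> r0" for r
    unfolding nb_def
  proof
    fix n
    have "tn n r F \<le> r / r0 * tn n r0 F"
      using tn_scale[OF assms(2), of "r / r0" r0 n] that r0 by simp
    also have "\<dots> \<le> r / r0 * B" using r0 that by (intro mult_left_mono) (auto simp: nb_def)
    finally show "tn n r F \<le> B / r0 * r" by (simp add: field_simps)
  qed
  then show ?thesis using r0 nb_nonneg[of r0 F B] by (intro exI[of _ r0]) (auto intro!: exI[of _ "B / r0"])
qed

fun ConvT :: "tup \<Rightarrow> bool" where
  "ConvT (G1, G2, G3, G4) \<longleftrightarrow> Conv G1 \<and> Conv G2 \<and> Conv G3 \<and> Conv G4"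

fun nb_t :: "tup \<Rightarrow> real \<Rightarrow> real \<Rightarrow> bool" where
  "nb_t (G1, G2, G3, G4) r B \<longleftrightarrow> nb G1 r B \<and> nb G2 r B \<and> nb G3 r B \<and> nb G4 r B"

lemma nb_mono_bound: "nb F r B \<Longrightarrow> B \<le> C \<Longrightarrow> nb F r C"
  unfolding nb_def by (meson order_trans)

lemma ConvT_small:
  assumes "ConvT G" "adm G"
  shows "\<exists>r0>0. \<exists>K. 0 \<le> K \<and> (\<forall>r. 0 < r \<longrightarrow> r \<le> r0 \<longrightarrow> nb_t G r (K * r))"
proof -
  obtain G1 G2 G3 G4 where Geq: "G = (G1, G2, G3, G4)" by (cases G)
  obtain r1 K1 where 1: "r1 > 0" "0 \<le> K1" "\<And>r. 0 < r \<Longrightarrow> r \<le> r1 \<Longrightarrow> nb G1 r (K1 * r)"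
    using Conv_small[of G1] assms unfolding Geq by auto
  obtain r2 K2 where 2: "r2 > 0" "0 \<le> K2" "\<And>r. 0 < r \<Longrightarrow> r \<le> r2 \<Longrightarrow> nb G2 r (K2 * r)"
    using Conv_small[of G2] assms unfolding Geq by auto
  obtain r3 K3 where 3: "r3 > 0" "0 \<le> K3" "\<And>r. 0 < r \<Longrightarrow> r \<le> r3 \<Longrightarrow> nb G3 r (K3 * r)"
    using Conv_small[of G3] assms unfolding Geq by auto
  obtain r4 K4 where 4: "r4 > 0" "0 \<le> K4" "\<And>r. 0 < r \<Longrightarrow> r \<le> r4 \<Longrightarrow> nb G4 r (K4 * r)"
    using Conv_small[of G4] assms unfolding Geq by auto
  define r0 K where "r0 = min (min r1 r2) (min r3 r4)" and "K = K1 + K2 + K3 + K4"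
  have "nb_t G r (K * r)" if "0 < r" "r \<le> r0" for r
    unfolding Geq nb_t.simps K_def using that 1 2 3 4
    by (intro conjI nb_mono_bound[OF 1(3)] nb_mono_bound[OF 2(3)] nb_mono_bound[OF 3(3)] nb_mono_bound[OF 4(3)])
       (auto simp: r0_def intro!: mult_right_mono)
  moreover have "r0 > 0" "0 \<le> K" using 1 2 3 4 by (auto simp: r0_def K_def)
  ultimately show ?thesis by blast
qed

lemma nb_t_tn_le: "nb_t G r B \<Longrightarrow> tn_le n r G B"
  by (cases G) (auto simp: nb_def)

lemma nb_sub: "0 \<le> r \<Longrightarrow> adm G \<Longrightarrow> nb_t G r \<epsilon> \<Longrightarrow> nb F \<epsilon> B \<Longrightarrow> nb (sub F G) r B"
  using tn_sub[OF _ _ nb_t_tn_le] unfolding nb_def by (meson order_trans)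

lemma nb_t_small:
  assumes "ConvT G" "adm G" "\<epsilon> > 0"
  shows "\<exists>r0>0. \<forall>r. 0 < r \<longrightarrow> r \<le> r0 \<longrightarrow> nb_t G r \<epsilon>"
proof -
  obtain r0 K where r: "r0 > 0" "0 \<le> K" "\<And>r. 0 < r \<Longrightarrow> r \<le> r0 \<Longrightarrow> nb_t G r (K * r)"
    using ConvT_small[OF assms(1,2)] by blast
  have m: "nb_t G r B \<Longrightarrow> B \<le> C \<Longrightarrow> nb_t G r C" for r B C by (cases G) (auto intro: nb_mono_bound)
  define r1 where "r1 = min r0 (\<epsilon> / (K + 1))"
  have "nb_t G r \<epsilon>" if "0 < r" "r \<le> r1" for r
  proof (rule m[OF r(3)])
    have "K * r \<le> (K + 1) * (\<epsilon> / (K + 1))" using that r by (intro mult_mono) (auto simp: r1_def)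
    then show "K * r \<le> \<epsilon>" using r by simp
  qed (use that in \<open>auto simp: r1_def\<close>)
  moreover have "r1 > 0" using r assms(3) by (auto simp: r1_def)
  ultimately show ?thesis by blast
qed

lemma Conv_sub: assumes "Conv F" "ConvT G" "adm G" shows "Conv (sub F G)"
proof -
  obtain \<epsilon> B where F: "\<epsilon> > 0" "nb F \<epsilon> B" using assms(1) by (auto simp: Conv_def)
  obtain r where "r > 0" "nb_t G r \<epsilon>" using nb_t_small[OF assms(2,3) F(1)] by blast
  then show ?thesis using nb_sub[OF _ assms(3) _ F(2)] unfolding Conv_def by (meson less_imp_le)
qed

lemma tn_cong: "(\<And>e. deg e \<le> n \<Longrightarrow> co F e = co G e) \<Longrightarrow> tn n r F = tn n r G"
  by (auto simp: tn_def upto_def)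

text \<open>
  The method of majorants, without a majorant: in the fixed point equation the coefficients of \<open>s\<close> of
  degree \<open>n + 1\<close> come from the truncation of \<open>s\<close> to degree \<open>n\<close>. The nonlinear part is quadratic in the
  radius, so on a small polydisc the bound \<open>M r\<close> reproduces itself from \<open>n\<close> to \<open>n + 1\<close>.
\<close>

lemma implicit_Conv:
  assumes R: "co R 0 = 0" and c: "lin R V \<noteq> 0" and G: "adm G" and g: "ord_ge 1 g"
    and s: "ord_ge 1 s" and eq: "sub R (shift G V s) = g"
    and CR: "Conv R" and CG: "ConvT G" and Cg: "Conv g"
  shows "Conv s"
proof -
  obtain G1 G2 G3 G4 v1 v2 v3 v4 where e: "G = (G1, G2, G3, G4)" "V = (v1, v2, v3, v4)"
    by (cases G; cases V)
  define R2 where "R2 = tail4 1 R"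
  define h where "h = g - linpart R G"
  have h1: "ord_ge 1 h" using G g unfolding h_def e by (auto intro!: ord_ge_diff ord_ge_add ord_ge_mult1(1))
  have Ch: "Conv h" using CG Cg unfolding h_def e by (auto intro!: Conv_diff Conv_add Conv_mult Conv_const4)
  have CR2: "Conv R2" unfolding R2_def by (rule Conv_smaller[OF CR]) (simp add: co_tail4)
  have R2: "ord_ge 2 R2" using ord_ge_tail4[of 1 R] by (simp add: R2_def numeral_2_eq_2)
  obtain \<epsilon> B where B: "\<epsilon> > 0" "nb R2 \<epsilon> B" using CR2 by (auto simp: Conv_def)
  have B0: "0 \<le> B" using nb_nonneg B less_imp_le by blast
  obtain r1 K1 where 1: "r1 > 0" "0 \<le> K1" "\<And>r. 0 < r \<Longrightarrow> r \<le> r1 \<Longrightarrow> nb h r (K1 * r)"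
    using Conv_small[OF Ch h1] by auto
  obtain r2 K2 where 2: "r2 > 0" "0 \<le> K2" "\<And>r. 0 < r \<Longrightarrow> r \<le> r2 \<Longrightarrow> nb_t G r (K2 * r)"
    using ConvT_small[OF CG G] by auto
  define v where "v = cmod v1 + cmod v2 + cmod v3 + cmod v4"
  define M where "M = (K1 + 1) / cmod (lin R V)"
  define E where "E = K2 + v * M + 1"
  have M: "0 \<le> M" using 1 by (simp add: M_def)
  have E: "E > 0" using 2 M by (auto simp: E_def v_def intro!: add_nonneg_pos)
  define r where "r = min (min r1 r2) (min (\<epsilon> / E) (1 / ((E / \<epsilon>)\<^sup>2 * B + 1)))"
  have r: "r > 0" "r \<le> r1" "r \<le> r2" using 1 2 B B0 E by (auto simp: r_def intro!: add_nonneg_pos)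
  have Er: "E * r \<le> \<epsilon>"
  proof -
    have "E * r \<le> E * (\<epsilon> / E)" using E by (intro mult_left_mono) (auto simp: r_def)
    then show ?thesis using E by simp
  qed
  have rB: "(E * r / \<epsilon>)\<^sup>2 * B \<le> r"
  proof -
    have pos: "(E / \<epsilon>)\<^sup>2 * B + 1 > 0" using B0 by (intro add_nonneg_pos) auto
    have "r \<le> 1 / ((E / \<epsilon>)\<^sup>2 * B + 1)" by (simp add: r_def)
    then have "r * ((E / \<epsilon>)\<^sup>2 * B + 1) \<le> 1" using pos by (simp add: pos_le_divide_eq)
    then have "r * ((E / \<epsilon>)\<^sup>2 * B) \<le> 1" using r by (simp add: algebra_simps)
    then have "r * (r * ((E / \<epsilon>)\<^sup>2 * B)) \<le> r * 1" using r by (intro mult_left_mono) auto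
    then show ?thesis by (simp add: power2_eq_square mult_ac)
  qed
  have fix': "s = const4 (1 / lin R V) * (h - sub R2 (shift G V s))"
    using ift_op_iff[OF R c G s, of g] eq by (simp add: ift_op_def h_def R2_def)
  have "tn n r s \<le> M * r" for n
  proof (induction n)
    case 0
    have "upto 0 = {0}" by (auto simp: upto_def)
    moreover have "co s 0 = 0" using s ord_ge_1 by blast
    ultimately show ?case using M r by (simp add: tn_def)
  next
    case (Suc n)
    define sn where "sn = s - tail4 n s"
    have sn: "ord_ge 1 sn" unfolding sn_def by (intro ord_ge_diff s ord_ge_mono[OF ord_ge_tail4]) simp
    have a: "adm (shift G V sn)" "adm (shift G V s)" by (intro adm_shift G sn s)+
    have tsn: "tn (Suc n) r sn \<le> M * r"
    proof -
      have "tn (Suc n) r sn = tn n r sn" unfolding tn_def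
        by (rule sum.mono_neutral_right) (auto simp: upto_def sn_def co_tail4)
      also have "\<dots> = tn n r s" by (rule tn_cong) (simp add: sn_def co_tail4)
      finally show ?thesis using Suc by simp
    qed
    have comp: "tn (Suc n) r (Gi + const4 w * sn) \<le> E * r"
      if "nb Gi r (K2 * r)" "cmod w \<le> v" for Gi w
    proof -
      have "tn (Suc n) r (Gi + const4 w * sn) \<le> tn (Suc n) r Gi + cmod w * tn (Suc n) r sn"
        using tn_add[of r "Suc n" Gi "const4 w * sn"] r by (simp add: tn_const_mult)
      also have "\<dots> \<le> K2 * r + v * (M * r)"
        using that tsn r by (intro add_mono mult_mono tn_nonneg) (auto simp: nb_def v_def)
      also have "\<dots> \<le> E * r" using r by (simp add: E_def algebra_simps)
      finally show ?thesis .
    qed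
    have "tn_le (Suc n) r (shift G V sn) (E * r)"
      using 2(3)[OF r(1,3)] unfolding e by (auto intro!: comp simp: v_def)
    then have "tn (Suc n) r (sub R2 (shift G V sn)) \<le> tn (Suc n) (E * r) R2"
      using r by (intro tn_sub a) auto
    also have "\<dots> \<le> (E * r / \<epsilon>)\<^sup>2 * tn (Suc n) \<epsilon> R2"
      using tn_scale[OF R2, of "E * r / \<epsilon>" \<epsilon> "Suc n"] B Er E r by simp
    also have "\<dots> \<le> (E * r / \<epsilon>)\<^sup>2 * B" using B by (intro mult_left_mono) (auto simp: nb_def)
    also have "\<dots> \<le> r" by (rule rB)
    finally have t2: "tn (Suc n) r (sub R2 (shift G V sn)) \<le> r" .
    have "ord_ge (Suc n) (s - sn)" by (simp add: sn_def ord_ge_tail4)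
    then have "ord_ge (Suc n + 2 - 1) (sub R2 (shift G V s) - sub R2 (shift G V sn))"
      by (intro ord_ge_sub_diff a tdiff_shift R2) auto
    then have "tn (Suc n) r (sub R2 (shift G V s)) = tn (Suc n) r (sub R2 (shift G V sn))"
      by (intro tn_cong) (auto simp: ord_ge_def)
    with t2 have t3: "tn (Suc n) r (sub R2 (shift G V s)) \<le> r" by simp
    have "tn (Suc n) r s = 1 / cmod (lin R V) * tn (Suc n) r (h - sub R2 (shift G V s))"
      by (subst fix') (simp add: tn_const_mult norm_divide)
    also have "\<dots> \<le> 1 / cmod (lin R V) * (K1 * r + r)"
    proof (rule mult_left_mono)
      have "tn (Suc n) r h \<le> K1 * r" using 1(3)[OF r(1,2)] by (simp add: nb_def)
      then show "tn (Suc n) r (h - sub R2 (shift G V s)) \<le> K1 * r + r"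
        using tn_diff[of r "Suc n" h "sub R2 (shift G V s)"] t3 r by simp
    qed simp
    also have "\<dots> = M * r" by (simp add: M_def algebra_simps add_divide_distrib)
    finally show ?case .
  qed
  then show ?thesis using r unfolding Conv_def nb_def by blast
qed

section \<open>Evaluation of convergent series\<close>

fun xpow :: "vec4 \<Rightarrow> mi \<Rightarrow> complex" where
  "xpow (x1, x2, x3, x4) (a, b, c, d) = x1 ^ a * x2 ^ b * x3 ^ c * x4 ^ d"

fun vle :: "vec4 \<Rightarrow> real \<Rightarrow> bool" where
  "vle (x1, x2, x3, x4) r \<longleftrightarrow> cmod x1 \<le> r \<and> cmod x2 \<le> r \<and> cmod x3 \<le> r \<and> cmod x4 \<le> r"

declare xpow.simps [simp del]

lemma xpow_add: "xpow x (e + f) = xpow x e * xpow x f"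
  by (cases x; cases e; cases f) (simp add: xpow.simps power_add)

lemma xpow_0 [simp]: "xpow x 0 = 1"
  by (cases x) (simp add: xpow.simps zero_prod_def)

lemma norm_xpow: assumes "vle x r" shows "cmod (xpow x e) \<le> r ^ deg e"
proof -
  obtain x1 x2 x3 x4 a b c d where eq: "x = (x1, x2, x3, x4)" "e = (a, b, c, d)" by (cases x; cases e)
  have r: "0 \<le> r" using assms unfolding eq vle.simps by (meson norm_ge_zero order_trans)
  have "cmod (xpow x e) = cmod x1 ^ a * cmod x2 ^ b * cmod x3 ^ c * cmod x4 ^ d"
    by (simp add: eq xpow.simps norm_mult norm_power)
  also have "\<dots> \<le> r ^ a * r ^ b * r ^ c * r ^ d"
    using assms r unfolding eq by (intro mult_mono power_mono) auto
  finally show ?thesis by (simp add: eq power_add)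
qed

definition lvl :: "nat \<Rightarrow> mi set" where "lvl n = {e. deg e = n}"

lemma finite_lvl [simp]: "finite (lvl n)"
  by (rule finite_subset[OF _ finite_upto[of n]]) (auto simp: lvl_def upto_def)

lemma sum_upto_lvl: "(\<Sum>e\<in>upto n. f e) = (\<Sum>k\<le>n. \<Sum>e\<in>lvl k. f e)"
proof -
  have "(\<Sum>k\<le>n. \<Sum>e\<in>lvl k. f e) = (\<Sum>k\<le>n. \<Sum>e\<in>{e\<in>upto n. deg e = k}. f e)"
    by (intro sum.cong refl arg_cong2[where f = sum]) (auto simp: lvl_def upto_def)
  also have "\<dots> = (\<Sum>e\<in>upto n. f e)" by (rule sum.group) (auto simp: upto_def)
  finally show ?thesis by simp
qed

definition line :: "fps4 \<Rightarrow> vec4 \<Rightarrow> nat \<Rightarrow> complex" where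
  "line F x n = (\<Sum>e\<in>lvl n. co F e * xpow x e)"

text \<open>
  Evaluation sums homogeneous components, so that it restricts to a one-variable power series on every
  line through the origin and products become Cauchy products.
\<close>

definition ev :: "fps4 \<Rightarrow> vec4 \<Rightarrow> complex" where "ev F x = (\<Sum>n. line F x n)"

lemma line_add: "line (F + G) x n = line F x n + line G x n"
  by (simp add: line_def sum.distrib algebra_simps)

lemma line_mult: "line (F * G) x n = (\<Sum>i\<le>n. line F x i * line G x (n - i))"
proof -
  define h where "h = (\<lambda>(f, g). (co F f * xpow x f) * (co G g * xpow x g))"
  have "line (F * G) x n = (\<Sum>e\<in>lvl n. \<Sum>p\<in>splits e. h p)"
    unfolding line_def co_mult sum_distrib_right
  proof (intro sum.cong refl)
    fix e p assume "p \<in> splits e"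
    then obtain f g where "p = (f, g)" "e = f + g" by (auto simp: splits_def)
    then show "(case p of (f, g) \<Rightarrow> co F f * co G g) * xpow x e = h p" by (simp add: h_def xpow_add)
  qed
  also have "\<dots> = (\<Sum>p\<in>{p. deg (fst p) + deg (snd p) = n}. h p)"
    by (subst sum.Sigma, simp, simp, rule sum.reindex_bij_witness[where
        i = "\<lambda>p. (fst p + snd p, p)" and j = snd])
      (auto simp: splits_def lvl_def case_prod_unfold)
  also have "\<dots> = (\<Sum>i\<le>n. \<Sum>p\<in>lvl i \<times> lvl (n - i). h p)"
    by (subst sum.Sigma, simp, simp, rule sum.reindex_bij_witness[where
        i = snd and j = "\<lambda>p. (deg (fst p), p)"])
      (auto simp: lvl_def case_prod_unfold simp del: deg.simps)
  also have "\<dots> = (\<Sum>i\<le>n. line F x i * line G x (n - i))"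
    by (simp add: line_def sum_product sum.cartesian_product h_def case_prod_unfold)
  finally show ?thesis .
qed

lemma sum_norm_line: "vle x r \<Longrightarrow> (\<Sum>n\<le>N. cmod (line F x n)) \<le> tn N r F"
  unfolding tn_def sum_upto_lvl line_def
  by (intro sum_mono order.trans[OF norm_sum])
    (auto simp: norm_mult lvl_def intro!: sum_mono mult_left_mono norm_xpow)

lemma summable_line: assumes "nb F r B" "vle x r" shows "summable (\<lambda>n. cmod (line F x n))"
proof (rule summableI_nonneg_bounded)
  fix n
  have "(\<Sum>i<n. cmod (line F x i)) \<le> (\<Sum>i\<le>n. cmod (line F x i))" by (rule sum_mono2) auto
  also have "\<dots> \<le> tn n r F" by (rule sum_norm_line[OF assms(2)])
  also have "\<dots> \<le> B" using assms(1) by (simp add: nb_def)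
  finally show "(\<Sum>i<n. cmod (line F x i)) \<le> B" .
qed simp

lemma summable_line': "nb F r B \<Longrightarrow> vle x r \<Longrightarrow> summable (line F x)"
  using summable_norm_cancel summable_line by blast

lemma ev_bound: assumes "nb F r B" "vle x r" shows "cmod (ev F x) \<le> B"
proof -
  have "cmod (ev F x) \<le> (\<Sum>n. cmod (line F x n))"
    unfolding ev_def by (rule summable_norm[OF summable_line[OF assms]])
  also have "\<dots> \<le> B"
  proof (rule suminf_le_const[OF summable_line[OF assms]])
    fix n
    have "(\<Sum>i<n. cmod (line F x i)) \<le> (\<Sum>i\<le>n. cmod (line F x i))" by (rule sum_mono2) auto
    also have "\<dots> \<le> tn n r F" by (rule sum_norm_line[OF assms(2)])
    also have "\<dots> \<le> B" using assms(1) by (simp add: nb_def)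
    finally show "(\<Sum>i<n. cmod (line F x i)) \<le> B" .
  qed
  finally show ?thesis .
qed

lemma ev_add: "nb F r B \<Longrightarrow> nb G r C \<Longrightarrow> vle x r \<Longrightarrow> ev (F + G) x = ev F x + ev G x"
  unfolding ev_def line_add by (rule suminf_add[symmetric]) (auto intro: summable_line')

lemma ev_mult: "nb F r B \<Longrightarrow> nb G r C \<Longrightarrow> vle x r \<Longrightarrow> ev (F * G) x = ev F x * ev G x"
  unfolding ev_def line_mult by (rule Cauchy_product[symmetric]) (auto intro: summable_line)

lemma ev_uminus: "nb F r B \<Longrightarrow> vle x r \<Longrightarrow> ev (- F) x = - ev F x"
  unfolding ev_def by (subst suminf_minus[symmetric, OF summable_line'])
    (auto simp: line_def sum_negf intro!: arg_cong[where f = suminf])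

lemma nb_uminus: "nb F r B \<Longrightarrow> nb (- F) r B" by (simp add: nb_def)

lemma nb_diff: "0 \<le> r \<Longrightarrow> nb F r B \<Longrightarrow> nb G r C \<Longrightarrow> nb (F - G) r (B + C)"
  using nb_add[of r F B "- G" C] nb_uminus by simp

lemma ev_diff: assumes "nb F r B" "nb G r C" "vle x r" shows "ev (F - G) x = ev F x - ev G x"
  using ev_add[OF assms(1) nb_uminus[OF assms(2)] assms(3)] ev_uminus[OF assms(2,3)] by simp

lemma line_monom4: "line (monom4 c e) x n = (if n = deg e then c * xpow x e else 0)"
proof -
  have "line (monom4 c e) x n = (\<Sum>f\<in>lvl n. if f = e then c * xpow x e else 0)"
    unfolding line_def by (rule sum.cong) (simp_all add: co_monom4)
  also have "\<dots> = (if n = deg e then c * xpow x e else 0)"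
    by (subst sum.delta[OF finite_lvl]) (auto simp: lvl_def)
  finally show ?thesis .
qed

lemma ev_monom4: "ev (monom4 c e) x = c * xpow x e"
  unfolding ev_def line_monom4 by (subst suminf_finite[where N = "{deg e}"]) auto

lemma ev_const4 [simp]: "ev (const4 c) x = c"
  by (simp add: const4_monom4 ev_monom4)

lemma ev_0 [simp]: "ev 0 x = 0" using ev_const4[of 0 x] by simp
lemma ev_1 [simp]: "ev 1 x = 1" using ev_const4[of 1 x] by simp

lemma ev_X [simp]: "ev X1 (x1, x2, x3, x4) = x1" "ev X2 (x1, x2, x3, x4) = x2"
  "ev X3 (x1, x2, x3, x4) = x3" "ev X4 (x1, x2, x3, x4) = x4"
  by (simp_all add: X1_def X2_def X3_def X4_def ev_monom4 xpow.simps E_defs)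

lemma nb_monom4: "0 \<le> r \<Longrightarrow> nb (monom4 c e) r (cmod c * r ^ deg e)"
  unfolding nb_def
proof
  fix n assume r: "0 \<le> r"
  have "tn n r (monom4 c e) = (\<Sum>f\<in>upto n. if f = e then cmod c * r ^ deg e else 0)"
    unfolding tn_def by (rule sum.cong) (simp_all add: co_monom4)
  also have "\<dots> \<le> cmod c * r ^ deg e" by (subst sum.delta[OF finite_upto]) (simp add: r)
  finally show "tn n r (monom4 c e) \<le> cmod c * r ^ deg e" .
qed

lemma nb_const4: "0 \<le> r \<Longrightarrow> nb (const4 c) r (cmod c)"
  using nb_monom4[of r c 0] by (simp add: const4_monom4)

lemma nb_X: "0 \<le> r \<Longrightarrow> nb X1 r r" "0 \<le> r \<Longrightarrow> nb X2 r r" "0 \<le> r \<Longrightarrow> nb X3 r r" "0 \<le> r \<Longrightarrow> nb X4 r r"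
  using nb_monom4[of r 1 E1] nb_monom4[of r 1 E2] nb_monom4[of r 1 E3] nb_monom4[of r 1 E4]
  by (simp_all add: X1_def X2_def X3_def X4_def)

lemma nb_power: "0 \<le> r \<Longrightarrow> nb F r B \<Longrightarrow> nb (F ^ n) r (B ^ n)"
  by (induction n) (use nb_const4[of r 1] nb_mult in auto)

lemma ev_power: "0 \<le> r \<Longrightarrow> nb F r B \<Longrightarrow> vle x r \<Longrightarrow> ev (F ^ n) x = ev F x ^ n"
  by (induction n) (auto simp: ev_mult[OF _ nb_power])

lemma nb_sum: "0 \<le> r \<Longrightarrow> (\<And>i. i \<in> A \<Longrightarrow> nb (f i) r (B i)) \<Longrightarrow> nb (sum f A) r (sum B A)"
  by (induction A rule: infinite_finite_induct) (use nb_const4[of r 0] in \<open>auto intro: nb_add\<close>)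

lemma ev_sum:
  assumes "0 \<le> r" "\<And>i. i \<in> A \<Longrightarrow> nb (f i) r (B i)" "vle x r"
  shows "ev (sum f A) x = (\<Sum>i\<in>A. ev (f i) x)"
  using assms(2)
proof (induction A rule: infinite_finite_induct)
  case (insert a A)
  have "nb (sum f A) r (sum B A)" using insert by (intro nb_sum assms(1)) auto
  with insert show ?case by (simp add: ev_add[OF _ _ assms(3), of "f a" "B a"])
qed auto

fun ev_t :: "tup \<Rightarrow> vec4 \<Rightarrow> vec4" where
  "ev_t (G1, G2, G3, G4) x = (ev G1 x, ev G2 x, ev G3 x, ev G4 x)"

lemma vle_ev_t: "nb_t G r \<epsilon> \<Longrightarrow> vle x r \<Longrightarrow> vle (ev_t G x) \<epsilon>"
  by (cases G) (auto intro: ev_bound)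

lemma ev_gpow:
  assumes r: "0 \<le> r" and G: "nb_t G r \<epsilon>" and x: "vle x r"
  shows "ev (gpow G f) x = xpow (ev_t G x) f" "\<exists>B. nb (gpow G f) r B"
proof -
  obtain G1 G2 G3 G4 a b c d where eq: "G = (G1, G2, G3, G4)" "f = (a, b, c, d)" by (cases G; cases f)
  have n: "nb G1 r \<epsilon>" "nb G2 r \<epsilon>" "nb G3 r \<epsilon>" "nb G4 r \<epsilon>" using G by (auto simp: eq)
  note p = n[THEN nb_power[OF r]]
  note m1 = nb_mult[OF r p(1) p(2)]
  note m2 = nb_mult[OF r m1 p(3)]
  show "\<exists>B. nb (gpow G f) r B" using nb_mult[OF r m2 p(4), of a b c d] unfolding eq gpow.simps by blast
  show "ev (gpow G f) x = xpow (ev_t G x) f"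
    unfolding eq gpow.simps ev_mult[OF m2 p(4) x] ev_mult[OF m1 p(3) x] ev_mult[OF p(1) p(2) x]
    by (simp add: xpow.simps ev_power[OF r n(1) x] ev_power[OF r n(2) x] ev_power[OF r n(3) x] ev_power[OF r n(4) x])
qed

lemma tail_bound_tendsto:
  assumes "0 \<le> r" "nb F r B"
  shows "\<exists>b. (b \<longlonglongrightarrow> 0) \<and> (\<forall>n. nb (tail4 n F) r (b n))"
proof -
  have mono: "incseq (\<lambda>n. tn n r F)" by (intro incseq_SucI tn_mono_deg assms) simp
  have le: "\<And>n. tn n r F \<le> B" using assms by (simp add: nb_def)
  obtain L where L: "(\<lambda>n. tn n r F) \<longlonglongrightarrow> L" "\<And>n. tn n r F \<le> L"
    using incseq_convergent[OF mono] le by metis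
  have "nb (tail4 n F) r (L - tn n r F)" for n
    unfolding nb_def
  proof
    fix m
    have eq: "tn k r (tail4 n F) + tn n r F = tn k r F" if "n \<le> k" for k
    proof -
      have "tn k r (tail4 n F) = (\<Sum>e\<in>upto k - upto n. cmod (co F e) * r ^ deg e)"
        unfolding tn_def by (rule sum.mono_neutral_cong_right) (auto simp: upto_def co_tail4)
      moreover have "upto n \<subseteq> upto k" using that by (auto simp: upto_def)
      ultimately show ?thesis unfolding tn_def
        using sum.subset_diff[OF _ finite_upto, of "upto n" k "\<lambda>e. cmod (co F e) * r ^ deg e"]
        by linarith
    qed
    have "tn m r (tail4 n F) \<le> tn (max m n) r (tail4 n F)" by (rule tn_mono_deg[OF assms(1)]) simp
    also have "\<dots> = tn (max m n) r F - tn n r F" using eq[of "max m n"] by simp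
    also have "\<dots> \<le> L - tn n r F" using L(2) by simp
    finally show "tn m r (tail4 n F) \<le> L - tn n r F" .
  qed
  moreover have "(\<lambda>n. L - tn n r F) \<longlonglongrightarrow> 0" using tendsto_diff[OF tendsto_const[of L] L(1)] by simp
  ultimately show ?thesis by blast
qed

text \<open>
  True for the truncations of \<open>F\<close>, which are polynomials; the tails are uniformly small on both sides.
\<close>

lemma ev_sub:
  assumes r: "0 \<le> r" and a: "adm G" and G: "nb_t G r \<epsilon>" and e: "0 \<le> \<epsilon>" and F: "nb F \<epsilon> B" and x: "vle x r"
  shows "ev (sub F G) x = ev F (ev_t G x)"
proof -
  define y where "y = ev_t G x"
  have y: "vle y \<epsilon>" unfolding y_def by (rule vle_ev_t[OF G x])
  define \<Delta> where "\<Delta> = (\<lambda>F. ev (sub F G) x - ev F y)"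
  have add: "\<Delta> (F1 + F2) = \<Delta> F1 + \<Delta> F2" if "nb F1 \<epsilon> B1" "nb F2 \<epsilon> B2" for F1 F2 B1 B2
    using ev_add[OF that y] ev_add[OF nb_sub[OF r a G that(1)] nb_sub[OF r a G that(2)] x]
    by (simp add: \<Delta>_def sub_add[OF a])
  have mon: "\<Delta> (monom4 c f) = 0" for c f
  proof -
    obtain C where C: "nb (gpow G f) r C" using ev_gpow(2)[OF r G x] by blast
    show ?thesis
      by (simp add: \<Delta>_def sub_monom4[OF a] ev_monom4 ev_mult[OF nb_const4[OF r] C x] ev_gpow(1)[OF r G x] y_def)
  qed
  have fin: "finite A \<Longrightarrow> \<Delta> (\<Sum>f\<in>A. monom4 (co F f) f) = 0" for A
  proof (induction A rule: finite_induct)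
    case (insert f A)
    have "nb (\<Sum>f\<in>A. monom4 (co F f) f) \<epsilon> (\<Sum>f\<in>A. cmod (co F f) * \<epsilon> ^ deg f)"
      by (intro nb_sum nb_monom4 e)
    with insert show ?case by (simp add: add[OF nb_monom4[OF e]] mon)
  qed (simp add: \<Delta>_def sub_0[OF a])
  obtain b where b: "b \<longlonglongrightarrow> 0" "\<And>n. nb (tail4 n F) \<epsilon> (b n)" using tail_bound_tendsto[OF e F] by blast
  have "cmod (\<Delta> F) \<le> 2 * b n" for n
  proof -
    have "nb (\<Sum>f\<in>upto n. monom4 (co F f) f) \<epsilon> (\<Sum>f\<in>upto n. cmod (co F f) * \<epsilon> ^ deg f)"
      by (intro nb_sum nb_monom4 e)
    then have "\<Delta> F = \<Delta> (tail4 n F)"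
      using add[OF _ b(2), of "\<Sum>f\<in>upto n. monom4 (co F f) f" _ n] fin[OF finite_upto, of n]
      by (simp flip: tail4_decomp)
    then have "cmod (\<Delta> F) \<le> cmod (ev (sub (tail4 n F) G) x) + cmod (ev (tail4 n F) y)"
      by (simp add: \<Delta>_def norm_triangle_ineq4)
    then show ?thesis using ev_bound[OF b(2) y, of n] ev_bound[OF nb_sub[OF r a G b(2)] x, of n] by simp
  qed
  then have "cmod (\<Delta> F) \<le> 2 * 0"
    using LIMSEQ_le_const[OF tendsto_mult[OF tendsto_const[of 2] b(1)]] by blast
  then show ?thesis by (simp add: \<Delta>_def y_def)
qed

lemma ev_LIMSEQ: "nb F r B \<Longrightarrow> vle x r \<Longrightarrow> (\<lambda>n. \<Sum>e\<in>upto n. co F e * xpow x e) \<longlonglongrightarrow> ev F x"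
  unfolding sum_upto_lvl ev_def line_def[symmetric]
  using summable_LIMSEQ'[OF summable_line'] by blast

lemma has_sum_LIMSEQ_upto:
  fixes f :: "mi \<Rightarrow> complex"
  assumes "(f has_sum s) UNIV" shows "(\<lambda>n. \<Sum>e\<in>upto n. f e) \<longlonglongrightarrow> s"
proof -
  have "filterlim upto (finite_subsets_at_top UNIV) sequentially"
    unfolding filterlim_finite_subsets_at_top
  proof (intro allI impI)
    fix X :: "mi set" assume X: "finite X \<and> X \<subseteq> UNIV"
    then obtain N where "\<forall>e\<in>X. deg e \<le> N" using finite_nat_set_iff_bounded_le[of "deg ` X"] by auto
    then show "\<forall>\<^sub>F n in sequentially. finite (upto n) \<and> X \<subseteq> upto n \<and> upto n \<subseteq> UNIV"
      unfolding eventually_sequentially by (intro exI[of _ N]) (auto simp: upto_def simp del: deg.simps)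
  qed
  with assms show ?thesis unfolding has_sum_def by (auto intro: filterlim_compose)
qed

section \<open>Real points and complexification\<close>

text \<open>The real points of the complexified space.\<close>

definition rp :: "complex^2 \<Rightarrow> vec4" where "rp Y = (Y$1, Y$2, cnj (Y$1), cnj (Y$2))"

lemma vle_rp: "norm Y \<le> r \<Longrightarrow> vle (rp Y) r"
  using Finite_Cartesian_Product.norm_nth_le[of Y 1] Finite_Cartesian_Product.norm_nth_le[of Y 2]
  by (simp add: rp_def)

lemma norm_vec2_le: fixes Y :: "complex^2" shows "norm Y \<le> cmod (Y$1) + cmod (Y$2)"
proof -
  have "norm Y \<le> (\<Sum>i\<in>UNIV. cmod (Y$i))" unfolding norm_vec_def by (rule L2_set_le_sum) simp
  then show ?thesis by (simp add: sum_2)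
qed

lemma zzbar_expansion_iff:
  "zzbar_expansion f p F \<longleftrightarrow>
     (\<exists>r>0. \<forall>Y. norm Y < r \<longrightarrow> ((\<lambda>e. co F e * xpow (rp Y) e) has_sum of_real (f (p + Y))) UNIV)"
proof -
  have t: "(\<lambda>(a, b, c, d). coeff4 F a b c d * (Z$1 - p$1) ^ a * (Z$2 - p$2) ^ b
             * cnj (Z$1 - p$1) ^ c * cnj (Z$2 - p$2) ^ d) = (\<lambda>e. co F e * xpow (rp (Z - p)) e)" for Z
    by (auto simp: fun_eq_iff co_def rp_def xpow.simps mult_ac)
  show ?thesis unfolding zzbar_expansion_def t
  proof (intro iffI; elim exE conjE)
    fix r assume "r > 0" and h: "\<forall>Z\<in>ball p r. ((\<lambda>e. co F e * xpow (rp (Z - p)) e) has_sum of_real (f Z)) UNIV"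
    then show "\<exists>r>0. \<forall>Y. norm Y < r \<longrightarrow> ((\<lambda>e. co F e * xpow (rp Y) e) has_sum of_real (f (p + Y))) UNIV"
      using h[rule_format, of "p + _"] by (intro exI[of _ r]) (auto simp: dist_norm)
  next
    fix r assume "r > 0" and h: "\<forall>Y. norm Y < r \<longrightarrow> ((\<lambda>e. co F e * xpow (rp Y) e) has_sum of_real (f (p + Y))) UNIV"
    then show "\<exists>r>0. \<forall>Z\<in>ball p r. ((\<lambda>e. co F e * xpow (rp (Z - p)) e) has_sum of_real (f Z)) UNIV"
      using h[rule_format, of "_ - p"] by (intro exI[of _ r]) (auto simp: dist_norm norm_minus_commute)
  qed
qed

lemma zzbar_expansion_Conv: assumes "zzbar_expansion f p F" shows "Conv F"
proof -
  obtain r where r: "r > 0"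
    and h: "\<And>Y. norm Y < r \<Longrightarrow> ((\<lambda>e. co F e * xpow (rp Y) e) has_sum of_real (f (p + Y))) UNIV"
    using assms by (auto simp: zzbar_expansion_iff)
  define Y :: "complex^2" where "Y = (\<chi> j. of_real (r / 4))"
  have "norm Y < r" using norm_vec2_le[of Y] r by (simp add: Y_def)
  then have "(\<lambda>e. co F e * xpow (rp Y) e) summable_on UNIV" using h has_sum_imp_summable by blast
  then have s: "(\<lambda>e. cmod (co F e * xpow (rp Y) e)) summable_on UNIV"
    using summable_on_iff_abs_summable_on_complex[of "\<lambda>e. co F e * xpow (rp Y) e"] by simp
  have x: "cmod (xpow (rp Y) e) = (r / 4) ^ deg e" for e
  proof -
    have c: "cmod (complex_of_real (r / 4)) = r / 4" using r by (simp only: norm_of_real)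
    show ?thesis
      by (cases e) (simp only: rp_def Y_def xpow.simps norm_mult norm_power power_add vec_lambda_beta
          complex_cnj_complex_of_real c deg.simps)
  qed
  show ?thesis
  proof (rule Conv_bound)
    show "r / 4 > 0" using r by simp
    fix e
    have "(\<Sum>e\<in>{e}. cmod (co F e * xpow (rp Y) e)) \<le> infsum (\<lambda>e. cmod (co F e * xpow (rp Y) e)) UNIV"
      by (rule finite_sum_le_infsum[OF s]) auto
    then show "cmod (co F e) * (r / 4) ^ deg e \<le> infsum (\<lambda>e. cmod (co F e * xpow (rp Y) e)) UNIV"
      by (simp add: norm_mult x)
  qed
qed

lemma zzbar_expansion_ev:
  assumes "zzbar_expansion f p F"
  shows "\<exists>r>0. \<forall>Y. norm Y < r \<longrightarrow> ev F (rp Y) = of_real (f (p + Y))"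
proof -
  obtain r where r: "r > 0"
    and h: "\<And>Y. norm Y < r \<Longrightarrow> ((\<lambda>e. co F e * xpow (rp Y) e) has_sum of_real (f (p + Y))) UNIV"
    using assms by (auto simp: zzbar_expansion_iff)
  obtain s B where s: "s > 0" "nb F s B" using zzbar_expansion_Conv[OF assms] by (auto simp: Conv_def)
  have "ev F (rp Y) = of_real (f (p + Y))" if "norm Y < min r s" for Y
    by (rule LIMSEQ_unique[OF ev_LIMSEQ[OF s(2) vle_rp] has_sum_LIMSEQ_upto[OF h]]) (use that in auto)
  then show ?thesis using r s by (intro exI[of _ "min r s"]) auto
qed

fun axpy :: "vec4 \<Rightarrow> vec4 \<Rightarrow> complex \<Rightarrow> vec4" where
  "axpy (x1, x2, x3, x4) (v1, v2, v3, v4) t = (x1 + t * v1, x2 + t * v2, x3 + t * v3, x4 + t * v4)"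

lemma poly_on_line:
  "\<exists>q. \<forall>t. (\<Sum>e\<in>S. c e * xpow (axpy x v t) e) = poly q t"
proof -
  obtain x1 x2 x3 x4 v1 v2 v3 v4 where eq: "x = (x1, x2, x3, x4)" "v = (v1, v2, v3, v4)"
    by (cases x; cases v)
  define m where "m = (\<lambda>(a, b, c, d). [:x1, v1:] ^ a * [:x2, v2:] ^ b * [:x3, v3:] ^ c * [:x4, v4:] ^ d)"
  have "xpow (axpy x v t) e = poly (m e) t" for e t
    by (cases e) (simp add: eq xpow.simps m_def)
  then have "(\<Sum>e\<in>S. c e * xpow (axpy x v t) e) = poly (\<Sum>e\<in>S. smult (c e) (m e)) t" for t
    by (simp add: poly_sum)
  then show ?thesis by blast
qed

lemma poly_zero_on_reals:
  assumes "\<And>t. (\<Sum>e\<in>S. c e * xpow (axpy x v (of_real t)) e) = 0"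
  shows "(\<Sum>e\<in>S. c e * xpow (axpy x v t) e) = 0"
proof -
  obtain q where q: "\<And>t. (\<Sum>e\<in>S. c e * xpow (axpy x v t) e) = poly q t"
    using poly_on_line[where S = S and c = c and x = x and v = v] by blast
  have "range complex_of_real \<subseteq> {z. poly q z = 0}" using assms by (auto simp: q)
  moreover have "infinite (range complex_of_real)"
    using finite_imageD[of complex_of_real UNIV] infinite_UNIV_char_0 by (auto simp: inj_def)
  ultimately have "q = 0" using poly_roots_finite finite_subset by blast
  then show ?thesis by (simp add: q)
qed

text \<open>
  The real points \<open>(Z, cnj Z)\<close> are Zariski dense: complexify the four real coordinates one by one.
\<close>

lemma poly_zero_on_real_points:
  assumes "\<And>Y. (\<Sum>e\<in>S. c e * xpow (rp Y) e) = 0"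
  shows "(\<Sum>e\<in>S. c e * xpow x e) = 0"
proof -
  define f where "f = (\<lambda>x. \<Sum>e\<in>S. c e * xpow x e)"
  define P where "P = (\<lambda>x1 y1 x2 y2. (x1 + \<i> * y1, x2 + \<i> * y2, x1 - \<i> * y1, x2 - \<i> * y2) :: vec4)"
  have ext: "f (axpy x v t) = 0" if "\<And>t. f (axpy x v (of_real t)) = 0" for x v t
    using poly_zero_on_reals[where S = S and c = c and x = x and v = v and t = t] that by (simp add: f_def)
  have 0: "f (P (of_real x1) (of_real y1) (of_real x2) (of_real y2)) = 0" for x1 y1 x2 y2
  proof -
    define Y :: "complex^2" where "Y = (\<chi> j. if j = 1 then Complex x1 y1 else Complex x2 y2)"
    have "rp Y = P (of_real x1) (of_real y1) (of_real x2) (of_real y2)"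
      by (simp add: rp_def Y_def P_def complex_eq_iff)
    then show ?thesis using assms[of Y] by (simp add: f_def)
  qed
  have 1: "f (P x1 (of_real y1) (of_real x2) (of_real y2)) = 0" for x1 y1 x2 y2
    using ext[of "P 0 (of_real y1) (of_real x2) (of_real y2)" "(1, 0, 1, 0)" x1] 0[of _ y1 x2 y2]
    by (simp add: P_def algebra_simps)
  have 2: "f (P x1 y1 (of_real x2) (of_real y2)) = 0" for x1 y1 x2 y2
    using ext[of "P x1 0 (of_real x2) (of_real y2)" "(\<i>, 0, - \<i>, 0)" y1] 1[of x1 _ x2 y2]
    by (simp add: P_def algebra_simps)
  have 3: "f (P x1 y1 x2 (of_real y2)) = 0" for x1 y1 x2 y2
    using ext[of "P x1 y1 0 (of_real y2)" "(0, 1, 0, 1)" x2] 2[of x1 y1 _ y2]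
    by (simp add: P_def algebra_simps)
  have 4: "f (P x1 y1 x2 y2) = 0" for x1 y1 x2 y2
    using ext[of "P x1 y1 x2 0" "(0, \<i>, 0, - \<i>)" y2] 3[of x1 y1 x2 _]
    by (simp add: P_def algebra_simps)
  obtain z1 z2 w1 w2 where x: "x = (z1, z2, w1, w2)" by (cases x)
  have "x = P ((z1 + w1) / 2) ((w1 - z1) * \<i> / 2) ((z2 + w2) / 2) ((w2 - z2) * \<i> / 2)"
    by (simp add: x P_def complex_eq_iff field_simps)
  then show ?thesis using 4 by (simp add: f_def)
qed

lemma poly_coeffs_zero:
  assumes "\<And>x. (\<Sum>e\<in>lvl n. c e * xpow x e) = 0" and e: "e \<in> lvl n"
  shows "c e = (0::complex)"
proof -
  define k where "k = (\<lambda>e. if deg e = n then c e else 0)"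
  have h0: "(\<Sum>i\<le>n. \<Sum>j\<le>n. \<Sum>l\<le>n. \<Sum>m\<le>n. k (i, j, l, m) * xpow x (i, j, l, m)) = 0" for x
  proof -
    have "(\<Sum>i\<le>n. \<Sum>j\<le>n. \<Sum>l\<le>n. \<Sum>m\<le>n. k (i, j, l, m) * xpow x (i, j, l, m))
        = (\<Sum>e\<in>{..n} \<times> {..n} \<times> {..n} \<times> {..n}. k e * xpow x e)"
      by (simp add: sum.cartesian_product case_prod_unfold)
    also have "\<dots> = (\<Sum>e\<in>lvl n. c e * xpow x e)"
      by (rule sum.mono_neutral_cong_right) (auto simp: k_def lvl_def)
    finally show ?thesis using assms(1) by simp
  qed
  have h1: "(\<Sum>i\<le>n. (\<Sum>j\<le>n. (\<Sum>l\<le>n. (\<Sum>m\<le>n. k (i, j, l, m) * x4 ^ m) * x3 ^ l) * x2 ^ j) * x1 ^ i) = 0"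
    for x1 x2 x3 x4
    using h0[of "(x1, x2, x3, x4)"]
    by (simp add: xpow.simps sum_distrib_right sum_distrib_left mult_ac)
  have h2: "(\<Sum>j\<le>n. (\<Sum>l\<le>n. (\<Sum>m\<le>n. k (i, j, l, m) * x4 ^ m) * x3 ^ l) * x2 ^ j) = 0"
    if "i \<le> n" for i x2 x3 x4
    using polyfun_eq_0[THEN iffD1, OF allI, OF h1] that by blast
  have h3: "(\<Sum>l\<le>n. (\<Sum>m\<le>n. k (i, j, l, m) * x4 ^ m) * x3 ^ l) = 0"
    if "i \<le> n" "j \<le> n" for i j x3 x4
    using polyfun_eq_0[THEN iffD1, OF allI, OF h2] that by blast
  have h4: "(\<Sum>m\<le>n. k (i, j, l, m) * x4 ^ m) = 0" if "i \<le> n" "j \<le> n" "l \<le> n" for i j l x4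
    using polyfun_eq_0[THEN iffD1, OF allI, OF h3] that by blast
  have "k (i, j, l, m) = 0" if "i \<le> n" "j \<le> n" "l \<le> n" "m \<le> n" for i j l m
    using polyfun_eq_0[THEN iffD1, OF allI, OF h4] that by blast
  moreover have "e = (a, b, c', d) \<Longrightarrow> a \<le> n \<and> b \<le> n \<and> c' \<le> n \<and> d \<le> n" for a b c' d
    using e by (auto simp: lvl_def)
  ultimately have "k e = 0" by (cases e) blast
  then show ?thesis using e by (simp add: k_def lvl_def)
qed

lemma powser_zero_on_reals:
  fixes a :: "nat \<Rightarrow> complex"
  assumes \<delta>: "\<delta> > 0" and sums: "\<And>t. norm t < \<delta> \<Longrightarrow> (\<lambda>k. a k * t ^ k) sums f t"
    and zero: "\<And>t. \<bar>t\<bar> < \<delta> \<Longrightarrow> f (of_real t) = 0"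
  shows "a m = 0"
proof (induction m rule: less_induct)
  case (less m)
  define g where "g = (\<lambda>t. f t / t ^ m)"
  have "(g \<longlongrightarrow> a (0 + m)) (at 0)"
  proof (rule powser_limit_0_strong[OF \<delta>])
    fix t :: complex assume t: "t \<noteq> 0" "norm t < \<delta>"
    have "(\<lambda>k. a (k + m) * t ^ (k + m)) sums f t"
      using sums_iff_shift[of "\<lambda>k. a k * t ^ k" m "f t"] sums[OF t(2)] less by simp
    then have "(\<lambda>k. a (k + m) * t ^ (k + m) / t ^ m) sums g t" unfolding g_def by (rule sums_divide)
    then show "(\<lambda>k. a (k + m) * t ^ k) sums g t" using t by (simp add: power_add)
  qed
  moreover have "filterlim complex_of_real (at 0) (at 0)"
    unfolding filterlim_at by (auto intro!: tendsto_eq_intros simp: eventually_at_filter)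
  ultimately have 1: "((\<lambda>t. g (complex_of_real t)) \<longlongrightarrow> a m) (at 0)"
    by (auto intro: filterlim_compose)
  have "\<forall>\<^sub>F t in at 0. g (complex_of_real t) = 0"
    unfolding eventually_at by (intro exI[of _ \<delta>]) (auto simp: g_def zero dist_norm \<delta>)
  then have 2: "((\<lambda>t. g (complex_of_real t)) \<longlongrightarrow> 0) (at 0)" by (rule tendsto_eventually)
  show ?case using tendsto_unique[OF _ 1 2] by simp
qed

text \<open>
  On real lines the series restricts to a power series in one variable, so every homogeneous component
  vanishes at the real points, which are Zariski dense.
\<close>

lemma identity_theorem:
  assumes F: "Conv F" and r: "r > 0" and z: "\<And>Y. norm Y < r \<Longrightarrow> ev F (rp Y) = 0"
  shows "F = 0"
proof -
  obtain s B where s: "s > 0" "nb F s B" using F by (auto simp: Conv_def)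
  have line0: "line F (rp Y) n = 0" for Y n
  proof -
    obtain y1 y2 y3 y4 where y: "rp Y = (y1, y2, y3, y4)" by (cases "rp Y")
    define tm where "tm = (\<lambda>t. (t * y1, t * y2, t * y3, t * y4) :: vec4)"
    have ln: "line F (tm t) k = line F (rp Y) k * t ^ k" for t k
    proof -
      have xp: "xpow (tm t) e = xpow (rp Y) e * t ^ deg e" for e
        by (cases e) (simp add: tm_def y xpow.simps power_mult_distrib power_add mult_ac)
      show ?thesis by (auto simp: line_def xp lvl_def sum_distrib_right mult.assoc intro!: sum.cong)
    qed
    define \<delta> where "\<delta> = min r s / (norm Y + 1)"
    have \<delta>: "\<delta> > 0" using r s by (simp add: \<delta>_def add_nonneg_pos)
    have small: "norm (t *\<^sub>R Y) < min r s" if "\<bar>t\<bar> < \<delta>" for t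
    proof -
      have "\<bar>t\<bar> * norm Y \<le> \<bar>t\<bar> * (norm Y + 1)" by (intro mult_left_mono) auto
      also have "\<dots> < \<delta> * (norm Y + 1)" using that by (intro mult_strict_right_mono) (auto intro: add_nonneg_pos)
      also have "\<dots> = min r s" by (simp add: \<delta>_def add_nonneg_eq_0_iff)
      finally show ?thesis by simp
    qed
    have v: "vle (tm t) s" if "norm t < \<delta>" for t
    proof -
      have "norm (norm t *\<^sub>R Y) < min r s" using small[of "norm t"] that by simp
      then have "vle (rp (norm t *\<^sub>R Y)) s" by (intro vle_rp) simp
      then show ?thesis using y by (auto simp: rp_def tm_def norm_mult)
    qed
    have sums: "(\<lambda>k. line F (rp Y) k * t ^ k) sums ev F (tm t)" if "norm t < \<delta>" for t
    proof -
      have "line F (tm t) = (\<lambda>k. line F (rp Y) k * t ^ k)" by (rule ext) (rule ln)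
      then show ?thesis using summable_sums[OF summable_line'[OF s(2) v[OF that]]] by (simp add: ev_def)
    qed
    have zero: "ev F (tm (of_real t)) = 0" if "\<bar>t\<bar> < \<delta>" for t
    proof -
      have "tm (of_real t) = rp (t *\<^sub>R Y)" using y
        by (simp only: rp_def vector_scaleR_component) (auto simp: tm_def scaleR_conv_of_real)
      then show ?thesis using z small[OF that] by simp
    qed
    show ?thesis by (rule powser_zero_on_reals[OF \<delta> sums zero])
  qed
  show ?thesis
  proof (rule co_eqI)
    fix e
    have "(\<Sum>e\<in>lvl (deg e). co F e * xpow x e) = 0" for x
      by (rule poly_zero_on_real_points) (use line0 in \<open>simp add: line_def\<close>)
    then have "co F e = 0" by (rule poly_coeffs_zero) (simp add: lvl_def)
    then show "co F e = co 0 e" by simp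
  qed
qed

subsection \<open>Conjugation\<close>

fun sw :: "mi \<Rightarrow> mi" where "sw (a, b, c, d) = (c, d, a, b)"

lemma sw_sw [simp]: "sw (sw e) = e" by (cases e) simp
lemma deg_sw [simp]: "deg (sw e) = deg e" by (cases e) simp
lemma sw_add: "sw (e + f) = sw e + sw f" by (cases e; cases f) simp
lemma sw_E [simp]: "sw E1 = E3" "sw E2 = E4" "sw E3 = E1" "sw E4 = E2" "sw 0 = 0"
  by (simp_all add: E_defs zero_prod_def)

text \<open>The involution \<open>F(Z, W) \<mapsto> cnj F(cnj W, cnj Z)\<close>; its fixed series are the real functions.\<close>

definition bar :: "fps4 \<Rightarrow> fps4" where "bar F = mk (\<lambda>e. cnj (co F (sw e)))"

lemma co_bar: "co (bar F) e = cnj (co F (sw e))" by (simp add: bar_def)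

lemma bar_bar [simp]: "bar (bar F) = F" by (rule co_eqI) (simp add: co_bar)
lemma bar_add: "bar (F + G) = bar F + bar G" by (rule co_eqI) (simp add: co_bar)
lemma bar_diff: "bar (F - G) = bar F - bar G" by (rule co_eqI) (simp add: co_bar)

lemma bar_const4 [simp]: "bar (const4 c) = const4 (cnj c)"
proof (rule co_eqI)
  fix e show "co (bar (const4 c)) e = co (const4 (cnj c)) e"
    using sw_sw[of e] by (cases "e = 0") (auto simp: co_bar co_const4 simp del: sw_sw)
qed

lemma bar_0 [simp]: "bar 0 = 0" by (rule co_eqI) (simp add: co_bar)
lemma bar_1 [simp]: "bar 1 = 1" using bar_const4[of 1] by simp

lemma bar_mult: "bar (F * G) = bar F * bar G"
proof (rule co_eqI)
  fix e
  have "co (bar (F * G)) e = (\<Sum>(f, g)\<in>splits (sw e). cnj (co F f) * cnj (co G g))"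
    by (simp add: co_bar co_mult case_prod_unfold)
  also have "\<dots> = (\<Sum>(f, g)\<in>splits e. cnj (co F (sw f)) * cnj (co G (sw g)))"
    by (rule sum.reindex_bij_witness[where i = "\<lambda>p. (sw (fst p), sw (snd p))" and j = "\<lambda>p. (sw (fst p), sw (snd p))"])
      (auto simp: splits_def sw_add[symmetric] case_prod_unfold simp del: sw.simps)
  finally show "co (bar (F * G)) e = co (bar F * bar G) e" by (simp add: co_mult co_bar)
qed

lemma bar_power: "bar (F ^ n) = bar F ^ n"
  by (induction n) (auto simp: bar_mult)

lemma bar_monom4: "bar (monom4 c e) = monom4 (cnj c) (sw e)"
proof (rule co_eqI)
  fix f show "co (bar (monom4 c e)) f = co (monom4 (cnj c) (sw e)) f"
    using sw_sw[of f] sw_sw[of e] by (cases "f = sw e") (auto simp: co_bar co_monom4 simp del: sw_sw sw.simps)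
qed

lemma bar_X [simp]: "bar X1 = X3" "bar X2 = X4" "bar X3 = X1" "bar X4 = X2"
  by (simp_all add: X1_def X2_def X3_def X4_def bar_monom4)

lemma ord_ge_bar [simp]: "ord_ge n (bar F) \<longleftrightarrow> ord_ge n F"
  unfolding ord_ge_def co_bar by (metis complex_cnj_zero_iff deg_sw sw_sw)

fun bar_t :: "tup \<Rightarrow> tup" where "bar_t (G1, G2, G3, G4) = (bar G3, bar G4, bar G1, bar G2)"

lemma adm_bar_t: "adm G \<Longrightarrow> adm (bar_t G)" by (cases G) auto

lemma bar_gpow: "bar (gpow G f) = gpow (bar_t G) (sw f)"
  by (cases G; cases f) (simp add: gpow.simps bar_mult bar_power mult_ac)

lemma bar_sub: assumes "adm G" shows "bar (sub F G) = sub (bar F) (bar_t G)"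
proof (rule co_eqI)
  fix e
  have "co (bar (sub F G)) e = (\<Sum>f\<in>upto (deg e). cnj (co F f) * co (bar (gpow G f)) e)"
    by (simp add: co_bar co_sub[OF assms order.refl])
  also have "\<dots> = (\<Sum>f\<in>upto (deg e). cnj (co F (sw f)) * co (gpow (bar_t G) f) e)"
    by (rule sum.reindex_bij_witness[where i = sw and j = sw]) (auto simp: upto_def bar_gpow simp del: sw.simps deg.simps)
  finally show "co (bar (sub F G)) e = co (sub (bar F) (bar_t G)) e"
    by (simp add: co_sub[OF adm_bar_t[OF assms] order.refl] co_bar)
qed

lemma tn_bar [simp]: "tn n r (bar F) = tn n r F"
  unfolding tn_def by (rule sum.reindex_bij_witness[where i = sw and j = sw])
    (auto simp: upto_def co_bar simp del: sw.simps deg.simps)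

lemma nb_bar [simp]: "nb (bar F) r B \<longleftrightarrow> nb F r B" by (simp add: nb_def)

lemma Conv_bar: "Conv F \<Longrightarrow> Conv (bar F)" by (simp add: Conv_def)

lemma ev_bar: assumes "nb F r B" "vle (rp Y) r" shows "ev (bar F) (rp Y) = cnj (ev F (rp Y))"
proof -
  have xp: "cnj (xpow (rp Y) (sw e)) = xpow (rp Y) e" for e
    by (cases e) (simp add: rp_def xpow.simps mult_ac)
  have eq: "(\<Sum>e\<in>upto n. co (bar F) e * xpow (rp Y) e) = cnj (\<Sum>e\<in>upto n. co F e * xpow (rp Y) e)" for n
    unfolding cnj_sum by (rule sum.reindex_bij_witness[where i = sw and j = sw])
      (auto simp: upto_def co_bar xp simp del: sw.simps deg.simps)
  have "(\<lambda>n. cnj (\<Sum>e\<in>upto n. co F e * xpow (rp Y) e)) \<longlonglongrightarrow> ev (bar F) (rp Y)"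
    using ev_LIMSEQ[of "bar F" r B "rp Y"] assms unfolding eq by simp
  moreover have "(\<lambda>n. cnj (\<Sum>e\<in>upto n. co F e * xpow (rp Y) e)) \<longlonglongrightarrow> cnj (ev F (rp Y))"
    by (intro tendsto_cnj ev_LIMSEQ[OF assms])
  ultimately show ?thesis by (rule LIMSEQ_unique)
qed

lemma zzbar_expansion_bar: assumes "zzbar_expansion f p F" shows "bar F = F"
proof -
  obtain r where r: "r > 0" "\<And>Y. norm Y < r \<Longrightarrow> ev F (rp Y) = of_real (f (p + Y))"
    using zzbar_expansion_ev[OF assms] by blast
  have C: "Conv F" by (rule zzbar_expansion_Conv[OF assms])
  then obtain s B where s: "s > 0" "nb F s B" by (auto simp: Conv_def)
  have "bar F - F = 0"
  proof (rule identity_theorem)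
    show "Conv (bar F - F)" by (intro Conv_diff Conv_bar C)
    show "min r s > 0" using r s by simp
    fix Y :: "complex^2" assume Y: "norm Y < min r s"
    then have v: "vle (rp Y) s" by (intro vle_rp) simp
    show "ev (bar F - F) (rp Y) = 0"
      using ev_diff[OF _ s(2) v, of "bar F" B] s(2) ev_bar[OF s(2) v] r(2)[of Y] Y by simp
  qed
  then show ?thesis by simp
qed

section \<open>Polynomial relations on a hypersurface hold formally\<close>

lemma ev_bound_ord:
  assumes "ord_ge k F" "nb F r B" "0 \<le> r" "0 \<le> t" "t \<le> 1" "vle x (t * r)"
  shows "cmod (ev F x) \<le> t ^ k * B"
proof (rule ev_bound[OF _ assms(6)])
  show "nb F (t * r) (t ^ k * B)"
    unfolding nb_def
  proof
    fix n
    have "tn n (t * r) F \<le> t ^ k * tn n r F" by (rule tn_scale) (use assms in auto)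
    also have "\<dots> \<le> t ^ k * B" using assms by (intro mult_left_mono) (auto simp: nb_def)
    finally show "tn n (t * r) F \<le> t ^ k * B" .
  qed
qed

lemma rp_scaleR: "rp (h *\<^sub>R v) = (of_real h * v$1, of_real h * v$2, of_real h * cnj (v$1), of_real h * cnj (v$2))"
  by (simp add: rp_def complex_eq_iff)

lemma nb_linpart_XX: "0 \<le> r \<Longrightarrow> \<exists>B. nb (linpart R XX) r B"
  unfolding XX_def linpart.simps by (rule exI, (assumption | rule nb_add nb_mult nb_const4 nb_X)+)

lemma ev_linpart_XX: "ev (linpart R XX) x = lin R x"
proof -
  obtain x1 x2 x3 x4 where x: "x = (x1, x2, x3, x4)" by (cases x)
  define r where "r = cmod x1 + cmod x2 + cmod x3 + cmod x4"
  have r: "0 \<le> r" "vle x r" by (auto simp: r_def x)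
  note c = nb_const4[OF r(1)]
  note m = nb_mult[OF r(1) c nb_X(1)[OF r(1)]] nb_mult[OF r(1) c nb_X(2)[OF r(1)]]
    nb_mult[OF r(1) c nb_X(3)[OF r(1)]] nb_mult[OF r(1) c nb_X(4)[OF r(1)]]
  note a = nb_add[OF r(1) m(1) m(2)]
  note a' = nb_add[OF r(1) a m(3)]
  show ?thesis
    unfolding XX_def linpart.simps
      ev_add[OF a' m(4) r(2)] ev_add[OF a m(3) r(2)] ev_add[OF m(1) m(2) r(2)]
      ev_mult[OF c nb_X(1)[OF r(1)] r(2)] ev_mult[OF c nb_X(2)[OF r(1)] r(2)]
      ev_mult[OF c nb_X(3)[OF r(1)] r(2)] ev_mult[OF c nb_X(4)[OF r(1)] r(2)]
    by (simp add: x mult.commute)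
qed

text \<open>
  The remainder of order two is bounded by a multiple of the square of the distance.
\<close>

lemma derivative_linear_part:
  assumes exp: "zzbar_expansion \<rho> p R" and D: "(\<rho> has_derivative D) (at p)" and R0: "co R 0 = 0"
  shows "of_real (D v) = lin R (rp v)"
proof -
  obtain r where r: "r > 0" "\<And>Y. norm Y < r \<Longrightarrow> ev R (rp Y) = of_real (\<rho> (p + Y))"
    using zzbar_expansion_ev[OF exp] by blast
  obtain s0 B where s0: "s0 > 0" "nb R s0 B" using zzbar_expansion_Conv[OF exp] by (auto simp: Conv_def)
  have CR2: "Conv (tail4 1 R)" using zzbar_expansion_Conv[OF exp]
    by (rule Conv_smaller) (simp add: co_tail4)
  then obtain s C where s: "s > 0" "nb (tail4 1 R) s C" by (auto simp: Conv_def)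
  have o2: "ord_ge 2 (tail4 1 R)" using ord_ge_tail4[of 1 R] by (simp add: numeral_2_eq_2)
  define N where "N = norm v + 1"
  have N: "N > 0" by (simp add: N_def add_nonneg_pos)
  define g where "g = (\<lambda>t. \<rho> (p + t *\<^sub>R v))"
  have \<rho>p: "\<rho> p = 0"
  proof -
    have "ev R (rp 0) = co R 0"
    proof -
      have "cmod (ev (tail4 1 R) (rp 0)) \<le> 0 ^ 2 * C"
        by (rule ev_bound_ord[OF o2 s(2)]) (use s in \<open>auto simp: rp_def\<close>)
      moreover obtain B' where "nb (linpart R XX) s B'" using nb_linpart_XX s(1) less_imp_le by blast
      moreover have "vle (rp 0) s" using s by (simp add: rp_def)
      ultimately have "ev (linpart R XX + tail4 1 R) (rp 0) = 0"
        using ev_add[OF _ s(2)] by (simp add: ev_linpart_XX rp_def)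
      then show ?thesis using linear_decomp[OF R0] R0 by simp
    qed
    then show ?thesis using r(2)[of 0] r(1) R0 by simp
  qed
  have "(g has_real_derivative D v) (at 0)"
  proof -
    have "((\<lambda>t. p + t *\<^sub>R v) has_derivative (\<lambda>t. t *\<^sub>R v)) (at 0)" by (auto intro!: derivative_eq_intros)
    moreover have "(\<rho> has_derivative D) (at (p + 0 *\<^sub>R v))" using D by simp
    ultimately have "(g has_derivative (\<lambda>t. D (t *\<^sub>R v))) (at 0)"
      unfolding g_def by (rule has_derivative_compose)
    moreover have "(\<lambda>t. D (t *\<^sub>R v)) = (*) (D v)"
      using linear_scale[OF has_derivative_linear[OF D]] by (auto simp: mult.commute)
    ultimately show ?thesis by (simp add: has_field_derivative_def)
  qed
  then have "((\<lambda>h. (g (0 + h) - g 0) / h) \<longlongrightarrow> D v) (at 0)" by (simp only: DERIV_def)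
  then have lim1: "((\<lambda>h. complex_of_real (g h / h)) \<longlongrightarrow> of_real (D v)) (at 0)"
    using \<rho>p by (intro tendsto_of_real) (simp add: g_def)
  define K where "K = (N / s)\<^sup>2 * C"
  define h0 where "h0 = min (r / N) (s / N)"
  have h0: "h0 > 0" using r s N by (simp add: h0_def)
  have est: "cmod (complex_of_real (g h / h) - lin R (rp v)) \<le> K * \<bar>h\<bar>" if h: "h \<noteq> 0" "\<bar>h\<bar> < h0" for h
  proof -
    have "\<bar>h\<bar> * N < h0 * N" using h N by (intro mult_strict_right_mono) auto
    also have "h0 * N \<le> min r s" using N by (auto simp: h0_def min_def field_simps)
    finally have hN: "\<bar>h\<bar> * N < min r s" .
    have nv: "norm (h *\<^sub>R v) \<le> \<bar>h\<bar> * N" by (simp add: N_def algebra_simps)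
    have v1: "vle (rp (h *\<^sub>R v)) s" using nv hN by (intro vle_rp) simp
    have v2: "vle (rp (h *\<^sub>R v)) ((\<bar>h\<bar> * N / s) * s)" using nv s by (intro vle_rp) simp
    have t: "cmod (ev (tail4 1 R) (rp (h *\<^sub>R v))) \<le> (\<bar>h\<bar> * N / s)\<^sup>2 * C"
      by (rule ev_bound_ord[OF o2 s(2) _ _ _ v2]) (use s N hN in auto)
    obtain B' where "nb (linpart R XX) s B'" using nb_linpart_XX s(1) less_imp_le by blast
    then have "ev (linpart R XX + tail4 1 R) (rp (h *\<^sub>R v)) = lin R (rp (h *\<^sub>R v)) + ev (tail4 1 R) (rp (h *\<^sub>R v))"
      using ev_add[OF _ s(2) v1] by (simp add: ev_linpart_XX)
    then have "of_real (g h) = lin R (rp (h *\<^sub>R v)) + ev (tail4 1 R) (rp (h *\<^sub>R v))"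
      using r(2)[of "h *\<^sub>R v"] nv hN linear_decomp[OF R0] by (simp add: g_def)
    also have "lin R (rp (h *\<^sub>R v)) = of_real h * lin R (rp v)"
      unfolding rp_scaleR by (simp add: rp_def algebra_simps)
    finally have "complex_of_real (g h / h) - lin R (rp v) = ev (tail4 1 R) (rp (h *\<^sub>R v)) / of_real h"
      using h by (simp add: field_simps)
    then have "cmod (complex_of_real (g h / h) - lin R (rp v)) \<le> (\<bar>h\<bar> * N / s)\<^sup>2 * C / \<bar>h\<bar>"
      using t by (simp add: norm_divide divide_right_mono)
    also have "\<dots> = K * \<bar>h\<bar>"
    proof -
      have "(\<bar>h\<bar> * N / s)\<^sup>2 * C = K * \<bar>h\<bar> * \<bar>h\<bar>" by (simp add: K_def power2_eq_square)
      then show ?thesis using h by simp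
    qed
    finally show ?thesis .
  qed
  have "((\<lambda>h. complex_of_real (g h / h) - lin R (rp v)) \<longlongrightarrow> 0) (at 0)"
  proof (rule Lim_null_comparison)
    show "\<forall>\<^sub>F h in at 0. cmod (complex_of_real (g h / h) - lin R (rp v)) \<le> K * \<bar>h\<bar>"
      unfolding eventually_at using est h0 by (intro exI[of _ h0]) (auto simp: dist_norm)
    have "((\<lambda>h. K * \<bar>h\<bar>) \<longlongrightarrow> K * \<bar>0\<bar>) (at 0)" by (intro tendsto_intros)
    then show "((\<lambda>h. K * \<bar>h\<bar>) \<longlongrightarrow> 0) (at 0)" by simp
  qed
  then have "((\<lambda>h. complex_of_real (g h / h)) \<longlongrightarrow> lin R (rp v)) (at 0)" by (simp add: LIM_zero_iff)
  then show ?thesis using tendsto_unique[OF _ lim1] by simp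
qed

lemma ev_at_0: assumes "Conv F" shows "ev F (rp 0) = co F 0"
proof -
  obtain s C where s: "s > 0" "nb (F - const4 (co F 0)) s C"
    using Conv_diff[OF assms Conv_const4, of "co F 0"] by (auto simp: Conv_def)
  have "ord_ge 1 (F - const4 (co F 0))" by (simp only: ord_ge_1) (simp add: co_const4)
  from ev_bound_ord[OF this s(2), of 0 "rp 0"] s have "ev (F - const4 (co F 0)) (rp 0) = 0"
    by (simp add: rp_def)
  moreover obtain r B where r: "r > 0" "nb F r B" using assms by (auto simp: Conv_def)
  then have "ev (F - const4 (co F 0)) (rp 0) = ev F (rp 0) - co F 0"
    using ev_diff[OF r(2) nb_const4, of "rp 0" "co F 0"] by (simp add: rp_def)
  ultimately show ?thesis by simp
qed

lemma defining_function_linear: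
  assumes exp: "zzbar_expansion \<rho> p R" and def: "local_defining_function M p \<rho>" and p: "p \<in> M"
  shows "co R 0 = 0" "\<exists>v. lin R (rp v) \<noteq> 0"
proof -
  obtain U D where U: "p \<in> U" "M \<inter> U = {Z \<in> U. \<rho> Z = 0}" "(\<rho> has_derivative D) (at p)" "D \<noteq> (\<lambda>v. 0)"
    using def unfolding local_defining_function_def by blast
  have "\<rho> p = 0" using U p by auto
  moreover obtain r where r: "r > 0" "\<And>Y. norm Y < r \<Longrightarrow> ev R (rp Y) = of_real (\<rho> (p + Y))"
    using zzbar_expansion_ev[OF exp] by blast
  ultimately show R0: "co R 0 = 0" using r(2)[of 0] ev_at_0[OF zzbar_expansion_Conv[OF exp]] by simp
  obtain v where "D v \<noteq> 0" using U(4) by auto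
  then show "\<exists>v. lin R (rp v) \<noteq> 0" using derivative_linear_part[OF exp U(3) R0, of v] by (metis of_real_eq_0_iff)
qed

subsection \<open>Nested polynomials as finite sums\<close>

definition pc :: "real poly poly poly poly \<Rightarrow> mi \<Rightarrow> real" where
  "pc P = (\<lambda>(a, b, c, d). coeff (coeff (coeff (coeff P a) b) c) d)"

definition cube :: "nat \<Rightarrow> mi set" where "cube N = {..N} \<times> {..N} \<times> {..N} \<times> {..N}"

lemma finite_cube [simp]: "finite (cube N)" by (simp add: cube_def)

lemma bound_coeffs:
  assumes "\<And>c. \<exists>n. \<forall>m\<ge>n. Q m c"
  shows "\<exists>n. \<forall>m\<ge>n. degree p \<le> m \<and> (\<forall>i. Q m (coeff p i))"
proof -
  obtain b where b: "\<And>c m. b c \<le> m \<Longrightarrow> Q m c" using assms by metis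
  have fin: "finite (range (coeff p))"
  proof (rule finite_subset)
    show "range (coeff p) \<subseteq> insert 0 (coeff p ` {..degree p})"
      by (auto simp: image_iff) (metis atMost_iff coeff_eq_0 not_le)
  qed auto
  define n where "n = degree p + (\<Sum>c\<in>range (coeff p). b c)"
  have "b (coeff p i) \<le> n" for i
    using member_le_sum[of "coeff p i" "range (coeff p)" b] fin by (auto simp: n_def)
  then show ?thesis using b by (intro exI[of _ n]) (auto simp: n_def intro: order_trans)
qed

text \<open>
  A single bound for all degrees of an iterated polynomial turns it into a sum over a cube of exponents.
\<close>

lemma eval_real_poly4_sum:
  "\<exists>N. (\<forall>Z. eval_real_poly4 P Z =
      (\<Sum>(a, b, c, d)\<in>cube N. pc P (a, b, c, d) * Re (Z$1) ^ a * Im (Z$1) ^ b * Re (Z$2) ^ c * Im (Z$2) ^ d))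
    \<and> (P \<noteq> 0 \<longrightarrow> (\<exists>e\<in>cube N. pc P e \<noteq> 0))"
proof -
  have "\<exists>n. \<forall>m\<ge>n. degree P \<le> m \<and> (\<forall>i. degree (coeff P i) \<le> m \<and> (\<forall>j. degree (coeff (coeff P i) j) \<le> m
      \<and> (\<forall>k. degree (coeff (coeff (coeff P i) j) k) \<le> m \<and> True)))"
    by (intro bound_coeffs) auto
  then obtain N where N: "degree P \<le> N" "\<And>i. degree (coeff P i) \<le> N" "\<And>i j. degree (coeff (coeff P i) j) \<le> N"
    "\<And>i j k. degree (coeff (coeff (coeff P i) j) k) \<le> N" by blast
  have alt: "poly p x = (\<Sum>i\<le>N. coeff p i * x ^ i)" if "degree p \<le> N" for p :: "'a::comm_semiring_1 poly" and x
    by (rule poly_sum_le[OF that])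
  have "eval_real_poly4 P Z = (\<Sum>(a, b, c, d)\<in>cube N. pc P (a, b, c, d) * Re (Z$1) ^ a * Im (Z$1) ^ b * Re (Z$2) ^ c * Im (Z$2) ^ d)" for Z
  proof -
    have "eval_real_poly4 P Z = (\<Sum>a\<le>N. \<Sum>b\<le>N. \<Sum>c\<le>N. \<Sum>d\<le>N.
        pc P (a, b, c, d) * Re (Z$1) ^ a * Im (Z$1) ^ b * Re (Z$2) ^ c * Im (Z$2) ^ d)"
      unfolding eval_real_poly4_def alt[OF N(1)] poly_sum poly_mult poly_power
        alt[OF N(2)] alt[OF N(3)] alt[OF N(4)]
      by (simp add: pc_def sum_distrib_right sum_distrib_left mult_ac)
    then show ?thesis by (simp add: cube_def sum.cartesian_product)
  qed
  moreover have "\<exists>e\<in>cube N. pc P e \<noteq> 0" if P0: "P \<noteq> 0"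
  proof -
    obtain a where a: "coeff P a \<noteq> 0" using P0 by (metis leading_coeff_0_iff)
    then obtain b where b: "coeff (coeff P a) b \<noteq> 0" by (metis leading_coeff_0_iff)
    then obtain c where c: "coeff (coeff (coeff P a) b) c \<noteq> 0" by (metis leading_coeff_0_iff)
    then obtain d where d: "coeff (coeff (coeff (coeff P a) b) c) d \<noteq> 0" by (metis leading_coeff_0_iff)
    have "a \<le> N" "b \<le> N" "c \<le> N" "d \<le> N"
      using le_degree[OF a] le_degree[OF b] le_degree[OF c] le_degree[OF d] N by (meson order_trans)+
    then show ?thesis using d by (intro bexI[of _ "(a, b, c, d)"]) (auto simp: pc_def cube_def)
  qed
  ultimately show ?thesis by blast
qed

text \<open>The tuple \<open>(Re Z1, Im Z1, Re Z2, Im Z2)\<close>, written in \<open>Z - p\<close> and its conjugate.\<close>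

fun re_im :: "complex^2 \<Rightarrow> tup \<Rightarrow> tup" where
  "re_im p (G1, G2, G3, G4) =
     (const4 (of_real (Re (p$1))) + const4 (1/2) * (G1 + G3), const4 (of_real (Im (p$1))) + const4 (- \<i>/2) * (G1 - G3),
      const4 (of_real (Re (p$2))) + const4 (1/2) * (G2 + G4), const4 (of_real (Im (p$2))) + const4 (- \<i>/2) * (G2 - G4))"

lemma subt_re_im: "adm G \<Longrightarrow> subt (re_im p XX) G = re_im p G"
  by (cases G) (auto simp: XX_def sub_add sub_diff sub_mult sub_const4 sub_X)

lemma subt_shift: "adm G \<Longrightarrow> adm K \<Longrightarrow> subt (shift G V s) K = shift (subt G K) V (sub s K)"
  by (cases G; cases V) (auto simp: sub_add sub_mult sub_const4)

lemma subt_XX: "adm G \<Longrightarrow> subt XX G = G"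
  by (cases G) (auto simp: XX_def sub_X)

lemma shift_0: "shift G V 0 = G"
  by (cases G; cases V) auto

lemma ConvT_XX: "ConvT XX" by (simp add: XX_def Conv_X)

lemma ConvT_shift: "ConvT G \<Longrightarrow> Conv s \<Longrightarrow> ConvT (shift G V s)"
  by (cases G; cases V) (auto intro!: Conv_add Conv_mult Conv_const4)

lemma re_im_XX_ev:
  assumes "0 \<le> r"
  shows "\<exists>B. nb_t (re_im p XX) r B" and
    "ev_t (re_im p XX) (rp W) = (of_real (Re ((p + W)$1)), of_real (Im ((p + W)$1)), of_real (Re ((p + W)$2)), of_real (Im ((p + W)$2)))"
proof -
  have one: "nb (const4 a + const4 b * (X + Y)) s (cmod a + cmod b * (s + s))"
    "nb (const4 a + const4 b * (X - Y)) s (cmod a + cmod b * (s + s))"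
    "vle x s \<Longrightarrow> ev (const4 a + const4 b * (X + Y)) x = a + b * (ev X x + ev Y x)"
    "vle x s \<Longrightarrow> ev (const4 a + const4 b * (X - Y)) x = a + b * (ev X x - ev Y x)"
    if s: "0 \<le> s" and X: "nb X s s" and Y: "nb Y s s" for a b X Y s x
  proof -
    note n = nb_add[OF s X Y] nb_diff[OF s X Y]
    note m = nb_mult[OF s nb_const4[OF s] n(1), of b] nb_mult[OF s nb_const4[OF s] n(2), of b]
    show "nb (const4 a + const4 b * (X + Y)) s (cmod a + cmod b * (s + s))"
      by (rule nb_add[OF s nb_const4[OF s] m(1)])
    show "nb (const4 a + const4 b * (X - Y)) s (cmod a + cmod b * (s + s))"
      by (rule nb_add[OF s nb_const4[OF s] m(2)])
    assume v: "vle x s"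
    show "ev (const4 a + const4 b * (X + Y)) x = a + b * (ev X x + ev Y x)"
      using ev_add[OF nb_const4[OF s] m(1) v] ev_mult[OF nb_const4[OF s] n(1) v] ev_add[OF X Y v] by simp
    show "ev (const4 a + const4 b * (X - Y)) x = a + b * (ev X x - ev Y x)"
      using ev_add[OF nb_const4[OF s] m(2) v] ev_mult[OF nb_const4[OF s] n(2) v] ev_diff[OF X Y v] by simp
  qed
  define q where "q = cmod (p$1) + cmod (p$2) + (r + r)"
  have le: "\<bar>Re (p$1)\<bar> \<le> cmod (p$1)" "\<bar>Im (p$1)\<bar> \<le> cmod (p$1)" "\<bar>Re (p$2)\<bar> \<le> cmod (p$2)" "\<bar>Im (p$2)\<bar> \<le> cmod (p$2)"
    by (auto simp: abs_Re_le_cmod abs_Im_le_cmod)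
  show "\<exists>B. nb_t (re_im p XX) r B"
    unfolding XX_def re_im.simps nb_t.simps
    by (intro exI[of _ q] conjI nb_mono_bound[OF one(1)] nb_mono_bound[OF one(2)] nb_X assms)
      (use le assms in \<open>auto simp: q_def norm_divide intro: add_mono\<close>)
  have h: "- \<i> / 2 * (z - cnj z) = of_real (Im z)" "1 / 2 * (z + cnj z) = of_real (Re z)" for z
    by (simp_all add: complex_eq_iff)
  have w: "0 \<le> norm W" "vle (rp W) (norm W)" using vle_rp[of W] by auto
  note n = one(3)[OF w(1) nb_X(1,3)[OF w(1)] w(2)] one(3)[OF w(1) nb_X(2,4)[OF w(1)] w(2)]
    one(4)[OF w(1) nb_X(1,3)[OF w(1)] w(2)] one(4)[OF w(1) nb_X(2,4)[OF w(1)] w(2)]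
  have e: "ev X1 (rp W) = W$1" "ev X2 (rp W) = W$2" "ev X3 (rp W) = cnj (W$1)" "ev X4 (rp W) = cnj (W$2)"
    by (simp_all add: rp_def)
  show "ev_t (re_im p XX) (rp W) = (of_real (Re ((p + W)$1)), of_real (Im ((p + W)$1)), of_real (Re ((p + W)$2)), of_real (Im ((p + W)$2)))"
    unfolding XX_def re_im.simps ev_t.simps n e h by simp
qed

text \<open>
  The formal retraction \<open>(Z, W) \<mapsto> (Z + \<theta> v, W + \<theta> cnj v)\<close> of the ambient space onto the
  complexified hypersurface converges and respects conjugation, so it produces actual points of \<open>M\<close>.
  On these the polynomial vanishes, and the identity theorem makes its pullback zero as a series; a
  parametrisation \<open>G\<close> of the complexification is fixed by the retraction.
\<close>

lemma real_algebraic_formal: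
  assumes exp: "zzbar_expansion \<rho> p R" and def: "local_defining_function M p \<rho>" and pM: "p \<in> M"
    and alg: "real_algebraic_germ M p"
  shows "\<exists>N c. (\<exists>e\<in>cube N. c e \<noteq> (0::real)) \<and>
    (\<forall>G. adm G \<longrightarrow> sub R G = 0 \<longrightarrow> (\<Sum>e\<in>cube N. const4 (of_real (c e)) * gpow (re_im p G) e) = 0)"
proof -
  obtain U where U: "open U" "p \<in> U" "M \<inter> U = {Z \<in> U. \<rho> Z = 0}"
    using def unfolding local_defining_function_def by blast
  obtain U' P where U': "open U'" "p \<in> U'" "P \<noteq> 0" "M \<inter> U' \<subseteq> {Z. eval_real_poly4 P Z = 0}"
    using alg unfolding real_algebraic_germ_def by blast
  obtain N where N: "\<And>Z. eval_real_poly4 P Z =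
      (\<Sum>(a, b, c, d)\<in>cube N. pc P (a, b, c, d) * Re (Z$1) ^ a * Im (Z$1) ^ b * Re (Z$2) ^ c * Im (Z$2) ^ d)"
    and nz: "\<exists>e\<in>cube N. pc P e \<noteq> 0" using eval_real_poly4_sum[of P] U'(3) by blast
  have CR: "Conv R" by (rule zzbar_expansion_Conv[OF exp])
  have R0: "co R 0 = 0" by (rule defining_function_linear(1)[OF exp def pM])
  obtain v where v: "lin R (rp v) \<noteq> 0" using defining_function_linear(2)[OF exp def pM] by blast
  have barR: "bar R = R" by (rule zzbar_expansion_bar[OF exp])
  obtain \<theta> where \<theta>: "ord_ge 1 \<theta>" "sub R (shift XX (rp v) \<theta>) = 0"
    using implicit_exists[OF R0 v adm_XX, of 0] by auto
  define \<Gamma> where "\<Gamma> = shift XX (rp v) \<theta>"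
  have a\<Gamma>: "adm \<Gamma>" unfolding \<Gamma>_def by (rule adm_shift[OF adm_XX \<theta>(1)])
  have C\<theta>: "Conv \<theta>" by (rule implicit_Conv[OF R0 v adm_XX _ \<theta> CR ConvT_XX]) (auto simp: Conv_0)
  have C\<Gamma>: "ConvT \<Gamma>" unfolding \<Gamma>_def by (rule ConvT_shift[OF ConvT_XX C\<theta>])
  have bar\<theta>: "bar \<theta> = \<theta>"
  proof (rule implicit_unique[OF R0 v adm_XX])
    have "bar_t \<Gamma> = shift XX (rp v) (bar \<theta>)"
      by (simp add: \<Gamma>_def XX_def rp_def bar_add bar_mult)
    then have "sub R (shift XX (rp v) (bar \<theta>)) = bar (sub R \<Gamma>)"
      using bar_sub[OF a\<Gamma>, of R] by (simp add: barR)
    then show "sub R (shift XX (rp v) (bar \<theta>)) = sub R (shift XX (rp v) \<theta>)"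
      using \<theta>(2) by (simp add: \<Gamma>_def)
  qed (use \<theta> in auto)
  define Pf where "Pf = (\<Sum>e\<in>cube N. const4 (of_real (pc P e)) * gpow (re_im p XX) e)"
  have nbPf: "\<exists>B. nb Pf r B" and evPf: "ev Pf (rp W) = of_real (eval_real_poly4 P (p + W))" if rW: "r \<ge> 0" "vle (rp W) r" for W r
  proof -
    obtain B where B: "nb_t (re_im p XX) r B" using re_im_XX_ev(1)[OF rW(1)] by blast
    have "\<exists>C. nb (const4 (of_real (pc P e)) * gpow (re_im p XX) e) r C" for e
      using ev_gpow(2)[OF rW(1) B rW(2)] nb_mult[OF rW(1) nb_const4[OF rW(1)]] by blast
    then obtain C where C: "\<And>e. nb (const4 (of_real (pc P e)) * gpow (re_im p XX) e) r (C e)" by metis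
    show "\<exists>B. nb Pf r B" unfolding Pf_def by (rule exI, rule nb_sum[OF rW(1) C])
    have "ev Pf (rp W) = (\<Sum>e\<in>cube N. ev (const4 (of_real (pc P e)) * gpow (re_im p XX) e) (rp W))"
      unfolding Pf_def by (rule ev_sum[OF rW(1) C rW(2)])
    also have "\<dots> = (\<Sum>e\<in>cube N. of_real (pc P e) * xpow (ev_t (re_im p XX) (rp W)) e)"
    proof (rule sum.cong[OF refl])
      fix e
      obtain D where "nb (gpow (re_im p XX) e) r D" using ev_gpow(2)[OF rW(1) B rW(2)] by blast
      from ev_mult[OF nb_const4[OF rW(1)] this rW(2)]
      show "ev (const4 (of_real (pc P e)) * gpow (re_im p XX) e) (rp W) = of_real (pc P e) * xpow (ev_t (re_im p XX) (rp W)) e"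
        by (simp add: ev_gpow(1)[OF rW(1) B rW(2)])
    qed
    also have "\<dots> = of_real (eval_real_poly4 P (p + W))"
      unfolding re_im_XX_ev(2)[OF rW(1)] N of_real_sum
      by (intro sum.cong refl) (auto simp: xpow.simps mult.assoc simp del: vector_add_component)
    finally show "ev Pf (rp W) = of_real (eval_real_poly4 P (p + W))" .
  qed
  obtain r1 where r1: "r1 > 0" "\<And>Y. norm Y < r1 \<Longrightarrow> ev R (rp Y) = of_real (\<rho> (p + Y))"
    using zzbar_expansion_ev[OF exp] by blast
  obtain r2 where r2: "r2 > 0" "ball p r2 \<subseteq> U \<inter> U'"
    using open_contains_ball[of "U \<inter> U'"] U U' open_Int by blast
  obtain r3 B where r3: "r3 > 0" "nb R r3 B" using CR by (auto simp: Conv_def)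
  define \<epsilon> where "\<epsilon> = min (min r1 r2) r3 / 3"
  have \<epsilon>: "\<epsilon> > 0" "2 * \<epsilon> < r1" "2 * \<epsilon> < r2" "\<epsilon> \<le> r3" using r1 r2 r3 by (auto simp: \<epsilon>_def)
  obtain r4 where r4: "r4 > 0" "\<And>r. 0 < r \<Longrightarrow> r \<le> r4 \<Longrightarrow> nb_t \<Gamma> r \<epsilon>" using nb_t_small[OF C\<Gamma> a\<Gamma> \<epsilon>(1)] by blast
  obtain r5 C where r5: "r5 > 0" "nb \<theta> r5 C" using C\<theta> by (auto simp: Conv_def)
  define r where "r = min r4 r5"
  have r: "0 < r" "0 \<le> r" using r4 r5 by (auto simp: r_def)
  have n\<Gamma>: "nb_t \<Gamma> r \<epsilon>" using r4 r by (auto simp: r_def)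
  have n\<theta>: "nb \<theta> r C" using r5 r by (auto simp: r_def intro: nb_mono_radius)
  have nR: "nb R \<epsilon> B" using r3 \<epsilon> by (auto intro: nb_mono_radius)
  have ev0: "ev (sub Pf \<Gamma>) (rp Y) = 0" if Y: "norm Y < r" for Y
  proof -
    have vY: "vle (rp Y) r" using Y by (intro vle_rp) simp
    define T where "T = Re (ev \<theta> (rp Y))"
    have "cnj (ev \<theta> (rp Y)) = ev \<theta> (rp Y)" using ev_bar[OF n\<theta> vY] bar\<theta> by simp
    then have T: "ev \<theta> (rp Y) = of_real T" unfolding T_def by (simp add: complex_eq_iff)
    define W where "W = Y + T *\<^sub>R v"
    have comp: "ev (X + const4 a * \<theta>) (rp Y) = ev X (rp Y) + a * of_real T" if "nb X r r" for X a
      using ev_add[OF that nb_mult[OF r(2) nb_const4[OF r(2)] n\<theta>] vY] ev_mult[OF nb_const4[OF r(2)] n\<theta> vY] T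
      by simp
    have "ev_t \<Gamma> (rp Y) = rp W"
      unfolding \<Gamma>_def XX_def rp_def[of v] shift.simps ev_t.simps comp[OF nb_X(1)[OF r(2)]] comp[OF nb_X(2)[OF r(2)]]
        comp[OF nb_X(3)[OF r(2)]] comp[OF nb_X(4)[OF r(2)]]
      by (simp add: rp_def W_def complex_eq_iff mult.commute)
    note eW = this
    have vW: "vle (rp W) \<epsilon>" using vle_ev_t[OF n\<Gamma> vY] eW by simp
    then have "cmod (W$1) \<le> \<epsilon>" "cmod (W$2) \<le> \<epsilon>" by (auto simp: rp_def)
    then have nW: "norm W \<le> 2 * \<epsilon>" using norm_vec2_le[of W] by simp
    have "of_real (\<rho> (p + W)) = ev R (rp W)" using r1(2)[of W] nW \<epsilon> by simp
    also have "\<dots> = ev (sub R \<Gamma>) (rp Y)" using ev_sub[OF r(2) a\<Gamma> n\<Gamma> _ nR vY] \<epsilon>(1) eW by simp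
    also have "\<dots> = 0" using \<theta>(2) by (simp add: \<Gamma>_def)
    finally have "\<rho> (p + W) = 0" by simp
    moreover have "p + W \<in> U \<inter> U'" using r2(2) nW \<epsilon> by (auto simp: dist_norm subset_iff)
    ultimately have "eval_real_poly4 P (p + W) = 0" using U(3) U'(4) by blast
    moreover obtain B' where "nb Pf \<epsilon> B'" using nbPf[OF _ vW] \<epsilon>(1) by auto
    then have "ev (sub Pf \<Gamma>) (rp Y) = ev Pf (rp W)" using ev_sub[OF r(2) a\<Gamma> n\<Gamma> _ _ vY] \<epsilon>(1) eW by simp
    ultimately show ?thesis using evPf[OF _ vW] \<epsilon>(1) by simp
  qed
  have CPf: "Conv Pf"
  proof -
    obtain B' where "nb Pf 1 B'" using nbPf[of 1 0] by (auto simp: rp_def)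
    then show ?thesis unfolding Conv_def by (intro exI[of _ 1] conjI exI[of _ B']) simp_all
  qed
  have subPf: "sub Pf \<Gamma> = 0"
    by (rule identity_theorem[OF Conv_sub[OF CPf C\<Gamma> a\<Gamma>] r(1) ev0])
  have subsum: "sub Pf G = (\<Sum>e\<in>cube N. const4 (of_real (pc P e)) * gpow (re_im p G) e)" if "adm G" for G
    by (simp add: Pf_def sub_sum[OF that] sub_mult[OF that] sub_const4[OF that] sub_gpow[OF that] subt_re_im[OF that])
  have "(\<Sum>e\<in>cube N. const4 (of_real (pc P e)) * gpow (re_im p G) e) = 0" if G: "adm G" "sub R G = 0" for G
  proof -
    have st: "subt \<Gamma> G = shift G (rp v) (sub \<theta> G)"
      unfolding \<Gamma>_def by (simp add: subt_shift[OF adm_XX G(1)] subt_XX[OF G(1)])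
    have "sub \<theta> G = 0"
    proof (rule implicit_unique[OF R0 v G(1)])
      show "ord_ge 1 (sub \<theta> G)" by (rule ord_ge_sub[OF G(1) \<theta>(1)])
      have "sub R (shift G (rp v) (sub \<theta> G)) = sub (sub R \<Gamma>) G"
        unfolding sub_sub[OF a\<Gamma> G(1)] st ..
      also have "\<dots> = sub R (shift G (rp v) 0)" using \<theta>(2) G by (simp add: \<Gamma>_def sub_0 shift_0)
      finally show "sub R (shift G (rp v) (sub \<theta> G)) = sub R (shift G (rp v) 0)" .
    qed simp
    then have "sub Pf G = sub (sub Pf \<Gamma>) G" unfolding sub_sub[OF a\<Gamma> G(1)] st by (simp add: shift_0)
    then show ?thesis unfolding subPf subsum[OF G(1)] by (simp add: sub_0[OF G(1)])
  qed
  then show ?thesis using nz by blast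
qed

section \<open>Series in part of the variables\<close>

lemma ip_E: "ip E1 (a, b, c, d) = a" "ip E2 (a, b, c, d) = b" "ip E3 (a, b, c, d) = c" "ip E4 (a, b, c, d) = d"
  by (simp_all add: E_defs)

text \<open>Series in the first pair of variables only, and in the second pair only.\<close>

definition zser :: "fps4 \<Rightarrow> bool" where "zser F \<longleftrightarrow> pd E3 F = 0 \<and> pd E4 F = 0"
definition wser :: "fps4 \<Rightarrow> bool" where "wser F \<longleftrightarrow> pd E1 F = 0 \<and> pd E2 F = 0"

lemma pd_zero_co: assumes "pd u F = 0" "u \<in> units" "ip u e > 0" shows "co F e = 0"
proof -
  have e: "e = (e - u) + u" using assms(2,3) by (cases e) (auto simp: units_def E_defs)
  have "co (pd u F) (e - u) = 0" using assms(1) by simp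
  then show ?thesis unfolding co_pd e[symmetric] using assms(3) by simp
qed

lemma co_zser: "zser F \<Longrightarrow> c > 0 \<or> d > 0 \<Longrightarrow> co F (a, b, c, d) = 0"
  using pd_zero_co[of E3 F "(a, b, c, d)"] pd_zero_co[of E4 F "(a, b, c, d)"] by (auto simp: zser_def ip_E)

lemma co_wser: "wser F \<Longrightarrow> a > 0 \<or> b > 0 \<Longrightarrow> co F (a, b, c, d) = 0"
  using pd_zero_co[of E1 F "(a, b, c, d)"] pd_zero_co[of E2 F "(a, b, c, d)"] by (auto simp: wser_def ip_E)

lemma sub_cong:
  assumes "adm G" "adm K" "\<And>f. co F f = 0 \<or> gpow G f = gpow K f"
  shows "sub F G = sub F K"
proof (rule co_eqI)
  fix e
  have "co F f * co (gpow G f) e = co F f * co (gpow K f) e" for f using assms(3)[of f] by auto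
  then show "co (sub F G) e = co (sub F K) e"
    by (simp only: co_sub[OF assms(1) order.refl] co_sub[OF assms(2) order.refl])
qed

lemma sub_zser:
  assumes "zser F" "adm (G1, G2, G3, G4)" "adm (G1, G2, K3, K4)"
  shows "sub F (G1, G2, G3, G4) = sub F (G1, G2, K3, K4)"
proof (rule sub_cong[OF assms(2,3)])
  fix f :: mi
  obtain a b c d where f: "f = (a, b, c, d)" by (cases f)
  show "co F f = 0 \<or> gpow (G1, G2, G3, G4) f = gpow (G1, G2, K3, K4) f"
    using co_zser[OF assms(1), of c d a b] by (cases "c > 0 \<or> d > 0") (auto simp: f gpow.simps)
qed

lemma sub_wser:
  assumes "wser F" "adm (G1, G2, G3, G4)" "adm (K1, K2, G3, G4)"
  shows "sub F (G1, G2, G3, G4) = sub F (K1, K2, G3, G4)"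
proof (rule sub_cong[OF assms(2,3)])
  fix f :: mi
  obtain a b c d where f: "f = (a, b, c, d)" by (cases f)
  show "co F f = 0 \<or> gpow (G1, G2, G3, G4) f = gpow (K1, K2, G3, G4) f"
    using co_wser[OF assms(1), of a b c d] by (cases "a > 0 \<or> b > 0") (auto simp: f gpow.simps)
qed

lemma sub_indep4:
  assumes "pd E4 F = 0" "adm (G1, G2, G3, G4)" "adm (G1, G2, G3, K4)"
  shows "sub F (G1, G2, G3, G4) = sub F (G1, G2, G3, K4)"
proof (rule sub_cong[OF assms(2,3)])
  fix f :: mi
  obtain a b c d where f: "f = (a, b, c, d)" by (cases f)
  show "co F f = 0 \<or> gpow (G1, G2, G3, G4) f = gpow (G1, G2, G3, K4) f"
    using pd_zero_co[OF assms(1), of f] by (cases "d > 0") (auto simp: f gpow.simps ip_E)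
qed

lemma zser_mult: "zser F \<Longrightarrow> zser G \<Longrightarrow> zser (F * G)"
  by (simp add: zser_def pd_mult)

lemma zser_one: "zser 1"
  by (simp add: zser_def derivation_1[OF derivation_pd])

lemma zser_power: "zser F \<Longrightarrow> zser (F ^ n)"
  by (induction n) (auto simp: zser_mult zser_one)

text \<open>In characteristic zero a series is recovered from its constant term and its partial derivatives.\<close>

lemma ord_ge_Suc_pd:
  assumes 0: "co F 0 = 0" and p: "\<And>u. u \<in> units \<Longrightarrow> ord_ge n (pd u F)"
  shows "ord_ge (Suc n) F"
  unfolding ord_ge_def
proof (intro allI impI)
  fix e assume e: "deg e < Suc n"
  show "co F e = 0"
  proof (cases "e = 0")
    case False
    obtain a b c d where abcd: "e = (a, b, c, d)" by (cases e)
    have "\<exists>u\<in>units. ip u e > 0"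
      using False by (auto simp: abcd units_def E_defs zero_prod_def)
    then obtain u where u: "u \<in> units" "ip u e > 0" by blast
    have eq: "e = (e - u) + u" and d: "deg e = Suc (deg (e - u))"
      using u by (auto simp: abcd units_def E_defs)
    have "deg (e - u) < n" using e d by simp
    then have "co (pd u F) (e - u) = 0" using p[OF u(1)] unfolding ord_ge_def by blast
    then show ?thesis unfolding co_pd eq[symmetric] using u(2) by simp
  qed (use 0 in simp)
qed

text \<open>
  By the chain rule and the nonvanishing Jacobian, all partial derivatives of a series in the kernel of the
  substitution lie in the kernel too, hence so do all higher ones; their constant terms are zero.
\<close>

lemma sub_injective:
  assumes T: "adm (X3, w, X4, v)" and w: "pd E4 w = 0" and v: "pd E3 v = 0"
    and J: "pd E1 w * pd E2 v \<noteq> pd E2 w * pd E1 v"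
    and F: "sub F (X3, w, X4, v) = 0"
  shows "F = 0"
proof (rule ord_ge_zeroI)
  have der: "sub (pd u F) (X3, w, X4, v) = 0" if u: "u \<in> units" and F: "sub F (X3, w, X4, v) = 0" for u F
  proof -
    let ?s = "\<lambda>F. sub F (X3, w, X4, v)"
    have z: "pd u' (?s F) = 0" if "u' \<in> units" for u'
      using F derivation_0[OF derivation_pd[OF that]] by simp
    have 1: "?s (pd E2 F) * pd E1 w + ?s (pd E4 F) * pd E1 v = 0"
      and 2: "?s (pd E2 F) * pd E2 w + ?s (pd E4 F) * pd E2 v = 0"
      and 3: "?s (pd E1 F) + ?s (pd E2 F) * pd E3 w = 0"
      and 4: "?s (pd E3 F) + ?s (pd E4 F) * pd E4 v = 0"
      using z[of E1] z[of E2] z[of E3] z[of E4] by (simp_all add: chain_rule[OF T] w v)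
    have "?s (pd E2 F) * (pd E1 w * pd E2 v - pd E2 w * pd E1 v)
        = (?s (pd E2 F) * pd E1 w + ?s (pd E4 F) * pd E1 v) * pd E2 v
          - (?s (pd E2 F) * pd E2 w + ?s (pd E4 F) * pd E2 v) * pd E1 v" by (simp add: algebra_simps)
    then have a: "?s (pd E2 F) = 0" using 1 2 J by simp
    have "?s (pd E4 F) * (pd E1 w * pd E2 v - pd E2 w * pd E1 v)
        = (?s (pd E2 F) * pd E2 w + ?s (pd E4 F) * pd E2 v) * pd E1 w
          - (?s (pd E2 F) * pd E1 w + ?s (pd E4 F) * pd E1 v) * pd E2 w" by (simp add: algebra_simps)
    then have b: "?s (pd E4 F) = 0" using 1 2 J by simp
    show ?thesis using u a b 3 4 by (auto simp: units_def)
  qed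
  fix n show "ord_ge n F" using F
  proof (induction n arbitrary: F)
    case (Suc n)
    have "co F 0 = 0" using co_sub_0[OF T, of F] Suc.prems by simp
    then show ?case using Suc.IH[OF der[OF _ Suc.prems]] by (rule ord_ge_Suc_pd)
  qed simp
qed

text \<open>The coefficient of \<open>X3^m X4^n\<close>, as a series in the first pair of variables.\<close>

definition slice :: "nat \<Rightarrow> nat \<Rightarrow> fps4 \<Rightarrow> fps4" where
  "slice m n F = mk (\<lambda>(a, b, c, d). if c = 0 \<and> d = 0 then co F (a, b, m, n) else 0)"

lemma co_slice: "co (slice m n F) (a, b, c, d) = (if c = 0 \<and> d = 0 then co F (a, b, m, n) else 0)"
  by (simp add: slice_def)

lemma slice_0 [simp]: "slice m n 0 = 0"
  by (rule co_eqI) (auto simp: slice_def split: prod.splits)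

lemma slice_sum: "slice m n (sum f A) = (\<Sum>i\<in>A. slice m n (f i))"
  by (rule co_eqI) (auto simp: slice_def split: prod.splits)

lemma slice_mult_zser: assumes H: "zser H" shows "slice m n (F * H) = slice m n F * H"
proof (rule co_eqI)
  fix e :: mi
  obtain a b c d where e: "e = (a, b, c, d)" by (cases e)
  have Hz: "co H (i, j, k, l) = 0" if "k > 0 \<or> l > 0" for i j k l by (rule co_zser[OF H that])
  define S where "S = {p \<in> splits (a, b, m, n). fst (snd (snd (snd p))) = 0 \<and> snd (snd (snd (snd p))) = 0}"
  define S' where "S' = {p \<in> splits (a, b, 0::nat, 0::nat). True}"
  have "co (F * H) (a, b, m, n) = (\<Sum>p\<in>S. co F (fst p) * co H (snd p))"
    unfolding co_mult
  proof (rule sum.mono_neutral_cong_right)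
    show "\<forall>p\<in>splits (a, b, m, n) - S. (case p of (f, g) \<Rightarrow> co F f * co H g) = 0"
    proof
      fix p assume p: "p \<in> splits (a, b, m, n) - S"
      obtain f i j k l where "p = (f, (i, j, k, l))" by (metis prod.collapse)
      then show "(case p of (f, g) \<Rightarrow> co F f * co H g) = 0" using p Hz[of k l i j] by (auto simp: S_def)
    qed
  qed (auto simp: S_def)
  also have "\<dots> = (\<Sum>p\<in>splits (a, b, 0, 0). co (slice m n F) (fst p) * co H (snd p))"
    by (rule sum.reindex_bij_witness[where
          i = "\<lambda>((f1, f2, f3, f4), g). ((f1, f2, m, n), g)" and j = "\<lambda>((f1, f2, f3, f4), g). ((f1, f2, 0, 0), g)"])
      (auto simp: S_def splits_def co_slice)
  finally have main: "co (F * H) (a, b, m, n) = co (slice m n F * H) (a, b, 0, 0)"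
    by (simp add: co_mult case_prod_unfold)
  show "co (slice m n (F * H)) e = co (slice m n F * H) e"
  proof (cases "c = 0 \<and> d = 0")
    case True
    then show ?thesis using main by (simp add: e co_slice)
  next
    case False
    have "co (slice m n F * H) e = 0"
      unfolding co_mult
    proof (rule sum.neutral, rule ballI)
      fix p assume p: "p \<in> splits e"
      obtain f1 f2 f3 f4 g1 g2 g3 g4 where pe: "p = ((f1, f2, f3, f4), (g1, g2, g3, g4))" by (metis prod.collapse)
      have "(f3 > 0 \<or> f4 > 0) \<or> (g3 > 0 \<or> g4 > 0)" using p False by (auto simp: pe e splits_def)
      then show "(case p of (f, g) \<Rightarrow> co (slice m n F) f * co H g) = 0"
        using Hz[of g3 g4 g1 g2] by (auto simp: pe co_slice)
    qed
    then show ?thesis using False by (auto simp: e co_slice)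
  qed
qed

text \<open>Polynomials in the first pair of variables over series in the second pair, and over constants.\<close>

definition zpoly :: "fps4 \<Rightarrow> bool" where
  "zpoly F \<longleftrightarrow> (\<exists>N. \<forall>a b c d. a + b > N \<longrightarrow> co F (a, b, c, d) = 0)"

definition zfin :: "fps4 \<Rightarrow> bool" where
  "zfin F \<longleftrightarrow> zser F \<and> (\<exists>N. \<forall>e. deg e > N \<longrightarrow> co F e = 0)"

lemma zserI: assumes "\<And>a b c d. c > 0 \<or> d > 0 \<Longrightarrow> co F (a, b, c, d) = 0" shows "zser F"
  unfolding zser_def
proof (intro conjI co_eqI)
  fix e :: mi
  obtain a b c d where e: "e = (a, b, c, d)" by (cases e)
  show "co (pd E3 F) e = co 0 e" "co (pd E4 F) e = co 0 e"
    unfolding co_pd e E_defs by (simp_all add: assms)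
qed

lemma zfin_slice: assumes "zpoly F" shows "zfin (slice m n F)"
proof -
  obtain N where N: "\<And>a b c d. a + b > N \<Longrightarrow> co F (a, b, c, d) = 0" using assms unfolding zpoly_def by blast
  have "zser (slice m n F)" by (rule zserI) (auto simp: co_slice)
  moreover have "co (slice m n F) e = 0" if "deg e > N" for e
    using that N by (cases e) (auto simp: co_slice)
  ultimately show ?thesis unfolding zfin_def by blast
qed

lemma zpoly_diff: assumes "zpoly F" "zpoly G" shows "zpoly (F - G)"
proof -
  obtain N M where "\<And>a b c d. a + b > N \<Longrightarrow> co F (a, b, c, d) = 0" "\<And>a b c d. a + b > M \<Longrightarrow> co G (a, b, c, d) = 0"
    using assms unfolding zpoly_def by blast
  then show ?thesis unfolding zpoly_def by (intro exI[of _ "max N M"]) auto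
qed

lemma zpoly_mult: assumes "zpoly F" "zpoly G" shows "zpoly (F * G)"
proof -
  obtain N M where N: "\<And>a b c d. a + b > N \<Longrightarrow> co F (a, b, c, d) = 0" and M: "\<And>a b c d. a + b > M \<Longrightarrow> co G (a, b, c, d) = 0"
    using assms unfolding zpoly_def by blast
  have "co (F * G) (a, b, c, d) = 0" if ab: "a + b > N + M" for a b c d
    unfolding co_mult
  proof (rule sum.neutral, rule ballI)
    fix p assume p: "p \<in> splits (a, b, c, d)"
    obtain f1 f2 f3 f4 g1 g2 g3 g4 where pe: "p = ((f1, f2, f3, f4), (g1, g2, g3, g4))" by (metis prod.collapse)
    have "f1 + f2 > N \<or> g1 + g2 > M" using p ab by (auto simp: pe splits_def)
    then show "(case p of (f, g) \<Rightarrow> co F f * co G g) = 0"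
      using N[of f1 f2 f3 f4] M[of g1 g2 g3 g4] by (auto simp: pe)
  qed
  then show ?thesis unfolding zpoly_def by blast
qed

lemma zpoly_const4: "zpoly (const4 c)"
  unfolding zpoly_def by (intro exI[of _ 0]) (auto simp: co_const4 zero_prod_def)

lemma zpoly_X: "zpoly X1" "zpoly X2"
  unfolding zpoly_def by (rule exI[of _ 1]; auto simp: co_X E_defs)+

lemma zpoly_wser: "wser F \<Longrightarrow> zpoly F"
  unfolding zpoly_def by (intro exI[of _ 0]) (auto intro: co_wser)

section \<open>Embedding into the fraction field\<close>

abbreviation \<iota> :: "fps4 \<Rightarrow> fps4 fract" where "\<iota> \<equiv> to_fract"

definition KK :: "fps4 fract set" where "KK = range (\<lambda>c. \<iota> (const4 c))"

instance fps :: (ring_char_0) ring_char_0 ..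

text \<open>The quotient rule, by the general extension of derivations to a field.\<close>

lemma derivation_fract:
  fixes d :: "'a::{idom,ring_char_0} \<Rightarrow> 'a"
  assumes d: "derivation d"
  shows "\<exists>D. derivation D \<and> (\<forall>F. D (to_fract F) = to_fract (d F))"
proof -
  define G where "G = range (\<lambda>F. (to_fract F, to_fract (d F)))"
  have mem: "(to_fract F, to_fract (d F)) \<in> G" for F by (simp add: G_def)
  have "partial_derivation G"
    unfolding partial_derivation_def
  proof (intro conjI allI impI)
    show "(1, 0) \<in> G" using mem[of 1] derivation_1[OF d] by simp
  next
    fix x a y b assume "(x, a) \<in> G" "(y, b) \<in> G"
    then obtain F F' where "x = to_fract F" "a = to_fract (d F)" "y = to_fract F'" "b = to_fract (d F')"
      by (auto simp: G_def)
    then show "(x - y, a - b) \<in> G" "(x * y, x * b + a * y) \<in> G"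
      using mem[of "F - F'"] mem[of "F * F'"] by (simp_all add: derivation_diff[OF d] derivation_mult[OF d])
  next
    fix a assume "(0, a) \<in> G"
    then show "a = 0" using derivation_0[OF d] by (auto simp: G_def)
  qed
  from partial_derivation_extends[OF this] show ?thesis by (auto simp: G_def)
qed

definition DD :: "mi \<Rightarrow> fps4 fract \<Rightarrow> fps4 fract" where
  "DD u = (SOME D. derivation D \<and> (\<forall>F. D (\<iota> F) = \<iota> (pd u F)))"

lemma DD: assumes "u \<in> units" shows "derivation (DD u)" "DD u (\<iota> F) = \<iota> (pd u F)"
proof -
  have "derivation (DD u) \<and> (\<forall>F. DD u (\<iota> F) = \<iota> (pd u F))"
    unfolding DD_def by (rule someI_ex[OF derivation_fract[OF derivation_pd[OF assms]]])
  then show "derivation (DD u)" "DD u (\<iota> F) = \<iota> (pd u F)" by auto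
qed

lemma DD_KK: "u \<in> units \<Longrightarrow> k \<in> KK \<Longrightarrow> DD u k = 0"
  by (auto simp: KK_def DD(2) pd_const4)

text \<open>
  The four series satisfy a nontrivial linear relation between their differentials, the coefficients
  being algebraic over the series themselves. All that is retained of algebraicity of a hypersurface is
  that this holds for every parametrisation \<open>G\<close> of it.
\<close>

fun grad_dep :: "tup \<Rightarrow> bool" where
  "grad_dep (G1, G2, G3, G4) \<longleftrightarrow> (\<exists>a1 a2 b1 b2.
     {a1, a2, b1, b2} \<subseteq> der_closure (KK \<union> {\<iota> G1, \<iota> G2, \<iota> G3, \<iota> G4}) \<and>
     (a1 \<noteq> 0 \<or> a2 \<noteq> 0 \<or> b1 \<noteq> 0 \<or> b2 \<noteq> 0) \<and> grad_rel KK (\<iota> G1) (\<iota> G2) (\<iota> G3) (\<iota> G4) a1 a2 b1 b2)"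

lemma grad_depI:
  assumes nz: "\<exists>e\<in>cube N. c e \<noteq> (0::real)"
    and rel: "(\<Sum>e\<in>cube N. const4 (of_real (c e)) * gpow (re_im p G) e) = 0"
  shows "grad_dep G"
proof -
  obtain G1 G2 G3 G4 where G: "G = (G1, G2, G3, G4)" by (cases G)
  define r1 where "r1 = const4 (of_real (Re (p$1))) + const4 (1/2) * (G1 + G3)"
  define r2 where "r2 = const4 (of_real (Im (p$1))) + const4 (- \<i>/2) * (G1 - G3)"
  define r3 where "r3 = const4 (of_real (Re (p$2))) + const4 (1/2) * (G2 + G4)"
  define r4 where "r4 = const4 (of_real (Im (p$2))) + const4 (- \<i>/2) * (G2 - G4)"
  have re: "re_im p G = (r1, r2, r3, r4)" by (simp add: G r1_def r2_def r3_def r4_def)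
  have isum: "\<iota> (sum f A) = (\<Sum>i\<in>A. \<iota> (f i))" for f :: "mi \<Rightarrow> fps4" and A
    by (induction A rule: infinite_finite_induct) auto
  have ip: "\<iota> (F ^ n) = \<iota> F ^ n" for F n by (induction n) auto
  define k where "k = (\<lambda>a b c' d. \<iota> (const4 (of_real (c (a, b, c', d)))))"
  have "(\<Sum>i\<le>N. \<Sum>j\<le>N. \<Sum>l\<le>N. \<Sum>m\<le>N. k i j l m * \<iota> r1 ^ i * \<iota> r2 ^ j * \<iota> r3 ^ l * \<iota> r4 ^ m)
      = \<iota> (\<Sum>e\<in>cube N. const4 (of_real (c e)) * gpow (re_im p G) e)"
    unfolding isum by (simp add: cube_def sum.cartesian_product k_def re case_prod_unfold gpow.simps ip)
      (rule sum.cong[OF refl], auto simp: gpow.simps ip mult.assoc)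
  then have s: "(\<Sum>i\<le>N. \<Sum>j\<le>N. \<Sum>l\<le>N. \<Sum>m\<le>N. k i j l m * \<iota> r1 ^ i * \<iota> r2 ^ j * \<iota> r3 ^ l * \<iota> r4 ^ m) = 0"
    using rel by simp
  obtain i0 j0 l0 m0 where nz': "i0 \<le> N" "j0 \<le> N" "l0 \<le> N" "m0 \<le> N" "c (i0, j0, l0, m0) \<noteq> 0"
    using nz by (auto simp: cube_def)
  have knz: "k i0 j0 l0 m0 \<noteq> 0"
  proof
    assume "k i0 j0 l0 m0 = 0"
    then have "co (const4 (of_real (c (i0, j0, l0, m0)))) 0 = 0" by (simp add: k_def)
    then show False using nz' by (simp add: co_const4)
  qed
  have kK: "k i j l m \<in> KK" for i j l m by (simp add: k_def KK_def)
  from dependence_gradient[where c = k and K = KK, OF s nz'(1-4) knz kK] obtain a1 a2 a3 a4 where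
    a: "{a1, a2, a3, a4} \<subseteq> ring_gen (KK \<union> {\<iota> r1, \<iota> r2, \<iota> r3, \<iota> r4})" "a1 \<noteq> 0 \<or> a2 \<noteq> 0 \<or> a3 \<noteq> 0 \<or> a4 \<noteq> 0"
    and gr: "grad_rel KK (\<iota> r1) (\<iota> r2) (\<iota> r3) (\<iota> r4) a1 a2 a3 a4" by blast
  define C where "C = KK \<union> {\<iota> G1, \<iota> G2, \<iota> G3, \<iota> G4}"
  have kc: "\<iota> (const4 x) \<in> ring_gen C" for x by (rule ring_gen.gen) (simp add: C_def KK_def)
  have gG: "\<iota> G1 \<in> ring_gen C" "\<iota> G2 \<in> ring_gen C" "\<iota> G3 \<in> ring_gen C" "\<iota> G4 \<in> ring_gen C"
    by (rule ring_gen.gen; simp add: C_def)+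
  have rC: "\<iota> r1 \<in> ring_gen C" "\<iota> r2 \<in> ring_gen C" "\<iota> r3 \<in> ring_gen C" "\<iota> r4 \<in> ring_gen C"
    unfolding r1_def r2_def r3_def r4_def to_fract_add to_fract_mult to_fract_diff
    by (intro ring_gen_add ring_gen.mult ring_gen.diff kc gG)+
  have "KK \<union> {\<iota> r1, \<iota> r2, \<iota> r3, \<iota> r4} \<subseteq> ring_gen C"
    using rC by (auto simp: C_def intro: ring_gen.gen)
  then have aC: "a1 \<in> ring_gen C" "a2 \<in> ring_gen C" "a3 \<in> ring_gen C" "a4 \<in> ring_gen C"
    using a(1) ring_gen_subset[of "KK \<union> {\<iota> r1, \<iota> r2, \<iota> r3, \<iota> r4}" C] by (auto simp del: Un_insert_right)
  define q s where "q = \<iota> (const4 (1/2))" and "s = \<iota> (const4 (- \<i>/2))"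
  have qs: "q + q = 1" "s * s = - (q * q)" "q \<noteq> 0"
  proof -
    have "const4 (1/2) + const4 (1/2) = 1" using const4_add[of "1/2" "1/2"] by simp
    then show qq: "q + q = 1" unfolding q_def by (metis to_fract_1 to_fract_add)
    have "const4 (- \<i>/2) * const4 (- \<i>/2) = - (const4 (1/2) * const4 (1/2))"
      by (simp add: flip: const4_mult const4_uminus)
    then show "s * s = - (q * q)" unfolding q_def s_def by (metis to_fract_mult to_fract_uminus)
    show "q \<noteq> 0" using qq by auto
  qed
  have qC: "q \<in> ring_gen C" "s \<in> ring_gen C" unfolding q_def s_def by (rule kc)+
  define b1 b3 b2 b4 where "b1 = q * a1 + s * a2" and "b3 = q * a1 - s * a2"
    and "b2 = q * a3 + s * a4" and "b4 = q * a3 - s * a4"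
  have snz: "s \<noteq> 0" using qs by auto
  have inv: "a1 = b1 + b3 \<and> a3 = b2 + b4" "s * a2 + s * a2 = b1 - b3" "s * a4 + s * a4 = b2 - b4"
  proof -
    have "b1 + b3 = (q + q) * a1" "b2 + b4 = (q + q) * a3" by (simp_all add: b1_def b3_def b2_def b4_def algebra_simps)
    then show "a1 = b1 + b3 \<and> a3 = b2 + b4" using qs(1) by simp
  qed (simp_all add: b1_def b3_def b2_def b4_def)
  have "b1 \<noteq> 0 \<or> b2 \<noteq> 0 \<or> b3 \<noteq> 0 \<or> b4 \<noteq> 0"
  proof (rule ccontr)
    assume z: "\<not> ?thesis"
    then have "a1 = 0" "a3 = 0" "s * a2 + s * a2 = 0" "s * a4 + s * a4 = 0" using inv by auto
    then have "2 * (s * a2) = 0" "2 * (s * a4) = 0" by (simp_all only: mult_2)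
    then show False using a(2) snz \<open>a1 = 0\<close> \<open>a3 = 0\<close> by simp
  qed
  moreover have "{b1, b2, b3, b4} \<subseteq> der_closure C"
  proof -
    have "b1 \<in> ring_gen C" "b2 \<in> ring_gen C" "b3 \<in> ring_gen C" "b4 \<in> ring_gen C"
      unfolding b1_def b2_def b3_def b4_def by (intro ring_gen_add ring_gen.diff ring_gen.mult qC aC)+
    then show ?thesis using subsetD[OF ring_gen_der_closure[of C]] by simp
  qed
  moreover have "grad_rel KK (\<iota> G1) (\<iota> G2) (\<iota> G3) (\<iota> G4) b1 b2 b3 b4"
    unfolding grad_rel_def
  proof (intro allI impI)
    fix D assume D: "derivation D" "\<forall>k\<in>KK. D k = 0"
    have kD: "D (\<iota> (const4 x)) = 0" for x using D(2) by (simp add: KK_def)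
    have d: "D (\<iota> r1) = q * (D (\<iota> G1) + D (\<iota> G3))" "D (\<iota> r2) = s * (D (\<iota> G1) - D (\<iota> G3))"
      "D (\<iota> r3) = q * (D (\<iota> G2) + D (\<iota> G4))" "D (\<iota> r4) = s * (D (\<iota> G2) - D (\<iota> G4))"
      unfolding r1_def r2_def r3_def r4_def to_fract_add to_fract_mult to_fract_diff q_def s_def
        derivation_add[OF D(1)] derivation_mult[OF D(1)] derivation_diff[OF D(1)] kD by simp_all
    have "a1 * D (\<iota> r1) + a2 * D (\<iota> r2) + a3 * D (\<iota> r3) + a4 * D (\<iota> r4) = 0"
      using gr D by (simp add: grad_rel_def)
    then show "b1 * D (\<iota> G1) + b2 * D (\<iota> G2) + b3 * D (\<iota> G3) + b4 * D (\<iota> G4) = 0"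
      unfolding d b1_def b2_def b3_def b4_def by (simp add: algebra_simps)
  qed
  ultimately show ?thesis unfolding G grad_dep.simps C_def by blast
qed

section \<open>Algebraicity of the formal map\<close>

text \<open>
  In the gradient relation the coefficient of the differential of \<open>w\<close> cannot vanish, because \<open>X1, X2\<close> and
  \<open>Y\<close> have independent differentials.
\<close>

lemma w_in_der_closure:
  assumes u: "u \<in> units" and G: "grad_dep (Y, w, X1, X2)"
    and Y: "pd E1 Y = 0" "pd E2 Y = 0" "pd u Y = 1" "pd u X1 = 0" "pd u X2 = 0"
  shows "\<iota> w \<in> der_closure (KK \<union> {\<iota> X1, \<iota> X2, \<iota> Y})"
proof -
  obtain a1 a2 b1 b2 where nz: "a1 \<noteq> 0 \<or> a2 \<noteq> 0 \<or> b1 \<noteq> 0 \<or> b2 \<noteq> 0"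
    and gr: "grad_rel KK (\<iota> Y) (\<iota> w) (\<iota> X1) (\<iota> X2) a1 a2 b1 b2" using G by auto
  have rel: "a1 * D (\<iota> Y) + a2 * D (\<iota> w) + b1 * D (\<iota> X1) + b2 * D (\<iota> X2) = 0"
    if "derivation D" "\<And>k. k \<in> KK \<Longrightarrow> D k = 0" for D
    using gr that by (simp add: grad_rel_def)
  have a2: "a2 \<noteq> 0"
  proof
    assume a2: "a2 = 0"
    have "a1 = 0" "b1 = 0" "b2 = 0"
      using rel[OF DD(1)[OF u] DD_KK[OF u]] rel[OF DD(1)[OF unitsI(1)] DD_KK[OF unitsI(1)]]
        rel[OF DD(1)[OF unitsI(2)] DD_KK[OF unitsI(2)]]
      by (simp_all add: DD(2)[OF u] DD(2)[OF unitsI(1)] DD(2)[OF unitsI(2)] Y a2)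
    then show False using nz a2 by simp
  qed
  show ?thesis
  proof (rule der_closureI)
    fix D :: "fps4 fract \<Rightarrow> fps4 fract"
    assume D: "derivation D" "\<And>b. b \<in> KK \<union> {\<iota> X1, \<iota> X2, \<iota> Y} \<Longrightarrow> D b = 0"
    then have "a2 * D (\<iota> w) = 0" using rel[OF D(1)] by simp
    then show "D (\<iota> w) = 0" using a2 by simp
  qed
qed

text \<open>
  The complexified hypersurface is parametrised by \<open>(x, t, z) = (X1, X2, Y)\<close> and \<open>w\<close>; a series in the
  point \<open>(z, w)\<close> or in the conjugate point \<open>(x, t)\<close> is pulled back by substitution of \<open>(Y, w, X1, X2)\<close>,
  and the chain rule gives its derivatives. Both \<open>Y = X3\<close> and \<open>Y = X4\<close> are of interest: they are two
  points on the Segre variety of the same \<open>(x, t)\<close>.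
\<close>

lemma segre_instance:
  assumes u: "u \<in> units" and ad: "adm (Y, w, X1, X2)"
    and Y: "pd E1 Y = 0" "pd E2 Y = 0" "pd u Y = 1" "pd u X1 = 0" "pd u X2 = 0"
    and dep: "grad_dep (Y, w, X1, X2)"
    and dtw: "pd E2 w \<noteq> 0" and levi: "pd E2 w * pd u (pd E1 w) \<noteq> pd E1 w * pd u (pd E2 w)"
    and H: "zser H1" "zser H2" "ord_ge 1 H1" "ord_ge 1 H2" "co H1 E1 * co H2 E2 \<noteq> co H2 E1 * co H1 E2"
    and K: "wser K1" "wser K2" "ord_ge 1 K1" "ord_ge 1 K2" "co K1 E3 * co K2 E4 \<noteq> co K2 E3 * co K1 E4"
    and dep': "grad_dep (sub H1 (Y, w, X1, X2), sub H2 (Y, w, X1, X2), sub K1 (Y, w, X1, X2), sub K2 (Y, w, X1, X2))"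
  shows "segre_point KK (DD E1) (DD E2) (DD u) (\<iota> X1) (\<iota> X2) (\<iota> Y) (\<iota> w)
    (\<iota> (sub K1 (Y, w, X1, X2))) (\<iota> (sub K2 (Y, w, X1, X2))) (\<iota> (sub H1 (Y, w, X1, X2))) (\<iota> (sub H2 (Y, w, X1, X2)))
    (\<iota> (sub (pd E1 H1) (Y, w, X1, X2))) (\<iota> (sub (pd E1 H2) (Y, w, X1, X2)))
    (\<iota> (sub (pd E2 H1) (Y, w, X1, X2))) (\<iota> (sub (pd E2 H2) (Y, w, X1, X2)))
    (\<iota> (sub (pd E2 (pd E1 H1)) (Y, w, X1, X2))) (\<iota> (sub (pd E2 (pd E1 H2)) (Y, w, X1, X2)))
    (\<iota> (sub (pd E2 (pd E2 H1)) (Y, w, X1, X2))) (\<iota> (sub (pd E2 (pd E2 H2)) (Y, w, X1, X2)))"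
proof -
  let ?s = "\<lambda>F. sub F (Y, w, X1, X2)"
  note U = unitsI
  have zd: "zser (pd v F)" if "zser F" "v \<in> units" for F v
    using that pd_commute[of v E3 F] pd_commute[of v E4 F] derivation_0[OF derivation_pd[OF that(2)]]
    by (simp add: zser_def pd_commute[of E3 v] pd_commute[of E4 v])
  have zch: "pd v (?s F) = ?s (pd E1 F) * pd v Y + ?s (pd E2 F) * pd v w" if "zser F" "v \<in> units" for F v
    using that by (simp add: chain_rule[OF ad that(2)] zser_def sub_0[OF ad])
  have wch: "pd v (?s F) = ?s (pd E3 F) * pd v X1 + ?s (pd E4 F) * pd v X2" if "wser F" "v \<in> units" for F v
    using that by (simp add: chain_rule[OF ad that(2)] wser_def sub_0[OF ad])
  have wd: "wser (pd v F)" if "wser F" "v \<in> units" for F v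
    using that derivation_0[OF derivation_pd[OF that(2)]]
    by (simp add: wser_def pd_commute[of E1 v] pd_commute[of E2 v])
  have z1: "pd E1 (?s F) = pd E1 w * ?s (pd E2 F)" "pd E2 (?s F) = pd E2 w * ?s (pd E2 F)"
    "pd u (?s F) = ?s (pd E1 F) + pd u w * ?s (pd E2 F)" if "zser F" for F
    using zch[OF that] u by (simp_all add: Y mult.commute)
  have w1: "pd E1 (?s F) = ?s (pd E3 F)" "pd E2 (?s F) = ?s (pd E4 F)" "pd u (?s F) = 0" if "wser F" for F
    using wch[OF that] u by (simp_all add: Y)
  have co_pd0: "co (pd E1 F) 0 = co F E1" "co (pd E2 F) 0 = co F E2" "co (pd E3 F) 0 = co F E3" "co (pd E4 F) 0 = co F E4" for F
    by (simp_all add: co_pd) (simp_all add: E_defs)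
  have detK: "?s (pd E3 K1) * ?s (pd E4 K2) \<noteq> ?s (pd E3 K2) * ?s (pd E4 K1)"
  proof
    assume "?s (pd E3 K1) * ?s (pd E4 K2) = ?s (pd E3 K2) * ?s (pd E4 K1)"
    then have "co (?s (pd E3 K1) * ?s (pd E4 K2)) 0 = co (?s (pd E3 K2) * ?s (pd E4 K1)) 0" by simp
    then show False using K(5) by (simp add: co_0_mult co_sub_0[OF ad] co_pd0)
  qed
  have detH: "?s (pd E1 H1) * ?s (pd E2 H2) \<noteq> ?s (pd E1 H2) * ?s (pd E2 H1)"
  proof
    assume "?s (pd E1 H1) * ?s (pd E2 H2) = ?s (pd E1 H2) * ?s (pd E2 H1)"
    then have "co (?s (pd E1 H1) * ?s (pd E2 H2)) 0 = co (?s (pd E1 H2) * ?s (pd E2 H1)) 0" by simp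
    then show False using H(5) by (simp add: co_0_mult co_sub_0[OF ad] co_pd0)
  qed
  have imul: "\<iota> a * \<iota> b = \<iota> (a * b)" for a b by simp
  note simps = DD(2)[OF U(1)] DD(2)[OF U(2)] DD(2)[OF u]
  show ?thesis
  proof (unfold_locales, goal_cases)
    case 1 show ?case by (rule DD(1)) simp
  next
    case 2 show ?case by (rule DD(1)) simp
  next
    case 3 show ?case by (rule DD(1)[OF u])
  next
    case (4 k) then show ?case by (simp add: DD_KK)
  next
    case (5 k) then show ?case by (simp add: DD_KK)
  next
    case (6 k) then show ?case by (simp add: DD_KK[OF u])
  next
    case 16 show ?case by (rule w_in_der_closure[OF u dep Y])
  next
    case 19 show ?case using levi by (simp only: simps imul to_fract_eq_iff not_False_eq_True)
  next
    case 27 show ?case using detK by (simp only: simps imul to_fract_eq_iff w1[OF K(1)] w1[OF K(2)] not_False_eq_True)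
  next
    case 42 show ?case using detH by (simp only: imul to_fract_eq_iff not_False_eq_True)
  next
    case 43 show ?case using dep' by (simp add: insert_commute)
  qed (simp_all add: simps Y z1[OF H(1)] z1[OF H(2)] w1[OF K(1)] w1[OF K(2)]
      z1[OF zd[OF H(1) U(1)]] z1[OF zd[OF H(2) U(1)]] z1[OF zd[OF H(1) U(2)]] z1[OF zd[OF H(2) U(2)]]
      w1[OF wd[OF K(1) U(3)]] w1[OF wd[OF K(2) U(3)]] w1[OF wd[OF K(1) U(4)]] w1[OF wd[OF K(2) U(4)]]
      pd_commute[OF U(1) u] pd_commute[OF U(2) u] dtw)
qed

text \<open>Algebraicity over the polynomials in the first pair of variables.\<close>

definition algebraic_zser :: "fps4 \<Rightarrow> bool" where
  "algebraic_zser F \<longleftrightarrow> (\<exists>p. p \<noteq> 0 \<and> (\<forall>i. zfin (coeff p i)) \<and> poly p F = 0)"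

text \<open>
  Independence of the two points \<open>(z, w)\<close> and \<open>(y, v)\<close> turns a relation whose coefficients involve
  the jet at \<open>(y, v)\<close> into relations with constant coefficients: expand in powers of \<open>(y, v)\<close>.
\<close>

lemma algebraic_from_remote_jet:
  assumes T: "adm (X3, w, X4, v)" and w: "pd E4 w = 0" and v: "pd E3 v = 0"
    and J: "pd E1 w * pd E2 v \<noteq> pd E2 w * pd E1 v"
    and F: "zser F" and B: "\<And>b. b \<in> B \<Longrightarrow> \<exists>f. zpoly f \<and> b = \<iota> (sub f (X3, w, X4, v))"
    and alg: "\<iota> (sub F (X3, w, X4, v)) \<in> der_closure B"
  shows "algebraic_zser F"
proof -
  let ?s = "\<lambda>F. sub F (X3, w, X4, v)"
  have lift: "\<exists>f. zpoly f \<and> b = \<iota> (?s f)" if "b \<in> ring_gen B" for b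
    using that
  proof induction
    case one
    show ?case using zpoly_const4[of 1] by (intro exI[of _ 1]) (simp add: sub_1[OF T])
  next
    case (diff x y)
    then obtain f g where "zpoly f" "x = \<iota> (?s f)" "zpoly g" "y = \<iota> (?s g)" by blast
    then show ?case by (intro exI[of _ "f - g"]) (simp add: zpoly_diff sub_diff[OF T])
  next
    case (mult x y)
    then obtain f g where "zpoly f" "x = \<iota> (?s f)" "zpoly g" "y = \<iota> (?s g)" by blast
    then show ?case by (intro exI[of _ "f * g"]) (simp add: zpoly_mult sub_mult[OF T])
  qed (use B in blast)
  obtain p where p: "p \<noteq> 0" "\<And>n. coeff p n \<in> ring_gen B" "poly p (\<iota> (?s F)) = 0"
    using der_closure_algebraic[OF alg] by blast
  obtain f where f: "\<And>n. zpoly (f n)" "\<And>n. coeff p n = \<iota> (?s (f n))" using lift[OF p(2)] by metis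
  define n where "n = degree p"
  have isum: "\<iota> (sum h A) = (\<Sum>i\<in>A. \<iota> (h i))" for h :: "nat \<Rightarrow> fps4" and A
    by (induction A rule: infinite_finite_induct) auto
  have ipw: "\<iota> (h ^ k) = \<iota> h ^ k" for h k by (induction k) auto
  have "\<iota> (?s (\<Sum>i\<le>n. f i * F ^ i)) = poly p (\<iota> (?s F))"
    by (simp add: poly_altdef n_def f(2) sub_sum[OF T] sub_mult[OF T] sub_power[OF T] isum ipw)
  then have "?s (\<Sum>i\<le>n. f i * F ^ i) = 0" using p(3) by simp
  then have rel: "(\<Sum>i\<le>n. f i * F ^ i) = 0" by (rule sub_injective[OF T w v J])
  have "\<iota> (?s (f n)) \<noteq> 0" using p(1) f(2)[of n] unfolding n_def by (metis leading_coeff_0_iff)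
  then have "f n \<noteq> 0" by (auto simp: sub_0[OF T])
  \<comment> \<open>The coefficient of \<open>y^c v^d\<close> is a relation with nonzero leading coefficient.\<close>
  then obtain a b c d where nz: "co (f n) (a, b, c, d) \<noteq> 0" by (metis co_eqI co_0 prod.collapse)
  define q where "q = (\<Sum>i\<le>n. monom (slice c d (f i)) i)"
  have cq: "coeff q i = (if i \<le> n then slice c d (f i) else 0)" for i by (simp add: q_def coeff_sum)
  have "co (slice c d (f n)) (a, b, 0, 0) \<noteq> 0" using nz by (simp add: co_slice)
  then have "coeff q n \<noteq> 0" by (auto simp: cq)
  then have "q \<noteq> 0" by auto
  moreover have "zfin (coeff q i)" for i
    using zfin_slice[OF f(1)] by (auto simp: cq zfin_def zser_def derivation_0[OF derivation_pd])
  moreover have "poly q F = slice c d (\<Sum>i\<le>n. f i * F ^ i)"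
    by (simp add: q_def poly_sum poly_monom slice_sum slice_mult_zser[OF zser_power[OF F]])
  ultimately show ?thesis unfolding algebraic_zser_def rel by (intro exI[of _ q]) simp
qed

lemma adm_perm: "adm (X1, X2, X4, X3)" "adm (X1, X2, X3, X3)"
  using ord_ge_X by auto

text \<open>
  Solve the equation as \<open>w = w(x, t, z)\<close> and put \<open>v = w(x, t, y)\<close>, with \<open>(x, t, z, y) = (X1, \<dots>, X4)\<close>: this
  is a pair of points \<open>(z, w)\<close>, \<open>(y, v)\<close> on the Segre variety of a third. The map at the first is algebraic
  over the jet at the second. If \<open>M\<close> is not Levi-flat then \<open>w\<close> and \<open>v\<close> are independent functions of
  \<open>(x, t)\<close>, that is, the two points are independent.
\<close>

theorem formal_map_algebraic:
  assumes R: "co R 0 = 0" "co R E2 \<noteq> 0" "co R E4 \<noteq> 0"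
    and dep: "\<And>G. adm G \<Longrightarrow> sub R G = 0 \<Longrightarrow> grad_dep G"
    and dep': "\<And>G. adm G \<Longrightarrow> sub R' G = 0 \<Longrightarrow> grad_dep G"
    and H: "zser H1" "zser H2" "ord_ge 1 H1" "ord_ge 1 H2" "co H1 E1 * co H2 E2 \<noteq> co H2 E1 * co H1 E2"
    and K: "wser K1" "wser K2" "ord_ge 1 K1" "ord_ge 1 K2" "co K1 E3 * co K2 E4 \<noteq> co K2 E3 * co K1 E4"
    and map: "sub R' (H1, H2, K1, K2) = A * R"
    and nonflat: "\<And>w. ord_ge 1 w \<Longrightarrow> sub R (X3, w, X1, X2) = 0 \<Longrightarrow> pd E4 w = 0 \<Longrightarrow>
      pd E2 w * pd E3 (pd E1 w) \<noteq> pd E1 w * pd E3 (pd E2 w)"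
  shows "algebraic_zser H1" "algebraic_zser H2"
proof -
  have linR: "lin R (0, 1, 0, 0) \<noteq> 0" using R by simp
  obtain w where w1: "ord_ge 1 w" and "sub R (shift (X3, 0, X1, X2) (0, 1, 0, 0) w) = 0"
    using implicit_exists[OF R(1) linR, of "(X3, 0, X1, X2)" 0] ord_ge_X by auto
  then have w: "sub R (X3, w, X1, X2) = 0" by simp
  have aw: "adm (X3, w, X1, X2)" using w1 ord_ge_X by auto
  have ch: "sub (pd E1 R) (X3, w, X1, X2) * pd u X3 + sub (pd E2 R) (X3, w, X1, X2) * pd u w
      + sub (pd E3 R) (X3, w, X1, X2) * pd u X1 + sub (pd E4 R) (X3, w, X1, X2) * pd u X2 = 0"
    if "u \<in> units" for u
    using chain_rule[OF aw that, of R] w derivation_0[OF derivation_pd[OF that]] by simp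
  have nz: "sub (pd E2 R) (X3, w, X1, X2) \<noteq> 0" "sub (pd E4 R) (X3, w, X1, X2) \<noteq> 0"
  proof -
    have "co (sub (pd E2 R) (X3, w, X1, X2)) 0 = co R E2" "co (sub (pd E4 R) (X3, w, X1, X2)) 0 = co R E4"
      by (simp_all add: co_sub_0[OF aw] co_pd) (simp_all add: E_defs)
    then show "sub (pd E2 R) (X3, w, X1, X2) \<noteq> 0" "sub (pd E4 R) (X3, w, X1, X2) \<noteq> 0" using R by auto
  qed
  have w4: "pd E4 w = 0" using ch[of E4] nz by simp
  have w2: "pd E2 w \<noteq> 0" using ch[of E2] nz by auto
  note levi = nonflat[OF w1 w w4]
  define v where "v = sub w (X1, X2, X4, X3)"
  have v1: "ord_ge 1 v" unfolding v_def by (rule ord_ge_sub[OF adm_perm(1) w1])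
  have av: "adm (X4, v, X1, X2)" using v1 ord_ge_X by auto
  have vR: "sub R (X4, v, X1, X2) = 0"
    using sub_sub[OF aw adm_perm(1), of R] w by (simp add: v_def sub_X[OF adm_perm(1)] sub_0[OF adm_perm(1)])
  have vd: "pd E1 (sub F (X1, X2, X4, X3)) = sub (pd E1 F) (X1, X2, X4, X3)"
    "pd E2 (sub F (X1, X2, X4, X3)) = sub (pd E2 F) (X1, X2, X4, X3)"
    "pd E3 (sub F (X1, X2, X4, X3)) = sub (pd E4 F) (X1, X2, X4, X3)"
    "pd E4 (sub F (X1, X2, X4, X3)) = sub (pd E3 F) (X1, X2, X4, X3)" for F
    by (simp_all add: chain_rule[OF adm_perm(1)])
  have diag: "sub (sub F (X1, X2, X4, X3)) (X1, X2, X3, X3) = F" if "pd E4 F = 0" for F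
    using sub_sub[OF adm_perm(1) adm_perm(2), of F] sub_indep4[OF that, of X1 X2 X3 X3 X4] ord_ge_X sub_XX[of F]
    by (simp add: sub_X[OF adm_perm(2)] XX_def)
  have diag': "sub F (X1, X2, X3, X3) = F" if "pd E4 F = 0" for F
    using sub_indep4[OF that, of X1 X2 X3 X3 X4] ord_ge_X sub_XX[of F] by (simp add: XX_def)
  have v3: "pd E3 v = 0" by (simp add: v_def vd w4 sub_0[OF adm_perm(1)])
  have comm4: "pd E4 (pd u w) = 0" "pd E4 (pd E3 (pd u w)) = 0" if "u \<in> units" for u
    using that w4 derivation_0[OF derivation_pd] by (simp_all add: pd_commute[of E4])
  \<comment> \<open>The Jacobian of \<open>w\<close> and \<open>v\<close> in \<open>(x, t)\<close> vanishes for \<open>y = z\<close>, and there its derivative in \<open>y\<close> is the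
    Levi determinant.\<close>
  have J: "pd E1 w * pd E2 v \<noteq> pd E2 w * pd E1 v"
  proof
    assume "pd E1 w * pd E2 v = pd E2 w * pd E1 v"
    then have "pd E4 (pd E1 w * pd E2 v) = pd E4 (pd E2 w * pd E1 v)" by simp
    then have "pd E1 w * sub (pd E3 (pd E2 w)) (X1, X2, X4, X3) = pd E2 w * sub (pd E3 (pd E1 w)) (X1, X2, X4, X3)"
      by (simp add: pd_mult comm4 v_def vd)
    then have "sub (pd E1 w * sub (pd E3 (pd E2 w)) (X1, X2, X4, X3)) (X1, X2, X3, X3)
        = sub (pd E2 w * sub (pd E3 (pd E1 w)) (X1, X2, X4, X3)) (X1, X2, X3, X3)" by simp
    then show False using levi by (simp add: sub_mult[OF adm_perm(2)] diag diag' comm4)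
  qed
  have v2: "pd E2 v \<noteq> 0" and levi_v: "pd E2 v * pd E4 (pd E1 v) \<noteq> pd E1 v * pd E4 (pd E2 v)"
  proof -
    show "pd E2 v \<noteq> 0"
    proof
      assume "pd E2 v = 0"
      then have "sub (pd E2 v) (X1, X2, X3, X3) = 0" by (simp add: sub_0[OF adm_perm(2)])
      then show False using w2 by (simp add: v_def vd diag comm4)
    qed
    show "pd E2 v * pd E4 (pd E1 v) \<noteq> pd E1 v * pd E4 (pd E2 v)"
    proof
      assume "pd E2 v * pd E4 (pd E1 v) = pd E1 v * pd E4 (pd E2 v)"
      then have "sub (pd E2 v * pd E4 (pd E1 v)) (X1, X2, X3, X3) = sub (pd E1 v * pd E4 (pd E2 v)) (X1, X2, X3, X3)" by simp
      then show False using levi by (simp add: sub_mult[OF adm_perm(2)] v_def vd diag comm4)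
    qed
  qed
  have aH: "adm (H1, H2, K1, K2)" using H K by auto
  have depm: "grad_dep (sub H1 G, sub H2 G, sub K1 G, sub K2 G)" if "adm G" "sub R G = 0" for G
  proof -
    have "sub R' (subt (H1, H2, K1, K2) G) = sub (sub R' (H1, H2, K1, K2)) G" by (rule sub_sub[OF aH that(1), symmetric])
    also have "\<dots> = 0" using that by (simp add: map sub_mult)
    finally show ?thesis using dep'[OF adm_subt[OF aH that(1)]] by simp
  qed
  have K_eq: "sub F (X3, w, X1, X2) = sub F (X4, v, X1, X2)" if "wser F" for F
    by (rule sub_wser[OF that aw av])
  note W = segre_instance[OF unitsI(3) aw _ _ _ _ _ dep[OF aw w] w2 levi H K depm[OF aw w]]
  note V = segre_instance[OF unitsI(4) av _ _ _ _ _ dep[OF av vR] v2 levi_v H K depm[OF av vR]]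
  have aT: "adm (X3, w, X4, v)" using w1 v1 ord_ge_X by auto
  have J': "DD E1 (\<iota> w) * DD E2 (\<iota> v) \<noteq> DD E2 (\<iota> w) * DD E1 (\<iota> v)"
    using J by (simp add: DD(2) flip: to_fract_mult)
  define B where "B = KK \<union> {\<iota> X3, \<iota> w, \<iota> X4, \<iota> v, \<iota> (sub H1 (X4, v, X1, X2)), \<iota> (sub H2 (X4, v, X1, X2)),
      \<iota> (sub (pd E1 H1) (X4, v, X1, X2)), \<iota> (sub (pd E1 H2) (X4, v, X1, X2)),
      \<iota> (sub (pd E2 H1) (X4, v, X1, X2)), \<iota> (sub (pd E2 H2) (X4, v, X1, X2)),
      \<iota> (sub (pd E2 (pd E1 H1)) (X4, v, X1, X2)), \<iota> (sub (pd E2 (pd E1 H2)) (X4, v, X1, X2)),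
      \<iota> (sub (pd E2 (pd E2 H1)) (X4, v, X1, X2)), \<iota> (sub (pd E2 (pd E2 H2)) (X4, v, X1, X2))}"
  have hB: "\<iota> (sub H1 (X3, w, X1, X2)) \<in> der_closure B" "\<iota> (sub H2 (X3, w, X1, X2)) \<in> der_closure B"
    using map_determined_by_remote_jet[OF W V[folded K_eq[OF K(1)] K_eq[OF K(2)]] J'] unfolding B_def by simp_all
  have zd: "zser (pd u F)" if "zser F" "u \<in> units" for F u
    using that derivation_0[OF derivation_pd[OF that(2)]] by (simp add: zser_def pd_commute[of E3 u] pd_commute[of E4 u])
  \<comment> \<open>In the coordinates \<open>(z, w, y, v)\<close> a series at the remote point is a series in the second pair.\<close>
  have remote: "\<exists>f. zpoly f \<and> \<iota> (sub F (X4, v, X1, X2)) = \<iota> (sub f (X3, w, X4, v))" if F: "zser F" for F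
  proof (intro exI conjI)
    have a34: "adm (X3, X4, X1, X2)" using ord_ge_X by simp
    have "wser (sub F (X3, X4, X1, X2))"
      using F by (simp add: wser_def chain_rule[OF a34] zser_def sub_0[OF a34])
    then show "zpoly (sub F (X3, X4, X1, X2))" by (rule zpoly_wser)
    have "sub (sub F (X3, X4, X1, X2)) (X3, w, X4, v) = sub F (X4, v, X3, w)"
      by (simp add: sub_sub[OF a34 aT] sub_X[OF aT])
    also have "\<dots> = sub F (X4, v, X1, X2)"
      by (rule sub_zser[OF F]) (use v1 w1 ord_ge_X in auto)
    finally show "\<iota> (sub F (X4, v, X1, X2)) = \<iota> (sub (sub F (X3, X4, X1, X2)) (X3, w, X4, v))" by simp
  qed
  have wX: "wser X3" "wser X4" by (simp_all add: wser_def)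
  have Bl: "\<exists>f. zpoly f \<and> b = \<iota> (sub f (X3, w, X4, v))" if b: "b \<in> B" for b
  proof -
    have 1: "\<exists>f. zpoly f \<and> \<iota> X3 = \<iota> (sub f (X3, w, X4, v))" using zpoly_X(1) sub_X(1)[OF aT] by metis
    have 2: "\<exists>f. zpoly f \<and> \<iota> w = \<iota> (sub f (X3, w, X4, v))" using zpoly_X(2) sub_X(2)[OF aT] by metis
    have 3: "\<exists>f. zpoly f \<and> \<iota> X4 = \<iota> (sub f (X3, w, X4, v))" using zpoly_wser[OF wX(1)] sub_X(3)[OF aT] by metis
    have 4: "\<exists>f. zpoly f \<and> \<iota> v = \<iota> (sub f (X3, w, X4, v))" using zpoly_wser[OF wX(2)] sub_X(4)[OF aT] by metis
    have 5: "\<exists>f. zpoly f \<and> k = \<iota> (sub f (X3, w, X4, v))" if "k \<in> KK" for k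
      using that zpoly_const4 sub_const4[OF aT] unfolding KK_def by (metis imageE)
    note Z = H(1,2) zd[OF H(1) unitsI(1)] zd[OF H(2) unitsI(1)] zd[OF H(1) unitsI(2)] zd[OF H(2) unitsI(2)]
    note ZZ = zd[OF Z(3) unitsI(2)] zd[OF Z(4) unitsI(2)] zd[OF Z(5) unitsI(2)] zd[OF Z(6) unitsI(2)]
    show ?thesis using b unfolding B_def
      by (elim UnE insertE emptyE)
        (simp_all only: 1 2 3 4 5 remote[OF Z(1)] remote[OF Z(2)] remote[OF Z(3)] remote[OF Z(4)] remote[OF Z(5)]
          remote[OF Z(6)] remote[OF ZZ(1)] remote[OF ZZ(2)] remote[OF ZZ(3)] remote[OF ZZ(4)])
  qed
  have eqT: "sub F (X3, w, X1, X2) = sub F (X3, w, X4, v)" if "zser F" for F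
    by (rule sub_zser[OF that aw aT])
  show "algebraic_zser H1" "algebraic_zser H2"
    using algebraic_from_remote_jet[OF aT w4 v3 J _ Bl] H(1,2) hB eqT[OF H(1)] eqT[OF H(2)] by simp_all
qed

section \<open>Degenerate Segre families are Levi-flat\<close>

lemma co_sub_kill:
  assumes "adm G" "\<And>f. gpow G f = (if P f then monom4 1 f else 0)"
  shows "co (sub F G) e = (if P e then co F e else 0)"
proof -
  have "co (sub F G) e = (\<Sum>f\<in>upto (deg e). if f = e then (if P e then co F e else 0) else 0)"
    unfolding co_sub[OF assms(1) order.refl]
    by (rule sum.cong) (auto simp: assms(2) co_monom4)
  also have "\<dots> = (if P e then co F e else 0)"
    by (subst sum.delta[OF finite_upto]) (simp add: upto_def)
  finally show ?thesis .
qed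

lemma adm_kill: "adm (X1, X2, 0, 0)" "adm (X1, 0, X3, X4)"
  using ord_ge_X by auto

lemma gpow_kill:
  "gpow (X1, X2, 0, 0) (a, b, c, d) = (if c = 0 \<and> d = 0 then monom4 1 (a, b, c, d) else 0)"
  "gpow (X1, 0, X3, X4) (a, b, c, d) = (if b = 0 then monom4 1 (a, b, c, d) else 0)"
  unfolding monom4_gpow by (auto simp: gpow.simps XX_def power_0_left)

lemma co_kill34: "co (sub F (X1, X2, 0, 0)) (a, b, c, d) = (if c = 0 \<and> d = 0 then co F (a, b, c, d) else 0)"
proof -
  have "gpow (X1, X2, 0, 0) f = (if fst (snd (snd f)) = 0 \<and> snd (snd (snd f)) = 0 then monom4 1 f else 0)" for f :: mi
    by (cases f) (simp add: gpow_kill)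
  from co_sub_kill[OF adm_kill(1) this, of F "(a, b, c, d)"] show ?thesis by simp
qed

lemma co_kill2: "co (sub F (X1, 0, X3, X4)) (a, b, c, d) = (if b = 0 then co F (a, b, c, d) else 0)"
proof -
  have "gpow (X1, 0, X3, X4) f = (if fst (snd f) = 0 then monom4 1 f else 0)" for f :: mi
    by (cases f) (simp add: gpow_kill)
  from co_sub_kill[OF adm_kill(2) this, of F "(a, b, c, d)"] show ?thesis by simp
qed

text \<open>Division by a variable, for series divisible by it.\<close>

definition coshift :: "mi \<Rightarrow> fps4 \<Rightarrow> fps4" where "coshift u F = mk (\<lambda>e. co F (e + u))"

lemma co_coshift: "co (coshift u F) e = co F (e + u)" by (simp add: coshift_def)

lemma Conv_coshift: assumes "Conv F" "u \<in> units" shows "Conv (coshift u F)"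
proof -
  obtain r M where r: "r > 0" "\<And>e. cmod (co F e) * r ^ deg e \<le> M" using assms(1) by (auto simp: Conv_iff)
  have d: "deg u = 1" using assms(2) by (auto simp: units_def)
  show ?thesis
  proof (rule Conv_bound[OF r(1)])
    fix e
    have "cmod (co F (e + u)) * r ^ deg e * r \<le> M" using r(2)[of "e + u"] d by (simp add: mult.assoc mult.commute[of r])
    then show "cmod (co (coshift u F) e) * r ^ deg e \<le> M / r" using r(1) by (simp add: co_coshift pos_le_divide_eq)
  qed
qed

lemma X2_coshift: assumes "sub F (X1, 0, X3, X4) = 0" shows "F = X2 * coshift E2 F"
proof (rule co_eqI)
  fix e :: mi
  obtain a b c d where e: "e = (a, b, c, d)" by (cases e)
  show "co F e = co (X2 * coshift E2 F) e"
  proof (cases b)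
    case 0
    have "co F e = 0" using co_kill2[of F a 0 c d] assms by (simp add: e 0)
    moreover have "co (X2 * coshift E2 F) e = 0"
      unfolding X2_def by (rule co_monom4_mult_0) (auto simp: e 0 E2_def)
    ultimately show ?thesis by simp
  next
    case (Suc b')
    have eq: "e = E2 + (a, b', c, d)" by (simp add: e Suc E2_def)
    show ?thesis unfolding eq X2_def co_monom4_mult co_coshift by (simp add: add.commute)
  qed
qed

lemma co_mult_lowest: assumes "ord_ge m F" "deg e = m" shows "co (u * F) e = co u 0 * co F e"
proof -
  have "ord_ge 1 (u - const4 (co u 0))" by (simp only: ord_ge_1) (simp add: co_const4)
  from ord_ge_mult[OF this assms(1)] have "co ((u - const4 (co u 0)) * F) e = 0"
    using assms(2) unfolding ord_ge_def by simp
  then show ?thesis by (simp add: left_diff_distrib)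
qed

lemma ord_ge_unit: assumes u: "co u 0 \<noteq> 0" and F: "ord_ge n (u * F)" shows "ord_ge n F"
proof -
  have "m \<le> n \<Longrightarrow> ord_ge m F" for m
  proof (induction m)
    case (Suc m)
    then have m: "ord_ge m F" "m < n" by auto
    have "co F e = 0" if "deg e < Suc m" for e
    proof (cases "deg e = m")
      case True
      have "co u 0 * co F e = 0" using co_mult_lowest[OF m(1) True, of u] F m(2) True unfolding ord_ge_def by simp
      then show ?thesis using u by simp
    qed (use m(1) that in \<open>simp add: ord_ge_def\<close>)
    then show ?case unfolding ord_ge_def by blast
  qed simp
  then show ?thesis by simp
qed

text \<open>
  A convergent series vanishing on the complexified hypersurface is divisible by its equation \<open>R\<close>, with
  convergent quotient: take \<open>R\<close> as the new second coordinate.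
\<close>

lemma divisible_by_equation:
  assumes R: "co R 0 = 0" "co R E2 \<noteq> 0" "Conv R" and N: "Conv N"
    and w: "ord_ge 1 w" "sub R (X3, w, X1, X2) = 0" and Nw: "sub N (X3, w, X1, X2) = 0"
  shows "\<exists>B. Conv B \<and> N = B * R"
proof -
  have linR: "lin R (0, 1, 0, 0) \<noteq> 0" using R by simp
  have aw: "adm (X3, w, X1, X2)" using w ord_ge_X by auto
  obtain s where s: "ord_ge 1 s" "sub R (shift (X1, 0, X3, X4) (0, 1, 0, 0) s) = X2"
    using implicit_exists[OF R(1) linR adm_kill(2) ord_ge_X(2)] by auto
  then have Rs: "sub R (X1, s, X3, X4) = X2" by simp
  have Cs: "Conv s"
    by (rule implicit_Conv[OF R(1) linR adm_kill(2) ord_ge_X(2) s R(3)]) (auto simp: Conv_X Conv_0)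
  have as: "adm (X1, s, X3, X4)" using s ord_ge_X by auto
  have a3: "adm (X3, X4, X1, 0)" using ord_ge_X by auto
  have R1: "ord_ge 1 R" using R(1) ord_ge_1 by blast
  have aR: "adm (X1, R, X3, X4)" using R1 ord_ge_X by auto
  have uniq: "p = q" if "ord_ge 1 p" "ord_ge 1 q" "sub R (X1, p, X3, X4) = sub R (X1, q, X3, X4)" for p q
    using implicit_unique[OF R(1) linR adm_kill(2) that(1,2)] that(3) by simp
  have "sub s (X1, 0, X3, X4) = sub w (X3, X4, X1, 0)"
  proof (rule uniq)
    show "ord_ge 1 (sub s (X1, 0, X3, X4))" "ord_ge 1 (sub w (X3, X4, X1, 0))"
      by (intro ord_ge_sub adm_kill a3 s w)+
    have "sub R (X1, sub s (X1, 0, X3, X4), X3, X4) = sub (sub R (X1, s, X3, X4)) (X1, 0, X3, X4)"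
      by (simp add: sub_sub[OF as adm_kill(2)] sub_X[OF adm_kill(2)])
    also have "\<dots> = 0" by (simp add: Rs sub_X[OF adm_kill(2)])
    also have "\<dots> = sub (sub R (X3, w, X1, X2)) (X3, X4, X1, 0)" by (simp add: w sub_0[OF a3])
    also have "\<dots> = sub R (X1, sub w (X3, X4, X1, 0), X3, X4)"
      by (simp add: sub_sub[OF aw a3] sub_X[OF a3])
    finally show "sub R (X1, sub s (X1, 0, X3, X4), X3, X4) = sub R (X1, sub w (X3, X4, X1, 0), X3, X4)" .
  qed
  then have "sub (sub N (X1, s, X3, X4)) (X1, 0, X3, X4) = sub (sub N (X3, w, X1, X2)) (X3, X4, X1, 0)"
    by (simp add: sub_sub[OF as adm_kill(2)] sub_X[OF adm_kill(2)] sub_sub[OF aw a3] sub_X[OF a3])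
  then have "sub (sub N (X1, s, X3, X4)) (X1, 0, X3, X4) = 0" by (simp add: Nw sub_0[OF a3])
  from X2_coshift[OF this] obtain B' where B': "sub N (X1, s, X3, X4) = X2 * B'" "B' = coshift E2 (sub N (X1, s, X3, X4))"
    by blast
  have CB': "Conv B'" unfolding B'(2) by (intro Conv_coshift Conv_sub N as) (auto simp: Conv_X Cs)
  have "sub s (X1, R, X3, X4) = X2"
  proof (rule uniq)
    show "ord_ge 1 (sub s (X1, R, X3, X4))" by (intro ord_ge_sub aR s)
    have "sub R (X1, sub s (X1, R, X3, X4), X3, X4) = sub (sub R (X1, s, X3, X4)) (X1, R, X3, X4)"
      by (simp add: sub_sub[OF as aR] sub_X[OF aR])
    also have "\<dots> = R" by (simp add: Rs sub_X[OF aR])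
    also have "\<dots> = sub R (X1, X2, X3, X4)" using sub_XX[of R] by (simp add: XX_def)
    finally show "sub R (X1, sub s (X1, R, X3, X4), X3, X4) = sub R (X1, X2, X3, X4)" .
  qed (rule ord_ge_X)
  then have "sub (sub N (X1, s, X3, X4)) (X1, R, X3, X4) = sub N (X1, X2, X3, X4)"
    by (simp add: sub_sub[OF as aR] sub_X[OF aR])
  then have "N = sub (X2 * B') (X1, R, X3, X4)" using sub_XX[of N] by (simp add: XX_def B'(1))
  then have "N = sub B' (X1, R, X3, X4) * R" by (simp add: sub_mult[OF aR] sub_X[OF aR] mult.commute)
  moreover have "Conv (sub B' (X1, R, X3, X4))" by (intro Conv_sub CB' aR) (auto simp: Conv_X R)
  ultimately show ?thesis by blast
qed

lemma bar_zser: "zser F \<Longrightarrow> wser (bar F)" and bar_wser: "wser F \<Longrightarrow> zser (bar F)"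
proof -
  have b: "pd u (bar F) = bar (pd (sw u) F)" for u F
    by (rule co_eqI, cases u) (auto simp: co_pd co_bar sw_add split: prod.splits)
  show "zser F \<Longrightarrow> wser (bar F)" "wser F \<Longrightarrow> zser (bar F)" by (auto simp: zser_def wser_def b)
qed

text \<open>
  If the Levi determinant vanishes identically then the functions \<open>w(x, t, z)\<close> of \<open>(x, t)\<close> have the same
  level sets for all \<open>z\<close>, so \<open>g = w(x, t, 0)\<close> is, on the complexified hypersurface, a function \<open>f\<close> of
  \<open>(z, w)\<close> alone. Thus \<open>f(z, w) - g(x, t)\<close> vanishes there, and so does its conjugate; a combination of the
  two has the form \<open>\<Phi> - bar \<Phi>\<close>, and its coefficients can be chosen so that the linear term of \<open>\<Phi>\<close> does not
  cancel.
\<close>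

lemma degenerate_first_integral:
  assumes R: "co R 0 = 0" "co R E2 \<noteq> 0" "Conv R" "bar R = R"
    and w: "ord_ge 1 w" "sub R (X3, w, X1, X2) = 0" "pd E4 w = 0"
    and flat: "pd E2 w * pd E3 (pd E1 w) = pd E1 w * pd E3 (pd E2 w)"
  shows "\<exists>\<Phi> B. Conv \<Phi> \<and> zser \<Phi> \<and> ord_ge 1 \<Phi> \<and> co \<Phi> E2 \<noteq> 0 \<and> Conv B \<and> co B 0 \<noteq> 0 \<and> \<Phi> - bar \<Phi> = B * R"
proof -
  have R4: "co R E4 \<noteq> 0"
  proof -
    have "co (bar R) E4 = cnj (co R E2)" by (simp add: co_bar)
    then show ?thesis using R by simp
  qed
  have linR: "lin R (0, 1, 0, 0) \<noteq> 0" "lin R (0, 0, 0, 1) \<noteq> 0" using R R4 by simp_all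
  have aw: "adm (X3, w, X1, X2)" using w ord_ge_X by auto
  have co_pd0: "co (pd E2 F) 0 = co F E2" "co (pd E4 F) 0 = co F E4" for F
    by (simp_all add: co_pd) (simp_all add: E_defs)
  have a3: "adm (X3, 0, X1, X2)" and a30: "adm (X1, X2, X3, 0)" using ord_ge_X by auto
  have Cw: "Conv w"
    by (rule implicit_Conv[OF R(1) linR(1) a3 _ w(1) _ R(3)]) (auto simp: Conv_X Conv_0 w)
  have w2: "co (pd E2 w) 0 \<noteq> 0"
  proof -
    have "pd E2 (sub R (X3, w, X1, X2)) = 0" using w(2) derivation_0[OF derivation_pd] by simp
    then have "sub (pd E2 R) (X3, w, X1, X2) * pd E2 w + sub (pd E4 R) (X3, w, X1, X2) = 0"
      by (simp add: chain_rule[OF aw])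
    then have "co (sub (pd E2 R) (X3, w, X1, X2) * pd E2 w + sub (pd E4 R) (X3, w, X1, X2)) 0 = 0" by simp
    then have "co R E2 * co (pd E2 w) 0 + co R E4 = 0" by (simp add: co_0_mult co_sub_0[OF aw] co_pd0)
    then show ?thesis using R4 by auto
  qed
  define g where "g = sub w (X1, X2, 0, 0)"
  have g1: "ord_ge 1 g" unfolding g_def by (intro ord_ge_sub adm_kill w)
  have Cg: "Conv g" unfolding g_def by (intro Conv_sub Cw adm_kill) (auto simp: Conv_X Conv_0)
  have gd: "pd E1 g = sub (pd E1 w) (X1, X2, 0, 0)" "pd E2 g = sub (pd E2 w) (X1, X2, 0, 0)" and gz: "zser g"
    using derivation_0[OF derivation_pd] by (simp_all add: g_def zser_def chain_rule[OF adm_kill(1)])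
  have gzd: "zser (pd E1 g)" "zser (pd E2 g)"
    using gz derivation_0[OF derivation_pd]
    by (simp_all add: zser_def pd_commute[of E3 E1] pd_commute[of E3 E2] pd_commute[of E4 E1] pd_commute[of E4 E2])
  have zk: "sub F (X1, X2, K, L) = F" if "zser F" "ord_ge 1 K" "ord_ge 1 L" for F K L
  proof -
    have "adm (X1, X2, K, L)" "adm (X1, X2, X3, X4)" using that ord_ge_X by auto
    from sub_zser[OF that(1) this] show ?thesis using sub_XX[of F] by (simp add: XX_def)
  qed
  \<comment> \<open>The Jacobian of \<open>w\<close> and \<open>g\<close> in \<open>(x, t)\<close> solves a linear homogeneous differential equation in \<open>z\<close>
    with initial value zero.\<close>
  define E where "E = pd E1 w * pd E2 g - pd E2 w * pd E1 g"
  have E4: "pd E4 E = 0"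
    using w(3) gzd derivation_0[OF derivation_pd]
    by (simp add: E_def derivation_diff[OF derivation_pd] pd_mult zser_def pd_commute[of E4 E1] pd_commute[of E4 E2])
  have E3: "pd E2 w * pd E3 E = pd E3 (pd E2 w) * E"
  proof -
    have pe: "pd E3 E = pd E3 (pd E1 w) * pd E2 g - pd E3 (pd E2 w) * pd E1 g"
      using gzd by (simp add: E_def derivation_diff[OF derivation_pd] pd_mult zser_def)
    have "pd E2 w * pd E3 E = (pd E2 w * pd E3 (pd E1 w)) * pd E2 g - pd E2 w * pd E3 (pd E2 w) * pd E1 g"
      unfolding pe by (simp add: algebra_simps)
    then show ?thesis unfolding flat E_def by (simp add: algebra_simps)
  qed
  have E0: "sub E (X1, X2, 0, 0) = 0"
    by (simp add: E_def sub_diff[OF adm_kill(1)] sub_mult[OF adm_kill(1)] gd(1,2)[symmetric] zk[OF gzd(1)] zk[OF gzd(2)] mult.commute)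
  have "ord_ge n E" for n
  proof (induction n)
    case (Suc n)
    have "ord_ge n (pd E2 w * pd E3 E)" unfolding E3 by (rule ord_ge_mult1(1)[OF Suc])
    then have d3: "ord_ge n (pd E3 E)" by (rule ord_ge_unit[OF w2])
    show ?case unfolding ord_ge_def
    proof (intro allI impI)
      fix e :: mi assume e: "deg e < Suc n"
      obtain a b c d where eq: "e = (a, b, c, d)" by (cases e)
      consider "d > 0" | "d = 0" "c = 0" | c' where "c = Suc c'" by (cases c; cases d) auto
      then show "co E e = 0"
      proof cases
        case 1
        then show ?thesis using pd_zero_co[OF E4, of e] by (simp add: eq ip_E)
      next
        case 2
        then show ?thesis using co_kill34[of E a b 0 0] E0 by (simp add: eq)
      next
        case 3
        have "co (pd E3 E) (a, b, c', d) = 0" using d3 e unfolding ord_ge_def by (simp add: eq 3)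
        moreover have "(a, b, c', d) + E3 = e" by (simp add: eq 3 E3_def)
        ultimately show ?thesis unfolding co_pd using 3 by (simp add: eq ip_E del: of_nat_Suc)
      qed
    qed
  qed simp
  then have E: "pd E1 w * pd E2 g = pd E2 w * pd E1 g" using ord_ge_zeroI[of E] by (simp add: E_def)
  \<comment> \<open>The inverse of the parametrisation: \<open>t\<close> in terms of \<open>(z, w, x)\<close>.\<close>
  obtain th where th: "ord_ge 1 th" "sub R (shift (X1, X2, X3, 0) (0, 0, 0, 1) th) = 0"
    using implicit_exists[OF R(1) linR(2) a30, of 0] by auto
  then have Rth: "sub R (X1, X2, X3, th) = 0" by simp
  have Cth: "Conv th"
    by (rule implicit_Conv[OF R(1) linR(2) a30 _ th R(3)]) (auto simp: Conv_X Conv_0)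
  have ath: "adm (X1, X2, X3, th)" using th ord_ge_X by auto
  have th4: "pd E4 th = 0"
  proof -
    have "pd E4 (sub R (X1, X2, X3, th)) = 0" using Rth derivation_0[OF derivation_pd] by simp
    then have "sub (pd E4 R) (X1, X2, X3, th) * pd E4 th = 0" by (simp add: chain_rule[OF ath])
    moreover have "co (sub (pd E4 R) (X1, X2, X3, th)) 0 \<noteq> 0" using R4 by (simp add: co_sub_0[OF ath] co_pd0)
    ultimately show ?thesis by auto
  qed
  have aP: "adm (X3, th, X1, 0)" and aP0: "adm (X3, th, 0, 0)" using th ord_ge_X by auto
  have wP: "sub w (X3, th, X1, 0) = X2"
  proof (rule implicit_unique[OF R(1) linR(1)])
    show a: "adm (X1, 0, X3, th)" using th ord_ge_X by auto
    show "ord_ge 1 (sub w (X3, th, X1, 0))" by (intro ord_ge_sub aP w)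
    have "sub R (X1, sub w (X3, th, X1, 0), X3, th) = sub (sub R (X3, w, X1, X2)) (X3, th, X1, 0)"
      by (simp add: sub_sub[OF aw aP] sub_X[OF aP])
    also have "\<dots> = 0" by (simp add: w sub_0[OF aP])
    finally show "sub R (shift (X1, 0, X3, th) (0, 1, 0, 0) (sub w (X3, th, X1, 0)))
        = sub R (shift (X1, 0, X3, th) (0, 1, 0, 0) X2)" using Rth by simp
  qed (rule ord_ge_X)
  define f where "f = sub g (X3, th, 0, 0)"
  have f1: "ord_ge 1 f" unfolding f_def by (intro ord_ge_sub aP0 g1)
  have Cf: "Conv f" unfolding f_def by (intro Conv_sub Cg aP0) (auto simp: Conv_X Conv_0 Cth)
  have gP: "sub F (X3, th, 0, 0) = sub F (X3, th, X1, 0)" if "zser F" for F by (rule sub_zser[OF that aP0 aP])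
  have fz: "zser f"
    unfolding zser_def
  proof
    have d: "sub (pd E1 w) (X3, th, X1, 0) + sub (pd E2 w) (X3, th, X1, 0) * pd E3 th = 0"
      using arg_cong[OF wP, of "pd E3"] derivation_0[OF derivation_pd] by (simp add: chain_rule[OF aP])
    have "pd E3 f = sub (pd E1 g) (X3, th, X1, 0) + sub (pd E2 g) (X3, th, X1, 0) * pd E3 th"
      using derivation_0[OF derivation_pd] by (simp add: f_def chain_rule[OF aP0] gP gzd)
    then have "sub (pd E2 w) (X3, th, X1, 0) * pd E3 f
        = sub (pd E2 w * pd E1 g) (X3, th, X1, 0) + sub (pd E2 g) (X3, th, X1, 0) * (sub (pd E2 w) (X3, th, X1, 0) * pd E3 th)"
      by (simp add: sub_mult[OF aP] algebra_simps)
    also have "sub (pd E2 w) (X3, th, X1, 0) * pd E3 th = - sub (pd E1 w) (X3, th, X1, 0)"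
      using d by (simp add: eq_neg_iff_add_eq_0 add.commute)
    also have "sub (pd E2 w * pd E1 g) (X3, th, X1, 0) + sub (pd E2 g) (X3, th, X1, 0) * - sub (pd E1 w) (X3, th, X1, 0) = 0"
      unfolding E[symmetric] by (simp add: sub_mult[OF aP])
    finally have "sub (pd E2 w) (X3, th, X1, 0) * pd E3 f = 0" .
    moreover have "co (sub (pd E2 w) (X3, th, X1, 0)) 0 \<noteq> 0" using w2 by (simp add: co_sub_0[OF aP])
    ultimately show "pd E3 f = 0" by auto
    show "pd E4 f = 0" using derivation_0[OF derivation_pd] by (simp add: f_def chain_rule[OF aP0] th4)
  qed
  have thG: "sub th (X3, w, X1, X2) = X2"
  proof (rule implicit_unique[OF R(1) linR(2)])
    show "adm (X3, w, X1, 0)" using w ord_ge_X by auto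
    show "ord_ge 1 (sub th (X3, w, X1, X2))" by (intro ord_ge_sub aw th)
    have "sub R (X3, w, X1, sub th (X3, w, X1, X2)) = sub (sub R (X1, X2, X3, th)) (X3, w, X1, X2)"
      by (simp add: sub_sub[OF ath aw] sub_X[OF aw])
    also have "\<dots> = 0" by (simp add: Rth sub_0[OF aw])
    finally show "sub R (shift (X3, w, X1, 0) (0, 0, 0, 1) (sub th (X3, w, X1, X2)))
        = sub R (shift (X3, w, X1, 0) (0, 0, 0, 1) X2)" using w by simp
  qed (rule ord_ge_X)
  have fG: "sub f (X3, w, X1, X2) = g"
    by (simp add: f_def sub_sub[OF aP0 aw] sub_X[OF aw] sub_0[OF aw] thG zk[OF gz])
  have a34: "adm (X3, X4, 0, 0)" using ord_ge_X by auto
  define gW where "gW = sub g (X3, X4, 0, 0)"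
  have gW1: "ord_ge 1 gW" unfolding gW_def by (intro ord_ge_sub a34 g1)
  have CgW: "Conv gW" unfolding gW_def by (intro Conv_sub Cg a34) (auto simp: Conv_X Conv_0)
  have gWw: "wser gW" using derivation_0[OF derivation_pd] by (simp add: wser_def gW_def chain_rule[OF a34])
  have gWG: "sub gW (X3, w, X1, X2) = g"
    by (simp add: gW_def sub_sub[OF a34 aw] sub_X[OF aw] sub_0[OF aw] zk[OF gz])
  have "sub (f - gW) (X3, w, X1, X2) = 0" by (simp add: sub_diff[OF aw] fG gWG)
  then obtain B1 where B1: "Conv B1" "f - gW = B1 * R"
    using divisible_by_equation[OF R(1,2,3) Conv_diff[OF Cf CgW] w(1,2)] by blast
  have f2: "co f E2 = 1"
  proof -
    have "pd E2 (sub f (X3, w, X1, X2)) = pd E2 g" by (simp add: fG)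
    then have "sub (pd E2 f) (X3, w, X1, X2) * pd E2 w = pd E2 g"
      using fz by (simp add: chain_rule[OF aw] zser_def sub_0[OF aw])
    then have "co (sub (pd E2 f) (X3, w, X1, X2) * pd E2 w) 0 = co (pd E2 g) 0" by simp
    then have "co f E2 * co (pd E2 w) 0 = co (pd E2 w) 0"
      by (simp add: co_0_mult co_sub_0[OF aw] gd(2) co_sub_0[OF adm_kill(1)] co_pd0(1)[of f])
    then show ?thesis using w2 by simp
  qed
  have "\<exists>\<alpha>. \<alpha> * co f E2 + cnj \<alpha> * co (bar gW) E2 \<noteq> 0"
  proof (rule ccontr)
    assume "\<not> ?thesis"
    then have "1 + co (bar gW) E2 = 0" "\<i> - \<i> * co (bar gW) E2 = 0"
      using f2 by (auto dest: spec[of _ 1] spec[of _ \<i>])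
    then show False by (simp add: complex_eq_iff)
  qed
  then obtain \<alpha> where \<alpha>: "\<alpha> * co f E2 + cnj \<alpha> * co (bar gW) E2 \<noteq> 0" by blast
  define \<Phi> where "\<Phi> = const4 \<alpha> * f + const4 (cnj \<alpha>) * bar gW"
  define B where "B = const4 \<alpha> * B1 - const4 (cnj \<alpha>) * bar B1"
  have "\<Phi> - bar \<Phi> = const4 \<alpha> * (f - gW) - const4 (cnj \<alpha>) * bar (f - gW)"
    by (simp add: \<Phi>_def bar_add bar_mult bar_diff algebra_simps)
  also have "\<dots> = B * R" unfolding B1(2) bar_mult R(4) by (simp add: B_def algebra_simps)
  finally have eq: "\<Phi> - bar \<Phi> = B * R" .
  have z: "zser \<Phi>" using fz bar_wser[OF gWw]
    by (simp add: \<Phi>_def zser_def pd_add pd_const4_mult)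
  have \<Phi>2: "co \<Phi> E2 \<noteq> 0" using \<alpha> by (simp add: \<Phi>_def)
  have "co (bar \<Phi>) E2 = 0" using co_wser[OF bar_zser[OF z], of 0 1 0 0] by (simp add: E2_def)
  then have "co (B * R) E2 \<noteq> 0" using \<Phi>2 by (simp flip: eq)
  moreover have "ord_ge 1 R" using R(1) ord_ge_1 by blast
  then have "co (B * R) E2 = co B 0 * co R E2" by (rule co_mult_lowest) simp
  ultimately have "co B 0 \<noteq> 0" by auto
  moreover have "Conv B" unfolding B_def by (intro Conv_diff Conv_mult Conv_const4 B1 Conv_bar)
  moreover have "Conv \<Phi>" unfolding \<Phi>_def by (intro Conv_add Conv_mult Conv_const4 Cf Conv_bar CgW)
  moreover have "ord_ge 1 \<Phi>" unfolding \<Phi>_def using f1 gW1 by (intro ord_ge_add ord_ge_mult1(1)) simp_all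
  ultimately show ?thesis using z \<Phi>2 eq by blast
qed

section \<open>Holomorphic coordinates from convergent series\<close>

text \<open>
  The infix \<open>$\<close> is shared by vectors and power series; terms with many occurrences become ambiguous.
\<close>

abbreviation cx :: "complex^2 \<Rightarrow> complex" where "cx v \<equiv> v$1"
abbreviation cy :: "complex^2 \<Rightarrow> complex" where "cy v \<equiv> v$2"

text \<open>
  A series in the first pair of variables is evaluated with zeros in the second pair; this makes
  \<open>fn F\<close> a function of two complex variables.
\<close>

definition zp :: "complex^2 \<Rightarrow> vec4" where "zp Y = (cx Y, cy Y, 0, 0)"

definition fn :: "fps4 \<Rightarrow> complex^2 \<Rightarrow> complex" where "fn F Y = ev F (zp Y)"

lemma ev_zser: assumes "zser F" shows "ev F (x1, x2, x3, x4) = ev F (x1, x2, y3, y4)"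
proof -
  have "co F e * xpow (x1, x2, x3, x4) e = co F e * xpow (x1, x2, y3, y4) e" for e
  proof -
    obtain a b c d where e: "e = (a, b, c, d)" by (cases e)
    show ?thesis using co_zser[OF assms, of c d a b] by (cases "c > 0 \<or> d > 0") (auto simp: e xpow.simps)
  qed
  then have "line F (x1, x2, x3, x4) = line F (x1, x2, y3, y4)" by (intro ext) (simp only: line_def)
  then show ?thesis by (simp add: ev_def)
qed

lemma Conv_common_finite:
  assumes "finite S" "\<And>F. F \<in> S \<Longrightarrow> Conv F" shows "\<exists>r>0. \<exists>B\<ge>0. \<forall>F\<in>S. nb F r B"
  using assms
proof (induction S rule: finite_induct)
  case empty then show ?case by (intro exI[of _ 1]) auto
next
  case (insert F S)
  then obtain r B where r: "r > 0" "B \<ge> 0" "\<forall>G\<in>S. nb G r B" by auto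
  have "Conv F" using insert by simp
  then obtain s C where s: "s > 0" "nb F s C" by (auto simp: Conv_def)
  have "nb F (min r s) (max B C)"
    by (rule nb_mono_bound[OF nb_mono_radius[OF s(2)]]) (use s r in simp_all)
  moreover have "nb G (min r s) (max B C)" if "G \<in> S" for G
    by (rule nb_mono_bound[OF nb_mono_radius[OF r(3)[rule_format, OF that]]]) (use s r in simp_all)
  ultimately show ?case using r s by (intro exI[of _ "min r s"] conjI exI[of _ "max B C"]) auto
qed

text \<open>Hadamard's lemma.\<close>

lemma split34:
  assumes "Conv D" "\<And>a b. co D (a, b, 0, 0) = 0"
  shows "\<exists>A C. Conv A \<and> Conv C \<and> D = X3 * A + X4 * C"
proof -
  define A where "A = coshift E3 D"
  define C where "C = mk (\<lambda>(a, b, c, d). if c = 0 then co D (a, b, 0, Suc d) else 0)"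
  have cC: "co C (a, b, c, d) = (if c = 0 then co D (a, b, 0, Suc d) else 0)" for a b c d by (simp add: C_def)
  have "Conv C"
  proof (rule Conv_smaller[OF Conv_coshift[OF assms(1), of E4]])
    fix e :: mi show "cmod (co C e) \<le> cmod (co (coshift E4 D) e)"
      by (cases e) (auto simp: cC co_coshift E4_def)
  qed simp
  moreover have "D = X3 * A + X4 * C"
  proof (rule co_eqI)
    fix e :: mi
    obtain a b c d where e: "e = (a, b, c, d)" by (cases e)
    show "co D e = co (X3 * A + X4 * C) e"
    proof (cases c)
      case (Suc c')
      have eq: "e = E3 + (a, b, c', d)" by (simp add: e Suc E3_def)
      have 1: "co (X3 * A) e = co D e"
        unfolding eq X3_def co_monom4_mult A_def co_coshift by (simp add: add.commute)
      have 2: "co (X4 * C) e = 0"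
      proof (cases d)
        case 0 then show ?thesis unfolding X4_def by (intro co_monom4_mult_0) (auto simp: e E4_def)
      next
        case (Suc d')
        have eq: "e = E4 + (a, b, c, d')" by (simp add: e Suc E4_def)
        show ?thesis unfolding eq X4_def co_monom4_mult by (simp add: cC \<open>c = Suc c'\<close>)
      qed
      show ?thesis by (simp add: 1 2)
    next
      case 0
      have 1: "co (X3 * A) e = 0" unfolding X3_def by (rule co_monom4_mult_0) (auto simp: e 0 E3_def)
      show ?thesis
      proof (cases d)
        case d0: 0
        have "co (X4 * C) e = 0" unfolding X4_def by (rule co_monom4_mult_0) (auto simp: e d0 E4_def)
        then show ?thesis by (simp add: 1) (simp add: e 0 d0 assms(2))
      next
        case (Suc d')
        have eq: "e = E4 + (a, b, 0, d')" by (simp add: e Suc 0 E4_def)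
        have "co (X4 * C) e = co D e" unfolding eq X4_def co_monom4_mult by (simp add: cC E4_def)
        then show ?thesis by (simp add: 1)
      qed
    qed
  qed
  moreover have "Conv A" unfolding A_def by (rule Conv_coshift[OF assms(1)]) simp
  ultimately show ?thesis by blast
qed

text \<open>A quadratic bound for the error of linear approximation.\<close>

lemma quadratic_error_has_derivative:
  fixes f :: "'a::real_normed_vector \<Rightarrow> 'b::real_normed_vector"
  assumes L: "bounded_linear L" and \<delta>: "\<delta> > 0"
    and e: "\<And>h. norm h < \<delta> \<Longrightarrow> norm (f (x + h) - f x - L h) \<le> K * (norm h)\<^sup>2"
  shows "(f has_derivative L) (at x)"
  unfolding has_derivative_at
proof (intro conjI L, rule Lim_null_comparison)
  show "\<forall>\<^sub>F h in at 0. norm (norm (f (x + h) - f x - L h) / norm h) \<le> K * norm h"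
    unfolding eventually_at
  proof (intro exI[of _ \<delta>] conjI \<delta> ballI impI)
    fix h :: 'a assume h: "h \<noteq> 0 \<and> dist h 0 < \<delta>"
    then have "norm (f (x + h) - f x - L h) \<le> K * (norm h)\<^sup>2" by (intro e) (simp add: dist_norm)
    then show "norm (norm (f (x + h) - f x - L h) / norm h) \<le> K * norm h"
      using h by (simp add: divide_le_eq power2_eq_square mult.assoc)
  qed
  have "((\<lambda>h::'a. K * norm h) \<longlongrightarrow> K * norm (0::'a)) (at 0)" by (intro tendsto_intros)
  then show "((\<lambda>h::'a. K * norm h) \<longlongrightarrow> 0) (at 0)" by simp
qed

text \<open>
  Expand \<open>F(Y + v) - F(Y)\<close>, as a series in \<open>(Y, v)\<close>, by Hadamard's lemma, twice: the coefficients of the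
  first step are the partial derivatives, those of the second bound the error by \<open>norm v\<close> squared.
\<close>

lemma fn_holomorphic:
  assumes C: "Conv F" and z: "zser F"
  shows "\<exists>r>0. \<forall>Y. norm Y < r \<longrightarrow> (\<exists>a b. (fn F has_derivative (\<lambda>v. a * cx v + b * cy v)) (at Y))"
proof -
  let ?G = "(X1 + X3, X2 + X4, 0, 0)" and ?k = "(X1, X2, 0, 0)"
  have aG: "adm ?G" using ord_ge_X by (auto intro: ord_ge_add)
  have CG: "ConvT ?G" by (simp add: Conv_X Conv_add Conv_0)
  have Ck: "ConvT ?k" by (simp add: Conv_X Conv_0)
  define D where "D = sub F ?G - F"
  have CD: "Conv D" unfolding D_def by (intro Conv_diff Conv_sub C CG aG)
  have Fk: "sub F ?k = F"
    using sub_zser[OF z adm_kill(1), of X3 X4] ord_ge_X sub_XX[of F] by (simp add: XX_def)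
  have "sub D ?k = 0"
    by (simp add: D_def sub_diff[OF adm_kill(1)] sub_sub[OF aG adm_kill(1)] sub_add[OF adm_kill(1)]
        sub_X[OF adm_kill(1)] sub_0[OF adm_kill(1)] Fk)
  then have "co D (a, b, 0, 0) = 0" for a b using co_kill34[of D a b 0 0] by simp
  then obtain A A' where A: "Conv A" "Conv A'" "D = X3 * A + X4 * A'" using split34[OF CD] by blast
  have dk: "co (H - sub H ?k) (a, b, 0, 0) = 0" for H a b by (simp add: co_kill34)
  have Cdk: "Conv (H - sub H ?k)" if "Conv H" for H by (intro Conv_diff Conv_sub that Ck adm_kill)
  obtain A1 A2 where A12: "Conv A1" "Conv A2" "A - sub A ?k = X3 * A1 + X4 * A2" using split34[OF Cdk[OF A(1)] dk] by blast
  obtain A3 A4 where A34: "Conv A3" "Conv A4" "A' - sub A' ?k = X3 * A3 + X4 * A4" using split34[OF Cdk[OF A(2)] dk] by blast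
  obtain s B where s: "s > 0" "B \<ge> 0" "\<forall>H\<in>{F, A, A', A1, A2, A3, A4}. nb H s B"
    using Conv_common_finite[of "{F, A, A', A1, A2, A3, A4}"] C A A12 A34 by auto
  then have n: "nb F s B" "nb A s B" "nb A' s B" "nb A1 s B" "nb A2 s B" "nb A3 s B" "nb A4 s B" by simp_all
  define r where "r = s / 2"
  have r: "0 < r" "0 \<le> r" "r \<le> s" using s by (auto simp: r_def)
  note nr = n[THEN nb_mono_radius, OF r(2,3)]
  have nG: "nb_t ?G r s"
    using nb_add[OF r(2) nb_X(1)[OF r(2)] nb_X(3)[OF r(2)]] nb_add[OF r(2) nb_X(2)[OF r(2)] nb_X(4)[OF r(2)]]
      nb_mono_bound[OF nb_const4[OF r(2), of 0], of s] s(1) by (simp add: r_def)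
  have nk: "nb_t ?k r s"
    using nb_mono_bound[OF nb_X(1)[OF r(2)] r(3)] nb_mono_bound[OF nb_X(2)[OF r(2)] r(3)]
      nb_mono_bound[OF nb_const4[OF r(2), of 0], of s] s(1) by simp
  have exp: "fn F (Y + v) - fn F Y - (ev A (zp Y) * cx v + ev A' (zp Y) * cy v)
      = cx v * (cx v * ev A1 x + cy v * ev A2 x) + cy v * (cx v * ev A3 x + cy v * ev A4 x)
      \<and> cmod (ev A1 x) \<le> B \<and> cmod (ev A2 x) \<le> B \<and> cmod (ev A3 x) \<le> B \<and> cmod (ev A4 x) \<le> B"
    if x: "x = (cx Y, cy Y, cx v, cy v)" and Y: "norm Y \<le> r" and v: "norm v \<le> r" for x Y and v :: "complex^2"
  proof -
    have vx: "vle x r" using vle_rp[OF Y] vle_rp[OF v] by (simp add: x rp_def)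
    have X: "ev X3 x = cx v" "ev X4 x = cy v" by (simp_all add: x)
    have m: "ev (X3 * H + X4 * H') x = cx v * ev H x + cy v * ev H' x" if H: "nb H r B" "nb H' r B" for H H'
      using ev_add[OF nb_mult[OF r(2) nb_X(3)[OF r(2)] H(1)] nb_mult[OF r(2) nb_X(4)[OF r(2)] H(2)] vx]
        ev_mult[OF nb_X(3)[OF r(2)] H(1) vx] ev_mult[OF nb_X(4)[OF r(2)] H(2) vx] by (simp add: X)
    have kz: "ev (sub H ?k) x = ev H (zp Y)" and nkH: "nb (sub H ?k) r B" if "nb H s B" for H
      using ev_sub[OF r(2) adm_kill(1) nk _ that vx] nb_sub[OF r(2) adm_kill(1) nk that] s(1) by (simp_all add: x zp_def)
    have "ev D x = ev (sub F ?G) x - ev F x"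
      unfolding D_def by (rule ev_diff[OF nb_sub[OF r(2) aG nG n(1)] nr(1) vx])
    moreover have "ev (sub F ?G) x = fn F (Y + v)"
    proof -
      have "ev_t ?G x = zp (Y + v)"
        using ev_add[OF nb_X(1)[OF r(2)] nb_X(3)[OF r(2)] vx] ev_add[OF nb_X(2)[OF r(2)] nb_X(4)[OF r(2)] vx]
        by (simp add: x zp_def)
      then show ?thesis using ev_sub[OF r(2) aG nG _ n(1) vx] s(1) by (simp add: fn_def)
    qed
    moreover have "ev F x = fn F Y" using ev_zser[OF z] by (simp add: x fn_def zp_def)
    moreover have "ev D x = cx v * ev A x + cy v * ev A' x" unfolding A(3) by (rule m[OF nr(2,3)])
    moreover have "ev A x - ev A (zp Y) = cx v * ev A1 x + cy v * ev A2 x"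
      using ev_diff[OF nr(2) nkH[OF n(2)] vx] kz[OF n(2)] m[OF nr(4,5)] by (simp add: A12(3))
    moreover have "ev A' x - ev A' (zp Y) = cx v * ev A3 x + cy v * ev A4 x"
      using ev_diff[OF nr(3) nkH[OF n(3)] vx] kz[OF n(3)] m[OF nr(6,7)] by (simp add: A34(3))
    ultimately have "fn F (Y + v) - fn F Y - (ev A (zp Y) * cx v + ev A' (zp Y) * cy v)
      = cx v * (cx v * ev A1 x + cy v * ev A2 x) + cy v * (cx v * ev A3 x + cy v * ev A4 x)"
      by (simp add: algebra_simps)
    then show ?thesis using ev_bound[OF nr(4) vx] ev_bound[OF nr(5) vx] ev_bound[OF nr(6) vx] ev_bound[OF nr(7) vx] by simp
  qed
  show ?thesis
  proof (intro exI[of _ r] conjI r(1) allI impI)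
    fix Y :: "complex^2" assume Y: "norm Y < r"
    let ?L = "\<lambda>v::complex^2. ev A (zp Y) * cx v + ev A' (zp Y) * cy v"
    have "(fn F has_derivative ?L) (at Y)"
    proof (rule quadratic_error_has_derivative[OF _ r(1)])
      show "bounded_linear ?L"
        by (intro bounded_linear_add bounded_linear_mult_right[THEN bounded_linear_compose] bounded_linear_vec_nth)
      fix v :: "complex^2" assume v: "norm v < r"
      define x where "x = (cx Y, cy Y, cx v, cy v)"
      define q where "q = norm v"
      have vi: "cmod (cx v) \<le> q" "cmod (cy v) \<le> q" by (simp_all add: q_def Finite_Cartesian_Product.norm_nth_le)
      have q: "0 \<le> q" by (simp add: q_def)
      note E = exp[OF x_def, of ] 
      have e: "fn F (Y + v) - fn F Y - ?L v
        = cx v * (cx v * ev A1 x + cy v * ev A2 x) + cy v * (cx v * ev A3 x + cy v * ev A4 x)"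
        and b: "cmod (ev A1 x) \<le> B" "cmod (ev A2 x) \<le> B" "cmod (ev A3 x) \<le> B" "cmod (ev A4 x) \<le> B"
        using E Y v by simp_all
      have in1: "cmod (a * (a * y + b * z)) \<le> q * (q * B + q * B)" if "cmod a \<le> q" "cmod b \<le> q" "cmod y \<le> B" "cmod z \<le> B" for a b y z
        unfolding norm_mult using that q s(2)
        by (intro mult_mono order.trans[OF norm_triangle_ineq] add_mono) (auto simp: norm_mult intro!: mult_mono)
      have in2: "cmod (b * (a * y + b * z)) \<le> q * (q * B + q * B)" if "cmod a \<le> q" "cmod b \<le> q" "cmod y \<le> B" "cmod z \<le> B" for a b y z
        unfolding norm_mult using that q s(2)
        by (intro mult_mono order.trans[OF norm_triangle_ineq] add_mono) (auto simp: norm_mult intro!: mult_mono)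
      have "cmod (fn F (Y + v) - fn F Y - ?L v) \<le> q * (q * B + q * B) + q * (q * B + q * B)"
        unfolding e using in1[OF vi b(1,2)] in2[OF vi b(3,4)] by (meson add_mono norm_triangle_ineq order_trans)
      then show "cmod (fn F (Y + v) - fn F Y - ?L v) \<le> 4 * B * (norm v)\<^sup>2"
        by (simp add: q_def power2_eq_square algebra_simps)
    qed
    then show "\<exists>a b. (fn F has_derivative (\<lambda>v. a * cx v + b * cy v)) (at Y)" by blast
  qed
qed

definition fn2 :: "fps4 \<Rightarrow> fps4 \<Rightarrow> complex^2 \<Rightarrow> complex^2" where
  "fn2 F1 F2 Y = (\<chi> j. if j = 1 then fn F1 Y else fn F2 Y)"

lemma fn2_nth [simp]: "cx (fn2 F1 F2 Y) = fn F1 Y" "cy (fn2 F1 F2 Y) = fn F2 Y"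
  by (simp_all add: fn2_def)

lemma vec2_eqI: fixes v w :: "complex^2" shows "cx v = cx w \<Longrightarrow> cy v = cy w \<Longrightarrow> v = w"
  by (simp add: vec_eq_iff forall_2)

lemma fn2_has_derivative:
  assumes "(fn F1 has_derivative (\<lambda>v. a1 * cx v + b1 * cy v)) (at Y)" "(fn F2 has_derivative (\<lambda>v. a2 * cx v + b2 * cy v)) (at Y)"
  shows "\<exists>A::complex^2^2. (fn2 F1 F2 has_derivative (\<lambda>v. A *v v)) (at Y)"
proof -
  define P where "P = (\<lambda>q::complex \<times> complex. (\<chi> j. if j = 1 then fst q else snd q) :: complex^2)"
  have "linear P" by (rule linearI) (simp_all add: P_def vec_eq_iff)
  then have P: "bounded_linear P" by (simp add: linear_conv_bounded_linear)
  define A :: "complex^2^2" where "A = (\<chi> j k. if j = 1 then (if k = 1 then a1 else b1) else (if k = 1 then a2 else b2))"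
  have "((\<lambda>Y. P (fn F1 Y, fn F2 Y)) has_derivative (\<lambda>v. P (a1 * cx v + b1 * cy v, a2 * cx v + b2 * cy v))) (at Y)"
    by (rule bounded_linear.has_derivative[OF P has_derivative_Pair[OF assms]])
  moreover have "(\<lambda>Y. P (fn F1 Y, fn F2 Y)) = fn2 F1 F2" by (simp add: P_def fn2_def fun_eq_iff)
  moreover have "(\<lambda>v. P (a1 * cx v + b1 * cy v, a2 * cx v + b2 * cy v)) = (\<lambda>v. A *v v)"
    by (rule ext, rule vec2_eqI) (simp_all add: P_def A_def matrix_vector_mult_def sum_2)
  ultimately show ?thesis by metis
qed

lemma fn2_holomorphic:
  assumes "Conv F1" "Conv F2" "zser F1" "zser F2"
  shows "\<exists>r>0. \<forall>Y. norm Y < r \<longrightarrow> (\<exists>A::complex^2^2. (fn2 F1 F2 has_derivative (\<lambda>v. A *v v)) (at Y))"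
proof -
  obtain r1 where r1: "r1 > 0" "\<And>Y. norm Y < r1 \<Longrightarrow> \<exists>a b. (fn F1 has_derivative (\<lambda>v. a * cx v + b * cy v)) (at Y)"
    using fn_holomorphic[OF assms(1,3)] by blast
  obtain r2 where r2: "r2 > 0" "\<And>Y. norm Y < r2 \<Longrightarrow> \<exists>a b. (fn F2 has_derivative (\<lambda>v. a * cx v + b * cy v)) (at Y)"
    using fn_holomorphic[OF assms(2,4)] by blast
  show ?thesis
  proof (intro exI[of _ "min r1 r2"] conjI allI impI)
    fix Y :: "complex^2" assume "norm Y < min r1 r2"
    then obtain a1 b1 a2 b2 where "(fn F1 has_derivative (\<lambda>v. a1 * cx v + b1 * cy v)) (at Y)"
      "(fn F2 has_derivative (\<lambda>v. a2 * cx v + b2 * cy v)) (at Y)" using r1(2)[of Y] r2(2)[of Y] by auto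
    then show "\<exists>A::complex^2^2. (fn2 F1 F2 has_derivative (\<lambda>v. A *v v)) (at Y)" by (rule fn2_has_derivative)
  qed (use r1 r2 in auto)
qed

lemma fn2_small:
  assumes "Conv F1" "Conv F2" "ord_ge 1 F1" "ord_ge 1 F2" "\<epsilon> > 0"
  shows "\<exists>\<delta>>0. \<forall>Y. norm Y < \<delta> \<longrightarrow> norm (fn2 F1 F2 Y) < \<epsilon>"
proof -
  have "ConvT (F1, F2, 0, 0)" "adm (F1, F2, 0, 0)" using assms by (simp_all add: Conv_0)
  then obtain \<delta> where d: "\<delta> > 0" "nb_t (F1, F2, 0, 0) \<delta> (\<epsilon> / 3)" using nb_t_small[of "(F1, F2, 0, 0)" "\<epsilon> / 3"] assms(5) by auto
  have "norm (fn2 F1 F2 Y) < \<epsilon>" if "norm Y < \<delta>" for Y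
  proof -
    have v: "vle (zp Y) \<delta>" using vle_rp[of Y \<delta>] that d(1) by (simp add: zp_def rp_def)
    have "cmod (fn F1 Y) \<le> \<epsilon> / 3" "cmod (fn F2 Y) \<le> \<epsilon> / 3"
      unfolding fn_def using ev_bound[OF _ v, of F1 "\<epsilon> / 3"] ev_bound[OF _ v, of F2 "\<epsilon> / 3"] d(2) by simp_all
    then show ?thesis using norm_vec2_le[of "fn2 F1 F2 Y"] assms(5) by simp
  qed
  then show ?thesis using d by blast
qed

lemma fn2_inverse:
  assumes C: "Conv F1" "Conv F2" "Conv S1" "Conv S2" and o: "ord_ge 1 F1" "ord_ge 1 F2"
    and inv: "sub S1 (F1, F2, 0, 0) = X1" "sub S2 (F1, F2, 0, 0) = X2"
  shows "\<exists>\<delta>>0. \<forall>Y. norm Y < \<delta> \<longrightarrow> fn2 S1 S2 (fn2 F1 F2 Y) = Y"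
proof -
  have CT: "ConvT (F1, F2, 0, 0)" and a: "adm (F1, F2, 0, 0)" using C o by (simp_all add: Conv_0)
  obtain \<epsilon> B where \<epsilon>: "\<epsilon> > 0" "nb S1 \<epsilon> B" "nb S2 \<epsilon> B" using Conv_common_finite[of "{S1, S2}"] C by auto
  obtain \<delta> where d: "\<delta> > 0" "nb_t (F1, F2, 0, 0) \<delta> \<epsilon>" using nb_t_small[OF CT a \<epsilon>(1)] by auto
  have "fn2 S1 S2 (fn2 F1 F2 Y) = Y" if "norm Y < \<delta>" for Y
  proof -
    have v: "vle (zp Y) \<delta>" using vle_rp[of Y \<delta>] that d(1) by (simp add: zp_def rp_def)
    have e: "ev_t (F1, F2, 0, 0) (zp Y) = zp (fn2 F1 F2 Y)" by (simp add: zp_def fn_def)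
    have "fn S1 (fn2 F1 F2 Y) = ev (sub S1 (F1, F2, 0, 0)) (zp Y)" "fn S2 (fn2 F1 F2 Y) = ev (sub S2 (F1, F2, 0, 0)) (zp Y)"
      using ev_sub[OF _ a d(2) _ \<epsilon>(2) v] ev_sub[OF _ a d(2) _ \<epsilon>(3) v] d(1) \<epsilon>(1) e by (simp_all add: fn_def)
    then show ?thesis by (intro vec2_eqI) (simp_all add: inv, simp_all add: zp_def)
  qed
  then show ?thesis using d by blast
qed

text \<open>
  Series that are formal inverses of each other define mutually inverse maps near the origin, because
  evaluation is compatible with substitution. The domain is cut down so that the image is a ball.
\<close>

lemma formal_biholomorphism:
  fixes p :: "complex^2"
  assumes C: "Conv F1" "Conv F2" "Conv S1" "Conv S2" and o: "ord_ge 1 F1" "ord_ge 1 F2" "ord_ge 1 S1" "ord_ge 1 S2"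
    and z: "zser F1" "zser F2" "zser S1" "zser S2"
    and inv: "sub S1 (F1, F2, 0, 0) = X1" "sub S2 (F1, F2, 0, 0) = X2" "sub F1 (S1, S2, 0, 0) = X1" "sub F2 (S1, S2, 0, 0) = X2"
    and r0: "r0 > 0"
  shows "\<exists>U. p \<in> U \<and> U \<subseteq> ball p r0 \<and> biholomorphic2_on (\<lambda>Z. fn2 F1 F2 (Z - p)) U"
proof -
  obtain h1 where h1: "h1 > 0" "\<And>Y. norm Y < h1 \<Longrightarrow> \<exists>A::complex^2^2. (fn2 F1 F2 has_derivative (\<lambda>v. A *v v)) (at Y)"
    using fn2_holomorphic[OF C(1,2) z(1,2)] by blast
  obtain h2 where h2: "h2 > 0" "\<And>Y. norm Y < h2 \<Longrightarrow> \<exists>A::complex^2^2. (fn2 S1 S2 has_derivative (\<lambda>v. A *v v)) (at Y)"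
    using fn2_holomorphic[OF C(3,4) z(3,4)] by blast
  obtain i1 where i1: "i1 > 0" "\<And>Y. norm Y < i1 \<Longrightarrow> fn2 S1 S2 (fn2 F1 F2 Y) = Y"
    using fn2_inverse[OF C o(1,2) inv(1,2)] by blast
  obtain i2 where i2: "i2 > 0" "\<And>Y. norm Y < i2 \<Longrightarrow> fn2 F1 F2 (fn2 S1 S2 Y) = Y"
    using fn2_inverse[OF C(3,4,1,2) o(3,4) inv(3,4)] by blast
  define d where "d = min (min r0 h1) i1"
  have d: "d > 0" using r0 h1 i1 by (simp add: d_def)
  obtain s where s: "s > 0" "\<And>Y. norm Y < s \<Longrightarrow> norm (fn2 S1 S2 Y) < d"
    using fn2_small[OF C(3,4) o(3,4) d] by blast
  define \<eta> where "\<eta> = min (min h2 i2) s"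
  have \<eta>: "\<eta> > 0" using h2 i2 s by (simp add: \<eta>_def)
  have zero: "fn2 F1 F2 0 = 0"
  proof -
    have "norm (fn2 F1 F2 0) < \<epsilon>" if "\<epsilon> > 0" for \<epsilon>
      using fn2_small[OF C(1,2) o(1,2) that] by auto
    then show ?thesis by (metis less_irrefl norm_le_zero_iff not_le)
  qed
  define U0 where "U0 = {Y \<in> ball 0 d. fn2 F1 F2 Y \<in> ball 0 \<eta>}"
  have cont: "continuous_on (ball 0 d) (fn2 F1 F2)"
  proof (rule continuous_at_imp_continuous_on, rule ballI)
    fix Y :: "complex^2" assume "Y \<in> ball 0 d"
    then have "norm Y < h1" by (simp add: d_def)
    then show "isCont (fn2 F1 F2) Y" using h1(2) has_derivative_continuous by blast
  qed
  have "U0 = ball 0 d \<inter> fn2 F1 F2 -` ball 0 \<eta>" unfolding U0_def by (rule set_eqI) simp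
  then have "open U0"
    using continuous_open_preimage[OF cont open_ball open_ball, of 0 \<eta>] by simp
  define U where "U = (\<lambda>Y. p + Y) ` U0"
  have memU: "Z \<in> U \<longleftrightarrow> Z - p \<in> U0" for Z by (auto simp: U_def image_iff intro!: bexI[of _ "Z - p"])
  have "open U" unfolding U_def by (rule open_translation[OF \<open>open U0\<close>])
  have im: "(\<lambda>Z. fn2 F1 F2 (Z - p)) ` U = ball 0 \<eta>"
  proof (intro equalityI subsetI)
    fix y assume "y \<in> (\<lambda>Z. fn2 F1 F2 (Z - p)) ` U"
    then show "y \<in> ball 0 \<eta>" by (auto simp: memU U0_def)
  next
    fix y :: "complex^2" assume y: "y \<in> ball 0 \<eta>"
    then have "fn2 F1 F2 (fn2 S1 S2 y) = y" "norm (fn2 S1 S2 y) < d" using i2(2) s(2) by (auto simp: \<eta>_def)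
    then show "y \<in> (\<lambda>Z. fn2 F1 F2 (Z - p)) ` U"
      using y by (intro image_eqI[of _ _ "p + fn2 S1 S2 y"]) (auto simp: memU U0_def)
  qed
  have hol: "holomorphic2_on (\<lambda>Z. fn2 F1 F2 (Z - p)) U"
    unfolding holomorphic2_on_def
  proof
    fix Z assume "Z \<in> U"
    then have "norm (Z - p) < h1" by (auto simp: memU U0_def d_def)
    then obtain A :: "complex^2^2" where A: "(fn2 F1 F2 has_derivative (\<lambda>v. A *v v)) (at (Z - p))" using h1(2) by blast
    have "((\<lambda>Z. Z - p) has_derivative (\<lambda>v. v)) (at Z)" by (auto intro!: derivative_eq_intros)
    from has_derivative_compose[OF this A] show "\<exists>A::complex^2^2. ((\<lambda>Z. fn2 F1 F2 (Z - p)) has_derivative (\<lambda>v. A *v v)) (at Z)" by blast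
  qed
  have "biholomorphic2_on (\<lambda>Z. fn2 F1 F2 (Z - p)) U"
    unfolding biholomorphic2_on_def im
  proof (intro conjI exI[of _ "\<lambda>y. p + fn2 S1 S2 y"] ballI)
    show "holomorphic2_on (\<lambda>y. p + fn2 S1 S2 y) (ball 0 \<eta>)"
      unfolding holomorphic2_on_def
    proof
      fix y :: "complex^2" assume "y \<in> ball 0 \<eta>"
      then obtain A :: "complex^2^2" where A: "(fn2 S1 S2 has_derivative (\<lambda>v. A *v v)) (at y)" using h2(2) by (auto simp: \<eta>_def)
      have "((\<lambda>y. p + fn2 S1 S2 y) has_derivative (\<lambda>v. 0 + A *v v)) (at y)"
        by (rule has_derivative_add[OF has_derivative_const A])
      then show "\<exists>A::complex^2^2. ((\<lambda>y. p + fn2 S1 S2 y) has_derivative (\<lambda>v. A *v v)) (at y)" by auto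
    qed
    fix Z assume "Z \<in> U"
    then have "norm (Z - p) < i1" by (auto simp: memU U0_def d_def)
    then show "p + fn2 S1 S2 (fn2 F1 F2 (Z - p)) = Z" using i1(2) by simp
  qed (use \<open>open U\<close> hol in auto)
  moreover have "p \<in> U" using d \<eta> zero by (simp add: memU U0_def)
  moreover have "U \<subseteq> ball p r0" by (auto simp: memU U0_def d_def dist_norm norm_minus_commute)
  ultimately show ?thesis by blast
qed

text \<open>
  Since \<open>B\<close> is a unit, near \<open>p\<close> the hypersurface is the zero set of the imaginary part of \<open>\<Phi>\<close>, and \<open>\<Phi>\<close>
  can be completed by one of the coordinate functions to a biholomorphic map.
\<close>

lemma levi_flatI:
  assumes exp: "zzbar_expansion \<rho> p R" and def: "local_defining_function M p \<rho>"
    and \<Phi>: "Conv \<Phi>" "zser \<Phi>" "ord_ge 1 \<Phi>" "co \<Phi> E1 \<noteq> 0 \<or> co \<Phi> E2 \<noteq> 0"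
    and B: "Conv B" "co B 0 \<noteq> 0" and eq: "\<Phi> - bar \<Phi> = B * R"
  shows "levi_flat_germ M p"
proof -
  have \<Phi>0: "co \<Phi> 0 = 0" using \<Phi>(3) ord_ge_1 by blast
  have \<Phi>id: "sub \<Phi> (X1, X2, 0, 0) = \<Phi>"
    using sub_zser[OF \<Phi>(2) adm_kill(1), of X3 X4] ord_ge_X sub_XX[of \<Phi>] by (simp add: XX_def)
  have co_pd0: "co (pd E1 \<Phi>) 0 = co \<Phi> E1" "co (pd E2 \<Phi>) 0 = co \<Phi> E2" by (simp_all add: co_pd) (simp_all add: E_defs)
  have zX: "zser X1" "zser X2" by (simp_all add: zser_def)
  have "\<exists>F1 S1 S2. Conv F1 \<and> Conv S1 \<and> Conv S2 \<and> ord_ge 1 F1 \<and> ord_ge 1 S1 \<and> ord_ge 1 S2 \<and> zser F1 \<and> zser S1 \<and> zser S2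
    \<and> sub S1 (F1, \<Phi>, 0, 0) = X1 \<and> sub S2 (F1, \<Phi>, 0, 0) = X2 \<and> sub F1 (S1, S2, 0, 0) = X1 \<and> sub \<Phi> (S1, S2, 0, 0) = X2"
  proof (cases "co \<Phi> E2 = 0")
    case False
    then have lin: "lin \<Phi> (0, 1, 0, 0) \<noteq> 0" by simp
    have a: "adm (X1, 0, 0, 0)" using ord_ge_X by simp
    obtain s where s: "ord_ge 1 s" "sub \<Phi> (shift (X1, 0, 0, 0) (0, 1, 0, 0) s) = X2"
      using implicit_exists[OF \<Phi>0 lin a ord_ge_X(2)] by auto
    then have ss: "sub \<Phi> (X1, s, 0, 0) = X2" by simp
    have Cs: "Conv s" by (rule implicit_Conv[OF \<Phi>0 lin a ord_ge_X(2) s \<Phi>(1)]) (auto simp: Conv_X Conv_0)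
    have as: "adm (X1, s, 0, 0)" and aF: "adm (X1, \<Phi>, 0, 0)" using s \<Phi>(3) ord_ge_X by auto
    have nz: "sub (pd E2 \<Phi>) (X1, s, 0, 0) \<noteq> 0" using co_sub_0[OF as, of "pd E2 \<Phi>"] co_pd0 False by auto
    have "zser s" unfolding zser_def
      using arg_cong[OF ss, of "pd E3"] arg_cong[OF ss, of "pd E4"] nz derivation_0[OF derivation_pd] by (simp add: chain_rule[OF as])
    moreover have "sub s (X1, \<Phi>, 0, 0) = X2"
    proof (rule implicit_unique[OF \<Phi>0 lin a])
      show "ord_ge 1 (sub s (X1, \<Phi>, 0, 0))" by (intro ord_ge_sub aF s)
      have "sub \<Phi> (X1, sub s (X1, \<Phi>, 0, 0), 0, 0) = sub (sub \<Phi> (X1, s, 0, 0)) (X1, \<Phi>, 0, 0)"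
        by (simp add: sub_sub[OF as aF] sub_X[OF aF] sub_0[OF aF])
      then show "sub \<Phi> (shift (X1, 0, 0, 0) (0, 1, 0, 0) (sub s (X1, \<Phi>, 0, 0))) = sub \<Phi> (shift (X1, 0, 0, 0) (0, 1, 0, 0) X2)"
        by (simp add: ss sub_X[OF aF] \<Phi>id)
    qed (rule ord_ge_X)
    ultimately show ?thesis using s Cs ss zX
      by (intro exI[of _ X1] exI[of _ X1] exI[of _ s]) (simp add: Conv_X ord_ge_X[unfolded One_nat_def] sub_X[OF aF] sub_X[OF as])
  next
    case True
    then have c1: "co \<Phi> E1 \<noteq> 0" using \<Phi>(4) by simp
    then have lin: "lin \<Phi> (1, 0, 0, 0) \<noteq> 0" by simp
    have a: "adm (0, X1, 0, 0)" using ord_ge_X by simp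
    obtain s where s: "ord_ge 1 s" "sub \<Phi> (shift (0, X1, 0, 0) (1, 0, 0, 0) s) = X2"
      using implicit_exists[OF \<Phi>0 lin a ord_ge_X(2)] by auto
    then have ss: "sub \<Phi> (s, X1, 0, 0) = X2" by simp
    have Cs: "Conv s" by (rule implicit_Conv[OF \<Phi>0 lin a ord_ge_X(2) s \<Phi>(1)]) (auto simp: Conv_X Conv_0)
    have as: "adm (s, X1, 0, 0)" and aF: "adm (X2, \<Phi>, 0, 0)" using s \<Phi>(3) ord_ge_X by auto
    have nz: "sub (pd E1 \<Phi>) (s, X1, 0, 0) \<noteq> 0" using co_sub_0[OF as, of "pd E1 \<Phi>"] co_pd0 c1 by auto
    have "zser s" unfolding zser_def
      using arg_cong[OF ss, of "pd E3"] arg_cong[OF ss, of "pd E4"] nz derivation_0[OF derivation_pd] by (simp add: chain_rule[OF as])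
    moreover have "sub s (X2, \<Phi>, 0, 0) = X1"
    proof (rule implicit_unique[OF \<Phi>0 lin])
      show "adm (0, X2, 0, 0)" using ord_ge_X by simp
      show "ord_ge 1 (sub s (X2, \<Phi>, 0, 0))" by (intro ord_ge_sub aF s)
      have "sub \<Phi> (sub s (X2, \<Phi>, 0, 0), X2, 0, 0) = sub (sub \<Phi> (s, X1, 0, 0)) (X2, \<Phi>, 0, 0)"
        by (simp add: sub_sub[OF as aF] sub_X[OF aF] sub_0[OF aF])
      then show "sub \<Phi> (shift (0, X2, 0, 0) (1, 0, 0, 0) (sub s (X2, \<Phi>, 0, 0))) = sub \<Phi> (shift (0, X2, 0, 0) (1, 0, 0, 0) X1)"
        by (simp add: ss sub_X[OF aF] \<Phi>id)
    qed (rule ord_ge_X)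
    ultimately show ?thesis using s Cs ss zX
      by (intro exI[of _ X2] exI[of _ s] exI[of _ X1]) (simp add: Conv_X ord_ge_X[unfolded One_nat_def] sub_X[OF aF] sub_X[OF as])
  qed
  then obtain F1 S1 S2 where FS: "Conv F1" "Conv S1" "Conv S2" "ord_ge 1 F1" "ord_ge 1 S1" "ord_ge 1 S2" "zser F1" "zser S1" "zser S2"
    "sub S1 (F1, \<Phi>, 0, 0) = X1" "sub S2 (F1, \<Phi>, 0, 0) = X2" "sub F1 (S1, S2, 0, 0) = X1" "sub \<Phi> (S1, S2, 0, 0) = X2" by blast
  obtain UM where UM: "open UM" "p \<in> UM" "M \<inter> UM = {Z \<in> UM. \<rho> Z = 0}"
    using def unfolding local_defining_function_def by blast
  obtain r1 where r1: "r1 > 0" "ball p r1 \<subseteq> UM" using UM open_contains_ball by blast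
  obtain r2 where r2: "r2 > 0" "\<And>Y. norm Y < r2 \<Longrightarrow> ev R (rp Y) = of_real (\<rho> (p + Y))"
    using zzbar_expansion_ev[OF exp] by blast
  have CR: "Conv R" by (rule zzbar_expansion_Conv[OF exp])
  obtain s C where s: "s > 0" "\<forall>F\<in>{\<Phi>, B, R}. nb F s C" using Conv_common_finite[of "{\<Phi>, B, R}"] \<Phi>(1) B(1) CR by auto
  define b where "b = B - const4 (co B 0)"
  have b1: "ord_ge 1 b" by (simp only: ord_ge_1) (simp add: b_def co_const4)
  have "ConvT (b, 0, 0, 0)" "adm (b, 0, 0, 0)" using b1 B(1) by (simp_all add: b_def Conv_0 Conv_diff Conv_const4)
  then obtain r3 where r3: "r3 > 0" "nb_t (b, 0, 0, 0) r3 (cmod (co B 0) / 2)"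
    using nb_t_small[of "(b, 0, 0, 0)" "cmod (co B 0) / 2"] B(2) by auto
  define r where "r = min (min r1 r2) (min r3 s)"
  have r: "r > 0" using r1 r2 r3 s by (simp add: r_def)
  obtain U where U: "p \<in> U" "U \<subseteq> ball p r" "biholomorphic2_on (\<lambda>Z. fn2 F1 \<Phi> (Z - p)) U"
    using formal_biholomorphism[OF FS(1) \<Phi>(1) FS(2,3) FS(4) \<Phi>(3) FS(5,6) FS(7) \<Phi>(2) FS(8,9) FS(10-13) r] by blast
  have key: "Im (cy (fn2 F1 \<Phi> (Z - p))) = 0 \<longleftrightarrow> \<rho> Z = 0" if Z: "Z \<in> U" for Z
  proof -
    define Y where "Y = Z - p"
    have Y: "norm Y < r" using U(2) Z by (auto simp: Y_def dist_norm norm_minus_commute)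
    have v: "vle (rp Y) s" and v3: "vle (rp Y) r3" using Y by (auto intro!: vle_rp simp: r_def)
    have n: "nb \<Phi> s C" "nb B s C" "nb R s C" using s by simp_all
    have "ev (\<Phi> - bar \<Phi>) (rp Y) = ev \<Phi> (rp Y) - cnj (ev \<Phi> (rp Y))"
      using ev_diff[OF n(1), of "bar \<Phi>" C "rp Y"] n(1) v ev_bar[OF n(1) v] by simp
    moreover have "ev (\<Phi> - bar \<Phi>) (rp Y) = ev B (rp Y) * of_real (\<rho> Z)"
      unfolding eq ev_mult[OF n(2,3) v] using r2(2)[of Y] Y by (simp add: r_def Y_def)
    moreover have "ev \<Phi> (rp Y) = fn \<Phi> Y" unfolding rp_def fn_def zp_def by (rule ev_zser[OF \<Phi>(2)])
    ultimately have e: "fn \<Phi> Y - cnj (fn \<Phi> Y) = ev B (rp Y) * of_real (\<rho> Z)" by simp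
    have "ev B (rp Y) \<noteq> 0"
    proof
      assume z: "ev B (rp Y) = 0"
      have "ev b (rp Y) = ev B (rp Y) - co B 0"
        unfolding b_def using ev_diff[OF n(2) nb_const4 v] s(1) by simp
      moreover have "cmod (ev b (rp Y)) \<le> cmod (co B 0) / 2"
        using ev_bound[OF _ v3, of b "cmod (co B 0) / 2"] r3(2) by simp
      ultimately show False using z B(2) by simp
    qed
    then have "fn \<Phi> Y - cnj (fn \<Phi> Y) = 0 \<longleftrightarrow> \<rho> Z = 0" unfolding e by simp
    moreover have "fn \<Phi> Y - cnj (fn \<Phi> Y) = 0 \<longleftrightarrow> Im (fn \<Phi> Y) = 0" by (simp add: complex_eq_iff)
    ultimately show ?thesis by (simp add: Y_def)
  qed
  have "U \<subseteq> UM" using U(2) r1(2) by (auto simp: r_def subset_iff)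
  then have "M \<inter> U = {Z \<in> U. Im (cy (fn2 F1 \<Phi> (Z - p))) = 0}" using UM(3) key by auto
  then show ?thesis unfolding levi_flat_germ_def using U by blast
qed

section \<open>Algebraic power series converge\<close>

lemma Conv_zfin: "zfin F \<Longrightarrow> Conv F"
  unfolding zfin_def using Conv_finite by blast

lemma poly_Taylor2:
  fixes p :: "'a::idom poly"
  shows "\<exists>c. poly p (x + a) = poly p x + poly (pderiv p) x * a + a\<^sup>2 * c"
proof (induction p)
  case 0 then show ?case by (intro exI[of _ 0]) simp
next
  case (pCons b p)
  then obtain c where c: "poly p (x + a) = poly p x + poly (pderiv p) x * a + a\<^sup>2 * c" by blast
  show ?case
    by (rule exI[of _ "poly (pderiv p) x + (x + a) * c"])
      (simp only: poly_pCons pderiv_pCons poly_add c, simp add: algebra_simps power2_eq_square)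
qed

lemma zfin_const_mult_of_nat: "zfin F \<Longrightarrow> zfin (of_nat n * F)"
proof -
  assume F: "zfin F"
  have eq: "of_nat n * F = const4 (of_nat n) * F"
    by (induction n) (simp_all add: const4_add algebra_simps)
  show ?thesis using F unfolding eq zfin_def by (auto simp: zser_def pd_const4_mult)
qed

text \<open>An annihilating polynomial of least degree is separable.\<close>

lemma algebraic_zser_separable:
  assumes "algebraic_zser F"
  shows "\<exists>p. (\<forall>i. zfin (coeff p i)) \<and> poly p F = 0 \<and> poly (pderiv p) F \<noteq> 0"
proof -
  define rel where "rel = (\<lambda>p. p \<noteq> 0 \<and> (\<forall>i. zfin (coeff p i)) \<and> poly p F = 0)"
  obtain p where "rel p" using assms by (auto simp: algebraic_zser_def rel_def)
  then obtain q where q: "rel q" and min: "\<And>r. rel r \<Longrightarrow> degree q \<le> degree r"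
    using exists_least_iff[of "\<lambda>n. \<exists>p. rel p \<and> degree p = n"] by (metis linorder_not_less)
  have deg: "degree q \<noteq> 0"
  proof
    assume "degree q = 0"
    then obtain c where "q = [:c:]" by (rule degree_eq_zeroE)
    then show False using q by (auto simp: rel_def)
  qed
  have "poly (pderiv q) F \<noteq> 0"
  proof
    assume z: "poly (pderiv q) F = 0"
    have "pderiv q \<noteq> 0" using deg by (simp add: pderiv_eq_0_iff)
    moreover have "zfin (coeff (pderiv q) n)" for n
      using q unfolding coeff_pderiv rel_def by (simp add: zfin_const_mult_of_nat del: of_nat_Suc)
    ultimately have "rel (pderiv q)" using z by (simp add: rel_def)
    from min[OF this] show False using deg by (simp add: degree_pderiv)
  qed
  then show ?thesis using q by (auto simp: rel_def)
qed

definition sub_poly :: "fps4 poly \<Rightarrow> tup \<Rightarrow> fps4 poly" where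
  "sub_poly p G = map_poly (\<lambda>F. sub F G) p"

lemma coeff_sub_poly: "adm G \<Longrightarrow> coeff (sub_poly p G) i = sub (coeff p i) G"
  by (simp add: sub_poly_def coeff_map_poly sub_0)

lemma sub_of_nat: "adm G \<Longrightarrow> sub (of_nat n) G = of_nat n"
  by (induction n) (auto simp: sub_0 sub_1 sub_add)

lemma sub_poly_eval: assumes G: "adm G" shows "sub (poly p F) G = poly (sub_poly p G) (sub F G)"
proof (induction p)
  case 0 then show ?case by (simp add: sub_poly_def sub_0[OF G])
next
  case (pCons a p)
  have "sub_poly (pCons a p) G = pCons (sub a G) (sub_poly p G)"
    unfolding sub_poly_def by (rule map_poly_pCons) (use pCons sub_0[OF G] in auto)
  with pCons show ?case by (simp add: sub_add[OF G] sub_mult[OF G])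
qed

lemma pderiv_sub_poly: assumes G: "adm G" shows "pderiv (sub_poly p G) = sub_poly (pderiv p) G"
  by (rule poly_eqI) (simp add: coeff_pderiv coeff_sub_poly[OF G] sub_mult[OF G] sub_of_nat[OF G] del: of_nat_Suc)

lemma Conv_poly: assumes "\<And>i. Conv (coeff p i)" "Conv F" shows "Conv (poly p F)"
  unfolding poly_altdef by (intro Conv_sum Conv_mult Conv_power assms)

lemma X1_power: "X1 ^ n = monom4 1 (n, 0, 0, 0)"
  unfolding monom4_gpow by (simp add: gpow.simps XX_def)

lemma X1_power_coshift:
  assumes "\<And>a b c d. a < n \<Longrightarrow> co F (a, b, c, d) = 0"
  shows "F = X1 ^ n * mk (\<lambda>e. co F (e + (n, 0, 0, 0)))"
proof (rule co_eqI)
  fix e :: mi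
  obtain a b c d where e: "e = (a, b, c, d)" by (cases e)
  show "co F e = co (X1 ^ n * mk (\<lambda>e. co F (e + (n, 0, 0, 0)))) e"
  proof (cases "a < n")
    case True
    have "co (X1 ^ n * mk (\<lambda>e. co F (e + (n, 0, 0, 0)))) e = 0"
      unfolding X1_power by (rule co_monom4_mult_0) (use True in \<open>auto simp: e\<close>)
    then show ?thesis using assms True by (simp add: e)
  next
    case False
    have eq: "e = (n, 0, 0, 0) + (a - n, b, c, d)" using False by (simp add: e)
    show ?thesis unfolding eq X1_power co_monom4_mult by (simp add: add.commute)
  qed
qed

lemma Conv_X1_cancel: assumes "Conv (X1 ^ n * F)" shows "Conv F"
proof -
  obtain r M where r: "r > 0" "\<And>e. cmod (co (X1 ^ n * F) e) * r ^ deg e \<le> M" using assms by (auto simp: Conv_iff)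
  show ?thesis
  proof (rule Conv_bound[OF r(1)])
    fix e
    have "cmod (co (X1 ^ n * F) ((n, 0, 0, 0) + e)) * r ^ deg ((n, 0, 0, 0) + e) \<le> M" by (rule r(2))
    then have "cmod (co F e) * r ^ deg e * r ^ n \<le> M"
      unfolding X1_power co_monom4_mult by (simp add: power_add mult_ac)
    then show "cmod (co F e) * r ^ deg e \<le> M / r ^ n" using r(1) by (simp add: pos_le_divide_eq)
  qed
qed

text \<open>
  The division by \<open>X1^(2m+1)\<close> in Newton's method: here \<open>x = X1\<close>, \<open>T = X1^m\<close>, \<open>T e\<close> is the derivative at the
  root and \<open>x T s\<close> the displacement from it.
\<close>

lemma newton_identity:
  fixes T e x s c :: "'a::comm_ring_1"
  shows "T * e * (x * T * s) + (x * T * s)\<^sup>2 * c = T * T * x * (s * (e + x * s * c))"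
  by (simp add: power2_eq_square algebra_simps)

text \<open>
  Newton's method, after Tougeron: with \<open>p'(F) = X1^m \<epsilon>\<close> and \<open>\<epsilon>\<close> a unit, write \<open>F = y + X1^(m+1) (v + u)\<close>,
  where the polynomial \<open>y\<close> collects the terms of degree at most \<open>m\<close> in \<open>X1\<close> and \<open>v\<close> is the constant making
  \<open>u\<close> of order one. Then \<open>p (y + X1^(m+1) (v + X3)) / X1^(2m+1)\<close> is a convergent series, and \<open>X3 = u\<close> is its
  unique root of order one, by the implicit function theorem.
\<close>

lemma newton_convergence:
  assumes pC: "\<And>i. Conv (coeff p i)" and F: "zser F" and root: "poly p F = 0"
    and simple: "poly (pderiv p) F = X1 ^ m * \<epsilon>" "co \<epsilon> 0 \<noteq> 0"
    and trunc: "\<And>a. a \<le> m \<Longrightarrow> finite {b. co F (a, b, 0, 0) \<noteq> 0}"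
  shows "Conv F"
proof -
  define y where "y = mk (\<lambda>(a, b, c, d). if a \<le> m then co F (a, b, c, d) else 0)"
  have cy: "co y (a, b, c, d) = (if a \<le> m then co F (a, b, c, d) else 0)" for a b c d by (simp add: y_def)
  have Cy: "Conv y"
  proof -
    have "finite (\<Union>a\<in>{..m}. {b. co F (a, b, 0, 0) \<noteq> 0})" using trunc by auto
    then obtain N where N: "\<And>a b. a \<le> m \<Longrightarrow> co F (a, b, 0, 0) \<noteq> 0 \<Longrightarrow> b \<le> N"
      unfolding finite_nat_set_iff_bounded_le by (metis (mono_tags, lifting) UN_I atMost_iff mem_Collect_eq)
    show ?thesis
    proof (rule Conv_finite[of "m + N"])
      fix e assume "deg e > m + N"
      then show "co y e = 0"
      proof (cases e)
        case (fields a b c d)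
        show ?thesis
        proof (cases "c > 0 \<or> d > 0")
          case True
          then show ?thesis using co_zser[OF F True, of a b] by (simp add: fields cy)
        next
          case False
          then show ?thesis using N[of a b] \<open>deg e > m + N\<close> by (auto simp: fields cy)
        qed
      qed
    qed
  qed
  define V where "V = mk (\<lambda>e. co (F - y) (e + (Suc m, 0, 0, 0)))"
  have "F - y = X1 ^ Suc m * V" unfolding V_def by (rule X1_power_coshift) (auto simp: cy)
  then have FV: "F = y + X1 ^ Suc m * V" by (simp add: algebra_simps)
  have zV: "zser V"
  proof (rule zserI)
    fix a b c d :: nat assume "c > 0 \<or> d > 0"
    then show "co V (a, b, c, d) = 0" using co_zser[OF F, of c d "a + Suc m" b] by (simp add: V_def cy)
  qed
  define u where "u = V - const4 (co V 0)"
  have u1: "ord_ge 1 u" by (simp only: ord_ge_1) (simp add: u_def co_const4)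
  have zu: "zser u" using zV by (simp add: u_def zser_def derivation_diff[OF derivation_pd] pd_const4)
  define a where "a = X1 ^ Suc m * (X3 - u)"
  define Z where "Z = y + X1 ^ Suc m * (const4 (co V 0) + X3)"
  have Za: "Z = F + a" by (simp add: Z_def a_def FV u_def algebra_simps)
  obtain c where c: "poly p (F + a) = poly p F + poly (pderiv p) F * a + a\<^sup>2 * c" using poly_Taylor2 by blast
  define R where "R = (X3 - u) * (\<epsilon> + X1 * (X3 - u) * c)"
  have "poly p Z = X1 ^ (2 * m + 1) * R"
  proof -
    have "poly p Z = X1 ^ m * \<epsilon> * a + a\<^sup>2 * c" unfolding Za c root simple(1) by (simp only: add_0_left)
    also have "\<dots> = X1 ^ (2 * m + 1) * R"
      unfolding a_def R_def using newton_identity[of "X1 ^ m" \<epsilon> X1 "X3 - u" c] by (simp add: mult_2 power_add)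
    finally show ?thesis .
  qed
  moreover have "Conv (poly p Z)" unfolding Z_def
    by (intro Conv_poly pC Conv_add Cy Conv_mult Conv_power Conv_X Conv_const4)
  ultimately have CR: "Conv R" using Conv_X1_cancel by metis
  have X3u: "ord_ge 1 (X3 - u)" by (intro ord_ge_diff ord_ge_X u1)
  have R0: "co R 0 = 0" using X3u unfolding R_def ord_ge_1 by (simp add: co_0_mult)
  have R3: "co R E3 = co \<epsilon> 0"
  proof -
    have "co R E3 = co ((\<epsilon> + X1 * (X3 - u) * c) * (X3 - u)) E3" by (simp add: R_def mult.commute)
    also have "\<dots> = co (\<epsilon> + X1 * (X3 - u) * c) 0 * co (X3 - u) E3" by (rule co_mult_lowest[OF X3u]) simp
    also have "co (X3 - u) E3 = 1" using co_zser[OF zu, of 1 0 0 0] by (simp add: co_X) (simp add: E3_def)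
    also have "co (\<epsilon> + X1 * (X3 - u) * c) 0 = co \<epsilon> 0" by (simp add: co_0_mult co_X)
    finally show ?thesis by simp
  qed
  have lin: "lin R (0, 0, 1, 0) \<noteq> 0" using R3 simple(2) by simp
  have a12: "adm (X1, X2, 0, 0)" and au: "adm (X1, X2, u, 0)" using ord_ge_X u1 by auto
  have "sub u (X1, X2, u, 0) = u"
  proof -
    have "adm (X1, X2, X3, X4)" using ord_ge_X by auto
    from sub_zser[OF zu au this] show ?thesis using sub_XX[of u] by (simp add: XX_def)
  qed
  then have "sub R (X1, X2, u, 0) = 0"
    by (simp add: R_def sub_mult[OF au] sub_diff[OF au] sub_X[OF au])
  then have "Conv u"
    by (intro implicit_Conv[OF R0 lin a12 _ u1 _ CR, of 0]) (auto simp: Conv_X Conv_0)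
  then have "Conv V" using Conv_add[OF \<open>Conv u\<close> Conv_const4[of "co V 0"]] by (simp add: u_def)
  then show ?thesis unfolding FV by (intro Conv_add Cy Conv_mult Conv_power Conv_X)
qed

lemma zser_sub: assumes "zser F" "adm (G1, G2, G3, G4)" "zser G1" "zser G2" shows "zser (sub F (G1, G2, G3, G4))"
  using assms by (simp add: zser_def chain_rule[OF assms(2)] sub_0[OF assms(2)])

text \<open>
  A linear change of coordinates makes the lowest form of \<open>p'(F)\<close> nonzero at \<open>(1, 0)\<close>; blowing up,
  \<open>X2 \<mapsto> X1 X2\<close>, turns \<open>p'(F)\<close> into a power of \<open>X1\<close> times a unit. Both substitutions reflect convergence.
\<close>

lemma co_blow_up:
  assumes "zser F"
  shows "co (sub F (X1, X1 * X2, 0, 0)) (a, b, c, d) = (if c = 0 \<and> d = 0 \<and> b \<le> a then co F (a - b, b, 0, 0) else 0)"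
proof -
  let ?G = "(X1, X1 * X2, 0, 0)"
  have G: "adm ?G" using ord_ge_X ord_ge_mult1 by auto
  have gp: "gpow ?G (i, j, k, l) = (if k = 0 \<and> l = 0 then monom4 1 (i + j, j, 0, 0) else 0)" for i j k l
    unfolding monom4_gpow by (auto simp: gpow.simps XX_def power_0_left power_add power_mult_distrib mult_ac)
  define e :: mi where "e = (a, b, c, d)"
  define P where "P = (c = 0 \<and> d = 0 \<and> b \<le> a)"
  have "co (sub F ?G) e = (\<Sum>f\<in>upto (deg e). if f = (a - b, b, 0, 0) then (if P then co F (a - b, b, 0, 0) else 0) else 0)"
    unfolding co_sub[OF G order.refl]
  proof (rule sum.cong[OF refl])
    fix f :: mi
    obtain i j k l where f: "f = (i, j, k, l)" by (cases f)
    show "co F f * co (gpow ?G f) e = (if f = (a - b, b, 0, 0) then (if P then co F (a - b, b, 0, 0) else 0) else 0)"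
      by (auto simp: f gp co_monom4 e_def P_def)
  qed
  also have "\<dots> = (if P then co F (a - b, b, 0, 0) else 0)"
    by (subst sum.delta[OF finite_upto]) (auto simp: upto_def e_def P_def)
  finally show ?thesis by (simp add: e_def P_def)
qed

text \<open>
  The blow-up moves the exponents \<open>(a, b)\<close> to \<open>(a + b, b)\<close>, which at most doubles the degree; a radius \<open>q\<close>
  for the blown-up series gives the radius \<open>q\<^sup>2\<close>.
\<close>

lemma Conv_blow_down:
  assumes z: "zser F" and C: "Conv (sub F (X1, X1 * X2, 0, 0))" shows "Conv F"
proof -
  obtain r M where r: "r > 0" "\<And>e. cmod (co (sub F (X1, X1 * X2, 0, 0)) e) * r ^ deg e \<le> M"
    using C by (auto simp: Conv_iff)
  define q where "q = min r 1"
  have q: "0 < q" "q \<le> r" "q \<le> 1" using r(1) by (auto simp: q_def)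
  have M: "0 \<le> M" using r(2)[of 0] by (meson mult_nonneg_nonneg norm_ge_zero order_trans r(1) zero_le_power less_imp_le)
  show ?thesis
  proof (rule Conv_bound[of "q\<^sup>2"])
    fix e :: mi
    obtain a b c d where e: "e = (a, b, c, d)" by (cases e)
    show "cmod (co F e) * (q\<^sup>2) ^ deg e \<le> M"
    proof (cases "c = 0 \<and> d = 0")
      case True
      have "cmod (co F (a, b, 0, 0)) * r ^ (a + b + b) \<le> M"
        using r(2)[of "(a + b, b, 0, 0)"] co_blow_up[OF z, of "a + b" b 0 0] by simp
      moreover have "(q\<^sup>2) ^ (a + b) \<le> r ^ (a + b + b)"
      proof -
        have "(q\<^sup>2) ^ (a + b) = q ^ (2 * (a + b))" by (simp only: power_mult)
        also have "\<dots> \<le> q ^ (a + b + b)" using q by (intro power_decreasing) auto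
        also have "\<dots> \<le> r ^ (a + b + b)" using q by (intro power_mono) auto
        finally show ?thesis .
      qed
      ultimately show ?thesis using True
        by (simp add: e) (meson mult_left_mono norm_ge_zero order_trans)
    next
      case False
      then have "co F e = 0" using co_zser[OF z, of c d a b] by (simp add: e)
      then show ?thesis using M by simp
    qed
  qed (use q in simp)
qed

lemma shear: 
  fixes slope :: complex
  defines "G \<equiv> (\<lambda>l. (X1, X2 + const4 l * X1, 0::fps4, 0::fps4))"
  shows "adm (G slope)" "ConvT (G slope)" "zser F \<Longrightarrow> sub (sub F (G slope)) (G (- slope)) = F"
    "zser F \<Longrightarrow> zser (sub F (G slope))"
proof -
  show a: "adm (G slope)" for slope unfolding G_def using ord_ge_X by (auto intro!: ord_ge_add ord_ge_mult1(1))
  show "ConvT (G slope)" by (simp add: G_def Conv_X Conv_0 Conv_add Conv_mult Conv_const4)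
  have a': "adm (X1, X2 + const4 l * X1, 0, 0)" for l using a[of l] by (simp add: G_def)
  show "sub (sub F (G slope)) (G (- slope)) = F" if F: "zser F"
  proof -
    have am: "adm (X1, X2 - const4 slope * X1, 0, 0)" using a'[of "- slope"] by (simp add: const4_uminus)
    have "subt (G slope) (G (- slope)) = (X1, X2, 0, 0)"
      by (simp add: G_def const4_uminus sub_X[OF am] sub_add[OF am] sub_mult[OF am] sub_const4[OF am] sub_0[OF am])
    then show ?thesis
      using sub_sub[OF a[of slope] a[of "- slope"], of F] sub_zser[OF F adm_kill(1), of X3 X4] ord_ge_X sub_XX[of F]
      by (simp add: XX_def)
  qed
  have "zser X1" "zser (X2 + const4 slope * X1)" by (simp_all add: zser_def pd_add pd_const4_mult)
  then show "zser F \<Longrightarrow> zser (sub F (G slope))" using zser_sub[OF _ a'] by (simp add: G_def)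
qed

text \<open>
  The lowest form is a polynomial in the slope, and it has finitely many roots.
\<close>

lemma lowest_form_after_shear:
  assumes D: "zser D" "D \<noteq> 0"
  shows "\<exists>m slope. ord_ge m D \<and> co (sub D (X1, X2 + const4 slope * X1, 0, 0)) (m, 0, 0, 0) \<noteq> 0"
proof -
  have "\<exists>f. co D f \<noteq> 0" using D(2) co_eqI[of D 0] by auto
  then obtain f where "co D f \<noteq> 0" ..
  from ex_has_least_nat[of "\<lambda>f. co D f \<noteq> 0", OF this, of deg]
  obtain e where e0: "co D e \<noteq> 0" "\<forall>f. co D f \<noteq> 0 \<longrightarrow> deg e \<le> deg f" by (elim exE conjE)
  define m where "m = deg e"
  have m: "ord_ge m D" unfolding ord_ge_def m_def using e0(2) by (meson not_le)
  have e: "deg e = m" "co D e \<noteq> 0" using e0(1) by (simp_all add: m_def)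
  define q where "q = (\<Sum>b\<le>m. monom (co D (m - b, b, 0, 0)) b)"
  have cq: "coeff q b = (if b \<le> m then co D (m - b, b, 0, 0) else 0)" for b by (simp add: q_def coeff_sum)
  obtain a b c d where abcd: "e = (a, b, c, d)" by (cases e)
  have "c = 0 \<and> d = 0" using co_zser[OF D(1), of c d a b] e(2) unfolding abcd by (cases "c > 0 \<or> d > 0") simp_all
  then have "coeff q b \<noteq> 0" using e by (auto simp: cq abcd)
  then have "q \<noteq> 0" by auto
  then have "finite {x. poly q x = 0}" by (rule poly_roots_finite)
  then obtain slope where l: "poly q slope \<noteq> 0" using infinite_UNIV_char_0 by (metis (mono_tags, lifting) UNIV_I finite_subset mem_Collect_eq subsetI)
  let ?G = "(X1, X2 + const4 slope * X1, 0, 0)"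
  have a: "adm ?G" by (rule shear(1))
  have gp: "co (gpow ?G (i, j, k, l)) (m, 0, 0, 0) = (if k = 0 \<and> l = 0 \<and> i + j = m then slope ^ j else 0)" for i j k l
  proof -
    let ?K = "(X1, 0, 0, 0)"
    have aK: "adm ?K" using ord_ge_X by simp
    have aP: "gpow ?K f = (if snd f = 0 then monom4 1 f else 0)" for f :: mi
      unfolding monom4_gpow by (cases f) (auto simp: gpow.simps XX_def power_0_left zero_prod_def)
    have "co (gpow ?G (i, j, k, l)) (m, 0, 0, 0) = co (sub (gpow ?G (i, j, k, l)) ?K) (m, 0, 0, 0)"
      using co_sub_kill[OF aK aP, of "gpow ?G (i, j, k, l)" "(m, 0, 0, 0)"] by (simp add: zero_prod_def)
    also have "sub (gpow ?G (i, j, k, l)) ?K = X1 ^ i * (const4 slope * X1) ^ j * 0 ^ k * 0 ^ l"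
      by (simp add: sub_power[OF aK] sub_X[OF aK] sub_add[OF aK] sub_mult[OF aK] sub_const4[OF aK] sub_0[OF aK] gpow.simps)
    also have "\<dots> = (if k = 0 \<and> l = 0 then const4 (slope ^ j) * X1 ^ (i + j) else 0)"
    proof -
      have cp: "const4 slope ^ j = const4 (slope ^ j)" by (induction j) (simp_all add: const4_mult)
      show ?thesis by (simp add: power_0_left power_mult_distrib cp power_add mult_ac)
    qed
    finally show ?thesis by (auto simp: X1_power co_monom4)
  qed
  have "co (sub D ?G) (m, 0, 0, 0) = (\<Sum>f\<in>upto m. co D f * co (gpow ?G f) (m, 0, 0, 0))"
    by (rule co_sub[OF a]) simp
  also have "\<dots> = (\<Sum>b\<le>m. co D (m - b, b, 0, 0) * slope ^ b)"
  proof -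
    have "(\<Sum>f\<in>upto m. co D f * co (gpow ?G f) (m, 0, 0, 0))
        = (\<Sum>f\<in>(\<lambda>b. (m - b, b, 0, 0)) ` {..m}. co D f * co (gpow ?G f) (m, 0, 0, 0))"
    proof (rule sum.mono_neutral_right)
      show "\<forall>f\<in>upto m - (\<lambda>b. (m - b, b, 0, 0)) ` {..m}. co D f * co (gpow ?G f) (m, 0, 0, 0) = 0"
      proof
        fix f :: mi assume f: "f \<in> upto m - (\<lambda>b. (m - b, b, 0, 0)) ` {..m}"
        obtain i j k l where ijkl: "f = (i, j, k, l)" by (cases f)
        have "\<not> (k = 0 \<and> l = 0 \<and> i + j = m)"
        proof
          assume "k = 0 \<and> l = 0 \<and> i + j = m"
          then have "f = (m - j, j, 0, 0)" "j \<le> m" by (auto simp: ijkl)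
          then show False using f by blast
        qed
        then have "co (gpow ?G (i, j, k, l)) (m, 0, 0, 0) = 0" unfolding gp by (rule if_not_P)
        then show "co D f * co (gpow ?G f) (m, 0, 0, 0) = 0" by (simp only: ijkl mult_zero_right)
      qed
    qed (auto simp: upto_def)
    also have "\<dots> = (\<Sum>b\<le>m. co D (m - b, b, 0, 0) * slope ^ b)"
      by (subst sum.reindex) (auto simp: inj_on_def gp intro!: sum.cong)
    finally show ?thesis .
  qed
  also have "\<dots> = poly q slope" by (simp add: q_def poly_sum poly_monom)
  finally show ?thesis using m l by (intro exI[of _ m] exI[of _ slope]) simp
qed

text \<open>
  After the shear and the blow-up the root of the transformed polynomial is simple up to a power of
  \<open>X1\<close>, as Newton's method requires, and its coefficients in \<open>X1\<close> are polynomials in \<open>X2\<close>.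
\<close>

theorem algebraic_zser_Conv:
  assumes z: "zser F" and alg: "algebraic_zser F"
  shows "Conv F"
proof -
  obtain p where p: "\<And>i. zfin (coeff p i)" "poly p F = 0" "poly (pderiv p) F \<noteq> 0"
    using algebraic_zser_separable[OF alg] by blast
  have zpd: "zser (poly q F)" if "\<And>i. zfin (coeff q i)" for q
    using that
  proof (induction q)
    case 0 then show ?case by (simp add: zser_def derivation_0[OF derivation_pd])
  next
    case (pCons a q)
    have "zfin a" "\<And>i. zfin (coeff q i)" using pCons.prems[of 0] pCons.prems[of "Suc _"] by simp_all
    then have "zser a" "zser (poly q F)" using pCons.IH by (simp_all add: zfin_def)
    then show ?case using zser_mult[OF z] by (simp add: zser_def pd_add pd_mult)
  qed
  define D where "D = poly (pderiv p) F"
  have D: "zser D" "D \<noteq> 0" unfolding D_def using p zpd[of "pderiv p"]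
    by (simp_all add: coeff_pderiv zfin_const_mult_of_nat del: of_nat_Suc)
  obtain m slope where m: "ord_ge m D" "co (sub D (X1, X2 + const4 slope * X1, 0, 0)) (m, 0, 0, 0) \<noteq> 0"
    using lowest_form_after_shear[OF D] by blast
  let ?G = "(X1, X2 + const4 slope * X1, 0, 0)" and ?b = "(X1, X1 * X2, 0, 0)"
  have aG: "adm ?G" and CG: "ConvT ?G" using shear(1,2)[of slope] by simp_all
  have ab: "adm ?b" and Cb: "ConvT ?b" using ord_ge_X ord_ge_mult1(1)[of 1 X2 X1] by (simp_all add: Conv_X Conv_mult Conv_0)
  define F' where "F' = sub F ?G"
  have zF': "zser F'" unfolding F'_def by (rule shear(4)[OF z])
  define p' where "p' = sub_poly (sub_poly p ?G) ?b"
  have zD': "zser (sub D ?G)" by (rule shear(4)[OF D(1)])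
  have oD': "ord_ge m (sub D ?G)" by (rule ord_ge_sub[OF aG m(1)])
  have zF'': "zser (sub F' ?b)" by (rule zser_sub[OF zF' ab]) (simp_all add: zser_def pd_mult)
  have "Conv (sub F' ?b)"
  proof (rule newton_convergence[of p'])
    show "Conv (coeff p' i)" for i
      unfolding p'_def coeff_sub_poly[OF ab] coeff_sub_poly[OF aG]
      by (intro Conv_sub Conv_zfin p aG ab CG Cb)
    show "poly p' (sub F' ?b) = 0"
      unfolding p'_def F'_def sub_poly_eval[OF ab, symmetric] sub_poly_eval[OF aG, symmetric] p(2)
      by (simp only: sub_0[OF aG] sub_0[OF ab])
    define \<epsilon> where "\<epsilon> = mk (\<lambda>e. co (sub (sub D ?G) ?b) (e + (m, 0, 0, 0)))"
    have blow: "co (sub (sub D ?G) ?b) (a, b, c, d) = 0" if "a < m" for a b c d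
      using that oD' unfolding co_blow_up[OF zD'] ord_ge_def by auto
    have "sub (sub D ?G) ?b = X1 ^ m * \<epsilon>" unfolding \<epsilon>_def by (rule X1_power_coshift[OF blow])
    moreover have "poly (pderiv p') (sub F' ?b) = sub (sub D ?G) ?b"
      unfolding p'_def F'_def D_def pderiv_sub_poly[OF ab] pderiv_sub_poly[OF aG] sub_poly_eval[OF ab] sub_poly_eval[OF aG] ..
    ultimately show "poly (pderiv p') (sub F' ?b) = X1 ^ m * \<epsilon>" by simp
    show "co \<epsilon> 0 \<noteq> 0" using m(2) by (simp add: \<epsilon>_def co_blow_up[OF zD'])
    show "finite {b. co (sub F' ?b) (a, b, 0, 0) \<noteq> 0}" for a
      by (rule finite_subset[of _ "{..a}"]) (auto simp: co_blow_up[OF zF'])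
  qed (rule zF'')
  then have "Conv F'" by (rule Conv_blow_down[OF zF'])
  then have "Conv (sub F' (X1, X2 + const4 (- slope) * X1, 0, 0))"
    by (intro Conv_sub shear(1,2))
  then show ?thesis using shear(3)[OF z, of slope] by (simp add: F'_def)
qed

section \<open>Exchanging the two coordinates\<close>

definition swp :: tup where "swp = (X2, X1, X4, X3)"

lemma adm_swp: "adm swp" using ord_ge_X by (simp add: swp_def)

lemma co_swp: "co (sub F swp) (a, b, c, d) = co F (b, a, d, c)"
proof -
  have gp: "gpow swp (i, j, k, l) = monom4 1 (j, i, l, k)" for i j k l
    unfolding monom4_gpow by (simp add: gpow.simps XX_def swp_def mult_ac)
  define e :: mi where "e = (a, b, c, d)"
  have "co (sub F swp) e = (\<Sum>f\<in>upto (deg e). if f = (b, a, d, c) then co F (b, a, d, c) else 0)"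
    unfolding co_sub[OF adm_swp order.refl]
  proof (rule sum.cong[OF refl])
    fix f :: mi
    obtain i j k l where f: "f = (i, j, k, l)" by (cases f)
    show "co F f * co (gpow swp f) e = (if f = (b, a, d, c) then co F (b, a, d, c) else 0)"
      by (auto simp: f gp co_monom4 e_def)
  qed
  also have "\<dots> = co F (b, a, d, c)"
    by (subst sum.delta[OF finite_upto]) (auto simp: upto_def e_def)
  finally show ?thesis by (simp add: e_def)
qed

lemma co_swp_E:
  "co (sub F swp) E1 = co F E2" "co (sub F swp) E2 = co F E1" "co (sub F swp) 0 = co F 0"
  by (simp_all add: E_defs co_swp zero_prod_def)

lemma swp_swp: "sub (sub F swp) swp = F"
proof (rule co_eqI)
  fix e :: mi show "co (sub (sub F swp) swp) e = co F e" by (cases e) (simp add: co_swp)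
qed

lemma zser_swp: "zser F \<Longrightarrow> zser (sub F swp)"
  by (rule zserI) (simp add: co_swp co_zser disj_commute)

lemma zfin_swp: assumes "zfin F" shows "zfin (sub F swp)"
proof -
  obtain N where N: "\<And>e. deg e > N \<Longrightarrow> co F e = 0" using assms unfolding zfin_def by blast
  have "co (sub F swp) e = 0" if "deg e > N" for e
  proof (cases e)
    case (fields a b c d)
    show ?thesis unfolding fields co_swp by (rule N) (use that fields in simp)
  qed
  then show ?thesis using assms zser_swp unfolding zfin_def by blast
qed

lemma Conv_swp: "Conv F \<Longrightarrow> Conv (sub F swp)"
  by (rule Conv_sub) (use ord_ge_X in \<open>simp_all add: swp_def Conv_X\<close>)

lemma bar_swp: "bar (sub F swp) = sub (bar F) swp"
  unfolding bar_sub[OF adm_swp] by (simp add: swp_def)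

lemma ord_ge_swp: "ord_ge n F \<Longrightarrow> ord_ge n (sub F swp)"
  by (rule ord_ge_sub[OF adm_swp])

text \<open>The notion is symmetric under permutations of the four series.\<close>

lemma grad_dep_swap: "grad_dep (G1, G2, G3, G4) \<Longrightarrow> grad_dep (G2, G1, G4, G3)"
proof -
  assume "grad_dep (G1, G2, G3, G4)"
  then obtain a1 a2 b1 b2 where a: "{a1, a2, b1, b2} \<subseteq> der_closure (KK \<union> {\<iota> G1, \<iota> G2, \<iota> G3, \<iota> G4})"
    "a1 \<noteq> 0 \<or> a2 \<noteq> 0 \<or> b1 \<noteq> 0 \<or> b2 \<noteq> 0" "grad_rel KK (\<iota> G1) (\<iota> G2) (\<iota> G3) (\<iota> G4) a1 a2 b1 b2"
    unfolding grad_dep.simps by (elim exE conjE)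
  have "{\<iota> G1, \<iota> G2, \<iota> G3, \<iota> G4} = {\<iota> G2, \<iota> G1, \<iota> G4, \<iota> G3}" by (simp add: insert_commute)
  then have "{a2, a1, b2, b1} \<subseteq> der_closure (KK \<union> {\<iota> G2, \<iota> G1, \<iota> G4, \<iota> G3})" using a(1) by auto
  moreover have "grad_rel KK (\<iota> G2) (\<iota> G1) (\<iota> G4) (\<iota> G3) a2 a1 b2 b1"
    using a(3) unfolding grad_rel_def by (metis (no_types, lifting) add.assoc add.commute)
  moreover have "a2 \<noteq> 0 \<or> a1 \<noteq> 0 \<or> b2 \<noteq> 0 \<or> b1 \<noteq> 0" using a(2) by auto
  ultimately show ?thesis unfolding grad_dep.simps by (intro exI conjI)
qed

lemma algebraic_zser_swp: assumes "algebraic_zser (sub F swp)" shows "algebraic_zser F"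
proof -
  obtain q where q: "q \<noteq> 0" "\<And>i. zfin (coeff q i)" "poly q (sub F swp) = 0"
    using assms unfolding algebraic_zser_def by (elim exE conjE) metis
  have "poly (sub_poly q swp) F = sub (poly q (sub F swp)) swp"
    unfolding sub_poly_eval[OF adm_swp] swp_swp ..
  then have "poly (sub_poly q swp) F = 0" unfolding q(3) sub_0[OF adm_swp] .
  moreover obtain i where i: "coeff q i \<noteq> 0" using q(1) poly_eqI[of q 0] by auto
  have "coeff (sub_poly q swp) i \<noteq> 0"
    using swp_swp[of "coeff q i"] i sub_0[OF adm_swp] unfolding coeff_sub_poly[OF adm_swp] by metis
  then have "sub_poly q swp \<noteq> 0" by auto
  moreover have "zfin (coeff (sub_poly q swp) i)" for i
    unfolding coeff_sub_poly[OF adm_swp] by (rule zfin_swp[OF q(2)])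
  ultimately show ?thesis unfolding algebraic_zser_def by blast
qed

section \<open>Algebraicity of the series of a CR map\<close>

text \<open>
  If the Levi determinant of the solution \<open>w\<close> vanished identically, there would be a holomorphic function
  \<open>\<Phi>\<close> whose imaginary part is a unit times the defining function.
\<close>

lemma CR_series_algebraic_transversal:
  assumes R: "co R 0 = 0" "co R E2 \<noteq> 0" "Conv R" "bar R = R"
    and dep: "\<And>G. adm G \<Longrightarrow> sub R G = 0 \<Longrightarrow> grad_dep G"
    and dep': "\<And>G. adm G \<Longrightarrow> sub R' G = 0 \<Longrightarrow> grad_dep G"
    and H: "zser H1" "zser H2" "ord_ge 1 H1" "ord_ge 1 H2" "co H1 E1 * co H2 E2 \<noteq> co H2 E1 * co H1 E2"
    and map: "sub R' (H1, H2, bar H1, bar H2) = A * R"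
    and nonflat: "\<And>\<Phi> B. Conv \<Phi> \<Longrightarrow> zser \<Phi> \<Longrightarrow> ord_ge 1 \<Phi> \<Longrightarrow> co \<Phi> E1 \<noteq> 0 \<or> co \<Phi> E2 \<noteq> 0 \<Longrightarrow>
      Conv B \<Longrightarrow> co B 0 \<noteq> 0 \<Longrightarrow> \<Phi> - bar \<Phi> \<noteq> B * R"
  shows "algebraic_zser H1 \<and> algebraic_zser H2"
proof -
  have R4: "co R E4 \<noteq> 0"
  proof -
    have "co (bar R) E4 = cnj (co R E2)" by (simp add: co_bar)
    then show ?thesis using R(2,4) by simp
  qed
  have J: "co (bar H1) E3 * co (bar H2) E4 \<noteq> co (bar H2) E3 * co (bar H1) E4"
    using H(5) unfolding co_bar sw_E by (metis complex_cnj_cancel_iff complex_cnj_mult)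
  have nf: "pd E2 w * pd E3 (pd E1 w) \<noteq> pd E1 w * pd E3 (pd E2 w)"
    if w: "ord_ge 1 w" "sub R (X3, w, X1, X2) = 0" "pd E4 w = 0" for w
  proof
    assume "pd E2 w * pd E3 (pd E1 w) = pd E1 w * pd E3 (pd E2 w)"
    from degenerate_first_integral[OF R w this]
    obtain \<Phi> B where "Conv \<Phi>" "zser \<Phi>" "ord_ge 1 \<Phi>" "co \<Phi> E2 \<noteq> 0" "Conv B" "co B 0 \<noteq> 0" "\<Phi> - bar \<Phi> = B * R"
      by (elim exE conjE)
    then show False using nonflat[of \<Phi> B] by simp
  qed
  have b: "wser (bar H1)" "wser (bar H2)" "ord_ge 1 (bar H1)" "ord_ge 1 (bar H2)" using H bar_zser by simp_all
  note * = formal_map_algebraic[OF R(1,2) R4 dep dep' H b J map nf]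
  show ?thesis by (intro conjI; rule *)
qed

text \<open>
  One of the two coordinates is transversal to \<open>M\<close>; exchange them if it is the first.
\<close>

lemma CR_series_algebraic:
  assumes R: "co R 0 = 0" "co R E1 \<noteq> 0 \<or> co R E2 \<noteq> 0" "Conv R" "bar R = R"
    and dep: "\<And>G. adm G \<Longrightarrow> sub R G = 0 \<Longrightarrow> grad_dep G"
    and dep': "\<And>G. adm G \<Longrightarrow> sub R' G = 0 \<Longrightarrow> grad_dep G"
    and H: "zser H1" "zser H2" "ord_ge 1 H1" "ord_ge 1 H2" "co H1 E1 * co H2 E2 \<noteq> co H2 E1 * co H1 E2"
    and map: "sub R' (H1, H2, bar H1, bar H2) = A * R"
    and nonflat: "\<And>\<Phi> B. Conv \<Phi> \<Longrightarrow> zser \<Phi> \<Longrightarrow> ord_ge 1 \<Phi> \<Longrightarrow> co \<Phi> E1 \<noteq> 0 \<or> co \<Phi> E2 \<noteq> 0 \<Longrightarrow>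
      Conv B \<Longrightarrow> co B 0 \<noteq> 0 \<Longrightarrow> \<Phi> - bar \<Phi> \<noteq> B * R"
  shows "algebraic_zser H1 \<and> algebraic_zser H2"
proof (cases "co R E2 = 0")
  case False
  from CR_series_algebraic_transversal[OF R(1) False R(3,4) dep dep' H map nonflat] show ?thesis .
next
  case True
  have aH: "adm (H1, H2, bar H1, bar H2)" using H by simp
  have depS: "grad_dep G" if G: "adm G" "sub (sub R swp) G = 0" for G
  proof -
    obtain G1 G2 G3 G4 where g: "G = (G1, G2, G3, G4)" by (cases G)
    have "sub R (G2, G1, G4, G3) = 0"
      using G(2) sub_sub[OF adm_swp G(1), of R] unfolding g swp_def subt.simps sub_X[OF G(1)[unfolded g]] by simp
    moreover have "adm (G2, G1, G4, G3)" using G(1) by (simp add: g)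
    ultimately have "grad_dep (G2, G1, G4, G3)" using dep by blast
    then show ?thesis unfolding g by (rule grad_dep_swap)
  qed
  have mapS: "sub R' (sub H1 swp, sub H2 swp, bar (sub H1 swp), bar (sub H2 swp)) = sub A swp * sub R swp"
    using sub_sub[OF aH adm_swp, of R'] unfolding map sub_mult[OF adm_swp] bar_swp by simp
  have nfS: "\<Phi> - bar \<Phi> \<noteq> B * sub R swp"
    if \<Phi>: "Conv \<Phi>" "zser \<Phi>" "ord_ge 1 \<Phi>" "co \<Phi> E1 \<noteq> 0 \<or> co \<Phi> E2 \<noteq> 0" "Conv B" "co B 0 \<noteq> 0" for \<Phi> B
  proof
    assume "\<Phi> - bar \<Phi> = B * sub R swp"
    then have "sub (\<Phi> - bar \<Phi>) swp = sub (B * sub R swp) swp" by simp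
    then have "sub \<Phi> swp - bar (sub \<Phi> swp) = sub B swp * R"
      unfolding sub_diff[OF adm_swp] sub_mult[OF adm_swp] swp_swp bar_swp .
    moreover have "co (sub \<Phi> swp) E1 \<noteq> 0 \<or> co (sub \<Phi> swp) E2 \<noteq> 0" "co (sub B swp) 0 \<noteq> 0"
      using \<Phi>(4,6) by (auto simp: co_swp_E)
    ultimately show False
      using nonflat[OF Conv_swp[OF \<Phi>(1)] zser_swp[OF \<Phi>(2)] ord_ge_swp[OF \<Phi>(3)] _ Conv_swp[OF \<Phi>(5)]] by blast
  qed
  have RS: "co (sub R swp) 0 = 0" "co (sub R swp) E2 \<noteq> 0" "Conv (sub R swp)" "bar (sub R swp) = sub R swp"
    using R True by (simp_all add: co_swp_E Conv_swp bar_swp)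
  have HS: "co (sub H1 swp) E1 * co (sub H2 swp) E2 \<noteq> co (sub H2 swp) E1 * co (sub H1 swp) E2"
    using H(5) unfolding co_swp_E by (metis mult.commute)
  from CR_series_algebraic_transversal[OF RS depS dep' zser_swp[OF H(1)] zser_swp[OF H(2)] ord_ge_swp[OF H(3)]
      ord_ge_swp[OF H(4)] HS mapS nfS]
  show ?thesis using algebraic_zser_swp by blast
qed

section \<open>Two-variable series\<close>

lemma co_in_Z: "co (in_Z f) (a, b, c, d) = (if c = 0 \<and> d = 0 then coeff2 f a b else 0)"
  by (auto simp: co_def coeff4_def in_Z_def)

text \<open>
  In this sense the second half of the complexified map is the conjugate of the first.
\<close>

lemma conj_in_W_bar: "conj_in_W f = bar (in_Z f)"
proof (rule co_eqI)
  fix e :: mi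
  obtain a b c d where e: "e = (a, b, c, d)" by (cases e)
  show "co (conj_in_W f) e = co (bar (in_Z f)) e"
    by (auto simp: e co_bar co_in_Z) (auto simp: co_def coeff4_def conj_in_W_def)
qed

lemma zser_in_Z: "zser (in_Z f)" by (rule zserI) (auto simp: co_in_Z)

lemma zser_const4: "zser (const4 c)" by (simp add: zser_def pd_const4)

lemma zser_diff: "zser F \<Longrightarrow> zser G \<Longrightarrow> zser (F - G)"
  by (simp add: zser_def derivation_diff[OF derivation_pd])

text \<open>Setting the last two variables to zero.\<close>

definition out_Z :: "fps4 \<Rightarrow> fps2" where
  "out_Z F = Abs_fps (\<lambda>a. Abs_fps (\<lambda>b. fps_nth (fps_nth (fps_nth (fps_nth F a) b) 0) 0))"

lemma coeff2_out_Z: "coeff2 (out_Z F) a b = co F (a, b, 0, 0)"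
  by (simp add: coeff2_def out_Z_def co_def coeff4_def)

lemma coeff2_eqI: "(\<And>a b. coeff2 f a b = coeff2 g a b) \<Longrightarrow> f = g"
  by (intro fps_ext) (simp add: coeff2_def)

text \<open>
  Evaluation of iterated polynomials is an iterated ring homomorphism; the unbundled notion allows it to
  be composed coefficientwise by \<open>map_poly\<close>.
\<close>

definition ring_hom1 :: "('a::comm_ring_1 \<Rightarrow> 'b::comm_ring_1) \<Rightarrow> bool" where
  "ring_hom1 h \<longleftrightarrow> h 0 = 0 \<and> h 1 = 1 \<and> (\<forall>x y. h (x + y) = h x + h y) \<and> (\<forall>x y. h (x * y) = h x * h y)"

lemma ring_hom1D:
  assumes "ring_hom1 h"
  shows "h 0 = 0" "h 1 = 1" "h (x + y) = h x + h y" "h (x * y) = h x * h y"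
  using assms by (simp_all add: ring_hom1_def)

lemma ring_hom1_eval_simps:
  assumes "ring_hom1 h"
  shows "poly (map_poly h 0) x = 0" "poly (map_poly h (pCons a q)) x = h a + x * poly (map_poly h q) x"
    "poly (map_poly h (q + r)) x = poly (map_poly h q) x + poly (map_poly h r) x"
    "poly (map_poly h (smult a q)) x = h a * poly (map_poly h q) x"
proof -
  note h = ring_hom1D[OF assms]
  have p: "map_poly h (pCons a q) = pCons (h a) (map_poly h q)" for a q
    by (rule poly_eqI) (simp add: coeff_map_poly h coeff_pCons split: nat.splits)
  have s: "map_poly h (q + r) = map_poly h q + map_poly h r" for q r
    by (rule poly_eqI) (simp add: coeff_map_poly h)
  have m: "map_poly h (smult a q) = smult (h a) (map_poly h q)" for a q
    by (rule poly_eqI) (simp add: coeff_map_poly h)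
  show "poly (map_poly h 0) x = 0" "poly (map_poly h (pCons a q)) x = h a + x * poly (map_poly h q) x"
    "poly (map_poly h (q + r)) x = poly (map_poly h q) x + poly (map_poly h r) x"
    "poly (map_poly h (smult a q)) x = h a * poly (map_poly h q) x"
    by (simp_all add: p s m)
qed

lemma ring_hom1_eval:
  assumes "ring_hom1 h" shows "ring_hom1 (\<lambda>q. poly (map_poly h q) x)"
proof -
  note e = ring_hom1_eval_simps[OF assms, where x = x] and h = ring_hom1D[OF assms]
  have "poly (map_poly h (q * r)) x = poly (map_poly h q) x * poly (map_poly h r) x" for q r
    by (induction q) (simp_all add: e h distrib_right mult.assoc)
  moreover have "poly (map_poly h 1) x = 1" unfolding one_pCons by (simp add: e h)
  ultimately show ?thesis by (simp add: ring_hom1_def e)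
qed

lemma ring_hom1_const2: "ring_hom1 const2" by (simp add: ring_hom1_def const2_def)

lemma ring_hom1_out_Z: "ring_hom1 out_Z"
  unfolding ring_hom1_def
  by (intro conjI allI fps_ext) (simp_all add: out_Z_def fps_mult_nth fps_sum_nth)

lemma ring_hom1_power: "ring_hom1 h \<Longrightarrow> h (x ^ n) = h x ^ n"
  by (induction n) (simp_all add: ring_hom1D)

lemma ring_hom1_sum: "ring_hom1 h \<Longrightarrow> h (sum f A) = (\<Sum>i\<in>A. h (f i))"
  by (induction A rule: infinite_finite_induct) (simp_all add: ring_hom1D)

text \<open>The inner evaluation in \<open>eval_poly_series\<close>, of a polynomial in \<open>Z\<close> at \<open>p + X\<close>.\<close>

definition eval2 :: "complex^2 \<Rightarrow> complex poly poly \<Rightarrow> fps2" where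
  "eval2 p Q = poly (map_poly (\<lambda>q. poly (map_poly const2 q) (const2 (p$2) + fps_const fps_X)) Q) (const2 (p$1) + fps_X)"

lemma ring_hom1_eval2: "ring_hom1 (eval2 p)"
  unfolding eval2_def by (intro ring_hom1_eval ring_hom1_const2)

lemma eval2_generators:
  "eval2 p [:[:c:]:] = const2 c" "eval2 p [:0, 1:] = const2 (p$1) + fps_X" "eval2 p [:[:0, 1:]:] = const2 (p$2) + fps_const fps_X"
proof -
  note e = ring_hom1_eval_simps[OF ring_hom1_const2] ring_hom1_eval_simps[OF ring_hom1_eval[OF ring_hom1_const2]]
  note h = ring_hom1D[OF ring_hom1_const2] ring_hom1D[OF ring_hom1_eval[OF ring_hom1_const2]]
  show "eval2 p [:[:c:]:] = const2 c" "eval2 p [:0, 1:] = const2 (p$1) + fps_X"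
    "eval2 p [:[:0, 1:]:] = const2 (p$2) + fps_const fps_X"
    unfolding eval2_def by (simp_all add: e h)
qed

text \<open>
  The image is a ring containing the constants and \<open>p + X\<close>, hence the monomials in \<open>X\<close>.
\<close>

lemma eval2_onto_finite:
  assumes N: "\<And>a b. a + b > N \<Longrightarrow> coeff2 f a b = 0"
  shows "\<exists>Q. eval2 p Q = f"
proof -
  let ?x = "[:0, 1:] - [:[:p$1:]:]" and ?y = "[:[:0, 1:]:] - [:[:p$2:]:]"
  note h = ring_hom1_eval2[of p]
  have minus: "eval2 p (q - r) = eval2 p q - eval2 p r" for q r
    using ring_hom1D(3)[OF h, of "q - r" r] by simp
  have x: "eval2 p ?x = fps_X" and y: "eval2 p ?y = fps_const fps_X"
    unfolding minus eval2_generators by simp_all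
  define Q where "Q = (\<Sum>a\<le>N. \<Sum>b\<le>N. [:[:coeff2 f a b:]:] * ?x ^ a * ?y ^ b)"
  have "eval2 p Q = (\<Sum>a\<le>N. \<Sum>b\<le>N. const2 (coeff2 f a b) * fps_X ^ a * fps_const fps_X ^ b)"
    unfolding Q_def ring_hom1_sum[OF h] ring_hom1D(4)[OF h] ring_hom1_power[OF h] x y eval2_generators ..
  also have "\<dots> = f"
  proof (rule coeff2_eqI)
    fix m n
    have t: "coeff2 (const2 c * fps_X ^ a * fps_const fps_X ^ b) m n = (if a = m then if b = n then c else 0 else 0)" for a b c
      unfolding coeff2_def const2_def by (simp add: fps_const_power)
    have "coeff2 (\<Sum>a\<le>N. \<Sum>b\<le>N. const2 (coeff2 f a b) * fps_X ^ a * fps_const fps_X ^ b) m n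
        = (\<Sum>a\<le>N. \<Sum>b\<le>N. coeff2 (const2 (coeff2 f a b) * fps_X ^ a * fps_const fps_X ^ b) m n)"
      by (simp add: coeff2_def fps_sum_nth)
    also have "\<dots> = (\<Sum>a\<le>N. if a = m then (\<Sum>b\<le>N. if b = n then coeff2 f a b else 0) else 0)"
      unfolding t by (intro sum.cong) auto
    also have "\<dots> = coeff2 f m n" using N[of m n] by (auto simp: sum.delta)
    finally show "coeff2 (\<Sum>a\<le>N. \<Sum>b\<le>N. const2 (coeff2 f a b) * fps_X ^ a * fps_const fps_X ^ b) m n = coeff2 f m n" .
  qed
  finally show ?thesis by blast
qed

text \<open>
  The coefficients of the relation are polynomials in \<open>X = Z - p\<close> and lift to polynomials in \<open>Z\<close>; setting
  the last two variables to zero is a homomorphism back to series in two variables. The relation is one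
  for \<open>h - c\<close>, whence the final translation of the polynomial.
\<close>

lemma algebraic_zser_polynomial:
  assumes alg: "algebraic_zser (in_Z h - const4 c)"
  shows "\<exists>P. P \<noteq> 0 \<and> eval_poly_series p P h = 0"
proof -
  let ?F = "in_Z h - const4 c"
  obtain q where q: "q \<noteq> 0" "\<And>i. zfin (coeff q i)" "poly q ?F = 0"
    using alg unfolding algebraic_zser_def by (elim exE conjE) metis
  have "\<exists>Q. eval2 p Q = out_Z (coeff q i)" for i
  proof -
    obtain N where N: "\<And>e. deg e > N \<Longrightarrow> co (coeff q i) e = 0" using q(2)[of i] unfolding zfin_def by blast
    show ?thesis by (rule eval2_onto_finite[of N]) (simp add: coeff2_out_Z N)
  qed
  then obtain Q where Q: "\<And>i. eval2 p (Q i) = out_Z (coeff q i)" by metis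
  define P0 where "P0 = (\<Sum>i\<le>degree q. monom (Q i) i)"
  note h = ring_hom1_eval2[of p]
  note e0 = ring_hom1_eval_simps[OF h] and E = ring_hom1_eval[OF h]
  have mon: "poly (map_poly (eval2 p) (monom a i)) x = eval2 p a * x ^ i" for a i x
    by (induction i) (simp_all add: monom_0 monom_Suc e0 ring_hom1D[OF h])
  have mon': "poly (map_poly out_Z (monom a i)) x = out_Z a * x ^ i" for a i x
    by (induction i) (simp_all add: monom_0 monom_Suc ring_hom1_eval_simps[OF ring_hom1_out_Z] ring_hom1D[OF ring_hom1_out_Z])
  have out: "out_Z (poly r F) = poly (map_poly out_Z r) (out_Z F)" for r F
    by (induction r) (simp_all add: ring_hom1_eval_simps[OF ring_hom1_out_Z] ring_hom1D[OF ring_hom1_out_Z])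
  have oF: "out_Z ?F = h - const2 c"
  proof (rule coeff2_eqI)
    fix a b
    have "coeff2 (h - const2 c) a b = coeff2 h a b - (if a = 0 \<and> b = 0 then c else 0)"
      by (simp add: coeff2_def const2_def)
    then show "coeff2 (out_Z ?F) a b = coeff2 (h - const2 c) a b"
      unfolding coeff2_out_Z co_diff co_in_Z co_const4 by (simp add: zero_prod_def)
  qed
  have "poly (map_poly (eval2 p) P0) (out_Z ?F) = (\<Sum>i\<le>degree q. out_Z (coeff q i) * out_Z ?F ^ i)"
    unfolding P0_def ring_hom1_sum[OF E] mon Q ..
  also have "\<dots> = poly (map_poly out_Z q) (out_Z ?F)"
    by (subst (2) poly_as_sum_of_monoms[of q, symmetric]) (simp only: ring_hom1_sum[OF ring_hom1_eval[OF ring_hom1_out_Z]] mon')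
  also have "\<dots> = 0" unfolding out[symmetric] q(3) by (rule ring_hom1D(1)[OF ring_hom1_out_Z])
  finally have root: "poly (map_poly (eval2 p) P0) (h - const2 c) = 0" unfolding oF .
  have "P0 \<noteq> 0"
  proof
    assume "P0 = 0"
    obtain i where i: "coeff q i \<noteq> 0" using q(1) poly_eqI[of q 0] by auto
    then have "coeff P0 i = Q i" by (simp add: P0_def coeff_sum le_degree)
    then have "out_Z (coeff q i) = 0" using Q[of i] \<open>P0 = 0\<close> by (simp add: ring_hom1D[OF h])
    then have z: "co (coeff q i) (a, b, 0, 0) = 0" for a b using coeff2_out_Z[of "coeff q i" a b] by (simp add: coeff2_def)
    have "zser (coeff q i)" using q(2) by (simp add: zfin_def)
    then have "co (coeff q i) (a, b, c, d) = 0" for a b c d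
      using z[of a b] co_zser[of "coeff q i" c d a b] by (cases "c > 0 \<or> d > 0") simp_all
    then have "coeff q i = 0" by (intro co_eqI) (simp add: split_paired_all)
    then show False using i by simp
  qed
  define l :: "complex poly poly poly" where "l = [:- [:[:c:]:], 1:]"
  define P where "P = pcompose P0 l"
  have lin: "poly (map_poly (eval2 p) l) h = h - const2 c"
  proof -
    have "eval2 p (- [:[:c:]:]) + eval2 p [:[:c:]:] = 0"
      using ring_hom1D(3)[OF h, of "- [:[:c:]:]" "[:[:c:]:]"] ring_hom1D(1)[OF h] by simp
    then have "eval2 p (- [:[:c:]:]) = - const2 c" unfolding eval2_generators by (simp add: eq_neg_iff_add_eq_0)
    then show ?thesis unfolding l_def by (simp only: e0 ring_hom1D[OF h]) simp
  qed
  have "poly (map_poly (eval2 p) (pcompose r l)) h = poly (map_poly (eval2 p) r) (h - const2 c)" for r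
    by (induction r) (simp_all only: pcompose_0 pcompose_pCons e0 ring_hom1D(3,4)[OF E] lin ring_hom1D(1)[OF h] mult_zero_right add_0_right)
  then have "poly (map_poly (eval2 p) P) h = 0" using root by (simp only: P_def)
  moreover have "eval_poly_series p P h = poly (map_poly (eval2 p) P) h"
    unfolding eval_poly_series_def eval2_def ..
  moreover have "P \<noteq> 0" using \<open>P0 \<noteq> 0\<close> unfolding P_def by (subst pcompose_eq_0_iff) (simp_all add: l_def)
  ultimately show ?thesis by metis
qed

lemma Conv_summable:
  fixes p :: "complex^2"
  assumes "Conv (in_Z h)"
  shows "\<exists>r>0. \<forall>Z\<in>ball p r. (\<lambda>(a, b). coeff2 h a b * (cx Z - cx p) ^ a * (cy Z - cy p) ^ b) summable_on UNIV"
proof -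
  obtain r B where r: "r > 0" "nb (in_Z h) r B" using assms by (auto simp: Conv_def)
  show ?thesis
  proof (intro exI[of _ r] conjI ballI)
    fix Z :: "complex^2" assume Z: "Z \<in> ball p r"
    define x where "x = cx Z - cx p"
    define y where "y = cy Z - cy p"
    have "cmod (cx (Z - p)) \<le> norm (Z - p)" "cmod (cy (Z - p)) \<le> norm (Z - p)"
      by (simp_all only: Finite_Cartesian_Product.norm_nth_le)
    then have "cmod x \<le> norm (Z - p)" "cmod y \<le> norm (Z - p)" by (simp_all add: x_def y_def)
    then have xy: "cmod x \<le> r" "cmod y \<le> r" using Z by (simp_all add: dist_norm norm_minus_commute)
    define f where "f = (\<lambda>(a, b). cmod (coeff2 h a b * x ^ a * y ^ b))"
    have "f summable_on UNIV"
    proof (rule nonneg_bdd_above_summable_on)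
      show "bdd_above (sum f ` {S. S \<subseteq> UNIV \<and> finite S})"
      proof (rule bdd_aboveI2[of _ _ B])
        fix S :: "(nat \<times> nat) set" assume "S \<in> {S. S \<subseteq> UNIV \<and> finite S}"
        then have S: "finite S" by simp
        define j :: "nat \<times> nat \<Rightarrow> mi" where "j = (\<lambda>(a, b). (a, b, 0, 0))"
        have inj: "inj_on j S" by (auto simp: inj_on_def j_def)
        obtain n where n: "\<And>s. s \<in> S \<Longrightarrow> deg (j s) \<le> n"
          using finite_nat_set_iff_bounded_le[of "(\<lambda>s. deg (j s)) ` S"] S by auto
        have "f s \<le> cmod (co (in_Z h) (j s)) * r ^ deg (j s)" for s
        proof (cases s)
          case (Pair a b)
          have "cmod x ^ a * cmod y ^ b \<le> r ^ a * r ^ b" using xy by (intro mult_mono power_mono) (use r in auto)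
          then show ?thesis
            by (simp add: Pair f_def j_def co_in_Z norm_mult norm_power power_add mult.assoc mult_left_mono)
        qed
        then have "sum f S \<le> (\<Sum>s\<in>S. cmod (co (in_Z h) (j s)) * r ^ deg (j s))" by (rule sum_mono)
        also have "\<dots> = (\<Sum>e\<in>j ` S. cmod (co (in_Z h) e) * r ^ deg e)" by (simp add: sum.reindex[OF inj])
        also have "\<dots> \<le> tn n r (in_Z h)" unfolding tn_def
          by (rule sum_mono2) (use n r in \<open>auto simp: upto_def\<close>)
        also have "\<dots> \<le> B" using r(2) by (simp add: nb_def)
        finally show "sum f S \<le> B" .
      qed
    qed (auto simp: f_def)
    moreover have "f = (\<lambda>s. norm (case s of (a, b) \<Rightarrow> coeff2 h a b * x ^ a * y ^ b))"
      by (rule ext) (simp add: f_def split: prod.split)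
    ultimately have "(\<lambda>s. norm (case s of (a, b) \<Rightarrow> coeff2 h a b * x ^ a * y ^ b)) summable_on UNIV"
      by simp
    then show "(\<lambda>(a, b). coeff2 h a b * (cx Z - cx p) ^ a * (cy Z - cy p) ^ b) summable_on UNIV"
      unfolding x_def[symmetric] y_def[symmetric] by (rule abs_summable_summable)
  qed (rule r(1))
qed

section \<open>The theorem\<close>

text \<open>
  The polynomial vanishing on the hypersurface gives, on every parametrisation of its complexification,
  a polynomial relation; only its gradient is kept.
\<close>

lemma algebraic_germ_grad_dep:
  assumes "zzbar_expansion \<rho> p R" "local_defining_function M p \<rho>" "p \<in> M" "real_algebraic_germ M p"
    and G: "adm G" "sub R G = 0"
  shows "grad_dep G"
proof -
  obtain N c where c: "\<exists>e\<in>cube N. c e \<noteq> (0::real)"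
    "\<forall>G. adm G \<longrightarrow> sub R G = 0 \<longrightarrow> (\<Sum>e\<in>cube N. const4 (of_real (c e)) * gpow (re_im p G) e) = 0"
    using real_algebraic_formal[OF assms(1-4)] by (elim exE conjE)
  show ?thesis by (rule grad_depI[OF c(1)]) (use c(2) G in blast)
qed

theorem theorem2:
  fixes M M' :: "(complex^2) set" and p p' :: "complex^2" and H :: "(complex fps fps)^2"
  assumes "hypersurface_germ M p" and "hypersurface_germ M' p'"
    and "real_algebraic_germ M p" and "real_algebraic_germ M' p'"
    and "\<not> levi_flat_germ M p" and "\<not> levi_flat_germ M' p'"
    and "formal_CR_map M p M' p' H" and "formally_invertible H"
  shows "algebraic_formal_map p H \<and> convergent_formal_map p H"
proof -
  have pM: "p \<in> M" "p' \<in> M'" using assms(1,2) by (simp_all add: hypersurface_germ_def)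
  obtain \<rho> \<rho>' R R' A where
    \<rho>: "local_defining_function M p \<rho>" "zzbar_expansion \<rho> p R"
    and \<rho>': "local_defining_function M' p' \<rho>'" "zzbar_expansion \<rho>' p' R'"
    and map0: "compose4 R' (in_Z (H$1) - const4 (p'$1)) (in_Z (H$2) - const4 (p'$2))
          (conj_in_W (H$1) - const4 (cnj (p'$1))) (conj_in_W (H$2) - const4 (cnj (p'$2))) = A * R"
    using assms(7) unfolding formal_CR_map_def by (elim conjE exE)
  have H0: "coeff2 (H$j) 0 0 = p'$j" for j using assms(7) unfolding formal_CR_map_def by blast
  define h where "h = (\<lambda>j. in_Z (H$j) - const4 (p'$j))"
  have zh: "zser (h j)" for j unfolding h_def by (intro zser_diff zser_in_Z zser_const4)
  have oh: "ord_ge 1 (h j)" for j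
    unfolding ord_ge_1 by (simp add: h_def co_const4 H0[symmetric] co_in_Z[of _ 0 0 0 0, folded zero_prod_def])
  have coh: "co (h j) E1 = coeff2 (H$j) 1 0" "co (h j) E2 = coeff2 (H$j) 0 1" for j
    by (simp_all add: h_def co_const4 E_defs co_in_Z zero_prod_def)
  have "det (formal_jacobian H) \<noteq> 0" using assms(8) by (simp add: formally_invertible_def invertible_det_nz)
  then have J: "co (h 1) E1 * co (h 2) E2 \<noteq> co (h 2) E1 * co (h 1) E2"
    unfolding coh by (simp add: det_2 formal_jacobian_def mult.commute)
  have map: "sub R' (h 1, h 2, bar (h 1), bar (h 2)) = A * R"
    using map0 by (simp add: h_def sub.simps conj_in_W_bar bar_diff)
  have bR: "bar R = R" by (rule zzbar_expansion_bar[OF \<rho>(2)])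
  have R0: "co R 0 = 0" and "\<exists>v. lin R (rp v) \<noteq> 0" using defining_function_linear[OF \<rho>(2,1) pM(1)] by blast+
  then obtain v where v: "lin R (rp v) \<noteq> 0" by blast
  have R12: "co R E1 \<noteq> 0 \<or> co R E2 \<noteq> 0"
  proof (rule ccontr)
    assume z: "\<not> ?thesis"
    have "co (bar R) E3 = cnj (co R E1)" "co (bar R) E4 = cnj (co R E2)" by (simp_all add: co_bar)
    then show False using v z by (simp add: bR rp_def)
  qed
  have "algebraic_zser (h 1) \<and> algebraic_zser (h 2)"
  proof (rule CR_series_algebraic[OF R0 R12 zzbar_expansion_Conv[OF \<rho>(2)] bR _ _ zh zh oh oh J map])
    show "grad_dep G" if "adm G" "sub R G = 0" for G
      by (rule algebraic_germ_grad_dep[OF \<rho>(2,1) pM(1) assms(3) that])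
    show "grad_dep G" if "adm G" "sub R' G = 0" for G
      by (rule algebraic_germ_grad_dep[OF \<rho>'(2,1) pM(2) assms(4) that])
    show "\<Phi> - bar \<Phi> \<noteq> B * R"
      if "Conv \<Phi>" "zser \<Phi>" "ord_ge 1 \<Phi>" "co \<Phi> E1 \<noteq> 0 \<or> co \<Phi> E2 \<noteq> 0" "Conv B" "co B 0 \<noteq> 0" for \<Phi> B
      using levi_flatI[OF \<rho>(2,1) that] assms(5) by blast
  qed
  then have alg: "algebraic_zser (h j)" for j using exhaust_2[of j] by auto
  have "algebraic_formal_map p H"
    unfolding algebraic_formal_map_def using algebraic_zser_polynomial alg unfolding h_def by blast
  moreover have "convergent_formal_map p H"
  proof -
    have C: "Conv (in_Z (H$j))" for j
    proof -
      have "Conv (h j + const4 (p'$j))" by (intro Conv_add algebraic_zser_Conv zh alg Conv_const4)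
      then show ?thesis by (simp add: h_def)
    qed
    let ?S = "\<lambda>j Z. (\<lambda>(a, b). coeff2 (H$j) a b * (cx Z - cx p) ^ a * (cy Z - cy p) ^ b) summable_on UNIV"
    obtain r1 where r1: "r1 > 0" "\<forall>Z\<in>ball p r1. ?S 1 Z" using Conv_summable[OF C[of 1], of p] by (elim exE conjE)
    obtain r2 where r2: "r2 > 0" "\<forall>Z\<in>ball p r2. ?S 2 Z" using Conv_summable[OF C[of 2], of p] by (elim exE conjE)
    show ?thesis unfolding convergent_formal_map_def
    proof (intro exI[of _ "min r1 r2"] conjI ballI allI)
      fix Z :: "complex^2" and j :: 2 assume Z: "Z \<in> ball p (min r1 r2)"
      consider "j = 1" | "j = 2" using exhaust_2[of j] by metis
      then show "?S j Z"
      proof cases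
        case 1
        have "Z \<in> ball p r1" using Z by simp
        from r1(2)[rule_format, OF this] show ?thesis unfolding 1 .
      next
        case 2
        have "Z \<in> ball p r2" using Z by simp
        from r2(2)[rule_format, OF this] show ?thesis unfolding 2 .
      qed
    qed (use r1(1) r2(1) in simp)
  qed
  ultimately show ?thesis ..
qed

end
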